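(* Let $\Lambda$ be a finite-dimensional basic algebra over an algebraically closed field $\mathbb{K}$ with quiver $Q$, let $\mathcal{E}$ be an open fully exact subcategory of $\Lambda\text{-mod}$, let $\mathbf{e},\mathbf{d}\in\mathbb{N}_0^{Q_0}$ and $M\in\mathrm{R}_{\mathbf{e}+\mathbf{d}}(\mathcal{E})$. Then the $\mathcal{E}$-Grassmannian $\mathrm{Gr}_{\mathcal{E}}(\mathbf{e},M)$ is isomorphic to the geometric quotient $\mathrm{Infl}_{\mathcal{E}}(\mathbf{e},M)/\mathrm{G}_{\mathbf{e}}$. In particular, it is an open subvariety of $\mathrm{Gr}_{\Lambda}(\mathbf{e},M)$.
   Context: $\Lambda\text{-mod}$ is the category of finite-dimensional left $\Lambda$-modules; $\Lambda\cong\mathbb{K}Q/I$ with $I$ admissible. For $\mathbf{d}\in\mathbb{N}_0^{Q_0}$, $\mathrm{R}_{\mathbf{d}}(\Lambda)$ is the closed subvariety of $\bigoplus_{(\alpha:i\to j)\in Q_1}\mathbb{K}^{d_j\times d_i}$ of $\mathbf{d}$-dimensional $\Lambda$-modules, and $\mathrm{G}_{\mathbf{d}}=\prod_{i\in Q_0}\mathrm{GL}_{d_i}(\mathbb{K})$. Varieties are $\mathbb{K}$-valued points of reduced, separated schemes of finite type over $\mathrm{Spec}(\mathbb{K})$. For a full subcategory $\mathcal{E}$ put $\mathrm{R}_{\mathbf{d}}(\mathcal{E})=\{M\in\mathrm{R}_{\mathbf{d}}(\Lambda):M\in\mathcal{E}\}$. An additively closed subcategory (full, closed under isomorphisms, finite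 direct sums and direct summands) is open if $\mathrm{R}_{\mathbf{d}}(\mathcal{E})$ is Zariski open in $\mathrm{R}_{\mathbf{d}}(\Lambda)$ for all $\mathbf{d}$. An open fully exact subcategory is an open, extension-closed subcategory with the exact structure restricted from $\Lambda\text{-mod}$. $\mathrm{Gr}_{\mathcal{E}}(\mathbf{e},M)$ is the set of $U=(U_i)_{i\in Q_0}\in\prod_{i\in Q_0}\mathrm{Gr}_{\mathbb{K}}(e_i,M_i)$ that are submodules of $M$ with $M|_U\in\mathrm{R}_{\mathbf{e}}(\mathcal{E})$ and $M/U\in\mathrm{R}_{\mathbf{d}}(\mathcal{E})$ (up to choice of bases). $\mathrm{Gr}_{\Lambda}(\mathbf{e},M)$ is the case $\mathcal{E}=\Lambda\text{-mod}$, the usual quiver Grassmannian, a closed subvariety of $\prod_{i\in Q_0}\mathrm{Gr}_{\mathbb{K}}(e_i,M_i)$. The variety structure on $\mathrm{Gr}_{\mathcal{E}}(\mathbf{e},M)$ is that of a subset of $\mathrm{Gr}_{\Lambda}(\mathbf{e},M)$. $\mathrm{Infl}_{\mathcal{E}}(\mathbf{e},M)$ is the variety of pairs $(U,f)$ with $U\in\mathrm{R}_{\mathbf{e}}(\mathcal{E})$ and $f=(f_i)_{i\in Q_0}\in\prod_{i\in Q_0}\mathbb{K}^{(e_i+d_i)\times e_i}$ such that every $f_i$ is injective, $M_\alpha f_i=f_jU_\alpha$ for all $(\alpha:i\to j)\in Q_1$, and the cokernel of $f\colon U\to M$ lies in $\mathcal{E}$ (i.e. $f$ is the first map of a short exact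 sequence $U\rightarrowtail M\twoheadrightarrow N$ with $U\in\mathrm{R}_{\mathbf{e}}(\mathcal{E})$, $N\in\mathrm{R}_{\mathbf{d}}(\mathcal{E})$). The group $\mathrm{G}_{\mathbf{e}}$ acts freely on it by $g.(U,f)=\big((g_jU_\alpha g_i^{-1})_{(\alpha:i\to j)\in Q_1},(f_ig_i^{-1})_{i\in Q_0}\big)$. *)

theory Defs
  imports
    "Jordan_Normal_Form.Gauss_Jordan_Elimination"
    "Jordan_Normal_Form.VS_Connect"
    "Jordan_Normal_Form.Matrix_Kernel"
    "Graph_Theory.Arc_Walk"
    "HOL-Algebra.QuotRing"
    "HOL-Algebra.Group_Action"
    "HOL-Analysis.Abstract_Topology"
    "HOL-Library.Poly_Mapping"
begin

section \<open>Varieties\<close>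

text \<open>
  Varieties are treated as spaces of \<open>K\<close>-valued points together with their Zariski topology and
  their sheaf of regular \<open>K\<close>-valued functions (Serre, Kempf). Regular functions on an open set \<open>W\<close> are
  represented by total functions; only their values on \<open>W\<close> matter.
\<close>

record ('x, 'k) kspace =
  zar :: "'x topology"
  reg :: "'x set \<Rightarrow> ('x \<Rightarrow> 'k) set"

abbreviation pts :: "('x, 'k) kspace \<Rightarrow> 'x set" where
  "pts X \<equiv> topspace (zar X)"

definition space_with_functions :: "('x, 'k::field) kspace \<Rightarrow> bool" where
  "space_with_functions X \<longleftrightarrow>
     (\<forall>W f g. openin (zar X) W \<and> f \<in> reg X W \<and> (\<forall>x\<in>W. f x = g x) \<longrightarrow> g \<in> reg X W) \<and>
     (\<forall>W V f. openin (zar X) W \<and> openin (zar X) V \<and> V \<subseteq> W \<and> f \<in> reg X W \<longrightarrow> f \<in> reg X V) \<and>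
     (\<forall>\<V> f. (\<forall>V\<in>\<V>. openin (zar X) V \<and> f \<in> reg X V) \<longrightarrow> f \<in> reg X (\<Union>\<V>)) \<and>
     (\<forall>W. openin (zar X) W \<longrightarrow>
        (\<forall>c. (\<lambda>x. c) \<in> reg X W) \<and>
        (\<forall>f\<in>reg X W. \<forall>g\<in>reg X W. (\<lambda>x. f x + g x) \<in> reg X W \<and> (\<lambda>x. f x * g x) \<in> reg X W) \<and>
        (\<forall>f\<in>reg X W. openin (zar X) {x \<in> W. f x \<noteq> 0} \<and>
           (\<lambda>x. inverse (f x)) \<in> reg X {x \<in> W. f x \<noteq> 0}))"

definition is_morphism :: "('x, 'k) kspace \<Rightarrow> ('y, 'k) kspace \<Rightarrow> ('x \<Rightarrow> 'y) \<Rightarrow> bool" where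
  "is_morphism X Y \<phi> \<longleftrightarrow>
     continuous_map (zar X) (zar Y) \<phi> \<and>
     (\<forall>V h. openin (zar Y) V \<and> h \<in> reg Y V \<longrightarrow> h \<circ> \<phi> \<in> reg X {x \<in> pts X. \<phi> x \<in> V})"

definition isomorphic :: "('x, 'k) kspace \<Rightarrow> ('y, 'k) kspace \<Rightarrow> bool" where
  "isomorphic X Y \<longleftrightarrow>
     (\<exists>\<phi> \<psi>. is_morphism X Y \<phi> \<and> is_morphism Y X \<psi> \<and>
        (\<forall>x\<in>pts X. \<psi> (\<phi> x) = x) \<and> (\<forall>y\<in>pts Y. \<phi> (\<psi> y) = y))"

text \<open>The (reduced) structure of a subset: regular functions are locally restrictions of regular
  functions of the ambient space.\<close>

definition induced :: "('x, 'k) kspace \<Rightarrow> 'x set \<Rightarrow> ('x, 'k) kspace" where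
  "induced X S =
     \<lparr> zar = subtopology (zar X) S,
       reg = (\<lambda>W. {f. \<forall>x\<in>W. \<exists>V h. openin (zar X) V \<and> x \<in> V \<and> h \<in> reg X V \<and>
                          (\<forall>y\<in>V \<inter> W. f y = h y)}) \<rparr>"

definition open_subvariety :: "('x, 'k) kspace \<Rightarrow> ('x, 'k) kspace \<Rightarrow> bool" where
  "open_subvariety Y X \<longleftrightarrow> openin (zar X) (pts Y) \<and> Y = induced X (pts Y)"

inductive_set polynomial_functions :: "('x \<Rightarrow> 'k) set \<Rightarrow> ('x \<Rightarrow> 'k::field) set"
  for C where
    const: "(\<lambda>x. c) \<in> polynomial_functions C"
  | coord: "f \<in> C \<Longrightarrow> f \<in> polynomial_functions C"
  | add: "f \<in> polynomial_functions C \<Longrightarrow> g \<in> polynomial_functions C \<Longrightarrow>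
            (\<lambda>x. f x + g x) \<in> polynomial_functions C"
  | mult: "f \<in> polynomial_functions C \<Longrightarrow> g \<in> polynomial_functions C \<Longrightarrow>
            (\<lambda>x. f x * g x) \<in> polynomial_functions C"

text \<open>\<open>coord_space S C\<close> is an affine space \<open>S\<close> with linear coordinates \<open>C\<close>.\<close>

definition coord_space :: "'x set \<Rightarrow> ('x \<Rightarrow> 'k::field) set \<Rightarrow> ('x, 'k) kspace" where
  "coord_space S C =
     (let T = topology_generated_by {{x \<in> S. p x \<noteq> 0} | p. p \<in> polynomial_functions C} in
     \<lparr> zar = T,
       reg = (\<lambda>W. {f. \<forall>x\<in>W. \<exists>V p q. openin T V \<and> x \<in> V \<and> V \<subseteq> W \<and>
                p \<in> polynomial_functions C \<and> q \<in> polynomial_functions C \<and>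
                (\<forall>y\<in>V. q y \<noteq> 0 \<and> f y = p y / q y)}) \<rparr>)"

definition affine_space :: "'i set \<Rightarrow> ('i \<Rightarrow> 'k, 'k::field) kspace" where
  "affine_space J = coord_space (J \<rightarrow>\<^sub>E UNIV) ((\<lambda>j x. x j) ` J)"

definition affine_variety :: "('x, 'k::field) kspace \<Rightarrow> bool" where
  "affine_variety X \<longleftrightarrow>
     (\<exists>(n::nat) Z. closedin (zar (affine_space {..<n} :: (nat \<Rightarrow> 'k, 'k) kspace)) Z \<and>
        isomorphic X (induced (affine_space {..<n}) Z))"

text \<open>The Zariski topology of the product \<open>X \<times> Y\<close>; it is finer than the product topology.\<close>

definition zar_prod :: "('x, 'k::field) kspace \<Rightarrow> ('y, 'k) kspace \<Rightarrow> ('x \<times> 'y) topology" where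
  "zar_prod X Y = topology_generated_by
     {{(x, y). x \<in> U \<and> y \<in> V \<and> (\<Sum>k<n. f k x * g k y) \<noteq> 0} | U V f g (n::nat).
        openin (zar X) U \<and> openin (zar Y) V \<and> (\<forall>k<n. f k \<in> reg X U \<and> g k \<in> reg Y V)}"

definition separated :: "('x, 'k::field) kspace \<Rightarrow> bool" where
  "separated X \<longleftrightarrow> closedin (zar_prod X X) {(x, x) | x. x \<in> pts X}"

definition variety :: "('x, 'k::field) kspace \<Rightarrow> bool" where
  "variety X \<longleftrightarrow>
     space_with_functions X \<and>
     (\<exists>\<U>. finite \<U> \<and> \<Union>\<U> = pts X \<and>
        (\<forall>U\<in>\<U>. openin (zar X) U \<and> affine_variety (induced X U))) \<and>
     separated X"

text \<open>Gluing along charts \<open>(A, \<phi>)\<close> with \<open>\<phi>\<close> a map from the points of \<open>A\<close> to \<open>S\<close>.\<close>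

definition glued :: "'x set \<Rightarrow> (('a, 'k) kspace \<times> ('a \<Rightarrow> 'x)) set \<Rightarrow> ('x, 'k) kspace" where
  "glued S \<Phi> =
     \<lparr> zar = topology (\<lambda>W. W \<subseteq> S \<and> (\<forall>(A, \<phi>)\<in>\<Phi>. openin (zar A) {a \<in> pts A. \<phi> a \<in> W})),
       reg = (\<lambda>W. {h. \<forall>(A, \<phi>)\<in>\<Phi>. h \<circ> \<phi> \<in> reg A {a \<in> pts A. \<phi> a \<in> W}}) \<rparr>"

lemma istopology_glued:
  "istopology (\<lambda>W. W \<subseteq> S \<and> (\<forall>(A, \<phi>)\<in>\<Phi>. openin (zar A) {a \<in> pts A. \<phi> a \<in> W}))"
proof (unfold istopology_def, intro conjI allI impI)
  fix V W
  assume V: "V \<subseteq> S \<and> (\<forall>(A, \<phi>)\<in>\<Phi>. openin (zar A) {a \<in> pts A. \<phi> a \<in> V})"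
    and W: "W \<subseteq> S \<and> (\<forall>(A, \<phi>)\<in>\<Phi>. openin (zar A) {a \<in> pts A. \<phi> a \<in> W})"
  show "V \<inter> W \<subseteq> S" using V by blast
  show "\<forall>(A, \<phi>)\<in>\<Phi>. openin (zar A) {a \<in> pts A. \<phi> a \<in> V \<inter> W}"
  proof (clarify)
    fix A \<phi> assume "(A, \<phi>) \<in> \<Phi>"
    then have "openin (zar A) ({a \<in> pts A. \<phi> a \<in> V} \<inter> {a \<in> pts A. \<phi> a \<in> W})"
      using V W by (blast intro: openin_Int)
    moreover have "{a \<in> pts A. \<phi> a \<in> V} \<inter> {a \<in> pts A. \<phi> a \<in> W} = {a \<in> pts A. \<phi> a \<in> V \<inter> W}"
      by blast
    ultimately show "openin (zar A) {a \<in> pts A. \<phi> a \<in> V \<inter> W}" by simp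
  qed
next
  fix \<K>
  assume K: "\<forall>W\<in>\<K>. W \<subseteq> S \<and> (\<forall>(A, \<phi>)\<in>\<Phi>. openin (zar A) {a \<in> pts A. \<phi> a \<in> W})"
  show "\<Union>\<K> \<subseteq> S" using K by blast
  show "\<forall>(A, \<phi>)\<in>\<Phi>. openin (zar A) {a \<in> pts A. \<phi> a \<in> \<Union>\<K>}"
  proof (clarify)
    fix A \<phi> assume "(A, \<phi>) \<in> \<Phi>"
    then have "openin (zar A) (\<Union>((\<lambda>W. {a \<in> pts A. \<phi> a \<in> W}) ` \<K>))"
      using K by (intro openin_Union) blast
    moreover have "\<Union>((\<lambda>W. {a \<in> pts A. \<phi> a \<in> W}) ` \<K>) = {a \<in> pts A. \<phi> a \<in> \<Union>\<K>}"
      by blast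
    ultimately show "openin (zar A) {a \<in> pts A. \<phi> a \<in> \<Union>\<K>}" by simp
  qed
qed

text \<open>
  Geometric quotients in the sense of Mumford: \<open>\<pi>\<close> is a surjective morphism whose fibres are the
  orbits, \<open>Y\<close> carries the quotient topology, and the regular functions on \<open>V\<close> are the
  invariant regular functions on the preimage of \<open>V\<close>.
\<close>

definition geometric_quotient ::
  "('g, 'm) monoid_scheme \<Rightarrow> ('g \<Rightarrow> 'x \<Rightarrow> 'x) \<Rightarrow> ('x, 'k::field) kspace \<Rightarrow> ('y, 'k) kspace \<Rightarrow>
   ('x \<Rightarrow> 'y) \<Rightarrow> bool" where
  "geometric_quotient G act X Y \<pi> \<longleftrightarrow>
     variety X \<and> variety Y \<and> group_action G (pts X) act \<and>
     is_morphism X Y \<pi> \<and> \<pi> ` pts X = pts Y \<and>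
     (\<forall>x\<in>pts X. \<forall>y\<in>pts X. \<pi> x = \<pi> y \<longleftrightarrow> y \<in> orbit G act x) \<and>
     (\<forall>V. V \<subseteq> pts Y \<longrightarrow> openin (zar X) {x \<in> pts X. \<pi> x \<in> V} \<longrightarrow> openin (zar Y) V) \<and>
     (\<forall>V f. openin (zar Y) V \<and> f \<in> reg X {x \<in> pts X. \<pi> x \<in> V} \<and>
        (\<forall>g\<in>carrier G. \<forall>x\<in>pts X. \<pi> x \<in> V \<longrightarrow> f (act g x) = f x) \<longrightarrow>
        (\<exists>h\<in>reg Y V. \<forall>x\<in>pts X. \<pi> x \<in> V \<longrightarrow> f x = h (\<pi> x)))"


section \<open>Bound quiver algebras\<close>

text \<open>
  A path in the quiver \<open>Q\<close> is a pair \<open>(i, p)\<close> of its starting vertex and its list of arrows in the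
  order in which they are traversed; \<open>(i, [])\<close> is the trivial path at \<open>i\<close>. Since left modules are
  considered, \<open>x \<otimes> y\<close> means \<open>y\<close> first, then \<open>x\<close>.
\<close>

type_synonym ('v, 'a) path = "'v \<times> 'a list"

definition path_set :: "('v, 'a) pre_digraph \<Rightarrow> ('v, 'a) path set" where
  "path_set Q = {(i, p). \<exists>j. pre_digraph.awalk Q i p j}"

definition path_end :: "('v, 'a) pre_digraph \<Rightarrow> ('v, 'a) path \<Rightarrow> 'v" where
  "path_end Q = (\<lambda>(i, p). last (pre_digraph.awalk_verts Q i p))"

definition path_algebra ::
  "('v, 'a) pre_digraph \<Rightarrow> ('k::field, ('v, 'a) path \<Rightarrow>\<^sub>0 'k) module" where
  "path_algebra Q =
     \<lparr> carrier = {x. Poly_Mapping.keys x \<subseteq> path_set Q},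
       monoid.mult = (\<lambda>x y. \<Sum>p\<in>Poly_Mapping.keys x. \<Sum>q\<in>Poly_Mapping.keys y.
          if path_end Q q = fst p
          then Poly_Mapping.single (fst q, snd q @ snd p)
                 (Poly_Mapping.lookup x p * Poly_Mapping.lookup y q)
          else 0),
       one = (\<Sum>i\<in>verts Q. Poly_Mapping.single (i, []) 1),
       zero = 0,
       add = (+),
       smult = (\<lambda>c. Poly_Mapping.map ((*) c)) \<rparr>"

text \<open>The \<open>m\<close>-th power of the arrow ideal, spanned by the paths of length at least \<open>m\<close>.\<close>

definition arrow_ideal_power ::
  "('v, 'a) pre_digraph \<Rightarrow> nat \<Rightarrow> (('v, 'a) path \<Rightarrow>\<^sub>0 'k::field) set" where
  "arrow_ideal_power Q m =
     {x \<in> carrier (path_algebra Q). \<forall>p\<in>Poly_Mapping.keys x. m \<le> length (snd p)}"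

definition admissible ::
  "('v, 'a) pre_digraph \<Rightarrow> (('v, 'a) path \<Rightarrow>\<^sub>0 'k::field) set \<Rightarrow> bool" where
  "admissible Q I \<longleftrightarrow>
     ideal I (path_algebra Q) \<and>
     (\<exists>m\<ge>2. arrow_ideal_power Q m \<subseteq> I) \<and> I \<subseteq> arrow_ideal_power Q 2"

text \<open>
  A finite-dimensional basic algebra with (finite) quiver \<open>Q\<close> over an algebraically closed field,
  given by an isomorphism of \<open>K\<close>-algebras with \<open>KQ/I\<close>, \<open>I\<close> admissible. Finite-dimensionality and
  basicness follow from the presentation.
\<close>

definition basic_algebra ::
  "('v, 'a) pre_digraph \<Rightarrow> (('v, 'a) path \<Rightarrow>\<^sub>0 'k::alg_closed_field) set \<Rightarrow>
   ('k, 'l) module \<Rightarrow> bool" where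
  "basic_algebra Q I \<Lambda> \<longleftrightarrow>
     fin_digraph Q \<and> admissible Q I \<and> ring \<Lambda> \<and>
     (\<exists>\<phi> \<in> ring_iso (path_algebra Q Quot I) \<Lambda>.
        \<forall>c. \<forall>x\<in>carrier (path_algebra Q).
          \<phi> (I +>\<^bsub>path_algebra Q\<^esub> (c \<odot>\<^bsub>path_algebra Q\<^esub> x)) =
          c \<odot>\<^bsub>\<Lambda>\<^esub> \<phi> (I +>\<^bsub>path_algebra Q\<^esub> x))"


section \<open>Modules\<close>

text \<open>
  A finite-dimensional \<open>KQ/I\<close>-module is a pair \<open>(d, M)\<close> of a dimension vector and a family
  of matrices satisfying the relations in \<open>I\<close>.
\<close>

type_synonym ('v, 'a, 'k) rep = "('v \<Rightarrow> nat) \<times> ('a \<Rightarrow> 'k mat)"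

definition rep_set :: "('v, 'a) pre_digraph \<Rightarrow> ('v \<Rightarrow> nat) \<Rightarrow> ('a \<Rightarrow> 'k mat) set" where
  "rep_set Q d = (\<Pi>\<^sub>E \<alpha>\<in>arcs Q. carrier_mat (d (head Q \<alpha>)) (d (tail Q \<alpha>)))"

fun path_mat ::
  "('v, 'a) pre_digraph \<Rightarrow> ('v \<Rightarrow> nat) \<Rightarrow> ('a \<Rightarrow> 'k::field mat) \<Rightarrow> 'v \<Rightarrow> 'a list \<Rightarrow> 'k mat" where
  "path_mat Q d M i [] = 1\<^sub>m (d i)"
| "path_mat Q d M i (\<alpha> # p) = path_mat Q d M (head Q \<alpha>) p * M \<alpha>"

text \<open>\<open>M\<close> satisfies \<open>x\<close> if \<open>x\<close> acts as zero on the direct sum of the spaces \<open>K\<^bsup>d i\<^esup>\<close>: each block of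
  the matrix of this action is zero.\<close>

definition satisfies ::
  "('v, 'a) pre_digraph \<Rightarrow> ('v \<Rightarrow> nat) \<Rightarrow> ('a \<Rightarrow> 'k::field mat) \<Rightarrow>
   (('v, 'a) path \<Rightarrow>\<^sub>0 'k) \<Rightarrow> bool" where
  "satisfies Q d M x \<longleftrightarrow>
     (\<forall>i\<in>verts Q. \<forall>j\<in>verts Q. \<forall>r<d j. \<forall>s<d i.
        (\<Sum>p | p \<in> Poly_Mapping.keys x \<and> fst p = i \<and> path_end Q p = j.
           Poly_Mapping.lookup x p * path_mat Q d M i (snd p) $$ (r, s)) = 0)"

definition mod_set ::
  "('v, 'a) pre_digraph \<Rightarrow> (('v, 'a) path \<Rightarrow>\<^sub>0 'k::field) set \<Rightarrow> ('v \<Rightarrow> nat) \<Rightarrow>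
   ('a \<Rightarrow> 'k mat) set" where
  "mod_set Q I d = {M \<in> rep_set Q d. \<forall>x\<in>I. satisfies Q d M x}"

definition modules ::
  "('v, 'a) pre_digraph \<Rightarrow> (('v, 'a) path \<Rightarrow>\<^sub>0 'k::field) set \<Rightarrow> ('v, 'a, 'k) rep set" where
  "modules Q I = {(d, M). M \<in> mod_set Q I d}"

definition rep_coords :: "('v, 'a) pre_digraph \<Rightarrow> ('v \<Rightarrow> nat) \<Rightarrow> (('a \<Rightarrow> 'k mat) \<Rightarrow> 'k) set" where
  "rep_coords Q d =
     {\<lambda>M. M \<alpha> $$ (r, s) | \<alpha> r s. \<alpha> \<in> arcs Q \<and> r < d (head Q \<alpha>) \<and> s < d (tail Q \<alpha>)}"

definition mod_variety ::
  "('v, 'a) pre_digraph \<Rightarrow> (('v, 'a) path \<Rightarrow>\<^sub>0 'k::field) set \<Rightarrow> ('v \<Rightarrow> nat) \<Rightarrow>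
   ('a \<Rightarrow> 'k mat, 'k) kspace" where
  "mod_variety Q I d = induced (coord_space (rep_set Q d) (rep_coords Q d)) (mod_set Q I d)"

abbreviation mat_injective :: "'k::field mat \<Rightarrow> bool" where
  "mat_injective A \<equiv> inj_on (\<lambda>v. A *\<^sub>v v) (carrier_vec (dim_col A))"

abbreviation mat_image :: "'k::field mat \<Rightarrow> 'k vec set" where
  "mat_image A \<equiv> (\<lambda>v. A *\<^sub>v v) ` carrier_vec (dim_col A)"

abbreviation mat_surjective :: "'k::field mat \<Rightarrow> bool" where
  "mat_surjective A \<equiv> mat_image A = carrier_vec (dim_row A)"

definition is_hom ::
  "('v, 'a) pre_digraph \<Rightarrow> ('v, 'a, 'k::field) rep \<Rightarrow> ('v, 'a, 'k) rep \<Rightarrow> ('v \<Rightarrow> 'k mat) \<Rightarrow> bool" where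
  "is_hom Q X Y f \<longleftrightarrow>
     (\<forall>i\<in>verts Q. f i \<in> carrier_mat (fst Y i) (fst X i)) \<and>
     (\<forall>\<alpha>\<in>arcs Q. snd Y \<alpha> * f (tail Q \<alpha>) = f (head Q \<alpha>) * snd X \<alpha>)"

definition iso_modules ::
  "('v, 'a) pre_digraph \<Rightarrow> ('v, 'a, 'k::field) rep \<Rightarrow> ('v, 'a, 'k) rep \<Rightarrow> bool" where
  "iso_modules Q X Y \<longleftrightarrow> (\<exists>f. is_hom Q X Y f \<and> (\<forall>i\<in>verts Q. invertible_mat (f i)))"

definition short_exact ::
  "('v, 'a) pre_digraph \<Rightarrow> ('v, 'a, 'k::field) rep \<Rightarrow> ('v \<Rightarrow> 'k mat) \<Rightarrow> ('v, 'a, 'k) rep \<Rightarrow>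
   ('v \<Rightarrow> 'k mat) \<Rightarrow> ('v, 'a, 'k) rep \<Rightarrow> bool" where
  "short_exact Q X f Y g Z \<longleftrightarrow>
     is_hom Q X Y f \<and> is_hom Q Y Z g \<and>
     (\<forall>i\<in>verts Q. mat_injective (f i) \<and> mat_image (f i) = mat_kernel (g i) \<and> mat_surjective (g i))"

definition zero_module :: "('v, 'a) pre_digraph \<Rightarrow> ('v, 'a, 'k::field) rep" where
  "zero_module Q = (\<lambda>i. 0, \<lambda>\<alpha>\<in>arcs Q. 0\<^sub>m 0 0)"

definition sum_module ::
  "('v, 'a) pre_digraph \<Rightarrow> ('v, 'a, 'k::field) rep \<Rightarrow> ('v, 'a, 'k) rep \<Rightarrow> ('v, 'a, 'k) rep" where
  "sum_module Q X Y =
     (\<lambda>i. fst X i + fst Y i,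
      \<lambda>\<alpha>\<in>arcs Q. four_block_mat
        (snd X \<alpha>) (0\<^sub>m (fst X (head Q \<alpha>)) (fst Y (tail Q \<alpha>)))
        (0\<^sub>m (fst Y (head Q \<alpha>)) (fst X (tail Q \<alpha>))) (snd Y \<alpha>))"

text \<open>Full subcategories are given by their classes of objects. A subcategory closed under finite
  direct sums contains the zero module, the empty direct sum.\<close>

definition additively_closed ::
  "('v, 'a) pre_digraph \<Rightarrow> (('v, 'a) path \<Rightarrow>\<^sub>0 'k::field) set \<Rightarrow> ('v, 'a, 'k) rep set \<Rightarrow> bool" where
  "additively_closed Q I \<E> \<longleftrightarrow>
     \<E> \<subseteq> modules Q I \<and>
     (\<forall>X\<in>\<E>. \<forall>Y\<in>modules Q I. iso_modules Q X Y \<longrightarrow> Y \<in> \<E>) \<and>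
     zero_module Q \<in> \<E> \<and>
     (\<forall>X\<in>\<E>. \<forall>Y\<in>\<E>. sum_module Q X Y \<in> \<E>) \<and>
     (\<forall>X\<in>modules Q I. \<forall>Y\<in>modules Q I. sum_module Q X Y \<in> \<E> \<longrightarrow> X \<in> \<E> \<and> Y \<in> \<E>)"

definition cat_set :: "('v, 'a, 'k) rep set \<Rightarrow> ('v \<Rightarrow> nat) \<Rightarrow> ('a \<Rightarrow> 'k mat) set" where
  "cat_set \<E> d = {M. (d, M) \<in> \<E>}"

definition open_subcategory ::
  "('v, 'a) pre_digraph \<Rightarrow> (('v, 'a) path \<Rightarrow>\<^sub>0 'k::field) set \<Rightarrow> ('v, 'a, 'k) rep set \<Rightarrow> bool" where
  "open_subcategory Q I \<E> \<longleftrightarrow> (\<forall>d. openin (zar (mod_variety Q I d)) (cat_set \<E> d))"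

definition extension_closed ::
  "('v, 'a) pre_digraph \<Rightarrow> (('v, 'a) path \<Rightarrow>\<^sub>0 'k::field) set \<Rightarrow> ('v, 'a, 'k) rep set \<Rightarrow> bool" where
  "extension_closed Q I \<E> \<longleftrightarrow>
     (\<forall>X\<in>\<E>. \<forall>Z\<in>\<E>. \<forall>Y\<in>modules Q I. \<forall>f g. short_exact Q X f Y g Z \<longrightarrow> Y \<in> \<E>)"

definition open_fully_exact ::
  "('v, 'a) pre_digraph \<Rightarrow> (('v, 'a) path \<Rightarrow>\<^sub>0 'k::field) set \<Rightarrow> ('v, 'a, 'k) rep set \<Rightarrow> bool" where
  "open_fully_exact Q I \<E> \<longleftrightarrow>
     additively_closed Q I \<E> \<and> open_subcategory Q I \<E> \<and> extension_closed Q I \<E>"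


section \<open>Grassmannians\<close>

definition grassmannian :: "nat \<Rightarrow> nat \<Rightarrow> 'k::field vec set set" where
  "grassmannian e n =
     {W. VectorSpace.subspace class_ring W (module_vec TYPE('k) n) \<and>
         vectorspace.dim (class_ring :: 'k ring) ((module_vec TYPE('k) n)\<lparr>carrier := W\<rparr>) = e}"

definition grassmannian_prod :: "'v set \<Rightarrow> ('v \<Rightarrow> nat) \<Rightarrow> ('v \<Rightarrow> nat) \<Rightarrow> ('v \<Rightarrow> 'k::field vec set) set" where
  "grassmannian_prod V e n = (\<Pi>\<^sub>E i\<in>V. grassmannian (e i) (n i))"

text \<open>
  The standard affine charts: for subsets \<open>J i\<close> of \<open>{..<n i}\<close> of size \<open>e i\<close>, the open subset of
  those \<open>U\<close> for which each \<open>U i\<close> is the graph of a linear map from the coordinates in \<open>J i\<close> to the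
  remaining coordinates, with the matrix entries as coordinates.
\<close>

definition chart_index :: "'v set \<Rightarrow> ('v \<Rightarrow> nat) \<Rightarrow> ('v \<Rightarrow> nat set) \<Rightarrow> ('v \<times> nat \<times> nat) set" where
  "chart_index V n J = (SIGMA i:V. ({..<n i} - J i) \<times> J i)"

definition chart ::
  "'v set \<Rightarrow> ('v \<Rightarrow> nat) \<Rightarrow> ('v \<Rightarrow> nat set) \<Rightarrow> ('v \<times> nat \<times> nat \<Rightarrow> 'k::field) \<Rightarrow> 'v \<Rightarrow> 'k vec set" where
  "chart V n J a =
     (\<lambda>i\<in>V. {w \<in> carrier_vec (n i). \<forall>r\<in>{..<n i} - J i. w $ r = (\<Sum>s\<in>J i. a (i, r, s) * w $ s)})"

definition grassmannian_prod_variety ::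
  "'v set \<Rightarrow> ('v \<Rightarrow> nat) \<Rightarrow> ('v \<Rightarrow> nat) \<Rightarrow> ('v \<Rightarrow> 'k vec set, 'k::field) kspace" where
  "grassmannian_prod_variety V e n = glued (grassmannian_prod V e n)
     {(affine_space (chart_index V n J), chart V n J) | J. \<forall>i\<in>V. J i \<subseteq> {..<n i} \<and> card (J i) = e i}"

text \<open>
  \<open>gr_set Q \<E> e d M\<close>, for \<open>M\<close> of dimension \<open>e + d\<close>. The restriction of \<open>M\<close> to \<open>U\<close> is represented in
  coordinates by any \<open>X\<close> with an injective homomorphism to \<open>M\<close> with image \<open>U\<close>, and \<open>M/U\<close> by
  any \<open>N\<close> with a surjective homomorphism from \<open>M\<close> with kernel \<open>U\<close>.
\<close>

definition gr_set ::
  "('v, 'a) pre_digraph \<Rightarrow> ('v, 'a, 'k::field) rep set \<Rightarrow> ('v \<Rightarrow> nat) \<Rightarrow> ('v \<Rightarrow> nat) \<Rightarrow>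
   ('a \<Rightarrow> 'k mat) \<Rightarrow> ('v \<Rightarrow> 'k vec set) set" where
  "gr_set Q \<E> e d M =
     {U \<in> grassmannian_prod (verts Q) e (\<lambda>i. e i + d i).
        (\<forall>\<alpha>\<in>arcs Q. \<forall>w\<in>U (tail Q \<alpha>). M \<alpha> *\<^sub>v w \<in> U (head Q \<alpha>)) \<and>
        (\<exists>X\<in>cat_set \<E> e. \<exists>f. is_hom Q (e, X) (\<lambda>i. e i + d i, M) f \<and>
           (\<forall>i\<in>verts Q. mat_injective (f i) \<and> mat_image (f i) = U i)) \<and>
        (\<exists>N\<in>cat_set \<E> d. \<exists>g. is_hom Q (\<lambda>i. e i + d i, M) (d, N) g \<and>
           (\<forall>i\<in>verts Q. mat_surjective (g i) \<and> mat_kernel (g i) = U i))}"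

definition quiver_grassmannian ::
  "('v, 'a) pre_digraph \<Rightarrow> (('v, 'a) path \<Rightarrow>\<^sub>0 'k::field) set \<Rightarrow> ('v \<Rightarrow> nat) \<Rightarrow> ('v \<Rightarrow> nat) \<Rightarrow>
   ('a \<Rightarrow> 'k mat) \<Rightarrow> ('v \<Rightarrow> 'k vec set, 'k) kspace" where
  "quiver_grassmannian Q I e d M =
     induced (grassmannian_prod_variety (verts Q) e (\<lambda>i. e i + d i)) (gr_set Q (modules Q I) e d M)"

definition cat_grassmannian ::
  "('v, 'a) pre_digraph \<Rightarrow> (('v, 'a) path \<Rightarrow>\<^sub>0 'k::field) set \<Rightarrow> ('v, 'a, 'k) rep set \<Rightarrow>
   ('v \<Rightarrow> nat) \<Rightarrow> ('v \<Rightarrow> nat) \<Rightarrow> ('a \<Rightarrow> 'k mat) \<Rightarrow> ('v \<Rightarrow> 'k vec set, 'k) kspace" where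
  "cat_grassmannian Q I \<E> e d M = induced (quiver_grassmannian Q I e d M) (gr_set Q \<E> e d M)"


section \<open>Inflations\<close>

type_synonym ('v, 'a, 'k) infl = "('a \<Rightarrow> 'k mat) \<times> ('v \<Rightarrow> 'k mat)"

definition infl_set ::
  "('v, 'a) pre_digraph \<Rightarrow> ('v, 'a, 'k::field) rep set \<Rightarrow> ('v \<Rightarrow> nat) \<Rightarrow> ('v \<Rightarrow> nat) \<Rightarrow>
   ('a \<Rightarrow> 'k mat) \<Rightarrow> ('v, 'a, 'k) infl set" where
  "infl_set Q \<E> e d M =
     {(U, f). U \<in> cat_set \<E> e \<and> f \<in> (\<Pi>\<^sub>E i\<in>verts Q. carrier_mat (e i + d i) (e i)) \<and>
        (\<forall>i\<in>verts Q. mat_injective (f i)) \<and>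
        (\<forall>\<alpha>\<in>arcs Q. M \<alpha> * f (tail Q \<alpha>) = f (head Q \<alpha>) * U \<alpha>) \<and>
        (\<exists>N\<in>cat_set \<E> d. \<exists>g. short_exact Q (e, U) f (\<lambda>i. e i + d i, M) g (d, N))}"

definition infl_variety ::
  "('v, 'a) pre_digraph \<Rightarrow> ('v, 'a, 'k::field) rep set \<Rightarrow> ('v \<Rightarrow> nat) \<Rightarrow> ('v \<Rightarrow> nat) \<Rightarrow>
   ('a \<Rightarrow> 'k mat) \<Rightarrow> (('v, 'a, 'k) infl, 'k) kspace" where
  "infl_variety Q \<E> e d M =
     induced
       (coord_space
          (rep_set Q e \<times> (\<Pi>\<^sub>E i\<in>verts Q. carrier_mat (e i + d i) (e i)))
          ({\<lambda>(U, f). c U | c. c \<in> rep_coords Q e} \<union>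
           {\<lambda>(U, f). f i $$ (r, s) | i r s. i \<in> verts Q \<and> r < e i + d i \<and> s < e i}))
       (infl_set Q \<E> e d M)"

definition GL_group :: "('v, 'a) pre_digraph \<Rightarrow> ('v \<Rightarrow> nat) \<Rightarrow> ('v \<Rightarrow> 'k::field mat) monoid" where
  "GL_group Q e =
     \<lparr> carrier = (\<Pi>\<^sub>E i\<in>verts Q. {A \<in> carrier_mat (e i) (e i). invertible_mat A}),
       monoid.mult = (\<lambda>g h. \<lambda>i\<in>verts Q. g i * h i),
       one = (\<lambda>i\<in>verts Q. 1\<^sub>m (e i)) \<rparr>"

definition infl_action ::
  "('v, 'a) pre_digraph \<Rightarrow> ('v, 'a, 'k::field) rep set \<Rightarrow> ('v \<Rightarrow> nat) \<Rightarrow> ('v \<Rightarrow> nat) \<Rightarrow>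
   ('a \<Rightarrow> 'k mat) \<Rightarrow> ('v \<Rightarrow> 'k mat) \<Rightarrow> ('v, 'a, 'k) infl \<Rightarrow> ('v, 'a, 'k) infl" where
  "infl_action Q \<E> e d M g =
     (\<lambda>(U, f)\<in>infl_set Q \<E> e d M.
        (\<lambda>\<alpha>\<in>arcs Q. g (head Q \<alpha>) * U \<alpha> * the (mat_inverse (g (tail Q \<alpha>))),
         \<lambda>i\<in>verts Q. f i * the (mat_inverse (g i))))"

definition infl_image :: "('v, 'a) pre_digraph \<Rightarrow> ('v, 'a, 'k::field) infl \<Rightarrow> 'v \<Rightarrow> 'k vec set" where
  "infl_image Q = (\<lambda>(U, f). \<lambda>i\<in>verts Q. mat_image (f i))"

end

theory Submission
  imports Defs "Jordan_Normal_Form.DL_Rank"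
begin

text \<open>
  A point \<open>U\<close> of a product of Grassmannians lies in a standard chart: after choosing, at every vertex, a
  set \<open>J i\<close> of coordinates, \<open>U i\<close> is the column space of a unique matrix \<open>F i\<close> whose rows in \<open>J i\<close> form an
  identity matrix, and it is the kernel of a complementary matrix \<open>G i\<close> (\<open>chart_graph\<close> and
  \<open>chart_cograph\<close>). The entries of \<open>F\<close> and \<open>G\<close> are regular functions of \<open>U\<close>, and \<open>F i\<close> and \<open>G i\<close> have the
  one-sided inverses \<open>sel_mat\<close> and \<open>cosel_mat\<close> that do not depend on \<open>U\<close>. Hence \<open>U\<close> is a submodule
  iff the product of \<open>G\<close>, \<open>M \<alpha>\<close> and \<open>F\<close> vanishes for every arrow \<open>\<alpha>\<close>, which is a closed condition, and then
  the matrices \<open>sub_rep\<close> and \<open>quot_rep\<close> of the restriction \<open>M|\<^sub>U\<close> and of the quotient \<open>M/U\<close> are regular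
  functions of \<open>U\<close> too.

  This gives the openness. Over a chart, \<open>U\<close> is sent to \<open>M|\<^sub>U\<close> and \<open>M/U\<close> by morphisms to the module
  varieties of dimensions \<open>e\<close> and \<open>d\<close>. Whether \<open>U\<close> lies in the \<open>\<E>\<close>-Grassmannian can be tested on these
  particular matrices because \<open>\<E>\<close> is closed under isomorphisms (\<open>gr_set_iff\<close>), so the
  \<open>\<E>\<close>-Grassmannian is the preimage of two open sets (\<open>openin_C_set\<close>).

  The quotient map sends an inflation \<open>(U, f)\<close> to the image of \<open>f\<close>. It is a morphism because the chart
  coordinates of the image are quotients of minors of \<open>f\<close> (\<open>family_morphism\<close>), and two inflations have
  the same image iff they differ by a change of basis of \<open>U\<close> (\<open>infl_image_orbit\<close>). The matrices
  \<open>sub_rep\<close> and \<open>F\<close> form an inflation with image \<open>U\<close>, so the map has a section over every chart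
  (\<open>local_section\<close>). Local sections are all that is needed to see that a subset with open preimage is
  open and that an invariant regular function descends (\<open>local_sections_quotient_topology\<close>,
  \<open>local_sections_descent\<close>). Finally, two geometric quotients of one action have the same functions and
  the same open sets, hence are isomorphic (\<open>geometric_quotient_unique\<close>).

  Both spaces have to be varieties. Locally they are locally closed subsets of an affine space. Such a
  subset is a finite union of sets that are closed in a principal open set, by Hilbert's basis theorem,
  and these are affine varieties by Rabinowitsch's trick (\<open>affine_covered_locally_closed\<close>). The
  \<open>\<E>\<close>-Grassmannian is separated since the entries of the product of \<open>G\<close> at \<open>U\<close> and \<open>F\<close> at \<open>U'\<close> vanish
  iff \<open>U = U'\<close> (\<open>separated_CGr\<close>).
\<close>

section \<open>Spaces with functions\<close>

lemma space_with_functionsD: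
  assumes "space_with_functions X"
  shows "\<forall>W f g. openin (zar X) W \<and> f \<in> reg X W \<and> (\<forall>x\<in>W. f x = g x) \<longrightarrow> g \<in> reg X W"
    and "\<forall>W V f. openin (zar X) W \<and> openin (zar X) V \<and> V \<subseteq> W \<and> f \<in> reg X W \<longrightarrow> f \<in> reg X V"
    and "\<forall>\<V> f. (\<forall>V\<in>\<V>. openin (zar X) V \<and> f \<in> reg X V) \<longrightarrow> f \<in> reg X (\<Union>\<V>)"
    and "\<forall>W. openin (zar X) W \<longrightarrow>
        (\<forall>c. (\<lambda>x. c) \<in> reg X W) \<and>
        (\<forall>f\<in>reg X W. \<forall>g\<in>reg X W. (\<lambda>x. f x + g x) \<in> reg X W \<and> (\<lambda>x. f x * g x) \<in> reg X W) \<and>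
        (\<forall>f\<in>reg X W. openin (zar X) {x \<in> W. f x \<noteq> 0} \<and>
           (\<lambda>x. inverse (f x)) \<in> reg X {x \<in> W. f x \<noteq> 0})"
  using assms unfolding space_with_functions_def by - (elim conjE, assumption)+

lemma swf_cong:
  "space_with_functions X \<Longrightarrow> openin (zar X) W \<Longrightarrow> f \<in> reg X W \<Longrightarrow> (\<And>x. x \<in> W \<Longrightarrow> f x = g x) \<Longrightarrow> g \<in> reg X W"
  using space_with_functionsD(1)[of X] by blast

lemma swf_restrict:
  "space_with_functions X \<Longrightarrow> openin (zar X) W \<Longrightarrow> f \<in> reg X W \<Longrightarrow> openin (zar X) V \<Longrightarrow> V \<subseteq> W \<Longrightarrow> f \<in> reg X V"
  using space_with_functionsD(2)[of X] by blast

lemma swf_local: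
  assumes "space_with_functions X"
    and "\<And>x. x \<in> W \<Longrightarrow> \<exists>V. openin (zar X) V \<and> x \<in> V \<and> V \<subseteq> W \<and> f \<in> reg X V"
  shows "f \<in> reg X W"
proof -
  let ?V = "{V. openin (zar X) V \<and> V \<subseteq> W \<and> f \<in> reg X V}"
  have "f \<in> reg X (\<Union>?V)"
    using space_with_functionsD(3)[OF assms(1)] by simp
  moreover have "\<Union>?V = W" using assms(2) by blast
  ultimately show ?thesis by simp
qed

lemma swf_const: "space_with_functions X \<Longrightarrow> openin (zar X) W \<Longrightarrow> (\<lambda>x. c) \<in> reg X W"
  using space_with_functionsD(4)[of X] by blast

lemma swf_add:
  "space_with_functions X \<Longrightarrow> openin (zar X) W \<Longrightarrow> f \<in> reg X W \<Longrightarrow> g \<in> reg X W \<Longrightarrow> (\<lambda>x. f x + g x) \<in> reg X W"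
  using space_with_functionsD(4)[of X] by blast

lemma swf_mult:
  "space_with_functions X \<Longrightarrow> openin (zar X) W \<Longrightarrow> f \<in> reg X W \<Longrightarrow> g \<in> reg X W \<Longrightarrow> (\<lambda>x. f x * g x) \<in> reg X W"
  using space_with_functionsD(4)[of X] by blast

lemma swf_nonzero:
  "space_with_functions X \<Longrightarrow> openin (zar X) W \<Longrightarrow> f \<in> reg X W \<Longrightarrow> openin (zar X) {x \<in> W. f x \<noteq> 0}"
  using space_with_functionsD(4)[of X] by blast

lemma swf_inverse_nonzero:
  "space_with_functions X \<Longrightarrow> openin (zar X) W \<Longrightarrow> f \<in> reg X W \<Longrightarrow>
   (\<lambda>x. inverse (f x)) \<in> reg X {x \<in> W. f x \<noteq> 0}"
  using space_with_functionsD(4)[of X] by blast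

lemma swf_inverse:
  assumes "space_with_functions X" "openin (zar X) W" "f \<in> reg X W" "\<And>x. x \<in> W \<Longrightarrow> f x \<noteq> 0"
  shows "(\<lambda>x. inverse (f x)) \<in> reg X W"
proof -
  have "{x \<in> W. f x \<noteq> 0} = W" using assms(4) by blast
  then show ?thesis using swf_inverse_nonzero[OF assms(1-3)] by simp
qed

lemma swf_uminus:
  "space_with_functions X \<Longrightarrow> openin (zar X) W \<Longrightarrow> f \<in> reg X W \<Longrightarrow> (\<lambda>x. - f x) \<in> reg X W"
  using swf_mult[OF _ _ swf_const, of X W f "-1"] by simp

lemma swf_sum:
  "space_with_functions X \<Longrightarrow> openin (zar X) W \<Longrightarrow> (\<And>k. k \<in> K \<Longrightarrow> f k \<in> reg X W) \<Longrightarrow>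
   (\<lambda>x. \<Sum>k\<in>K. f k x) \<in> reg X W"
  by (induction K rule: infinite_finite_induct) (simp_all add: swf_const swf_add)

lemma swf_prod:
  "space_with_functions X \<Longrightarrow> openin (zar X) W \<Longrightarrow> (\<And>k. k \<in> K \<Longrightarrow> f k \<in> reg X W) \<Longrightarrow>
   (\<lambda>x. \<Prod>k\<in>K. f k x) \<in> reg X W"
  by (induction K rule: infinite_finite_induct) (simp_all add: swf_const swf_mult)

text \<open>A polynomial in coordinate functions is regular along every map for which the coordinates are.\<close>

lemma swf_polynomial:
  assumes "space_with_functions X" "openin (zar X) W"
    and "p \<in> polynomial_functions C" and "\<And>c. c \<in> C \<Longrightarrow> (\<lambda>x. c (\<phi> x)) \<in> reg X W"
  shows "(\<lambda>x. p (\<phi> x)) \<in> reg X W"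
  using assms(3) by induction (simp_all add: assms swf_const swf_add swf_mult)

lemma space_with_functionsI:
  assumes "\<And>W f g. openin (zar X) W \<Longrightarrow> f \<in> reg X W \<Longrightarrow> \<forall>x\<in>W. f x = g x \<Longrightarrow> g \<in> reg X W"
    and "\<And>W V f. openin (zar X) W \<Longrightarrow> openin (zar X) V \<Longrightarrow> V \<subseteq> W \<Longrightarrow> f \<in> reg X W \<Longrightarrow> f \<in> reg X V"
    and "\<And>\<V> f. \<forall>V\<in>\<V>. openin (zar X) V \<and> f \<in> reg X V \<Longrightarrow> f \<in> reg X (\<Union>\<V>)"
    and "\<And>W c. openin (zar X) W \<Longrightarrow> (\<lambda>x. c) \<in> reg X W"
    and "\<And>W f g. openin (zar X) W \<Longrightarrow> f \<in> reg X W \<Longrightarrow> g \<in> reg X W \<Longrightarrow> (\<lambda>x. f x + g x) \<in> reg X W"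
    and "\<And>W f g. openin (zar X) W \<Longrightarrow> f \<in> reg X W \<Longrightarrow> g \<in> reg X W \<Longrightarrow> (\<lambda>x. f x * g x) \<in> reg X W"
    and "\<And>W f. openin (zar X) W \<Longrightarrow> f \<in> reg X W \<Longrightarrow> openin (zar X) {x \<in> W. f x \<noteq> 0}"
    and "\<And>W f. openin (zar X) W \<Longrightarrow> f \<in> reg X W \<Longrightarrow> (\<lambda>x. inverse (f x)) \<in> reg X {x \<in> W. f x \<noteq> 0}"
  shows "space_with_functions X"
  unfolding space_with_functions_def
proof (intro conjI)
  show "\<forall>W f g. openin (zar X) W \<and> f \<in> reg X W \<and> (\<forall>x\<in>W. f x = g x) \<longrightarrow> g \<in> reg X W"
    using assms(1) by blast
  show "\<forall>W V f. openin (zar X) W \<and> openin (zar X) V \<and> V \<subseteq> W \<and> f \<in> reg X W \<longrightarrow> f \<in> reg X V"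
    using assms(2) by blast
  show "\<forall>\<V> f. (\<forall>V\<in>\<V>. openin (zar X) V \<and> f \<in> reg X V) \<longrightarrow> f \<in> reg X (\<Union>\<V>)"
    using assms(3) by blast
  show "\<forall>W. openin (zar X) W \<longrightarrow>
        (\<forall>c. (\<lambda>x. c) \<in> reg X W) \<and>
        (\<forall>f\<in>reg X W. \<forall>g\<in>reg X W. (\<lambda>x. f x + g x) \<in> reg X W \<and> (\<lambda>x. f x * g x) \<in> reg X W) \<and>
        (\<forall>f\<in>reg X W. openin (zar X) {x \<in> W. f x \<noteq> 0} \<and>
           (\<lambda>x. inverse (f x)) \<in> reg X {x \<in> W. f x \<noteq> 0})"
    by (simp add: assms(4-8))
qed

subsection \<open>Induced structures\<close>

lemma zar_induced [simp]: "zar (induced X S) = subtopology (zar X) S"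
  by (simp add: induced_def)

lemma reg_induced_iff:
  "f \<in> reg (induced X S) W \<longleftrightarrow>
     (\<forall>x\<in>W. \<exists>V h. openin (zar X) V \<and> x \<in> V \<and> h \<in> reg X V \<and> (\<forall>y\<in>V \<inter> W. f y = h y))"
  by (simp add: induced_def)

lemma reg_inducedE:
  assumes "f \<in> reg (induced X S) W" "x \<in> W"
  obtains V h where "openin (zar X) V" "x \<in> V" "h \<in> reg X V" "\<forall>y\<in>V \<inter> W. f y = h y"
  using bspec[OF assms(1)[unfolded reg_induced_iff] assms(2)] by (elim exE conjE) simp

text \<open>Being locally the restriction of a regular function is preserved by the ring operations because finitely
  many ambient neighbourhoods of a point can be intersected. For inverses, the ambient function has to be
  restricted further to the open set where it does not vanish.\<close>

lemma swf_induced: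
  assumes X: "space_with_functions X"
  shows "space_with_functions (induced X S)"
proof (rule space_with_functionsI)
  fix W f g assume f: "f \<in> reg (induced X S) W" and g: "\<forall>x\<in>W. f x = g x"
  show "g \<in> reg (induced X S) W" unfolding reg_induced_iff
  proof
    fix x assume "x \<in> W"
    with f obtain V h where "openin (zar X) V" "x \<in> V" "h \<in> reg X V" "\<forall>y\<in>V \<inter> W. f y = h y"
      by (rule reg_inducedE)
    then show "\<exists>V h. openin (zar X) V \<and> x \<in> V \<and> h \<in> reg X V \<and> (\<forall>y\<in>V \<inter> W. g y = h y)"
      using g by (intro exI[of _ V] exI[of _ h]) simp
  qed
next
  fix W V f assume f: "f \<in> reg (induced X S) W" and V: "V \<subseteq> W"
  show "f \<in> reg (induced X S) V" unfolding reg_induced_iff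
  proof
    fix x assume "x \<in> V"
    then have "x \<in> W" using V by blast
    with f obtain N h where "openin (zar X) N" "x \<in> N" "h \<in> reg X N" "\<forall>y\<in>N \<inter> W. f y = h y"
      by (rule reg_inducedE)
    then show "\<exists>N h. openin (zar X) N \<and> x \<in> N \<and> h \<in> reg X N \<and> (\<forall>y\<in>N \<inter> V. f y = h y)"
      using V by (intro exI[of _ N] exI[of _ h]) auto
  qed
next
  fix \<V> f assume V: "\<forall>V\<in>\<V>. openin (zar (induced X S)) V \<and> f \<in> reg (induced X S) V"
  show "f \<in> reg (induced X S) (\<Union>\<V>)" unfolding reg_induced_iff
  proof
    fix x assume "x \<in> \<Union>\<V>"
    then obtain V where v: "V \<in> \<V>" "x \<in> V" by blast
    then obtain V' where V': "openin (zar X) V'" "V = V' \<inter> S"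
      using bspec[OF V v(1)] unfolding zar_induced openin_subtopology by blast
    obtain N h where N: "openin (zar X) N" "x \<in> N" "h \<in> reg X N" "\<forall>y\<in>N \<inter> V. f y = h y"
      using bspec[OF V v(1), THEN conjunct2] v(2) by (rule reg_inducedE)
    have sub: "U \<subseteq> S" if "U \<in> \<V>" for U using bspec[OF V that] openin_subset[of "zar (induced X S)" U] by simp
    have "openin (zar X) (N \<inter> V')" "x \<in> N \<inter> V'" using N V' v by auto
    moreover have "h \<in> reg X (N \<inter> V')" using swf_restrict[OF X N(1,3)] N V' by auto
    moreover have "\<forall>y\<in>(N \<inter> V') \<inter> \<Union>\<V>. f y = h y" using N V' sub by blast
    ultimately show "\<exists>V h. openin (zar X) V \<and> x \<in> V \<and> h \<in> reg X V \<and> (\<forall>y\<in>V \<inter> \<Union>\<V>. f y = h y)"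
      by blast
  qed
next
  fix W c assume "openin (zar (induced X S)) W"
  then have W: "W \<subseteq> pts X" using openin_subset[of "zar (induced X S)" W] by simp
  show "(\<lambda>x. c) \<in> reg (induced X S) W" unfolding reg_induced_iff
  proof
    fix x assume "x \<in> W"
    then show "\<exists>V h. openin (zar X) V \<and> x \<in> V \<and> h \<in> reg X V \<and> (\<forall>y\<in>V \<inter> W. c = h y)"
      using swf_const[OF X, of "pts X" c] W by (intro exI[of _ "pts X"] exI[of _ "\<lambda>x. c"]) auto
  qed
next
  fix W f g assume fg: "f \<in> reg (induced X S) W" "g \<in> reg (induced X S) W"
  have loc: "\<exists>V h k. openin (zar X) V \<and> x \<in> V \<and> h \<in> reg X V \<and> k \<in> reg X V \<and> (\<forall>y\<in>V \<inter> W. f y = h y \<and> g y = k y)"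
    if x: "x \<in> W" for x
  proof -
    obtain V h where 1: "openin (zar X) V" "x \<in> V" "h \<in> reg X V" "\<forall>y\<in>V \<inter> W. f y = h y"
      using fg(1) x by (rule reg_inducedE)
    obtain V' k where 2: "openin (zar X) V'" "x \<in> V'" "k \<in> reg X V'" "\<forall>y\<in>V' \<inter> W. g y = k y"
      using fg(2) x by (rule reg_inducedE)
    have "h \<in> reg X (V \<inter> V')" "k \<in> reg X (V \<inter> V')"
      using 1 2 swf_restrict[OF X 1(1) 1(3), of "V \<inter> V'"] swf_restrict[OF X 2(1) 2(3), of "V \<inter> V'"] by auto
    then show ?thesis using 1 2 by (intro exI[of _ "V \<inter> V'"] exI[of _ h] exI[of _ k]) auto
  qed
  show "(\<lambda>x. f x + g x) \<in> reg (induced X S) W" unfolding reg_induced_iff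
  proof
    fix x assume "x \<in> W"
    from loc[OF this] obtain V h k where "openin (zar X) V" "x \<in> V" "h \<in> reg X V" "k \<in> reg X V"
      "\<forall>y\<in>V \<inter> W. f y = h y \<and> g y = k y" by blast
    then show "\<exists>V h. openin (zar X) V \<and> x \<in> V \<and> h \<in> reg X V \<and> (\<forall>y\<in>V \<inter> W. f y + g y = h y)"
      using swf_add[OF X, of V h k] by (intro exI[of _ V] exI[of _ "\<lambda>x. h x + k x"]) auto
  qed
  show "(\<lambda>x. f x * g x) \<in> reg (induced X S) W" unfolding reg_induced_iff
  proof
    fix x assume "x \<in> W"
    from loc[OF this] obtain V h k where "openin (zar X) V" "x \<in> V" "h \<in> reg X V" "k \<in> reg X V"
      "\<forall>y\<in>V \<inter> W. f y = h y \<and> g y = k y" by blast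
    then show "\<exists>V h. openin (zar X) V \<and> x \<in> V \<and> h \<in> reg X V \<and> (\<forall>y\<in>V \<inter> W. f y * g y = h y)"
      using swf_mult[OF X, of V h k] by (intro exI[of _ V] exI[of _ "\<lambda>x. h x * k x"]) auto
  qed
next
  fix W f assume W: "openin (zar (induced X S)) W" and f: "f \<in> reg (induced X S) W"
  obtain W' where W': "openin (zar X) W'" "W = W' \<inter> S"
    using W by (auto simp: openin_subtopology)
  have loc: "\<exists>V h. openin (zar X) {y \<in> V. h y \<noteq> 0} \<and> x \<in> {y \<in> V. h y \<noteq> 0} \<and>
      (\<lambda>y. inverse (h y)) \<in> reg X {y \<in> V. h y \<noteq> 0} \<and> (\<forall>y\<in>V \<inter> W. f y = h y)"
    if "x \<in> W" "f x \<noteq> 0" for x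
  proof -
    obtain V h where 1: "openin (zar X) V" "x \<in> V" "h \<in> reg X V" "\<forall>y\<in>V \<inter> W. f y = h y"
      using f \<open>x \<in> W\<close> by (rule reg_inducedE)
    then show ?thesis using swf_nonzero[OF X 1(1,3)] swf_inverse_nonzero[OF X 1(1,3)] that
      by (intro exI[of _ V] exI[of _ h]) auto
  qed
  show "openin (zar (induced X S)) {x \<in> W. f x \<noteq> 0}"
  proof (subst openin_subopen, clarify)
    fix x assume x: "x \<in> W" "f x \<noteq> 0"
    from loc[OF x] obtain V h where V: "openin (zar X) {y \<in> V. h y \<noteq> 0}" "x \<in> {y \<in> V. h y \<noteq> 0}"
      "\<forall>y\<in>V \<inter> W. f y = h y" by blast
    have "openin (zar (induced X S)) ({y \<in> V. h y \<noteq> 0} \<inter> W' \<inter> S)"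
      using V(1) W'(1) unfolding zar_induced openin_subtopology by (blast intro: openin_Int)
    moreover have "x \<in> {y \<in> V. h y \<noteq> 0} \<inter> W' \<inter> S" using V(2) x W'(2) by blast
    moreover have "{y \<in> V. h y \<noteq> 0} \<inter> W' \<inter> S \<subseteq> {x \<in> W. f x \<noteq> 0}" using V(3) W'(2) by auto
    ultimately show "\<exists>T. openin (zar (induced X S)) T \<and> x \<in> T \<and> T \<subseteq> {x \<in> W. f x \<noteq> 0}" by blast
  qed
  show "(\<lambda>x. inverse (f x)) \<in> reg (induced X S) {x \<in> W. f x \<noteq> 0}" unfolding reg_induced_iff
  proof
    fix x assume "x \<in> {x \<in> W. f x \<noteq> 0}"
    then have x: "x \<in> W" "f x \<noteq> 0" by auto
    from loc[OF x] obtain V h where V: "openin (zar X) {y \<in> V. h y \<noteq> 0}" "x \<in> {y \<in> V. h y \<noteq> 0}"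
      "(\<lambda>y. inverse (h y)) \<in> reg X {y \<in> V. h y \<noteq> 0}" "\<forall>y\<in>V \<inter> W. f y = h y" by blast
    then show "\<exists>V h. openin (zar X) V \<and> x \<in> V \<and> h \<in> reg X V \<and>
        (\<forall>y\<in>V \<inter> {x \<in> W. f x \<noteq> 0}. inverse (f y) = h y)"
      by (intro exI[of _ "{y \<in> V. h y \<noteq> 0}"] exI[of _ "\<lambda>y. inverse (h y)"]) auto
  qed
qed

lemma reg_into_induced:
  "openin (zar X) V \<Longrightarrow> h \<in> reg X V \<Longrightarrow> W \<subseteq> V \<Longrightarrow> h \<in> reg (induced X S) W"
  unfolding reg_induced_iff by (intro ballI exI[of _ V] exI[of _ h]) auto

text \<open>The converse of \<open>reg_into_induced\<close> for open subspaces: the local extensions agree with the function on an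
  open set of the ambient space, where regularity is a local property.\<close>

lemma reg_induced_open:
  assumes X: "space_with_functions X" and U: "openin (zar X) U" and V: "openin (zar X) V" "V \<subseteq> U"
    and f: "f \<in> reg (induced X U) V"
  shows "f \<in> reg X V"
proof (rule swf_local[OF X])
  fix x assume x: "x \<in> V"
  obtain N h where N: "openin (zar X) N" "x \<in> N" "h \<in> reg X N" "\<forall>y\<in>N \<inter> V. f y = h y"
    using f x by (rule reg_inducedE)
  have NV: "openin (zar X) (N \<inter> V)" using N V by blast
  have "h \<in> reg X (N \<inter> V)" by (rule swf_restrict[OF X N(1,3) NV]) blast
  from swf_cong[OF X NV this, of f] have "f \<in> reg X (N \<inter> V)" using N(4) by simp
  then show "\<exists>V'. openin (zar X) V' \<and> x \<in> V' \<and> V' \<subseteq> V \<and> f \<in> reg X V'"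
    using NV N(2) x by blast
qed

subsection \<open>Morphisms\<close>

lemma is_morphismD_pts: "is_morphism X Y \<phi> \<Longrightarrow> x \<in> pts X \<Longrightarrow> \<phi> x \<in> pts Y"
  unfolding is_morphism_def continuous_map_def by blast

lemma is_morphismD_open:
  "is_morphism X Y \<phi> \<Longrightarrow> openin (zar Y) V \<Longrightarrow> openin (zar X) {x \<in> pts X. \<phi> x \<in> V}"
  unfolding is_morphism_def continuous_map_def by blast

lemma is_morphismD_reg:
  "is_morphism X Y \<phi> \<Longrightarrow> openin (zar Y) V \<Longrightarrow> h \<in> reg Y V \<Longrightarrow>
   (\<lambda>x. h (\<phi> x)) \<in> reg X {x \<in> pts X. \<phi> x \<in> V}"
  unfolding is_morphism_def by (auto simp: comp_def)

lemma is_morphismI: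
  assumes "\<And>x. x \<in> pts X \<Longrightarrow> \<phi> x \<in> pts Y"
    and "\<And>V. openin (zar Y) V \<Longrightarrow> openin (zar X) {x \<in> pts X. \<phi> x \<in> V}"
    and "\<And>V h. openin (zar Y) V \<Longrightarrow> h \<in> reg Y V \<Longrightarrow> (\<lambda>x. h (\<phi> x)) \<in> reg X {x \<in> pts X. \<phi> x \<in> V}"
  shows "is_morphism X Y \<phi>"
  using assms unfolding is_morphism_def continuous_map_def by (auto simp: comp_def)

lemma is_morphism_comp:
  assumes "is_morphism X Y \<phi>" "is_morphism Y Z \<psi>"
  shows "is_morphism X Z (\<lambda>x. \<psi> (\<phi> x))"
proof -
  have eq: "{x \<in> pts X. \<phi> x \<in> {y \<in> pts Y. \<psi> y \<in> V}} = {x \<in> pts X. \<psi> (\<phi> x) \<in> V}" for V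
    using is_morphismD_pts[OF assms(1)] by blast
  show ?thesis
  proof (rule is_morphismI)
    show "\<psi> (\<phi> x) \<in> pts Z" if "x \<in> pts X" for x
      by (rule is_morphismD_pts[OF assms(2) is_morphismD_pts[OF assms(1) that]])
    show "openin (zar X) {x \<in> pts X. \<psi> (\<phi> x) \<in> V}" if "openin (zar Z) V" for V
      using is_morphismD_open[OF assms(1) is_morphismD_open[OF assms(2) that]] unfolding eq .
    show "(\<lambda>x. h (\<psi> (\<phi> x))) \<in> reg X {x \<in> pts X. \<psi> (\<phi> x) \<in> V}"
      if "openin (zar Z) V" "h \<in> reg Z V" for V h
      using is_morphismD_reg[OF assms(1) is_morphismD_open[OF assms(2) that(1)] is_morphismD_reg[OF assms(2) that]]
      unfolding eq .
  qed
qed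

lemma is_morphism_inclusion: "is_morphism (induced X S) X (\<lambda>x. x)"
proof (rule is_morphismI)
  show "openin (zar (induced X S)) {x \<in> pts (induced X S). x \<in> V}" if "openin (zar X) V" for V
  proof -
    have "{x \<in> pts (induced X S). x \<in> V} = V \<inter> S" using openin_subset[OF that] by auto
    then show ?thesis using that unfolding zar_induced openin_subtopology by blast
  qed
  show "h \<in> reg (induced X S) {x \<in> pts (induced X S). x \<in> V}"
    if "openin (zar X) V" "h \<in> reg X V" for V h
    using that by (rule reg_into_induced) auto
qed simp

text \<open>A subset carries the structure that makes it universal for maps that land in it. This is how maps into the
  Grassmannians and into the varieties of modules and inflations are recognised as morphisms.\<close>

lemma is_morphism_into_induced:
  assumes X: "space_with_functions X" and \<phi>: "is_morphism X Y \<phi>" and S: "\<And>x. x \<in> pts X \<Longrightarrow> \<phi> x \<in> S"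
  shows "is_morphism X (induced Y S) \<phi>"
proof -
  have eq: "{x \<in> pts X. \<phi> x \<in> V \<inter> S} = {x \<in> pts X. \<phi> x \<in> V}" for V using S by blast
  have op: "openin (zar X) {x \<in> pts X. \<phi> x \<in> V}" if V: "openin (zar (induced Y S)) V" for V
    using V is_morphismD_open[OF \<phi>] eq unfolding zar_induced openin_subtopology by auto
  show ?thesis
  proof (rule is_morphismI)
    show "\<phi> x \<in> pts (induced Y S)" if "x \<in> pts X" for x
      using that S is_morphismD_pts[OF \<phi>] by simp
    show "openin (zar X) {x \<in> pts X. \<phi> x \<in> V}" if V: "openin (zar (induced Y S)) V" for V
      using op[OF that] .
    fix V h assume V: "openin (zar (induced Y S)) V" and h: "h \<in> reg (induced Y S) V"
    show "(\<lambda>x. h (\<phi> x)) \<in> reg X {x \<in> pts X. \<phi> x \<in> V}"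
    proof (rule swf_local[OF X])
      fix x assume x: "x \<in> {x \<in> pts X. \<phi> x \<in> V}"
      then have "\<phi> x \<in> V" by simp
      with h obtain N k where N: "openin (zar Y) N" "\<phi> x \<in> N" "k \<in> reg Y N" "\<forall>y\<in>N \<inter> V. h y = k y"
        by (rule reg_inducedE)
      let ?N = "{x \<in> pts X. \<phi> x \<in> N}" let ?O = "?N \<inter> {x \<in> pts X. \<phi> x \<in> V}"
      have oN: "openin (zar X) ?N" using is_morphismD_open[OF \<phi> N(1)] .
      have oO: "openin (zar X) ?O" using oN op[OF V] by (rule openin_Int)
      have "(\<lambda>x. k (\<phi> x)) \<in> reg X ?O"
        by (rule swf_restrict[OF X oN is_morphismD_reg[OF \<phi> N(1,3)] oO]) blast
      from swf_cong[OF X oO this, of "\<lambda>x. h (\<phi> x)"]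
      have "(\<lambda>x. h (\<phi> x)) \<in> reg X ?O" using N(4) by simp
      then show "\<exists>V'. openin (zar X) V' \<and> x \<in> V' \<and> V' \<subseteq> {x \<in> pts X. \<phi> x \<in> V} \<and> (\<lambda>x. h (\<phi> x)) \<in> reg X V'"
        using oO x N(2) by blast
    qed
  qed
qed

lemma is_morphism_restrict:
  "is_morphism X Y \<phi> \<Longrightarrow> is_morphism (induced X S) Y \<phi>"
  using is_morphism_comp[OF is_morphism_inclusion[of X S], of Y \<phi>] by simp

lemma is_morphism_restrict_both:
  assumes "space_with_functions X" "is_morphism X Y \<phi>" "\<And>x. x \<in> pts X \<Longrightarrow> x \<in> S \<Longrightarrow> \<phi> x \<in> T"
  shows "is_morphism (induced X S) (induced Y T) \<phi>"
  by (rule is_morphism_into_induced[OF swf_induced[OF assms(1)] is_morphism_restrict[OF assms(2)]])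
     (use assms(3) in auto)

lemma is_morphism_local:
  assumes X: "space_with_functions X"
    and loc: "\<And>x. x \<in> pts X \<Longrightarrow> \<exists>W. openin (zar X) W \<and> x \<in> W \<and> is_morphism (induced X W) Y \<phi>"
  shows "is_morphism X Y \<phi>"
proof -
  have locV: "\<exists>N. openin (zar X) N \<and> x \<in> N \<and> N \<subseteq> {x \<in> pts X. \<phi> x \<in> V} \<and>
      (h \<in> reg Y V \<longrightarrow> (\<lambda>x. h (\<phi> x)) \<in> reg X N)"
    if V: "openin (zar Y) V" and x: "x \<in> pts X" "\<phi> x \<in> V" for V x h
  proof -
    obtain W where W: "openin (zar X) W" "x \<in> W" "is_morphism (induced X W) Y \<phi>" using loc[OF x(1)] by blast
    let ?O = "{x \<in> pts (induced X W). \<phi> x \<in> V}"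
    have "openin (zar (induced X W)) ?O" using is_morphismD_open[OF W(3) V] .
    then have O: "openin (zar X) ?O" using openin_trans_full W(1) by fastforce
    moreover have "(\<lambda>x. h (\<phi> x)) \<in> reg X ?O" if "h \<in> reg Y V"
      using reg_induced_open[OF X W(1) O _ is_morphismD_reg[OF W(3) V that]] by auto
    moreover have "x \<in> ?O" using W x by auto
    moreover have "?O \<subseteq> {x \<in> pts X. \<phi> x \<in> V}" by auto
    ultimately show ?thesis by blast
  qed
  show ?thesis
  proof (rule is_morphismI)
    fix x assume x: "x \<in> pts X"
    then obtain W where W: "x \<in> W" "is_morphism (induced X W) Y \<phi>" using loc[OF x(1)] by blast
    then show "\<phi> x \<in> pts Y" using is_morphismD_pts[OF W(2)] x by auto
  next
    fix V assume V: "openin (zar Y) V"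
    show "openin (zar X) {x \<in> pts X. \<phi> x \<in> V}"
      by (subst openin_subopen) (use locV[OF V] in blast)
  next
    fix V h assume V: "openin (zar Y) V" and h: "h \<in> reg Y V"
    show "(\<lambda>x. h (\<phi> x)) \<in> reg X {x \<in> pts X. \<phi> x \<in> V}"
      by (rule swf_local[OF X]) (use locV[OF V] h in blast)
  qed
qed

lemma isomorphicI:
  "is_morphism X Y \<phi> \<Longrightarrow> is_morphism Y X \<psi> \<Longrightarrow> (\<And>x. x \<in> pts X \<Longrightarrow> \<psi> (\<phi> x) = x) \<Longrightarrow>
   (\<And>y. y \<in> pts Y \<Longrightarrow> \<phi> (\<psi> y) = y) \<Longrightarrow> isomorphic X Y"
  unfolding isomorphic_def by blast

lemma isomorphic_trans:
  assumes "isomorphic X Y" "isomorphic Y Z" shows "isomorphic X Z"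
proof -
  obtain \<phi> \<psi> where 1: "is_morphism X Y \<phi>" "is_morphism Y X \<psi>" "\<forall>x\<in>pts X. \<psi> (\<phi> x) = x" "\<forall>y\<in>pts Y. \<phi> (\<psi> y) = y"
    using assms(1) unfolding isomorphic_def by blast
  obtain \<phi>' \<psi>' where 2: "is_morphism Y Z \<phi>'" "is_morphism Z Y \<psi>'" "\<forall>x\<in>pts Y. \<psi>' (\<phi>' x) = x" "\<forall>y\<in>pts Z. \<phi>' (\<psi>' y) = y"
    using assms(2) unfolding isomorphic_def by blast
  show ?thesis
    by (rule isomorphicI[OF is_morphism_comp[OF 1(1) 2(1)] is_morphism_comp[OF 2(2) 1(2)]])
      (use 1 2 is_morphismD_pts in \<open>metis\<close>)+
qed

subsection \<open>Coordinate spaces\<close>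

abbreviation principal :: "'x set \<Rightarrow> ('x \<Rightarrow> 'k::field) \<Rightarrow> 'x set" where
  "principal S p \<equiv> {x \<in> S. p x \<noteq> 0}"

lemma zar_coord_space:
  "zar (coord_space S C) = topology_generated_by {principal S p | p. p \<in> polynomial_functions C}"
  by (simp add: coord_space_def Let_def)

lemma openin_principal:
  "p \<in> polynomial_functions C \<Longrightarrow> openin (zar (coord_space S C)) (principal S p)"
  unfolding zar_coord_space by (rule topology_generated_by_Basis) blast

text \<open>Principal open sets form a basis and not just a subbasis, since the intersection of two of them is the principal
  open set of the product.\<close>

lemma openin_coord_space:
  "openin (zar (coord_space S C)) W \<longleftrightarrow>
     W \<subseteq> S \<and> (\<forall>x\<in>W. \<exists>p\<in>polynomial_functions C. p x \<noteq> 0 \<and> principal S p \<subseteq> W)" (is "?L \<longleftrightarrow> ?R")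
proof
  assume ?L
  then have "generate_topology_on {principal S p | p. p \<in> polynomial_functions C} W"
    unfolding zar_coord_space openin_topology_generated_by_iff .
  then show ?R
  proof induction
    case (Int a b)
    show ?case
    proof (intro conjI ballI)
      fix x assume "x \<in> a \<inter> b"
      then obtain p q where p: "p \<in> polynomial_functions C" "p x \<noteq> 0" "principal S p \<subseteq> a"
        and q: "q \<in> polynomial_functions C" "q x \<noteq> 0" "principal S q \<subseteq> b" using Int by blast
      show "\<exists>p\<in>polynomial_functions C. p x \<noteq> 0 \<and> principal S p \<subseteq> a \<inter> b"
        using p q by (intro bexI[OF _ polynomial_functions.mult[OF p(1) q(1)]]) auto
    qed (use Int in blast)
  next
    case (UN K)
    then show ?case by (meson Sup_least Sup_upper UnionE order_trans)
  qed auto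
next
  assume R: ?R
  show ?L
  proof (subst openin_subopen, intro ballI)
    fix x assume x: "x \<in> W"
    then obtain p where "p \<in> polynomial_functions C" "p x \<noteq> 0" "principal S p \<subseteq> W" using R by blast
    then show "\<exists>T. openin (zar (coord_space S C)) T \<and> x \<in> T \<and> T \<subseteq> W"
      using openin_principal[of p C S] R x by blast
  qed
qed

lemma pts_coord_space [simp]: "pts (coord_space S C) = S"
proof
  show "pts (coord_space S C) \<subseteq> S" using openin_topspace[of "zar (coord_space S C)"]
    unfolding openin_coord_space by simp
  have "openin (zar (coord_space S C)) S"
    unfolding openin_coord_space by (auto intro!: bexI[OF _ polynomial_functions.const[of 1]])
  then show "S \<subseteq> pts (coord_space S C)" by (rule openin_subset)
qed

lemma reg_coord_space_iff:
  "f \<in> reg (coord_space S C) W \<longleftrightarrow>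
     (\<forall>x\<in>W. \<exists>V p q. openin (zar (coord_space S C)) V \<and> x \<in> V \<and> V \<subseteq> W \<and>
        p \<in> polynomial_functions C \<and> q \<in> polynomial_functions C \<and> (\<forall>y\<in>V. q y \<noteq> 0 \<and> f y = p y / q y))"
  by (simp add: coord_space_def Let_def)

lemma reg_coord_spaceE:
  assumes "f \<in> reg (coord_space S C) W" "x \<in> W"
  obtains V p q where "openin (zar (coord_space S C)) V" "x \<in> V" "V \<subseteq> W"
    "p \<in> polynomial_functions C" "q \<in> polynomial_functions C" "\<forall>y\<in>V. q y \<noteq> 0" "\<forall>y\<in>V. f y = p y / q y"
  using bspec[OF assms(1)[unfolded reg_coord_space_iff] assms(2)] by (elim exE conjE) simp

lemma reg_coord_spaceI:
  assumes "\<And>x. x \<in> W \<Longrightarrow> \<exists>V p q. openin (zar (coord_space S C)) V \<and> x \<in> V \<and> V \<subseteq> W \<and>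
     p \<in> polynomial_functions C \<and> q \<in> polynomial_functions C \<and> (\<forall>y\<in>V. q y \<noteq> 0 \<and> f y = p y / q y)"
  shows "f \<in> reg (coord_space S C) W"
  unfolding reg_coord_space_iff using assms by simp

lemma polynomial_reg:
  assumes "p \<in> polynomial_functions C" "openin (zar (coord_space S C)) W"
  shows "p \<in> reg (coord_space S C) W"
  unfolding reg_coord_space_iff
proof
  fix x assume "x \<in> W"
  then show "\<exists>V p' q. openin (zar (coord_space S C)) V \<and> x \<in> V \<and> V \<subseteq> W \<and> p' \<in> polynomial_functions C \<and>
      q \<in> polynomial_functions C \<and> (\<forall>y\<in>V. q y \<noteq> 0 \<and> p y = p' y / q y)"
    using assms polynomial_functions.const[of 1 C] by (intro exI[of _ W] exI[of _ p] exI[of _ "\<lambda>x. 1"]) simp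
qed

text \<open>Sums, products and inverses of fractions of polynomials are fractions of polynomials. The inverse of \<open>p / q\<close>
  is defined on the principal open set of \<open>p\<close>.\<close>

lemma swf_coord_space: "space_with_functions (coord_space S C)"
proof (rule space_with_functionsI)
  fix W f g assume f: "f \<in> reg (coord_space S C) W" and g: "\<forall>x\<in>W. f x = g x"
  show "g \<in> reg (coord_space S C) W"
  proof (rule reg_coord_spaceI)
    fix x assume x: "x \<in> W"
    from f x obtain N p q where N: "openin (zar (coord_space S C)) N" "x \<in> N" "N \<subseteq> W" "p \<in> polynomial_functions C"
      "q \<in> polynomial_functions C" "\<forall>y\<in>N. q y \<noteq> 0" "\<forall>y\<in>N. f y = p y / q y"
      by (rule reg_coord_spaceE)
    have "g y = p y / q y" if "y \<in> N" for y using N(3,7) g that by (metis subsetD)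
    with N(1-6) show "\<exists>V p q. openin (zar (coord_space S C)) V \<and> x \<in> V \<and> V \<subseteq> W \<and>
       p \<in> polynomial_functions C \<and> q \<in> polynomial_functions C \<and> (\<forall>y\<in>V. q y \<noteq> 0 \<and> g y = p y / q y)"
      by (intro exI[of _ N] exI[of _ p] exI[of _ q]) simp
  qed
next
  fix W V f assume V: "openin (zar (coord_space S C)) V" "V \<subseteq> W" and f: "f \<in> reg (coord_space S C) W"
  show "f \<in> reg (coord_space S C) V" unfolding reg_coord_space_iff
  proof
    fix x assume x: "x \<in> V"
    then have "x \<in> W" using V(2) by blast
    with f obtain N p q where N: "openin (zar (coord_space S C)) N" "x \<in> N" "N \<subseteq> W" "p \<in> polynomial_functions C"
      "q \<in> polynomial_functions C" "\<forall>y\<in>N. q y \<noteq> 0" "\<forall>y\<in>N. f y = p y / q y"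
      by (rule reg_coord_spaceE)
    then show "\<exists>N p q. openin (zar (coord_space S C)) N \<and> x \<in> N \<and> N \<subseteq> V \<and> p \<in> polynomial_functions C \<and>
        q \<in> polynomial_functions C \<and> (\<forall>y\<in>N. q y \<noteq> 0 \<and> f y = p y / q y)"
      using x V by (intro exI[of _ "N \<inter> V"] exI[of _ p] exI[of _ q]) auto
  qed
next
  fix \<V> f assume V: "\<forall>V\<in>\<V>. openin (zar (coord_space S C)) V \<and> f \<in> reg (coord_space S C) V"
  show "f \<in> reg (coord_space S C) (\<Union>\<V>)"
  proof (rule reg_coord_spaceI)
    fix x assume "x \<in> \<Union>\<V>"
    then obtain V where x: "V \<in> \<V>" "x \<in> V" by blast
    then have "f \<in> reg (coord_space S C) V" using V by blast
    then obtain N p q where N: "openin (zar (coord_space S C)) N" "x \<in> N" "N \<subseteq> V" "p \<in> polynomial_functions C"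
      "q \<in> polynomial_functions C" "\<forall>y\<in>N. q y \<noteq> 0" "\<forall>y\<in>N. f y = p y / q y"
      using x(2) by (rule reg_coord_spaceE)
    have "N \<subseteq> \<Union>\<V>" using N(3) x(1) by blast
    with N show "\<exists>N p q. openin (zar (coord_space S C)) N \<and> x \<in> N \<and> N \<subseteq> \<Union>\<V> \<and>
       p \<in> polynomial_functions C \<and> q \<in> polynomial_functions C \<and> (\<forall>y\<in>N. q y \<noteq> 0 \<and> f y = p y / q y)"
      by (intro exI[of _ N] exI[of _ p] exI[of _ q]) simp
  qed
next
  fix W c assume "openin (zar (coord_space S C)) W"
  then show "(\<lambda>x. c) \<in> reg (coord_space S C) W" by (intro polynomial_reg polynomial_functions.const)
next
  fix W f g assume W: "openin (zar (coord_space S C)) W"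
    and fg: "f \<in> reg (coord_space S C) W" "g \<in> reg (coord_space S C) W"
  have loc: "\<exists>N p q p' q'. openin (zar (coord_space S C)) N \<and> x \<in> N \<and> N \<subseteq> W \<and> p \<in> polynomial_functions C \<and>
        q \<in> polynomial_functions C \<and> p' \<in> polynomial_functions C \<and> q' \<in> polynomial_functions C \<and>
        (\<forall>y\<in>N. q y \<noteq> 0 \<and> f y = p y / q y \<and> q' y \<noteq> 0 \<and> g y = p' y / q' y)" if "x \<in> W" for x
  proof -
    obtain N p q where N: "openin (zar (coord_space S C)) N" "x \<in> N" "N \<subseteq> W" "p \<in> polynomial_functions C"
      "q \<in> polynomial_functions C" "\<forall>y\<in>N. q y \<noteq> 0" "\<forall>y\<in>N. f y = p y / q y"
      using fg(1) \<open>x \<in> W\<close> by (rule reg_coord_spaceE)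
    obtain N' p' q' where N': "openin (zar (coord_space S C)) N'" "x \<in> N'" "N' \<subseteq> W" "p' \<in> polynomial_functions C"
      "q' \<in> polynomial_functions C" "\<forall>y\<in>N'. q' y \<noteq> 0" "\<forall>y\<in>N'. g y = p' y / q' y"
      using fg(2) \<open>x \<in> W\<close> by (rule reg_coord_spaceE)
    have "\<forall>y\<in>N \<inter> N'. q y \<noteq> 0 \<and> f y = p y / q y \<and> q' y \<noteq> 0 \<and> g y = p' y / q' y"
      using N(6,7) N'(6,7) by simp
    moreover have "x \<in> N \<inter> N'" "N \<inter> N' \<subseteq> W" using N(2,3) N'(2) by auto
    ultimately show ?thesis using openin_Int[OF N(1) N'(1)] N(4,5) N'(4,5)
      by (intro exI[of _ "N \<inter> N'"] exI[of _ p] exI[of _ q] exI[of _ p'] exI[of _ q'] conjI)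
  qed
  show "(\<lambda>x. f x + g x) \<in> reg (coord_space S C) W" unfolding reg_coord_space_iff
  proof
    fix x assume "x \<in> W"
    from loc[OF this] obtain N p q p' q' where N: "openin (zar (coord_space S C)) N" "x \<in> N" "N \<subseteq> W"
      and poly: "p \<in> polynomial_functions C" "q \<in> polynomial_functions C" "p' \<in> polynomial_functions C" "q' \<in> polynomial_functions C"
      and eq: "\<forall>y\<in>N. q y \<noteq> 0 \<and> f y = p y / q y \<and> q' y \<noteq> 0 \<and> g y = p' y / q' y" by metis
    have "(\<lambda>x. p x * q' x + p' x * q x) \<in> polynomial_functions C" "(\<lambda>x. q x * q' x) \<in> polynomial_functions C"
      using poly by (simp_all add: polynomial_functions.intros)
    moreover have "\<forall>y\<in>N. q y * q' y \<noteq> 0 \<and> f y + g y = (p y * q' y + p' y * q y) / (q y * q' y)"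
      using eq by (simp add: add_frac_eq)
    ultimately show "\<exists>N p q. openin (zar (coord_space S C)) N \<and> x \<in> N \<and> N \<subseteq> W \<and> p \<in> polynomial_functions C \<and>
        q \<in> polynomial_functions C \<and> (\<forall>y\<in>N. q y \<noteq> 0 \<and> f y + g y = p y / q y)"
      using N by (intro exI[of _ N] exI[of _ "\<lambda>x. p x * q' x + p' x * q x"] exI[of _ "\<lambda>x. q x * q' x"] conjI)
  qed
  show "(\<lambda>x. f x * g x) \<in> reg (coord_space S C) W" unfolding reg_coord_space_iff
  proof
    fix x assume "x \<in> W"
    from loc[OF this] obtain N p q p' q' where N: "openin (zar (coord_space S C)) N" "x \<in> N" "N \<subseteq> W"
      and poly: "p \<in> polynomial_functions C" "q \<in> polynomial_functions C" "p' \<in> polynomial_functions C" "q' \<in> polynomial_functions C"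
      and eq: "\<forall>y\<in>N. q y \<noteq> 0 \<and> f y = p y / q y \<and> q' y \<noteq> 0 \<and> g y = p' y / q' y" by metis
    have "(\<lambda>x. p x * p' x) \<in> polynomial_functions C" "(\<lambda>x. q x * q' x) \<in> polynomial_functions C"
      using poly by (simp_all add: polynomial_functions.intros)
    moreover have "\<forall>y\<in>N. q y * q' y \<noteq> 0 \<and> f y * g y = (p y * p' y) / (q y * q' y)"
      using eq by simp
    ultimately show "\<exists>N p q. openin (zar (coord_space S C)) N \<and> x \<in> N \<and> N \<subseteq> W \<and> p \<in> polynomial_functions C \<and>
        q \<in> polynomial_functions C \<and> (\<forall>y\<in>N. q y \<noteq> 0 \<and> f y * g y = p y / q y)"
      using N by (intro exI[of _ N] exI[of _ "\<lambda>x. p x * p' x"] exI[of _ "\<lambda>x. q x * q' x"] conjI)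
  qed
next
  fix W f assume W: "openin (zar (coord_space S C)) W" and f: "f \<in> reg (coord_space S C) W"
  have loc: "\<exists>N p q. openin (zar (coord_space S C)) N \<and> x \<in> N \<and> N \<subseteq> {x \<in> W. f x \<noteq> 0} \<and> p \<in> polynomial_functions C \<and>
        q \<in> polynomial_functions C \<and> (\<forall>y\<in>N. p y \<noteq> 0 \<and> inverse (f y) = q y / p y)"
    if "x \<in> {x \<in> W. f x \<noteq> 0}" for x
  proof -
    have "x \<in> W" using that by blast
    with f obtain N p q where N: "openin (zar (coord_space S C)) N" "x \<in> N" "N \<subseteq> W" "p \<in> polynomial_functions C"
      "q \<in> polynomial_functions C" "\<forall>y\<in>N. q y \<noteq> 0" "\<forall>y\<in>N. f y = p y / q y"
      by (rule reg_coord_spaceE)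
    have NS: "N \<subseteq> S" using N(1) unfolding openin_coord_space by blast
    show ?thesis
    proof (rule exI[of _ "N \<inter> principal S p"], rule exI[of _ p], rule exI[of _ q], intro conjI)
      show "openin (zar (coord_space S C)) (N \<inter> principal S p)"
        using N openin_principal by blast
      show "x \<in> N \<inter> principal S p" using that N(2,7) NS by auto
      show "N \<inter> principal S p \<subseteq> {x \<in> W. f x \<noteq> 0}" using N(3,6,7) by auto
      show "\<forall>y\<in>N \<inter> principal S p. p y \<noteq> 0 \<and> inverse (f y) = q y / p y" using N(7) by simp
    qed (fact N(4), fact N(5))
  qed
  show "openin (zar (coord_space S C)) {x \<in> W. f x \<noteq> 0}"
    by (subst openin_subopen) (use loc in blast)
  show "(\<lambda>x. inverse (f x)) \<in> reg (coord_space S C) {x \<in> W. f x \<noteq> 0}"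
  proof (rule reg_coord_spaceI)
    fix x assume "x \<in> {x \<in> W. f x \<noteq> 0}"
    from loc[OF this] show "\<exists>V p q. openin (zar (coord_space S C)) V \<and> x \<in> V \<and> V \<subseteq> {x \<in> W. f x \<noteq> 0} \<and>
       p \<in> polynomial_functions C \<and> q \<in> polynomial_functions C \<and> (\<forall>y\<in>V. q y \<noteq> 0 \<and> inverse (f y) = p y / q y)"
      by (elim exE conjE) (rule exI, rule exI, rule exI, intro conjI, assumption+)
  qed
qed

text \<open>Coordinates decide morphisms to affine spaces: topology and regular functions of the target
  are made from polynomials in the coordinates.\<close>

lemma is_morphism_coord_space:
  assumes Z: "space_with_functions Z" and S: "\<And>z. z \<in> pts Z \<Longrightarrow> \<phi> z \<in> S"
    and C: "\<And>c. c \<in> C \<Longrightarrow> (\<lambda>z. c (\<phi> z)) \<in> reg Z (pts Z)"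
  shows "is_morphism Z (coord_space S C) \<phi>"
proof -
  have poly: "(\<lambda>z. p (\<phi> z)) \<in> reg Z (pts Z)" if "p \<in> polynomial_functions C" for p
    by (rule swf_polynomial[OF Z _ that C]) auto
  have op: "openin (zar Z) {z \<in> pts Z. \<phi> z \<in> V}" if V: "openin (zar (coord_space S C)) V" for V
  proof (subst openin_subopen, clarify)
    fix z assume z: "z \<in> pts Z" "\<phi> z \<in> V"
    then obtain p where p: "p \<in> polynomial_functions C" "p (\<phi> z) \<noteq> 0" "principal S p \<subseteq> V"
      using V unfolding openin_coord_space by blast
    have "openin (zar Z) {z \<in> pts Z. p (\<phi> z) \<noteq> 0}" by (rule swf_nonzero[OF Z _ poly[OF p(1)]]) auto
    moreover have "{z \<in> pts Z. p (\<phi> z) \<noteq> 0} \<subseteq> {z \<in> pts Z. \<phi> z \<in> V}" using p(3) S by blast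
    ultimately show "\<exists>T. openin (zar Z) T \<and> z \<in> T \<and> T \<subseteq> {z \<in> pts Z. \<phi> z \<in> V}" using z p(2) by blast
  qed
  show ?thesis
  proof (rule is_morphismI)
    fix V h assume V: "openin (zar (coord_space S C)) V" and h: "h \<in> reg (coord_space S C) V"
    show "(\<lambda>z. h (\<phi> z)) \<in> reg Z {z \<in> pts Z. \<phi> z \<in> V}"
    proof (rule swf_local[OF Z])
      fix z assume z: "z \<in> {z \<in> pts Z. \<phi> z \<in> V}"
      then have "\<phi> z \<in> V" by simp
      with h obtain N p q where N: "openin (zar (coord_space S C)) N" "\<phi> z \<in> N" "N \<subseteq> V" "p \<in> polynomial_functions C"
        "q \<in> polynomial_functions C" "\<forall>y\<in>N. q y \<noteq> 0" "\<forall>y\<in>N. h y = p y / q y"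
        by (rule reg_coord_spaceE)
      let ?O = "{z \<in> pts Z. \<phi> z \<in> N}"
      have O: "openin (zar Z) ?O" using op[OF N(1)] .
      have sub: "?O \<subseteq> pts Z" by blast
      have "(\<lambda>z. inverse (q (\<phi> z))) \<in> reg Z ?O"
        by (rule swf_inverse[OF Z O swf_restrict[OF Z openin_topspace poly[OF N(5)] O sub]]) (use N(6) in blast)
      from swf_mult[OF Z O swf_restrict[OF Z openin_topspace poly[OF N(4)] O sub] this]
      have "(\<lambda>z. p (\<phi> z) * inverse (q (\<phi> z))) \<in> reg Z ?O" .
      from swf_cong[OF Z O this, of "\<lambda>z. h (\<phi> z)"]
      have "(\<lambda>z. h (\<phi> z)) \<in> reg Z ?O"
        using N(6,7) by (simp add: divide_inverse)
      then show "\<exists>V'. openin (zar Z) V' \<and> z \<in> V' \<and> V' \<subseteq> {z \<in> pts Z. \<phi> z \<in> V} \<and> (\<lambda>z. h (\<phi> z)) \<in> reg Z V'"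
        using O z N(2,3) by (intro exI[of _ ?O]) auto
    qed
  qed (use S op in auto)
qed

subsection \<open>Glued spaces\<close>

lemma openin_glued:
  "openin (zar (glued S \<Phi>)) W \<longleftrightarrow> W \<subseteq> S \<and> (\<forall>(A, \<phi>)\<in>\<Phi>. openin (zar A) {a \<in> pts A. \<phi> a \<in> W})"
  by (simp add: glued_def topology_inverse'[OF istopology_glued])

lemma reg_glued_iff:
  "h \<in> reg (glued S \<Phi>) W \<longleftrightarrow> (\<forall>(A, \<phi>)\<in>\<Phi>. (\<lambda>a. h (\<phi> a)) \<in> reg A {a \<in> pts A. \<phi> a \<in> W})"
  by (simp add: glued_def comp_def)

lemma openin_gluedI:
  "W \<subseteq> S \<Longrightarrow> (\<And>A \<phi>. (A, \<phi>) \<in> \<Phi> \<Longrightarrow> openin (zar A) {a \<in> pts A. \<phi> a \<in> W}) \<Longrightarrow> openin (zar (glued S \<Phi>)) W"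
  unfolding openin_glued by auto

lemma openin_gluedD:
  "openin (zar (glued S \<Phi>)) W \<Longrightarrow> (A, \<phi>) \<in> \<Phi> \<Longrightarrow> openin (zar A) {a \<in> pts A. \<phi> a \<in> W}"
  unfolding openin_glued by auto

lemma reg_gluedI:
  "(\<And>A \<phi>. (A, \<phi>) \<in> \<Phi> \<Longrightarrow> (\<lambda>a. h (\<phi> a)) \<in> reg A {a \<in> pts A. \<phi> a \<in> W}) \<Longrightarrow> h \<in> reg (glued S \<Phi>) W"
  unfolding reg_glued_iff by auto

lemma reg_gluedD:
  "h \<in> reg (glued S \<Phi>) W \<Longrightarrow> (A, \<phi>) \<in> \<Phi> \<Longrightarrow> (\<lambda>a. h (\<phi> a)) \<in> reg A {a \<in> pts A. \<phi> a \<in> W}"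
  unfolding reg_glued_iff by auto

lemma pts_glued:
  assumes "\<And>A \<phi> a. (A, \<phi>) \<in> \<Phi> \<Longrightarrow> a \<in> pts A \<Longrightarrow> \<phi> a \<in> S"
  shows "pts (glued S \<Phi>) = S"
proof
  show "pts (glued S \<Phi>) \<subseteq> S" using openin_topspace[of "zar (glued S \<Phi>)"]
    unfolding openin_glued by simp
  have "{a \<in> pts A. \<phi> a \<in> S} = pts A" if "(A, \<phi>) \<in> \<Phi>" for A \<phi> using assms that by blast
  then have "openin (zar (glued S \<Phi>)) S" unfolding openin_glued by auto
  then show "S \<subseteq> pts (glued S \<Phi>)" by (rule openin_subset)
qed

lemma swf_glued:
  assumes A: "\<And>A \<phi>. (A, \<phi>) \<in> \<Phi> \<Longrightarrow> space_with_functions A"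
  shows "space_with_functions (glued S \<Phi>)"
proof (rule space_with_functionsI)
  fix W f g assume W: "openin (zar (glued S \<Phi>)) W" "f \<in> reg (glued S \<Phi>) W" "\<forall>x\<in>W. f x = g x"
  show "g \<in> reg (glued S \<Phi>) W"
  proof (rule reg_gluedI)
    fix B \<phi> assume B: "(B, \<phi>) \<in> \<Phi>"
    show "(\<lambda>a. g (\<phi> a)) \<in> reg B {a \<in> pts B. \<phi> a \<in> W}"
      by (rule swf_cong[OF A[OF B] openin_gluedD[OF W(1) B] reg_gluedD[OF W(2) B]]) (use W(3) in simp)
  qed
next
  fix W V f assume W: "openin (zar (glued S \<Phi>)) W" and V: "openin (zar (glued S \<Phi>)) V" "V \<subseteq> W" 
    and f: "f \<in> reg (glued S \<Phi>) W"
  show "f \<in> reg (glued S \<Phi>) V"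
  proof (rule reg_gluedI)
    fix B \<phi> assume B: "(B, \<phi>) \<in> \<Phi>"
    show "(\<lambda>a. f (\<phi> a)) \<in> reg B {a \<in> pts B. \<phi> a \<in> V}"
      by (rule swf_restrict[OF A[OF B] openin_gluedD[OF W B] reg_gluedD[OF f B] openin_gluedD[OF V(1) B]])
         (use V(2) in blast)
  qed
next
  fix \<V> f assume V: "\<forall>V\<in>\<V>. openin (zar (glued S \<Phi>)) V \<and> f \<in> reg (glued S \<Phi>) V"
  show "f \<in> reg (glued S \<Phi>) (\<Union>\<V>)"
  proof (rule reg_gluedI)
    fix B \<phi> assume B: "(B, \<phi>) \<in> \<Phi>"
    show "(\<lambda>a. f (\<phi> a)) \<in> reg B {a \<in> pts B. \<phi> a \<in> \<Union>\<V>}"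
    proof (rule swf_local[OF A[OF B]])
      fix a assume "a \<in> {a \<in> pts B. \<phi> a \<in> \<Union>\<V>}"
      then obtain V where v: "V \<in> \<V>" "a \<in> pts B" "\<phi> a \<in> V" by blast
      then have "openin (zar (glued S \<Phi>)) V" "f \<in> reg (glued S \<Phi>) V" using V by simp_all
      then show "\<exists>N. openin (zar B) N \<and> a \<in> N \<and> N \<subseteq> {a \<in> pts B. \<phi> a \<in> \<Union>\<V>} \<and> (\<lambda>a. f (\<phi> a)) \<in> reg B N"
        using v openin_gluedD[OF _ B] reg_gluedD[OF _ B]
        by (intro exI[of _ "{a \<in> pts B. \<phi> a \<in> V}"]) auto
    qed
  qed
next
  fix W c assume W: "openin (zar (glued S \<Phi>)) W"
  show "(\<lambda>x. c) \<in> reg (glued S \<Phi>) W"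
    by (rule reg_gluedI) (rule swf_const[OF A openin_gluedD[OF W]])
next
  fix W f g assume W: "openin (zar (glued S \<Phi>)) W" and f: "f \<in> reg (glued S \<Phi>) W" and g: "g \<in> reg (glued S \<Phi>) W"
  show "(\<lambda>x. f x + g x) \<in> reg (glued S \<Phi>) W"
    by (rule reg_gluedI) (rule swf_add[OF A openin_gluedD[OF W] reg_gluedD[OF f] reg_gluedD[OF g]])
  show "(\<lambda>x. f x * g x) \<in> reg (glued S \<Phi>) W"
    by (rule reg_gluedI) (rule swf_mult[OF A openin_gluedD[OF W] reg_gluedD[OF f] reg_gluedD[OF g]])
next
  fix W f assume W: "openin (zar (glued S \<Phi>)) W" and f: "f \<in> reg (glued S \<Phi>) W"
  have eq: "{a \<in> pts B. \<phi> a \<in> {x \<in> W. f x \<noteq> 0}} = {a \<in> {a \<in> pts B. \<phi> a \<in> W}. f (\<phi> a) \<noteq> 0}" for B \<phi> by blast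
  show "openin (zar (glued S \<Phi>)) {x \<in> W. f x \<noteq> 0}"
  proof (rule openin_gluedI)
    show "{x \<in> W. f x \<noteq> 0} \<subseteq> S" using W unfolding openin_glued by blast
    fix B \<phi> assume B: "(B, \<phi>) \<in> \<Phi>"
    show "openin (zar B) {a \<in> pts B. \<phi> a \<in> {x \<in> W. f x \<noteq> 0}}" unfolding eq
      by (rule swf_nonzero[OF A[OF B] openin_gluedD[OF W B] reg_gluedD[OF f B]])
  qed
  show "(\<lambda>x. inverse (f x)) \<in> reg (glued S \<Phi>) {x \<in> W. f x \<noteq> 0}"
  proof (rule reg_gluedI)
    fix B \<phi> assume B: "(B, \<phi>) \<in> \<Phi>"
    show "(\<lambda>a. inverse (f (\<phi> a))) \<in> reg B {a \<in> pts B. \<phi> a \<in> {x \<in> W. f x \<noteq> 0}}" unfolding eq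
      by (rule swf_inverse_nonzero[OF A[OF B] openin_gluedD[OF W B] reg_gluedD[OF f B]])
  qed
qed

lemma is_morphism_chart:
  assumes "(A, \<phi>) \<in> \<Phi>" and "\<And>A \<phi> a. (A, \<phi>) \<in> \<Phi> \<Longrightarrow> a \<in> pts A \<Longrightarrow> \<phi> a \<in> S"
  shows "is_morphism A (glued S \<Phi>) \<phi>"
proof (rule is_morphismI)
  have "pts (glued S \<Phi>) = S" by (rule pts_glued) (rule assms(2))
  then show "\<phi> x \<in> pts (glued S \<Phi>)" if "x \<in> pts A" for x using assms(2)[OF assms(1) that] by simp
  show "openin (zar A) {x \<in> pts A. \<phi> x \<in> V}" if "openin (zar (glued S \<Phi>)) V" for V
    by (rule openin_gluedD[OF that assms(1)])
  show "(\<lambda>x. h (\<phi> x)) \<in> reg A {x \<in> pts A. \<phi> x \<in> V}" if "h \<in> reg (glued S \<Phi>) V" for V h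
    by (rule reg_gluedD[OF that assms(1)])
qed

subsection \<open>Quotients with local sections\<close>

text \<open>Near a point, \<open>V\<close> is the preimage under a local section of the preimage of \<open>V\<close>.\<close>

lemma local_sections_quotient_topology:
  assumes X: "space_with_functions X" and \<pi>: "is_morphism X Y \<pi>"
    and sec: "\<And>y. y \<in> pts Y \<Longrightarrow> \<exists>W s. openin (zar Y) W \<and> y \<in> W \<and> is_morphism (induced Y W) X s \<and> (\<forall>w\<in>W. \<pi> (s w) = w)"
    and V: "V \<subseteq> pts Y" "openin (zar X) {x \<in> pts X. \<pi> x \<in> V}"
  shows "openin (zar Y) V"
proof (subst openin_subopen, clarify)
  fix y assume y: "y \<in> V"
  then obtain W s where W: "openin (zar Y) W" "y \<in> W" and s: "is_morphism (induced Y W) X s" "\<forall>w\<in>W. \<pi> (s w) = w"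
    using sec V(1) by blast
  have "openin (zar (induced Y W)) {w \<in> pts (induced Y W). s w \<in> {x \<in> pts X. \<pi> x \<in> V}}"
    by (rule is_morphismD_open[OF s(1) V(2)])
  moreover have "{w \<in> pts (induced Y W). s w \<in> {x \<in> pts X. \<pi> x \<in> V}} = V \<inter> W"
    using s(2) V(1) is_morphismD_pts[OF s(1)] by auto
  ultimately have "openin (zar Y) (V \<inter> W)" using W(1) by (auto intro: openin_trans_full)
  then show "\<exists>T. openin (zar Y) T \<and> y \<in> T \<and> T \<subseteq> V" using y W by blast
qed

text \<open>A function that is constant on the fibres is a function of \<open>\<pi> x\<close>, and locally this function is the
  composition of the given one with a section.\<close>

lemma local_sections_descent:
  assumes X: "space_with_functions X" and Y: "space_with_functions Y" and \<pi>: "is_morphism X Y \<pi>"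
    and sec: "\<And>y. y \<in> pts Y \<Longrightarrow> \<exists>W s. openin (zar Y) W \<and> y \<in> W \<and> is_morphism (induced Y W) X s \<and> (\<forall>w\<in>W. \<pi> (s w) = w)"
    and V: "openin (zar Y) V" and f: "f \<in> reg X {x \<in> pts X. \<pi> x \<in> V}"
    and inv: "\<And>x x'. x \<in> pts X \<Longrightarrow> x' \<in> pts X \<Longrightarrow> \<pi> x \<in> V \<Longrightarrow> \<pi> x = \<pi> x' \<Longrightarrow> f x = f x'"
  shows "\<exists>h\<in>reg Y V. \<forall>x\<in>pts X. \<pi> x \<in> V \<longrightarrow> f x = h (\<pi> x)"
proof -
  \<comment> \<open>evaluate \<open>f\<close> at any preimage\<close>
  define h where "h = (\<lambda>y. f (SOME x. x \<in> pts X \<and> \<pi> x = y))"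
  have h: "f x = h (\<pi> x)" if "x \<in> pts X" "\<pi> x \<in> V" for x
  proof -
    have "(SOME x'. x' \<in> pts X \<and> \<pi> x' = \<pi> x) \<in> pts X \<and> \<pi> (SOME x'. x' \<in> pts X \<and> \<pi> x' = \<pi> x) = \<pi> x"
      by (rule someI[of "\<lambda>x'. x' \<in> pts X \<and> \<pi> x' = \<pi> x" x]) (use that in auto)
    then show ?thesis unfolding h_def using inv[of x] that by metis
  qed
  have "h \<in> reg Y V"
  proof (rule swf_local[OF Y])
    fix y assume y: "y \<in> V"
    then have "y \<in> pts Y" using openin_subset[OF V] by blast
    from sec[OF this] obtain W s where W: "openin (zar Y) W" "y \<in> W" and s: "is_morphism (induced Y W) X s" "\<forall>w\<in>W. \<pi> (s w) = w"
      by blast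
    let ?P = "{x \<in> pts X. \<pi> x \<in> V}"
    have P: "openin (zar X) ?P" using is_morphismD_open[OF \<pi> V] .
    have eq: "{w \<in> pts (induced Y W). s w \<in> ?P} = V \<inter> W"
      using s(2) openin_subset[OF V] is_morphismD_pts[OF s(1)] by auto
    have VW: "openin (zar Y) (V \<inter> W)" using V W by blast
    have "(\<lambda>w. f (s w)) \<in> reg (induced Y W) (V \<inter> W)"
      using is_morphismD_reg[OF s(1) P f] unfolding eq .
    then have "(\<lambda>w. f (s w)) \<in> reg Y (V \<inter> W)"
      by (intro reg_induced_open[OF Y W(1) VW]) auto
    moreover have fh: "f (s w) = h w" if "w \<in> V \<inter> W" for w
    proof -
      have "s w \<in> pts X" using that openin_subset[OF V] is_morphismD_pts[OF s(1)] by auto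
      then show ?thesis using h[of "s w"] s(2) that by auto
    qed
    ultimately have "h \<in> reg Y (V \<inter> W)" using swf_cong[OF Y VW, of "\<lambda>w. f (s w)" h] by simp
    then show "\<exists>N. openin (zar Y) N \<and> y \<in> N \<and> N \<subseteq> V \<and> h \<in> reg Y N" using VW y W by blast
  qed
  then show ?thesis using h by blast
qed

lemma geometric_quotientD:
  assumes "geometric_quotient G act X Y \<pi>"
  shows "variety X" "variety Y" "group_action G (pts X) act" "is_morphism X Y \<pi>" "\<pi> ` pts X = pts Y"
    and "\<forall>x\<in>pts X. \<forall>y\<in>pts X. \<pi> x = \<pi> y \<longleftrightarrow> y \<in> orbit G act x"
    and "\<forall>V. V \<subseteq> pts Y \<longrightarrow> openin (zar X) {x \<in> pts X. \<pi> x \<in> V} \<longrightarrow> openin (zar Y) V"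
    and "\<forall>V f. openin (zar Y) V \<and> f \<in> reg X {x \<in> pts X. \<pi> x \<in> V} \<and>
        (\<forall>g\<in>carrier G. \<forall>x\<in>pts X. \<pi> x \<in> V \<longrightarrow> f (act g x) = f x) \<longrightarrow>
        (\<exists>h\<in>reg Y V. \<forall>x\<in>pts X. \<pi> x \<in> V \<longrightarrow> f x = h (\<pi> x))"
  using assms unfolding geometric_quotient_def by - (elim conjE, assumption)+

text \<open>A geometric quotient is categorical: preimages of open sets under \<open>\<phi>\<close> are open by the quotient topology, and the
  pullback of a regular function along \<open>\<pi>'\<close> is invariant and hence descends along \<open>\<pi>\<close>.\<close>

lemma geometric_quotient_morphism:
  assumes 1: "geometric_quotient G act X Y \<pi>" and 2: "geometric_quotient G act X Y' \<pi>'"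
    and \<phi>: "\<And>x. x \<in> pts X \<Longrightarrow> \<phi> (\<pi> x) = \<pi>' x"
  shows "is_morphism Y Y' \<phi>"
proof -
  have swf: "space_with_functions Y" using geometric_quotientD(2)[OF 1] by (simp add: variety_def)
  note surj = geometric_quotientD(5)[OF 1] and top = geometric_quotientD(7)[OF 1, rule_format]
    and desc = geometric_quotientD(8)[OF 1, rule_format]
  note ga = geometric_quotientD(3)[OF 2] and \<pi>' = geometric_quotientD(4)[OF 2]
    and fib = geometric_quotientD(6)[OF 2, rule_format]
  have pre: "{x \<in> pts X. \<pi> x \<in> {y \<in> pts Y. \<phi> y \<in> V}} = {x \<in> pts X. \<pi>' x \<in> V}" for V
    using \<phi> surj by auto
  have op: "openin (zar Y) {y \<in> pts Y. \<phi> y \<in> V}" if "openin (zar Y') V" for V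
    by (rule top) (use is_morphismD_open[OF \<pi>' that] in \<open>auto simp: pre[unfolded mem_Collect_eq]\<close>)
  show ?thesis
  proof (rule is_morphismI)
    show "\<phi> y \<in> pts Y'" if "y \<in> pts Y" for y
      using that surj \<phi> is_morphismD_pts[OF \<pi>'] by force
    show "openin (zar Y) {y \<in> pts Y. \<phi> y \<in> V}" if "openin (zar Y') V" for V using op[OF that] .
    fix V h assume V: "openin (zar Y') V" and h: "h \<in> reg Y' V"
    let ?W = "{y \<in> pts Y. \<phi> y \<in> V}"
    have inv: "\<pi>' (act g x) = \<pi>' x" if "g \<in> carrier G" "x \<in> pts X" for g x
    proof -
      have "act g x \<in> pts X" using group_action.element_image[OF ga that] by simp
      moreover have "act g x \<in> orbit G act x" using that by (auto simp: orbit_def)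
      ultimately show ?thesis using fib[OF that(2)] by metis
    qed
    have r: "(\<lambda>x. h (\<pi>' x)) \<in> reg X {x \<in> pts X. \<pi> x \<in> ?W}"
      using is_morphismD_reg[OF \<pi>' V h] unfolding pre .
    have "\<exists>k\<in>reg Y ?W. \<forall>x\<in>pts X. \<pi> x \<in> ?W \<longrightarrow> h (\<pi>' x) = k (\<pi> x)"
      using spec[OF spec[OF geometric_quotientD(8)[OF 1], of ?W], of "\<lambda>x. h (\<pi>' x)"] op[OF V] r
      by (simp add: inv)
    then obtain k where k: "k \<in> reg Y ?W" "\<forall>x\<in>pts X. \<pi> x \<in> ?W \<longrightarrow> h (\<pi>' x) = k (\<pi> x)" by (rule bexE)
    have "k y = h (\<phi> y)" if "y \<in> ?W" for y
    proof -
      have "y \<in> \<pi> ` pts X" using that unfolding surj by simp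
      then obtain x where "y = \<pi> x" "x \<in> pts X" by (rule imageE)
      then show ?thesis using bspec[OF k(2), of x] \<phi>[of x] that by simp
    qed
    then show "(\<lambda>y. h (\<phi> y)) \<in> reg Y ?W" by (rule swf_cong[OF swf op[OF V] k(1)])
  qed
qed

text \<open>Both quotient maps have the orbits as fibres, so each factors through the other.\<close>

lemma geometric_quotient_unique:
  assumes 1: "geometric_quotient G act X Y \<pi>" and 2: "geometric_quotient G act X Y' \<pi>'"
  shows "isomorphic Y Y'"
proof -
  have s1: "\<pi> ` pts X = pts Y" and s2: "\<pi>' ` pts X = pts Y'"
    using geometric_quotientD(5)[OF 1] geometric_quotientD(5)[OF 2] .
  have eq: "\<pi> x = \<pi> y \<longleftrightarrow> \<pi>' x = \<pi>' y" if "x \<in> pts X" "y \<in> pts X" for x y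
    using geometric_quotientD(6)[OF 1, rule_format, OF that] geometric_quotientD(6)[OF 2, rule_format, OF that] by simp
  define \<phi> where "\<phi> = (\<lambda>y. \<pi>' (inv_into (pts X) \<pi> y))"
  define \<psi> where "\<psi> = (\<lambda>y. \<pi> (inv_into (pts X) \<pi>' y))"
  have \<phi>: "\<phi> (\<pi> x) = \<pi>' x" if "x \<in> pts X" for x
    using eq[of "inv_into (pts X) \<pi> (\<pi> x)" x] that
    by (simp add: \<phi>_def inv_into_into f_inv_into_f)
  have \<psi>: "\<psi> (\<pi>' x) = \<pi> x" if "x \<in> pts X" for x
    using eq[of "inv_into (pts X) \<pi>' (\<pi>' x)" x] that
    by (simp add: \<psi>_def inv_into_into f_inv_into_f)
  show ?thesis
  proof (rule isomorphicI)
    show "is_morphism Y Y' \<phi>" by (rule geometric_quotient_morphism[OF 1 2 \<phi>])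
    show "is_morphism Y' Y \<psi>" by (rule geometric_quotient_morphism[OF 2 1 \<psi>])
    show "\<psi> (\<phi> y) = y" if y: "y \<in> pts Y" for y
    proof -
      have "y \<in> \<pi> ` pts X" using y unfolding s1 .
      then obtain x where "y = \<pi> x" "x \<in> pts X" by (rule imageE)
      then show ?thesis by (simp add: \<phi> \<psi>)
    qed
    show "\<phi> (\<psi> y) = y" if y: "y \<in> pts Y'" for y
    proof -
      have "y \<in> \<pi>' ` pts X" using y unfolding s2 .
      then obtain x where "y = \<pi>' x" "x \<in> pts X" by (rule imageE)
      then show ?thesis by (simp add: \<phi> \<psi>)
    qed
  qed
qed

section \<open>Hilbert's basis theorem for rings of functions\<close>

text \<open>The ideal generated by \<open>F\<close> in the ring \<open>R\<close> of functions, built one multiple of a generator at a time.\<close>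

inductive_set ideal_gen :: "('x \<Rightarrow> 'k::field) set \<Rightarrow> ('x \<Rightarrow> 'k) set \<Rightarrow> ('x \<Rightarrow> 'k) set" for R F where
  zero: "(\<lambda>x. 0) \<in> ideal_gen R F"
| step: "g \<in> ideal_gen R F \<Longrightarrow> r \<in> R \<Longrightarrow> p \<in> F \<Longrightarrow> (\<lambda>x. g x + r x * p x) \<in> ideal_gen R F"

definition function_ideal :: "('x \<Rightarrow> 'k::field) set \<Rightarrow> ('x \<Rightarrow> 'k) set \<Rightarrow> bool" where
  "function_ideal R I \<longleftrightarrow> I \<subseteq> R \<and> (\<lambda>x. 0) \<in> I \<and> (\<forall>f\<in>I. \<forall>g\<in>I. (\<lambda>x. f x + g x) \<in> I) \<and>
     (\<forall>r\<in>R. \<forall>f\<in>I. (\<lambda>x. r x * f x) \<in> I)"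

definition noetherian_functions :: "('x \<Rightarrow> 'k::field) set \<Rightarrow> bool" where
  "noetherian_functions R \<longleftrightarrow>
     (\<forall>I. function_ideal R I \<longrightarrow> (\<exists>F. finite F \<and> F \<subseteq> I \<and> I \<subseteq> ideal_gen R F))"

lemma function_idealD:
  assumes "function_ideal R I"
  shows "I \<subseteq> R" "(\<lambda>x. 0) \<in> I" "f \<in> I \<Longrightarrow> g \<in> I \<Longrightarrow> (\<lambda>x. f x + g x) \<in> I"
    "r \<in> R \<Longrightarrow> f \<in> I \<Longrightarrow> (\<lambda>x. r x * f x) \<in> I"
  using assms unfolding function_ideal_def by simp_all

lemma ideal_gen_add:
  assumes "g \<in> ideal_gen R F" "f \<in> ideal_gen R F"
  shows "(\<lambda>x. f x + g x) \<in> ideal_gen R F"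
  using assms(1)
proof induction
  case zero then show ?case using assms(2) by simp
next
  case (step g r p)
  from ideal_gen.step[OF step(4,2,3)] show ?case by (simp add: add.assoc)
qed

lemma ideal_gen_subset:
  assumes "function_ideal R I" "F \<subseteq> I"
  shows "ideal_gen R F \<subseteq> I"
proof
  fix f assume "f \<in> ideal_gen R F"
  then show "f \<in> I"
    by induction (use assms(2) in \<open>auto intro!: function_idealD[OF assms(1)]\<close>)
qed

text \<open>The functions that are polynomials of degree less than \<open>n\<close> in \<open>f\<close> with coefficients in \<open>R\<close>. As \<open>f\<close> may satisfy
  algebraic relations over \<open>R\<close>, the coefficients are not determined by the function, and a degree can
  only be bounded.\<close>

primrec deg_less :: "('x \<Rightarrow> 'k::field) set \<Rightarrow> ('x \<Rightarrow> 'k) \<Rightarrow> nat \<Rightarrow> ('x \<Rightarrow> 'k) set" where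
  "deg_less R f 0 = {\<lambda>x. 0}"
| "deg_less R f (Suc n) = {\<lambda>x. g x + r x * f x ^ n | g r. g \<in> deg_less R f n \<and> r \<in> R}"

lemma deg_less_SucI:
  "g \<in> deg_less R f n \<Longrightarrow> r \<in> R \<Longrightarrow> (\<lambda>x. g x + r x * f x ^ n) \<in> deg_less R f (Suc n)"
  unfolding deg_less.simps by (rule CollectI, rule exI[of _ g], rule exI[of _ r]) simp

lemma deg_less_SucE:
  assumes "h \<in> deg_less R f (Suc n)"
  obtains g r where "h = (\<lambda>x. g x + r x * f x ^ n)" "g \<in> deg_less R f n" "r \<in> R"
  using assms unfolding deg_less.simps by (elim CollectE exE conjE) simp

context
  fixes C :: "('x \<Rightarrow> 'k::field) set" and f :: "'x \<Rightarrow> 'k"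
begin

private abbreviation (input) "R \<equiv> polynomial_functions C"
private abbreviation (input) "R' \<equiv> polynomial_functions (insert f C)"

lemma deg_less_add:
  "g \<in> deg_less R f n \<Longrightarrow> h \<in> deg_less R f n \<Longrightarrow> (\<lambda>x. g x + h x) \<in> deg_less R f n"
proof (induction n arbitrary: g h)
  case (Suc n)
  from Suc.prems(1) obtain g1 r1 where 1: "g = (\<lambda>x. g1 x + r1 x * f x ^ n)" "g1 \<in> deg_less R f n" "r1 \<in> R"
    by (rule deg_less_SucE)
  from Suc.prems(2) obtain g2 r2 where 2: "h = (\<lambda>x. g2 x + r2 x * f x ^ n)" "g2 \<in> deg_less R f n" "r2 \<in> R"
    by (rule deg_less_SucE)
  from deg_less_SucI[OF Suc.IH[OF 1(2) 2(2)] polynomial_functions.add[OF 1(3) 2(3)]]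
  show ?case unfolding 1(1) 2(1) by (simp add: algebra_simps)
qed simp

lemma deg_less_mult:
  "s \<in> R \<Longrightarrow> g \<in> deg_less R f n \<Longrightarrow> (\<lambda>x. s x * g x) \<in> deg_less R f n"
proof (induction n arbitrary: g)
  case (Suc n)
  from Suc.prems(2) obtain g1 r1 where 1: "g = (\<lambda>x. g1 x + r1 x * f x ^ n)" "g1 \<in> deg_less R f n" "r1 \<in> R"
    by (rule deg_less_SucE)
  from deg_less_SucI[OF Suc.IH[OF Suc.prems(1) 1(2)] polynomial_functions.mult[OF Suc.prems(1) 1(3)]]
  show ?case unfolding 1(1) by (simp add: algebra_simps)
qed simp

lemma deg_less_zero: "(\<lambda>x. 0) \<in> deg_less R f n"
proof (induction n)
  case (Suc n)
  from deg_less_SucI[OF Suc polynomial_functions.const[of 0]] show ?case by simp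
qed simp

lemma deg_less_Suc: "g \<in> deg_less R f n \<Longrightarrow> g \<in> deg_less R f (Suc n)"
  using deg_less_SucI[OF _ polynomial_functions.const[of 0], of g C f n] by simp

lemma deg_less_mono: "g \<in> deg_less R f n \<Longrightarrow> n \<le> m \<Longrightarrow> g \<in> deg_less R f m"
  by (rule dec_induct[of n m "\<lambda>m. g \<in> deg_less R f m"]) (simp_all add: deg_less_Suc del: deg_less.simps)

lemma deg_less_mult_gen: "g \<in> deg_less R f n \<Longrightarrow> (\<lambda>x. f x * g x) \<in> deg_less R f (Suc n)"
proof (induction n arbitrary: g)
  case 0
  then show ?case using deg_less_zero[of "Suc 0"] by (simp del: deg_less.simps(2))
next
  case (Suc n)
  from Suc.prems(1) obtain g1 r1 where 1: "g = (\<lambda>x. g1 x + r1 x * f x ^ n)" "g1 \<in> deg_less R f n" "r1 \<in> R"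
    by (rule deg_less_SucE)
  from deg_less_SucI[OF Suc.IH[OF 1(2)] 1(3)]
  show ?case unfolding 1(1) by (simp add: algebra_simps del: deg_less.simps)
qed

lemma deg_less_mult_power: "g \<in> deg_less R f n \<Longrightarrow> (\<lambda>x. f x ^ k * g x) \<in> deg_less R f (n + k)"
proof (induction k)
  case (Suc k)
  from deg_less_mult_gen[OF Suc.IH[OF Suc.prems]] show ?case by (simp add: mult.assoc del: deg_less.simps)
qed simp

lemma polynomial_functions_mono: "p \<in> R \<Longrightarrow> p \<in> R'"
  by (induction rule: polynomial_functions.induct) (auto intro: polynomial_functions.intros)

lemma polynomial_functions_power: "(\<lambda>x. f x ^ k) \<in> R'"
proof (induction k)
  case 0
  show ?case using polynomial_functions.const[of 1] by simp
next
  case (Suc k)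
  from polynomial_functions.mult[OF polynomial_functions.coord[of f "insert f C"] Suc] show ?case by simp
qed

lemma coeff_deg_less: "r \<in> R \<Longrightarrow> r \<in> deg_less R f (Suc 0)"
  using deg_less_SucI[OF deg_less_zero[of 0], of r] by simp

lemma exhaust_deg_less: "p \<in> R' \<Longrightarrow> \<exists>n. p \<in> deg_less R f n"
proof (induction rule: polynomial_functions.induct)
  case (const c)
  show ?case using coeff_deg_less[OF polynomial_functions.const] by blast
next
  case (coord g)
  show ?case
  proof (cases "g = f")
    case True
    from deg_less_SucI[OF deg_less_zero[of 1] polynomial_functions.const[of 1]] show ?thesis
      unfolding True by (simp del: deg_less.simps) blast
  next
    case False
    then have "g \<in> R" using coord by (auto intro: polynomial_functions.coord)
    then show ?thesis using coeff_deg_less by blast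
  qed
next
  case (add p q)
  then obtain n m where "p \<in> deg_less R f n" "q \<in> deg_less R f m" by blast
  then have "p \<in> deg_less R f (max n m)" "q \<in> deg_less R f (max n m)"
    by (auto intro: deg_less_mono)
  then show ?case using deg_less_add by blast
next
  case (mult p q)
  then obtain n m where p: "p \<in> deg_less R f n" and q: "q \<in> deg_less R f m" by blast
  from q show ?case
  proof (induction m arbitrary: q)
    case 0
    then show ?case using deg_less_zero[of 0] by (intro exI[of _ 0]) simp
  next
    case (Suc m)
    from Suc.prems obtain g r where 1: "q = (\<lambda>x. g x + r x * f x ^ m)" "g \<in> deg_less R f m" "r \<in> R"
      by (rule deg_less_SucE)
    from Suc.IH[OF 1(2)] obtain k where k: "(\<lambda>x. p x * g x) \<in> deg_less R f k" by blast
    from deg_less_mult[OF 1(3) deg_less_mult_power[OF p, of m]]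
    have l: "(\<lambda>x. r x * (f x ^ m * p x)) \<in> deg_less R f (n + m)" .
    have "(\<lambda>x. p x * g x + r x * (f x ^ m * p x)) \<in> deg_less R f (max k (n + m))"
      by (rule deg_less_add) (auto intro: deg_less_mono[OF k] deg_less_mono[OF l])
    then show ?case unfolding 1(1) by (intro exI[of _ "max k (n + m)"]) (simp add: algebra_simps)
  qed
qed

text \<open>Hilbert's argument. The coefficients at \<open>f\<^sup>n\<close> of those elements of the ideal that are polynomials in \<open>f\<close> of degree
  at most \<open>n\<close> form an ideal \<open>L n\<close>; as \<open>f\<close> need not be an indeterminate, one function may contribute several
  coefficients. These ideals increase with \<open>n\<close> and are constant from some \<open>N\<close> on. Lifting finitely many generators of
  \<open>L n\<close> for each \<open>n \<le> N\<close> to the ideal gives generators, since the leading term of any element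
  can be removed by a combination of the lifts.\<close>

lemma hilbert_basis_step:
  assumes R: "noetherian_functions R"
  shows "noetherian_functions R'"
  unfolding noetherian_functions_def
proof (intro allI impI)
  fix I assume I: "function_ideal R' I"
  \<comment> \<open>\<open>L n\<close>: the possible coefficients at \<open>f\<^sup>n\<close> of elements of degree at most \<open>n\<close>\<close>
  define L where "L n = {r \<in> R. \<exists>g\<in>deg_less R f n. (\<lambda>x. g x + r x * f x ^ n) \<in> I}" for n
  have LD: "\<exists>g\<in>deg_less R f n. (\<lambda>x. g x + r x * f x ^ n) \<in> I" if "r \<in> L n" for r n
    using that unfolding L_def by blast
  have LI: "r \<in> L n" if "r \<in> R" "g \<in> deg_less R f n" "(\<lambda>x. g x + r x * f x ^ n) \<in> I" for r n g
    using that unfolding L_def by blast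
  have L_add: "(\<lambda>x. r x + s x) \<in> L n" if r: "r \<in> L n" and s: "s \<in> L n" for r s n
  proof -
    from LD[OF r] obtain g where g: "g \<in> deg_less R f n" "(\<lambda>x. g x + r x * f x ^ n) \<in> I" ..
    from LD[OF s] obtain h where h: "h \<in> deg_less R f n" "(\<lambda>x. h x + s x * f x ^ n) \<in> I" ..
    have rs: "r \<in> R" "s \<in> R" using r s unfolding L_def by simp_all
    have "(\<lambda>x. (g x + h x) + (r x + s x) * f x ^ n) \<in> I"
      using function_idealD(3)[OF I g(2) h(2)] by (simp add: algebra_simps)
    then show ?thesis by (rule LI[OF polynomial_functions.add[OF rs] deg_less_add[OF g(1) h(1)]])
  qed
  have L_mult: "(\<lambda>x. s x * r x) \<in> L n" if r: "r \<in> L n" and s: "s \<in> R" for r s n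
  proof -
    from LD[OF r] obtain g where g: "g \<in> deg_less R f n" "(\<lambda>x. g x + r x * f x ^ n) \<in> I" ..
    have rs: "r \<in> R" using r unfolding L_def by simp
    have "(\<lambda>x. s x * g x + (s x * r x) * f x ^ n) \<in> I"
      using function_idealD(4)[OF I polynomial_functions_mono[OF s] g(2)] by (simp add: algebra_simps)
    then show ?thesis by (rule LI[OF polynomial_functions.mult[OF s rs] deg_less_mult[OF s g(1)]])
  qed
  have L_zero: "(\<lambda>x. 0) \<in> L n" for n
    using LI[OF polynomial_functions.const[of 0] deg_less_zero] function_idealD(2)[OF I] by simp
  have L_ideal: "function_ideal R (L n)" for n
    unfolding function_ideal_def
    by (intro conjI ballI L_add L_mult L_zero) (auto simp: L_def)
  have L_Suc: "r \<in> L (Suc n)" if r: "r \<in> L n" for r n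
  proof -
    from LD[OF r] obtain g where g: "g \<in> deg_less R f n" "(\<lambda>x. g x + r x * f x ^ n) \<in> I" ..
    have rs: "r \<in> R" using r unfolding L_def by simp
    have "(\<lambda>x. f x * g x + r x * f x ^ Suc n) \<in> I"
      using function_idealD(4)[OF I polynomial_functions.coord[of f] g(2)] by (simp add: algebra_simps)
    then show ?thesis by (rule LI[OF rs deg_less_mult_gen[OF g(1)]])
  qed
  have L_mono: "r \<in> L n \<Longrightarrow> n \<le> m \<Longrightarrow> r \<in> L m" for r n m
    by (rule dec_induct[of n m "\<lambda>m. r \<in> L m"]) (simp_all add: L_Suc)
  have U_ideal: "function_ideal R (\<Union>n. L n)"
    unfolding function_ideal_def
  proof (intro conjI ballI)
    fix r s assume "r \<in> (\<Union>n. L n)" "s \<in> (\<Union>n. L n)"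
    then obtain n m where "r \<in> L n" "s \<in> L m" by blast
    then have "r \<in> L (max n m)" "s \<in> L (max n m)" by (auto intro: L_mono)
    then show "(\<lambda>x. r x + s x) \<in> (\<Union>n. L n)" by (auto intro: L_add)
  next
    fix s r assume "s \<in> R" "r \<in> (\<Union>n. L n)"
    then show "(\<lambda>x. s x * r x) \<in> (\<Union>n. L n)" by (auto intro: L_mult)
  qed (use L_zero in \<open>auto simp: L_def\<close>)
  then obtain F where F: "finite F" "F \<subseteq> (\<Union>n. L n)" "(\<Union>n. L n) \<subseteq> ideal_gen R F"
    using R unfolding noetherian_functions_def by blast
  have "\<exists>N. F \<subseteq> L N" using F(1,2)
  proof (induction F)
    case (insert r F)
    then obtain N m where "F \<subseteq> L N" "r \<in> L m" by blast
    then have "insert r F \<subseteq> L (max N m)" by (auto intro: L_mono)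
    then show ?case by blast
  qed simp
  then obtain N where N: "F \<subseteq> L N" by blast
  \<comment> \<open>the ideals \<open>L n\<close> are constant from \<open>N\<close> on\<close>
  have stab: "r \<in> L N" if "r \<in> L n" for r n
    using that F(3) ideal_gen_subset[OF L_ideal N] by blast
  have "\<forall>n. \<exists>F. finite F \<and> F \<subseteq> L n \<and> L n \<subseteq> ideal_gen R F"
    using R L_ideal unfolding noetherian_functions_def by blast
  then obtain G where G: "\<forall>n. finite (G n) \<and> G n \<subseteq> L n \<and> L n \<subseteq> ideal_gen R (G n)"
    by (rule choice[THEN exE])
  \<comment> \<open>\<open>w n r\<close> completes \<open>r f\<^sup>n\<close> to an element of the ideal by terms of lower degree\<close>
  define w where "w n r = (SOME g. g \<in> deg_less R f n \<and> (\<lambda>x. g x + r x * f x ^ n) \<in> I)" for n r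
  have w: "w n r \<in> deg_less R f n" "(\<lambda>x. w n r x + r x * f x ^ n) \<in> I" if "r \<in> L n" for n r
    using someI_ex[of "\<lambda>g. g \<in> deg_less R f n \<and> (\<lambda>x. g x + r x * f x ^ n) \<in> I"] LD[OF that]
    unfolding w_def by blast+
  define W where "W = (\<Union>n\<in>{..N}. (\<lambda>r x. w n r x + r x * f x ^ n) ` G n)"
  have W: "finite W" "W \<subseteq> I"
  proof -
    show "finite W" unfolding W_def using G by simp
    have "(\<lambda>x. w n r x + r x * f x ^ n) \<in> I" if "r \<in> G n" for n r
      by (rule w(2)) (use G that in blast)
    then show "W \<subseteq> I" unfolding W_def by blast
  qed
  \<comment> \<open>a leading coefficient in degree \<open>m \<le> N\<close> is realised in every degree \<open>n \<ge> m\<close> by multiplying with \<open>f\<^bsup>n - m\<^esup>\<close>\<close>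
  have lift: "\<exists>v g. v \<in> ideal_gen R' W \<and> g \<in> deg_less R f n \<and> v = (\<lambda>x. g x + r x * f x ^ n)"
    if "r \<in> ideal_gen R (G m)" "m \<le> n" "m \<le> N" for r m n
    using that(1)
  proof induction
    case zero
    show ?case by (rule exI[of _ "\<lambda>x. 0"], rule exI[of _ "\<lambda>x. 0"]) (simp add: ideal_gen.zero deg_less_zero)
  next
    case (step r s p)
    then obtain v g where v: "v \<in> ideal_gen R' W" "g \<in> deg_less R f n" "v = (\<lambda>x. g x + r x * f x ^ n)" by blast
    have p: "p \<in> L m" using step(3) G by blast
    have pW: "(\<lambda>x. w m p x + p x * f x ^ m) \<in> W" unfolding W_def using step(3) that(3) by blast
    have sR: "(\<lambda>x. s x * f x ^ (n - m)) \<in> R'"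
      by (rule polynomial_functions.mult[OF polynomial_functions_mono[OF step(2)] polynomial_functions_power])
    have "(\<lambda>x. s x * (f x ^ (n - m) * w m p x)) \<in> deg_less R f n"
      using deg_less_mult[OF step(2) deg_less_mult_power[OF w(1)[OF p], of "n - m"]] that(2) by simp
    from deg_less_add[OF v(2) this]
    have 1: "(\<lambda>x. g x + s x * (f x ^ (n - m) * w m p x)) \<in> deg_less R f n" .
    have 2: "(\<lambda>x. v x + s x * f x ^ (n - m) * (w m p x + p x * f x ^ m)) \<in> ideal_gen R' W"
      by (rule ideal_gen.step[OF v(1) sR pW])
    have pow: "f x ^ n = f x ^ (n - m) * f x ^ m" for x
      using that(2) by (simp add: power_add[symmetric])
    have 3: "(\<lambda>x. v x + s x * f x ^ (n - m) * (w m p x + p x * f x ^ m)) =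
        (\<lambda>x. (g x + s x * (f x ^ (n - m) * w m p x)) + (r x + s x * p x) * f x ^ n)"
      unfolding v(3) pow by (simp add: algebra_simps)
    show ?case using 1 2 3 by blast
  qed
  have "h \<in> ideal_gen R' W" if "h \<in> I" "h \<in> deg_less R f n" for h n
    using that
  proof (induction n arbitrary: h)
    case 0
    then show ?case using ideal_gen.zero[of R' W] by simp
  next
    case (Suc n)
    from Suc.prems(2) obtain g r where h: "h = (\<lambda>x. g x + r x * f x ^ n)" "g \<in> deg_less R f n" "r \<in> R"
      by (rule deg_less_SucE)
    \<comment> \<open>cancel the leading term of \<open>h\<close> by a combination \<open>v\<close> of the generators\<close>
    have "r \<in> L n" by (rule LI[OF h(3,2)]) (use Suc.prems(1) h(1) in simp)
    then have "r \<in> L (min n N)" using stab by (auto simp: min_def)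
    then have "r \<in> ideal_gen R (G (min n N))" using G by blast
    from lift[OF this min.cobounded1 min.cobounded2]
    obtain v g' where v: "v \<in> ideal_gen R' W" "g' \<in> deg_less R f n" "v = (\<lambda>x. g' x + r x * f x ^ n)" by blast
    have vI: "v \<in> I" using v(1) ideal_gen_subset[OF I W(2)] by blast
    have m1: "(\<lambda>x. - 1) \<in> polynomial_functions X" for X :: "('x \<Rightarrow> 'k) set" by (rule polynomial_functions.const)
    have "(\<lambda>x. h x + (- 1) * v x) \<in> I"
      by (rule function_idealD(3)[OF I Suc.prems(1) function_idealD(4)[OF I m1 vI]])
    moreover have "(\<lambda>x. h x + (- 1) * v x) = (\<lambda>x. g x + (- 1) * g' x)" unfolding h(1) v(3) by simp
    moreover have "(\<lambda>x. g x + (- 1) * g' x) \<in> deg_less R f n"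
      by (rule deg_less_add[OF h(2) deg_less_mult[OF m1 v(2)]])
    ultimately have "(\<lambda>x. h x + (- 1) * v x) \<in> ideal_gen R' W" using Suc.IH by simp
    from ideal_gen_add[OF v(1) this] show ?case by simp
  qed
  then have "I \<subseteq> ideal_gen R' W"
    using exhaust_deg_less function_idealD(1)[OF I] by blast
  then show "\<exists>F. finite F \<and> F \<subseteq> I \<and> I \<subseteq> ideal_gen R' F" using W by blast
qed

end

lemma polynomial_functions_empty: "p \<in> polynomial_functions {} \<Longrightarrow> \<exists>c. p = (\<lambda>x. c)"
  by (induction rule: polynomial_functions.induct) auto

text \<open>The constants form a field.\<close>

lemma noetherian_constants: "noetherian_functions (polynomial_functions {} :: ('x \<Rightarrow> 'k::field) set)"
  unfolding noetherian_functions_def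
proof (intro allI impI)
  fix I :: "('x \<Rightarrow> 'k) set" assume I: "function_ideal (polynomial_functions {}) I"
  show "\<exists>F. finite F \<and> F \<subseteq> I \<and> I \<subseteq> ideal_gen (polynomial_functions {}) F"
  proof (cases "I \<subseteq> {\<lambda>x. 0}")
    case True
    then have "I \<subseteq> ideal_gen (polynomial_functions {}) {}" using ideal_gen.zero by blast
    then show ?thesis by blast
  next
    case False
    then obtain p where p: "p \<in> I" "p \<noteq> (\<lambda>x. 0)" by blast
    then have "p \<in> polynomial_functions {}" using function_idealD(1)[OF I] by blast
    from polynomial_functions_empty[OF this] obtain c where c: "p = (\<lambda>x. c)" by (rule exE)
    then have c0: "c \<noteq> 0" using p(2) by auto
    have "q \<in> ideal_gen (polynomial_functions {}) {p}" if "q \<in> I" for q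
    proof -
      have "q \<in> polynomial_functions {}" using that function_idealD(1)[OF I] by blast
      from polynomial_functions_empty[OF this] obtain d where d: "q = (\<lambda>x. d)" by (rule exE)
      have pp: "p \<in> {p}" by simp
      from ideal_gen.step[OF ideal_gen.zero polynomial_functions.const[of "d / c"] pp]
      show ?thesis unfolding d c using c0 by simp
    qed
    then show ?thesis using p(1) by (intro exI[of _ "{p}"]) auto
  qed
qed

theorem hilbert_basis: "finite C \<Longrightarrow> noetherian_functions (polynomial_functions C)"
  by (induction rule: finite_induct) (simp_all add: noetherian_constants hilbert_basis_step)

text \<open>Functions that vanish wherever finitely many elements of \<open>P\<close> do form an ideal, which is
  finitely generated; each generator contributes finitely many elements of \<open>P\<close>.\<close>

lemma finite_defining_equations:
  assumes C: "finite C" and P: "P \<subseteq> polynomial_functions C"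
  shows "\<exists>P0. finite P0 \<and> P0 \<subseteq> P \<and> (\<forall>x. (\<forall>q\<in>P0. q x = 0) \<longrightarrow> (\<forall>p\<in>P. p x = 0))"
proof -
  \<comment> \<open>the union of the ideals of functions that vanish on the zeros of a finite subset of \<open>P\<close>\<close>
  let ?I = "{f \<in> polynomial_functions C. \<exists>P0. finite P0 \<and> P0 \<subseteq> P \<and> (\<forall>x. (\<forall>q\<in>P0. q x = 0) \<longrightarrow> f x = 0)}"
  have "function_ideal (polynomial_functions C) ?I"
    unfolding function_ideal_def
  proof (intro conjI ballI)
    show "(\<lambda>x. 0) \<in> ?I" using polynomial_functions.const[of 0 C] by blast
    fix f g assume "f \<in> ?I" "g \<in> ?I"
    then obtain F G where "f \<in> polynomial_functions C" "g \<in> polynomial_functions C"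
      "finite F" "F \<subseteq> P" "\<forall>x. (\<forall>q\<in>F. q x = 0) \<longrightarrow> f x = 0"
      "finite G" "G \<subseteq> P" "\<forall>x. (\<forall>q\<in>G. q x = 0) \<longrightarrow> g x = 0" by auto
    then show "(\<lambda>x. f x + g x) \<in> ?I"
      by (intro CollectI conjI[OF polynomial_functions.add] exI[of _ "F \<union> G"]) (assumption, assumption, simp)
  next
    fix r f assume r: "r \<in> polynomial_functions C" and "f \<in> ?I"
    then obtain F where "f \<in> polynomial_functions C" "finite F" "F \<subseteq> P" "\<forall>x. (\<forall>q\<in>F. q x = 0) \<longrightarrow> f x = 0" by auto
    then show "(\<lambda>x. r x * f x) \<in> ?I" using r
      by (intro CollectI conjI[OF polynomial_functions.mult] exI[of _ F]) (assumption, assumption, simp)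
  qed auto
  from hilbert_basis[OF C, unfolded noetherian_functions_def, rule_format, OF this]
  obtain F where F: "finite F" "F \<subseteq> ?I" "?I \<subseteq> ideal_gen (polynomial_functions C) F"
    by (elim exE conjE)
  have "\<forall>f\<in>F. \<exists>P0. finite P0 \<and> P0 \<subseteq> P \<and> (\<forall>x. (\<forall>q\<in>P0. q x = 0) \<longrightarrow> f x = 0)" using F(2) by blast
  then obtain H where H: "\<forall>f\<in>F. finite (H f) \<and> H f \<subseteq> P \<and> (\<forall>x. (\<forall>q\<in>H f. q x = 0) \<longrightarrow> f x = 0)"
    by (rule bchoice[THEN exE])
  have van: "p x = 0" if "p \<in> ideal_gen (polynomial_functions C) F" "\<forall>q\<in>F. q x = 0" for p x
    using that(1) by induction (use that(2) in auto)
  have PI: "p \<in> ?I" if "p \<in> P" for p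
    by (rule CollectI, rule conjI, use that P in blast, rule exI[of _ "{p}"]) (use that in simp)
  have "p x = 0" if x: "\<forall>q\<in>(\<Union>f\<in>F. H f). q x = 0" and p: "p \<in> P" for p x
  proof (rule van)
    show "p \<in> ideal_gen (polynomial_functions C) F" using PI[OF p] F(3) by blast
    show "\<forall>q\<in>F. q x = 0" using H x by blast
  qed
  then show ?thesis using F(1) H by (intro exI[of _ "\<Union>f\<in>F. H f"]) auto
qed

text \<open>An open set is the complement of the common zeros of polynomials, and finitely many of these suffice.\<close>

lemma openin_finite_union_principal:
  assumes C: "finite C" and W: "openin (zar (coord_space S C)) W"
  shows "\<exists>P. finite P \<and> P \<subseteq> polynomial_functions C \<and> W = (\<Union>p\<in>P. principal S p)"
proof -
  let ?P = "{p \<in> polynomial_functions C. principal S p \<subseteq> W}"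
  obtain P0 where P0: "finite P0" "P0 \<subseteq> ?P" "\<forall>x. (\<forall>q\<in>P0. q x = 0) \<longrightarrow> (\<forall>p\<in>?P. p x = 0)"
    using finite_defining_equations[OF C, of ?P] by blast
  have "W \<subseteq> (\<Union>p\<in>P0. principal S p)"
  proof
    fix x assume x: "x \<in> W"
    then obtain p where p: "p \<in> ?P" "p x \<noteq> 0" using W unfolding openin_coord_space by blast
    then obtain q where "q \<in> P0" "q x \<noteq> 0" using P0(3) by blast
    moreover have "x \<in> S" using x W unfolding openin_coord_space by blast
    ultimately show "x \<in> (\<Union>p\<in>P0. principal S p)" by blast
  qed
  then show ?thesis using P0(1,2) by blast
qed

section \<open>Affine covers and separatedness\<close>

text \<open>\<open>C\<close> consists of finitely many functions that identify \<open>S\<close> with an affine space \<open>k\<^sup>n\<close>.\<close>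

definition affine_coords :: "'x set \<Rightarrow> ('x \<Rightarrow> 'k::field) set \<Rightarrow> bool" where
  "affine_coords S C \<longleftrightarrow> (\<exists>(n::nat) c. C = c ` {..<n} \<and> (\<forall>y. \<exists>x\<in>S. \<forall>k<n. c k x = y k) \<and>
     (\<forall>x\<in>S. \<forall>x'\<in>S. (\<forall>k<n. c k x = c k x') \<longrightarrow> x = x'))"

lemma affine_coordsI:
  assumes K: "finite K" and C: "C = c ` K" and ex: "\<And>y. \<exists>x\<in>S. \<forall>k\<in>K. c k x = y k"
    and inj: "\<And>x x'. x \<in> S \<Longrightarrow> x' \<in> S \<Longrightarrow> (\<And>k. k \<in> K \<Longrightarrow> c k x = c k x') \<Longrightarrow> x = x'"
  shows "affine_coords S C"
proof -
  obtain b where b: "bij_betw b {..<card K} K"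
    using ex_bij_betw_nat_finite[OF K] by (auto simp: atLeast0LessThan)
  have "C = (\<lambda>k. c (b k)) ` {..<card K}" using b C by (simp add: bij_betw_def image_image[symmetric])
  moreover have "\<exists>x\<in>S. \<forall>k<card K. c (b k) x = y k" for y
  proof -
    obtain x where "x \<in> S" "\<forall>k\<in>K. c k x = y (inv_into {..<card K} b k)"
      using ex[of "\<lambda>k. y (inv_into {..<card K} b k)"] by blast
    moreover have "b k \<in> K \<and> inv_into {..<card K} b (b k) = k" if "k < card K" for k
      using b that by (auto simp: bij_betw_def)
    ultimately show ?thesis by (intro bexI[of _ x]) simp_all
  qed
  moreover have "x = x'" if "x \<in> S" "x' \<in> S" "\<forall>k<card K. c (b k) x = c (b k) x'" for x x'
  proof (rule inj[OF that(1,2)])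
    fix k assume "k \<in> K"
    then obtain j where "j < card K" "k = b j" using b unfolding bij_betw_def by blast
    then show "c k x = c k x'" using that(3) by simp
  qed
  ultimately show ?thesis unfolding affine_coords_def
    by (intro exI[of _ "card K"] exI[of _ "\<lambda>k. c (b k)"]) blast
qed

lemma affine_coords_finite: "affine_coords S C \<Longrightarrow> finite C"
  unfolding affine_coords_def by auto

lemma isomorphic_induced_induced:
  assumes X: "space_with_functions X" and UT: "U \<subseteq> T"
  shows "isomorphic (induced (induced X T) U) (induced X U)"
proof (rule isomorphicI[of _ _ "\<lambda>x. x" "\<lambda>x. x"])
  show "is_morphism (induced (induced X T) U) (induced X U) (\<lambda>x. x)"
    by (rule is_morphism_into_induced[OF swf_induced[OF swf_induced[OF X]]
          is_morphism_restrict[OF is_morphism_inclusion]]) simp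
  have "is_morphism (induced X U) (induced X T) (\<lambda>x. x)"
    by (rule is_morphism_into_induced[OF swf_induced[OF X] is_morphism_inclusion]) (use UT in auto)
  then show "is_morphism (induced X U) (induced (induced X T) U) (\<lambda>x. x)"
    by (rule is_morphism_into_induced[OF swf_induced[OF X]]) simp
qed simp_all

text \<open>Rabinowitsch's trick: \<open>x\<close> with \<open>p x \<noteq> 0\<close> is sent to the point of affine space with the coordinates of \<open>x\<close> and
  the additional coordinate \<open>inverse (p x)\<close>. The image is closed, cut out by \<open>T\<close> and by the equation that
  the additional coordinate times \<open>p\<close> is \<open>1\<close>.\<close>

lemma affine_variety_principal:
  fixes S :: "'x set" and C :: "('x \<Rightarrow> 'k::field) set"
  assumes aff: "affine_coords S C" and T: "closedin (zar (coord_space S C)) T"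
    and p: "p \<in> polynomial_functions C"
  shows "affine_variety (induced (coord_space S C) (principal S p \<inter> T))"
proof -
  let ?A = "coord_space S C"
  obtain n c where C: "C = c ` {..<n::nat}" and ex: "\<forall>y. \<exists>x\<in>S. \<forall>k<n. c k x = y k"
    and inj: "\<forall>x\<in>S. \<forall>x'\<in>S. (\<forall>k<n. c k x = c k x') \<longrightarrow> x = x'"
    using aff unfolding affine_coords_def by (elim exE conjE)
  \<comment> \<open>\<open>rec\<close> recovers a point of \<open>S\<close> from its coordinates\<close>
  obtain rec where rec: "\<forall>y. rec y \<in> S \<and> (\<forall>k<n. c k (rec y) = y k)"
    using choice[of "\<lambda>y x. x \<in> S \<and> (\<forall>k<n. c k x = y k)"] ex by blast
  have rec_c: "rec y = x" if "x \<in> S" "\<And>k. k < n \<Longrightarrow> y k = c k x" for x y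
    using inj[rule_format, of "rec y" x] rec[rule_format, of y] that by simp
  let ?N = "affine_space {..<Suc n} :: (nat \<Rightarrow> 'k, 'k) kspace"
  have swfN: "space_with_functions ?N" unfolding affine_space_def by (rule swf_coord_space)
  have ptsN: "pts ?N = {..<Suc n} \<rightarrow>\<^sub>E UNIV" unfolding affine_space_def by simp
  have coordN: "(\<lambda>y. y k) \<in> reg ?N (pts ?N)" if "k < Suc n" for k
    unfolding affine_space_def
    by (rule polynomial_reg[OF polynomial_functions.coord openin_topspace]) (use that in blast)
  have recM: "is_morphism ?N ?A rec"
  proof (rule is_morphism_coord_space[OF swfN])
    show "rec y \<in> S" for y using rec by blast
    fix d assume "d \<in> C"
    then obtain k where k: "k < n" "d = c k" using C by blast
    then have "(\<lambda>y. d (rec y)) = (\<lambda>y. y k)" using rec by auto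
    then show "(\<lambda>y. d (rec y)) \<in> reg ?N (pts ?N)" using coordN[of k] k(1) by simp
  qed
  have precN: "(\<lambda>y. p (rec y)) \<in> reg ?N (pts ?N)"
    using is_morphismD_reg[OF recM openin_topspace polynomial_reg[OF p openin_topspace]] rec by simp
  have "(\<lambda>y. y n * p (rec y) + (- 1)) \<in> reg ?N (pts ?N)"
    by (intro swf_add[OF swfN] swf_mult[OF swfN] coordN precN swf_const[OF swfN]) auto
  from swf_nonzero[OF swfN openin_topspace this]
  have op: "openin (zar ?N) {y \<in> pts ?N. y n * p (rec y) + (- 1) \<noteq> 0}" .
  \<comment> \<open>coordinate number \<open>n\<close> is the additional one, the inverse of \<open>p\<close>\<close>
  define Z where "Z = {y \<in> pts ?N. y n * p (rec y) = 1 \<and> rec y \<in> T}"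
  have "openin (zar ?A) (S - T)" using T unfolding closedin_def by simp
  from openin_Un[OF op is_morphismD_open[OF recM this]]
  have "openin (zar ?N) (pts ?N - Z)"
    by (rule back_subst[of "openin (zar ?N)"]) (use rec in \<open>auto simp: Z_def\<close>)
  then have closed: "closedin (zar ?N) Z" unfolding closedin_def Z_def by auto
  let ?X = "induced ?A (principal S p \<inter> T)"
  have ptsX: "pts ?X = principal S p \<inter> T" by auto
  have swfX: "space_with_functions ?X" by (rule swf_induced[OF swf_coord_space])
  define \<phi> where "\<phi> = (\<lambda>x. \<lambda>k\<in>{..<Suc n}. if k < n then c k x else inverse (p x))"
  have pX: "q \<in> reg ?X (pts ?X)" if "q \<in> polynomial_functions C" for q
    by (rule reg_into_induced[OF openin_topspace polynomial_reg[OF that openin_topspace]]) auto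
  have \<phi>1: "is_morphism ?X ?N \<phi>"
    unfolding affine_space_def
  proof (rule is_morphism_coord_space[OF swfX])
    show "\<phi> x \<in> {..<Suc n} \<rightarrow>\<^sub>E UNIV" for x unfolding \<phi>_def by simp
    fix d assume "d \<in> (\<lambda>j (x :: nat \<Rightarrow> 'k). x j) ` {..<Suc n}"
    then obtain k where k: "k < Suc n" "d = (\<lambda>x. x k)" by blast
    show "(\<lambda>x. d (\<phi> x)) \<in> reg ?X (pts ?X)"
    proof (cases "k < n")
      case True
      then have "(\<lambda>x. d (\<phi> x)) = c k" using k by (simp add: \<phi>_def)
      then show ?thesis using pX[OF polynomial_functions.coord[of "c k"]] True C by auto
    next
      case False
      then have "(\<lambda>x. d (\<phi> x)) = (\<lambda>x. inverse (p x))" using k by (simp add: \<phi>_def)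
      then show ?thesis using swf_inverse[OF swfX openin_topspace pX[OF p]] by auto
    qed
  qed
  have rec\<phi>: "rec (\<phi> x) = x" if "x \<in> S" for x by (rule rec_c[OF that]) (simp add: \<phi>_def)
  have \<phi>Z: "\<phi> x \<in> Z" if "x \<in> pts ?X" for x
  proof -
    have x: "x \<in> S" "p x \<noteq> 0" "x \<in> T" using that ptsX by auto
    then show ?thesis unfolding Z_def ptsN by (simp add: rec\<phi>) (simp add: \<phi>_def)
  qed
  have "isomorphic ?X (induced ?N Z)"
  proof (rule isomorphicI[of _ _ \<phi> rec])
    show "is_morphism ?X (induced ?N Z) \<phi>" by (rule is_morphism_into_induced[OF swfX \<phi>1 \<phi>Z])
    show "is_morphism (induced ?N Z) ?X rec"
    proof (rule is_morphism_restrict_both[OF swfN recM])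
      fix y assume "y \<in> Z"
      then have "y n * p (rec y) = 1" "rec y \<in> T" unfolding Z_def by simp_all
      then show "rec y \<in> principal S p \<inter> T" using rec by force
    qed
    show "rec (\<phi> x) = x" if "x \<in> pts ?X" for x using that rec\<phi> by simp
    fix y assume "y \<in> pts (induced ?N Z)"
    then have y: "y \<in> {..<Suc n} \<rightarrow>\<^sub>E UNIV" "y n * p (rec y) = 1" unfolding Z_def ptsN by auto
    have "inverse (p (rec y)) = y n" using y(2) by (metis inverse_unique mult.commute)
    moreover have "y k = undefined" if "\<not> k < Suc n" for k using y(1) that by auto
    ultimately show "\<phi> (rec y) = y" unfolding \<phi>_def
      using rec by (auto simp: fun_eq_iff restrict_def less_Suc_eq)
  qed
  then show ?thesis unfolding affine_variety_def using closed by blast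
qed

definition affine_covered :: "('x, 'k::field) kspace \<Rightarrow> bool" where
  "affine_covered X \<longleftrightarrow> (\<exists>\<U>. finite \<U> \<and> \<Union>\<U> = pts X \<and>
     (\<forall>U\<in>\<U>. openin (zar X) U \<and> affine_variety (induced X U)))"

lemma affine_variety_isomorphic: "isomorphic X Y \<Longrightarrow> affine_variety Y \<Longrightarrow> affine_variety X"
  unfolding affine_variety_def using isomorphic_trans by blast

text \<open>The open part is a finite union of principal open sets, and each of them meets \<open>T\<close> in an affine variety.\<close>

lemma affine_covered_locally_closed:
  assumes aff: "affine_coords S C" and W: "openin (zar (coord_space S C)) W"
    and T: "closedin (zar (coord_space S C)) T"
  shows "affine_covered (induced (coord_space S C) (W \<inter> T))"
proof -
  obtain P where P: "finite P" "P \<subseteq> polynomial_functions C" "W = (\<Union>p\<in>P. principal S p)"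
    using openin_finite_union_principal[OF affine_coords_finite[OF aff] W] by blast
  have TS: "T \<subseteq> S" using closedin_subset[OF T] by simp
  let ?X = "induced (coord_space S C) (W \<inter> T)"
  let ?U = "(\<lambda>p. principal S p \<inter> T) ` P"
  have "openin (zar ?X) (principal S p \<inter> T) \<and> affine_variety (induced ?X (principal S p \<inter> T))" if "p \<in> P" for p
  proof
    have pC: "p \<in> polynomial_functions C" using that P(2) by blast
    have sub: "principal S p \<inter> T \<subseteq> W \<inter> T" using that P(3) by blast
    have "principal S p \<inter> T = principal S p \<inter> (W \<inter> T)" using sub by blast
    then show "openin (zar ?X) (principal S p \<inter> T)"
      unfolding zar_induced openin_subtopology using openin_principal[OF pC] by blast
    show "affine_variety (induced ?X (principal S p \<inter> T))"
      by (rule affine_variety_isomorphic[OF isomorphic_induced_induced[OF swf_coord_space sub]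
            affine_variety_principal[OF aff T pC]])
  qed
  moreover have "\<Union>?U = pts ?X" using P(3) TS by auto
  ultimately show ?thesis unfolding affine_covered_def using P(1) by (intro exI[of _ ?U]) auto
qed

lemma isomorphic_induced_preimage:
  assumes X: "space_with_functions X" and Y: "space_with_functions Y"
    and \<phi>: "is_morphism X Y \<phi>" and \<psi>: "is_morphism Y X \<psi>"
    and inv: "\<And>x. x \<in> pts X \<Longrightarrow> \<psi> (\<phi> x) = x" "\<And>y. y \<in> pts Y \<Longrightarrow> \<phi> (\<psi> y) = y"
    and U: "U \<subseteq> pts Y"
  shows "isomorphic (induced X {x \<in> pts X. \<phi> x \<in> U}) (induced Y U)"
proof (rule isomorphicI[of _ _ \<phi> \<psi>])
  show "is_morphism (induced X {x \<in> pts X. \<phi> x \<in> U}) (induced Y U) \<phi>"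
    by (rule is_morphism_restrict_both[OF X \<phi>]) simp
  show "is_morphism (induced Y U) (induced X {x \<in> pts X. \<phi> x \<in> U}) \<psi>"
    by (rule is_morphism_restrict_both[OF Y \<psi>]) (use is_morphismD_pts[OF \<psi>] inv in simp)
qed (use inv in auto)

lemma affine_covered_isomorphic:
  assumes X: "space_with_functions X" and Y: "space_with_functions Y"
    and iso: "isomorphic X Y" and cov: "affine_covered Y"
  shows "affine_covered X"
proof -
  obtain \<phi> \<psi> where \<phi>: "is_morphism X Y \<phi>" "is_morphism Y X \<psi>" "\<forall>x\<in>pts X. \<psi> (\<phi> x) = x" "\<forall>y\<in>pts Y. \<phi> (\<psi> y) = y"
    using iso unfolding isomorphic_def by blast
  obtain \<U> where U: "finite \<U>" "\<Union>\<U> = pts Y" "\<forall>U\<in>\<U>. openin (zar Y) U \<and> affine_variety (induced Y U)"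
    using cov unfolding affine_covered_def by blast
  let ?U = "(\<lambda>U. {x \<in> pts X. \<phi> x \<in> U}) ` \<U>"
  have "openin (zar X) {x \<in> pts X. \<phi> x \<in> U} \<and> affine_variety (induced X {x \<in> pts X. \<phi> x \<in> U})" if "U \<in> \<U>" for U
  proof
    show "openin (zar X) {x \<in> pts X. \<phi> x \<in> U}" using is_morphismD_open[OF \<phi>(1)] U(3) that by blast
    have "U \<subseteq> pts Y" using U(2) that by blast
    from isomorphic_induced_preimage[OF X Y \<phi>(1,2) bspec[OF \<phi>(3)] bspec[OF \<phi>(4)] this]
    show "affine_variety (induced X {x \<in> pts X. \<phi> x \<in> U})"
      using conjunct2[OF bspec[OF U(3) that]] by (rule affine_variety_isomorphic)
  qed
  moreover have "\<Union>?U = pts X" using U(2) is_morphismD_pts[OF \<phi>(1)] by auto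
  ultimately show ?thesis unfolding affine_covered_def using U(1) by (intro exI[of _ ?U]) auto
qed

lemma affine_covered_union:
  assumes X: "space_with_functions X" and fin: "finite \<W>" and un: "\<Union>\<W> = pts X"
    and W: "\<And>W. W \<in> \<W> \<Longrightarrow> openin (zar X) W \<and> affine_covered (induced X W)"
  shows "affine_covered X"
proof -
  have "\<forall>W\<in>\<W>. \<exists>\<U>. finite \<U> \<and> \<Union>\<U> = pts (induced X W) \<and>
     (\<forall>U\<in>\<U>. openin (zar (induced X W)) U \<and> affine_variety (induced (induced X W) U))"
    using W unfolding affine_covered_def by blast
  then obtain \<U> where U: "\<forall>W\<in>\<W>. finite (\<U> W) \<and> \<Union>(\<U> W) = pts (induced X W) \<and>
     (\<forall>U\<in>\<U> W. openin (zar (induced X W)) U \<and> affine_variety (induced (induced X W) U))"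
    by (rule bchoice[THEN exE])
  let ?U = "\<Union>(\<U> ` \<W>)"
  have "openin (zar X) U \<and> affine_variety (induced X U)" if "W \<in> \<W>" "U \<in> \<U> W" for U W
  proof
    have o: "openin (zar (induced X W)) U" and a: "affine_variety (induced (induced X W) U)"
      using U that by blast+
    show "openin (zar X) U" using o W[OF that(1)] openin_trans_full by fastforce
    have sub: "U \<subseteq> W" using openin_subset[OF o] by auto
    obtain \<phi> \<psi> where "is_morphism (induced (induced X W) U) (induced X U) \<phi>" "is_morphism (induced X U) (induced (induced X W) U) \<psi>"
       "\<forall>x\<in>pts (induced (induced X W) U). \<psi> (\<phi> x) = x" "\<forall>y\<in>pts (induced X U). \<phi> (\<psi> y) = y"
      using isomorphic_induced_induced[OF X sub] unfolding isomorphic_def by blast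
    then have "isomorphic (induced X U) (induced (induced X W) U)" unfolding isomorphic_def by blast
    then show "affine_variety (induced X U)" using a by (rule affine_variety_isomorphic)
  qed
  moreover have "\<Union>?U = pts X"
  proof -
    have "\<Union>?U = (\<Union>W\<in>\<W>. \<Union>(\<U> W))" by auto
    also have "\<dots> = (\<Union>W\<in>\<W>. pts (induced X W))" using U by (intro SUP_cong refl) simp
    also have "\<dots> = pts X" using un by auto
    finally show ?thesis .
  qed
  ultimately show ?thesis unfolding affine_covered_def using U fin by (intro exI[of _ ?U]) auto
qed

text \<open>A finite sum of products of functions of the first and of the second argument is a regular function near
  \<open>(x, y)\<close> in the product. If it vanishes on the diagonal but not at \<open>(x, y)\<close>, then its nonvanishing locus is a
  neighbourhood of \<open>(x, y)\<close> in the complement of the diagonal.\<close>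

lemma separatedI:
  fixes X :: "('x, 'k::field) kspace"
  assumes X: "space_with_functions X"
    and sep: "\<And>x y. x \<in> pts X \<Longrightarrow> y \<in> pts X \<Longrightarrow> x \<noteq> y \<Longrightarrow>
      \<exists>U V f g (n::nat). openin (zar X) U \<and> openin (zar X) V \<and> x \<in> U \<and> y \<in> V \<and>
        (\<forall>k<n. f k \<in> reg X U \<and> g k \<in> reg X V) \<and> (\<Sum>k<n. f k x * g k y) \<noteq> 0 \<and>
        (\<forall>z\<in>U \<inter> V. (\<Sum>k<n. f k z * g k z) = 0)"
  shows "separated X"
proof -
  let ?B = "{{(x, y). x \<in> U \<and> y \<in> V \<and> (\<Sum>k<n. f k x * g k y) \<noteq> (0::'k)} | U V f g (n::nat).
        openin (zar X) U \<and> openin (zar X) V \<and> (\<forall>k<n. f k \<in> reg X U \<and> g k \<in> reg X V)}"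
  have basis: "openin (zar_prod X X) {(x, y). x \<in> U \<and> y \<in> V \<and> (\<Sum>k<n. f k x * g k y) \<noteq> 0}"
    if "openin (zar X) U" "openin (zar X) V" "\<forall>k<n. f k \<in> reg X U \<and> g k \<in> reg X V" for U V f g and n :: nat
  proof -
    have "{(x, y). x \<in> U \<and> y \<in> V \<and> (\<Sum>k<n. f k x * g k y) \<noteq> 0} \<in> ?B"
      by (rule CollectI, rule exI[of _ U], rule exI[of _ V], rule exI[of _ f], rule exI[of _ g], rule exI[of _ n])
         (use that in simp)
    then show ?thesis unfolding zar_prod_def by (rule topology_generated_by_Basis)
  qed
  have top: "topspace (zar_prod X X) = pts X \<times> pts X"
  proof
    show "topspace (zar_prod X X) \<subseteq> pts X \<times> pts X"
      unfolding zar_prod_def topology_generated_by_topspace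
    proof (rule Union_least)
      fix D assume "D \<in> ?B"
      then show "D \<subseteq> pts X \<times> pts X"
        by (elim CollectE exE conjE) (auto dest: openin_subset)
    qed
    \<comment> \<open>with the constant functions \<open>1\<close>, the whole product is one of the basic open sets\<close>
    have "{(x, y). x \<in> pts X \<and> y \<in> pts X \<and> (\<Sum>k<1::nat. (1::'k) * 1) \<noteq> 0} = pts X \<times> pts X" by auto
    moreover have "openin (zar_prod X X) {(x, y). x \<in> pts X \<and> y \<in> pts X \<and> (\<Sum>k<1::nat. (1::'k) * 1) \<noteq> 0}"
      by (rule basis[of _ _ 1 "\<lambda>k x. 1" "\<lambda>k x. 1"]) (simp_all add: swf_const[OF X])
    ultimately show "pts X \<times> pts X \<subseteq> topspace (zar_prod X X)" using openin_subset by metis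
  qed
  have "openin (zar_prod X X) (pts X \<times> pts X - {(x, x) | x. x \<in> pts X})"
  proof (subst openin_subopen, intro ballI)
    fix xy assume "xy \<in> pts X \<times> pts X - {(x, x) | x. x \<in> pts X}"
    then obtain x y where xy: "xy = (x, y)" "x \<in> pts X" "y \<in> pts X" "x \<noteq> y" by auto
    note x = xy(2) and y = xy(3)
    from sep[OF x y xy(4)] obtain U V f g n where s: "openin (zar X) U" "openin (zar X) V" "x \<in> U" "y \<in> V"
      "\<forall>k<n. f k \<in> reg X U \<and> g k \<in> reg X V" "(\<Sum>k<n. f k x * g k y) \<noteq> 0" "\<forall>z\<in>U \<inter> V. (\<Sum>k<n::nat. f k z * g k z) = 0"
      by (elim exE conjE)
    let ?T = "{(x, y). x \<in> U \<and> y \<in> V \<and> (\<Sum>k<n. f k x * g k y) \<noteq> 0}"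
    have "openin (zar_prod X X) ?T" by (rule basis[OF s(1,2,5)])
    moreover have "(x, y) \<in> ?T" using s by simp
    moreover have "?T \<subseteq> pts X \<times> pts X - {(x, x) | x. x \<in> pts X}"
      using s(7) openin_subset[OF s(1)] openin_subset[OF s(2)] by auto
    ultimately show "\<exists>T. openin (zar_prod X X) T \<and> xy \<in> T \<and> T \<subseteq> pts X \<times> pts X - {(x, x) | x. x \<in> pts X}"
      unfolding xy(1) by blast
  qed
  then show ?thesis unfolding separated_def closedin_def top by auto
qed

text \<open>Two different points are separated by \<open>c x - c y\<close> for some coordinate \<open>c\<close>.\<close>

lemma separated_induced_coord_space:
  assumes aff: "affine_coords S C"
  shows "separated (induced (coord_space S C) T)" (is "separated ?X")
proof (rule separatedI)
  show X: "space_with_functions ?X" by (rule swf_induced[OF swf_coord_space])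
  fix x y assume xy: "x \<in> pts ?X" "y \<in> pts ?X" "x \<noteq> y"
  obtain n c where C: "C = c ` {..<n::nat}" and inj: "\<forall>x\<in>S. \<forall>x'\<in>S. (\<forall>k<n. c k x = c k x') \<longrightarrow> x = x'"
    using aff unfolding affine_coords_def by (elim exE conjE)
  have "\<exists>k<n. c k x \<noteq> c k y" using inj[rule_format, of x y] xy by auto
  then obtain c where c: "c \<in> C" "c x \<noteq> c y" unfolding C by blast
  have c': "c \<in> reg ?X (pts ?X)"
    by (rule reg_into_induced[OF openin_topspace polynomial_reg[OF polynomial_functions.coord[OF c(1)] openin_topspace]]) auto
  \<comment> \<open>\<open>c x - c y\<close> written as \<open>c x * 1 + 1 * (- c y)\<close>\<close>
  let ?f = "\<lambda>k::nat. if k = 0 then c else (\<lambda>x. 1)" let ?g = "\<lambda>k::nat. if k = 0 then (\<lambda>x. 1) else (\<lambda>x. - c x)"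
  have r: "\<forall>k<2::nat. ?f k \<in> reg ?X (pts ?X) \<and> ?g k \<in> reg ?X (pts ?X)"
    using c' swf_const[OF X openin_topspace, of 1] swf_uminus[OF X openin_topspace c'] by simp
  have s: "(\<Sum>k<2::nat. ?f k a * ?g k b) = c a - c b" for a b by (simp add: numeral_2_eq_2)
  show "\<exists>U V f g (n::nat). openin (zar ?X) U \<and> openin (zar ?X) V \<and> x \<in> U \<and> y \<in> V \<and>
        (\<forall>k<n. f k \<in> reg ?X U \<and> g k \<in> reg ?X V) \<and> (\<Sum>k<n. f k x * g k y) \<noteq> 0 \<and>
        (\<forall>z\<in>U \<inter> V. (\<Sum>k<n. f k z * g k z) = 0)"
    by (rule exI[of _ "pts ?X"], rule exI[of _ "pts ?X"], rule exI[of _ ?f], rule exI[of _ ?g], rule exI[of _ 2])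
       (use xy r c(2) in \<open>simp only: s openin_topspace, simp\<close>)
qed

section \<open>Injective matrices and subspaces\<close>

lemma mult_index:
  "A \<in> carrier_mat m n \<Longrightarrow> B \<in> carrier_mat n l \<Longrightarrow> i < m \<Longrightarrow> j < l \<Longrightarrow>
   (A * B) $$ (i, j) = (\<Sum>k<n. A $$ (i, k) * B $$ (k, j))"
  by (auto simp: scalar_prod_def lessThan_atLeast0 intro!: sum.cong)

lemma mult_unit_vec:
  "A \<in> carrier_mat n e \<Longrightarrow> j < e \<Longrightarrow> A *\<^sub>v unit_vec e j = (col A j :: 'k::comm_ring_1 vec)"
  by (intro eq_vecI) auto

lemma mat_injective_iff:
  fixes A :: "'k::field mat"
  assumes A: "A \<in> carrier_mat n e"
  shows "mat_injective A \<longleftrightarrow> (\<forall>v\<in>carrier_vec e. A *\<^sub>v v = 0\<^sub>v n \<longrightarrow> v = 0\<^sub>v e)"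
proof
  assume inj: "mat_injective A"
  show "\<forall>v\<in>carrier_vec e. A *\<^sub>v v = 0\<^sub>v n \<longrightarrow> v = 0\<^sub>v e"
  proof (intro ballI impI)
    fix v assume v: "v \<in> carrier_vec e" "A *\<^sub>v v = 0\<^sub>v n"
    have "A *\<^sub>v v = A *\<^sub>v 0\<^sub>v e" using v A by auto
    then show "v = 0\<^sub>v e" using inj_onD[OF inj, of v "0\<^sub>v e"] v A by simp
  qed
next
  assume ker: "\<forall>v\<in>carrier_vec e. A *\<^sub>v v = 0\<^sub>v n \<longrightarrow> v = 0\<^sub>v e"
  show "mat_injective A"
  proof (rule inj_onI)
    fix v w assume vw: "v \<in> carrier_vec (dim_col A)" "w \<in> carrier_vec (dim_col A)" "A *\<^sub>v v = A *\<^sub>v w"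
    then have c: "v \<in> carrier_vec e" "w \<in> carrier_vec e" using A by auto
    have "A *\<^sub>v (v - w) = A *\<^sub>v v - A *\<^sub>v w" by (rule mult_minus_distrib_mat_vec[OF A c])
    also have "\<dots> = 0\<^sub>v n" using vw(3) A c by simp
    finally have "v - w = 0\<^sub>v e" using ker c by simp
    then have "(v - w) $ i = 0" if "i < e" for i using that by simp
    then show "v = w" using c by (intro eq_vecI) auto
  qed
qed

lemma mat_injective_cancel:
  fixes A :: "'k::field mat"
  assumes A: "A \<in> carrier_mat n e" and inj: "mat_injective A"
    and XY: "X \<in> carrier_mat e m" "Y \<in> carrier_mat e m" and eq: "A * X = A * Y"
  shows "X = Y"
proof (rule mat_col_eqI)
  fix j assume "j < dim_col Y"
  then have j: "j < m" using XY by simp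
  have "A *\<^sub>v col X j = col (A * X) j" by (rule col_mult2[OF A XY(1) j, symmetric])
  also have "\<dots> = A *\<^sub>v col Y j" unfolding eq by (rule col_mult2[OF A XY(2) j])
  finally show "col X j = col Y j" using inj_onD[OF inj] A XY j by simp
qed (use XY in auto)

lemma mat_injective_left_inverse:
  fixes A :: "'k::field mat"
  assumes A: "A \<in> carrier_mat n e" and P: "P \<in> carrier_mat e n" and PA: "P * A = 1\<^sub>m e"
  shows "mat_injective A"
  unfolding mat_injective_iff[OF A]
proof (intro ballI impI)
  fix v assume v: "v \<in> carrier_vec e" "A *\<^sub>v v = 0\<^sub>v n"
  have "v = (P * A) *\<^sub>v v" unfolding PA using v by simp
  also have "\<dots> = P *\<^sub>v (A *\<^sub>v v)" by (rule assoc_mult_mat_vec[OF P A v(1)])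
  finally show "v = 0\<^sub>v e" using v P by auto
qed

lemma mat_injective_mult:
  fixes A :: "'k::field mat"
  assumes A: "A \<in> carrier_mat n m" "mat_injective A" and B: "B \<in> carrier_mat m e" "mat_injective B"
  shows "mat_injective (A * B)"
  unfolding mat_injective_iff[OF mult_carrier_mat[OF A(1) B(1)]]
proof (intro ballI impI)
  fix v assume v: "v \<in> carrier_vec e" "A * B *\<^sub>v v = 0\<^sub>v n"
  then have "A *\<^sub>v (B *\<^sub>v v) = 0\<^sub>v n" using A B by simp
  then have "B *\<^sub>v v = 0\<^sub>v m" using A(2)[unfolded mat_injective_iff[OF A(1)]] B v by simp
  then show "v = 0\<^sub>v e" using B(2)[unfolded mat_injective_iff[OF B(1)]] v by simp
qed

text \<open>Otherwise \<open>A\<close> could be filled up with zero rows to a square matrix, which is singular.\<close>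

lemma mat_injective_dim_le:
  fixes A :: "'k::field mat"
  assumes A: "A \<in> carrier_mat m e" and inj: "mat_injective A"
  shows "e \<le> m"
proof (rule ccontr)
  assume "\<not> e \<le> m"
  then have me: "m < e" by simp
  \<comment> \<open>row \<open>m\<close> of \<open>B\<close> is zero, since \<open>m < e\<close>\<close>
  define B where "B = mat e e (\<lambda>(i, j). if i < m then A $$ (i, j) else 0)"
  have B: "B \<in> carrier_mat e e" unfolding B_def by simp
  have "(B * adj_mat B) $$ (m, m) = (\<Sum>k<e. B $$ (m, k) * adj_mat B $$ (k, m))"
    by (rule mult_index[OF B adj_mat(1)[OF B] me me])
  also have "\<dots> = 0" using me by (simp add: B_def)
  finally have "det B = 0" using adj_mat(2)[OF B] me by simp
  then obtain v where v: "v \<in> carrier_vec e" "v \<noteq> 0\<^sub>v e" "B *\<^sub>v v = 0\<^sub>v e"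
    using det_0_iff_vec_prod_zero_field[OF B] by blast
  have "A *\<^sub>v v = 0\<^sub>v m"
  proof (rule eq_vecI)
    fix i assume "i < dim_vec (0\<^sub>v m :: 'k vec)"
    then have i: "i < m" by simp
    have "row B i = row A i" using i me A by (intro eq_vecI) (auto simp: B_def)
    then have "(A *\<^sub>v v) $ i = (B *\<^sub>v v) $ i" using i me A B by simp
    then show "(A *\<^sub>v v) $ i = 0\<^sub>v m $ i" using v(3) i me by simp
  qed (use A in auto)
  then show False using inj[unfolded mat_injective_iff[OF A]] v by blast
qed

text \<open>Cramer's formula, which shows that the entries of the inverse are regular functions of the matrix.\<close>

definition minv :: "'k::field mat \<Rightarrow> 'k mat" where
  "minv A = inverse (det A) \<cdot>\<^sub>m adj_mat A"

lemma minv: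
  assumes A: "A \<in> carrier_mat n n" and d: "det A \<noteq> 0"
  shows "minv A \<in> carrier_mat n n" "A * minv A = 1\<^sub>m n" "minv A * A = 1\<^sub>m n"
proof -
  show c: "minv A \<in> carrier_mat n n" unfolding minv_def using adj_mat(1)[OF A] by simp
  have s: "inverse (det A) \<cdot>\<^sub>m (det A \<cdot>\<^sub>m 1\<^sub>m n) = 1\<^sub>m n" using d by (intro eq_matI) auto
  show "A * minv A = 1\<^sub>m n"
    unfolding minv_def mult_smult_distrib[OF A adj_mat(1)[OF A]] adj_mat(2)[OF A] by (rule s)
  show "minv A * A = 1\<^sub>m n"
    unfolding minv_def mult_smult_assoc_mat[OF adj_mat(1)[OF A] A] adj_mat(3)[OF A] by (rule s)
qed

lemma inverse_mat_det:
  fixes A :: "'k::field mat"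
  assumes "A \<in> carrier_mat n n" "B \<in> carrier_mat n n" "A * B = 1\<^sub>m n"
  shows "det A \<noteq> 0"
  using det_mult[OF assms(1,2)] assms(3) by auto

lemma invertible_mat_iff_det:
  fixes A :: "'k::field mat"
  assumes A: "A \<in> carrier_mat n n"
  shows "invertible_mat A \<longleftrightarrow> det A \<noteq> 0"
proof
  assume "invertible_mat A"
  then obtain B where B: "A * B = 1\<^sub>m n" "B * A = 1\<^sub>m (dim_row B)"
    unfolding invertible_mat_def inverts_mat_def using A by auto
  have "dim_col B = n" using arg_cong[OF B(1), of dim_col] by simp
  moreover have "dim_row B = n" using arg_cong[OF B(2), of dim_col] A by simp
  ultimately show "det A \<noteq> 0" using inverse_mat_det[OF A _ B(1)] by auto
next
  assume "det A \<noteq> 0"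
  from minv[OF A this] show "invertible_mat A"
    unfolding invertible_mat_def inverts_mat_def using A by auto
qed

lemma the_mat_inverse:
  fixes A :: "'k::field mat"
  assumes A: "A \<in> carrier_mat n n" and inv: "invertible_mat A"
  shows "the (mat_inverse A) \<in> carrier_mat n n" "A * the (mat_inverse A) = 1\<^sub>m n" "the (mat_inverse A) * A = 1\<^sub>m n"
proof -
  have "A \<in> Units (ring_mat TYPE('k) n ())"
    by (rule det_non_zero_imp_unit[OF A]) (use inv invertible_mat_iff_det[OF A] in blast)
  then obtain B where "mat_inverse A = Some B" using mat_inverse(1)[OF A, of "()"] by (cases "mat_inverse A") auto
  from mat_inverse(2)[OF A this] this
  show "the (mat_inverse A) \<in> carrier_mat n n" "A * the (mat_inverse A) = 1\<^sub>m n" "the (mat_inverse A) * A = 1\<^sub>m n"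
    by simp_all
qed

lemma mat_image_mult_subset:
  fixes A :: "'k::field mat"
  assumes "A \<in> carrier_mat n m" "B \<in> carrier_mat m e"
  shows "mat_image (A * B) \<subseteq> mat_image A"
proof
  fix w assume "w \<in> mat_image (A * B)"
  then obtain v where v: "v \<in> carrier_vec e" "w = A * B *\<^sub>v v" using assms by auto
  then have "w = A *\<^sub>v (B *\<^sub>v v)" using assms by simp
  then show "w \<in> mat_image A" using assms v(1) by (intro image_eqI[of _ _ "B *\<^sub>v v"]) auto
qed

lemma mat_image_mult_invertible:
  fixes A :: "'k::field mat"
  assumes A: "A \<in> carrier_mat n e" and B: "B \<in> carrier_mat e e" and d: "det B \<noteq> 0"
  shows "mat_image (A * B) = mat_image A"
proof
  show "mat_image (A * B) \<subseteq> mat_image A" by (rule mat_image_mult_subset[OF A B])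
  have "A * B * minv B = A" using A B minv[OF B d] by simp
  then show "mat_image A \<subseteq> mat_image (A * B)"
    using mat_image_mult_subset[OF mult_carrier_mat[OF A B] minv(1)[OF B d]] by simp
qed

lemma mat_image_subset_factor:
  fixes A :: "'k::field mat"
  assumes A: "A \<in> carrier_mat n m" and B: "B \<in> carrier_mat n e" and sub: "mat_image B \<subseteq> mat_image A"
  shows "\<exists>X\<in>carrier_mat m e. B = A * X"
proof -
  have "\<exists>x\<in>carrier_vec m. A *\<^sub>v x = col B j" if j: "j < e" for j
  proof -
    have "col B j = B *\<^sub>v unit_vec e j" using B j by (simp add: mult_unit_vec)
    then have "col B j \<in> mat_image B" using B by (intro image_eqI[of _ _ "unit_vec e j"]) auto
    then have "col B j \<in> mat_image A" using sub by (rule subsetD[rotated])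
    then show ?thesis using A by auto
  qed
  then obtain x where x: "\<forall>j<e. x j \<in> carrier_vec m \<and> A *\<^sub>v x j = col B j" by metis
  define X where "X = mat m e (\<lambda>(i, j). x j $ i)"
  have X: "X \<in> carrier_mat m e" unfolding X_def by simp
  have "col (A * X) j = col B j" if j: "j < e" for j
  proof -
    have "col X j = x j" using x j by (intro eq_vecI) (auto simp: X_def)
    then show ?thesis using x j by (simp only: col_mult2[OF A X j])
  qed
  then have "B = A * X" using A B X by (intro mat_col_eqI) auto
  then show ?thesis using X by blast
qed

text \<open>Two bases of one subspace differ by an invertible matrix. This is why the fibres of the
  map from inflations to their images are orbits.\<close>

lemma mat_image_eq_factor:
  fixes A :: "'k::field mat"
  assumes A: "A \<in> carrier_mat n e" "mat_injective A" and B: "B \<in> carrier_mat n e" "mat_injective B"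
    and eq: "mat_image A = mat_image B"
  shows "\<exists>X\<in>carrier_mat e e. det X \<noteq> 0 \<and> B = A * X"
proof -
  obtain X where X: "X \<in> carrier_mat e e" "B = A * X"
    using mat_image_subset_factor[OF A(1) B(1) equalityD2[OF eq]] by (rule bexE)
  obtain Y where Y: "Y \<in> carrier_mat e e" "A = B * Y"
    using mat_image_subset_factor[OF B(1) A(1) equalityD1[OF eq]] by (rule bexE)
  have "A * (X * Y) = B * Y" unfolding X(2) by (rule assoc_mult_mat[OF A(1) X(1) Y(1), symmetric])
  also have "\<dots> = A * 1\<^sub>m e" using Y(2) right_mult_one_mat[OF A(1)] by simp
  finally have "A * (X * Y) = A * 1\<^sub>m e" .
  then have "X * Y = 1\<^sub>m e" by (rule mat_injective_cancel[OF A mult_carrier_mat[OF X(1) Y(1)] one_carrier_mat])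
  then show ?thesis using inverse_mat_det[OF X(1) Y(1)] X by blast
qed

text \<open>A maximal linearly independent subset exists because the sizes of such subsets are bounded by the dimension of the ambient
  space; this makes the dimension of the subspace the size of an actual basis.\<close>

lemma (in vectorspace) subspace_basis:
  assumes fd: "fin_dim" and W: "VectorSpace.subspace K W V"
  shows "\<exists>\<beta>. finite \<beta> \<and> \<beta> \<subseteq> W \<and> lin_indpt \<beta> \<and> span \<beta> = W \<and> vectorspace.dim K (vs W) = card \<beta>"
proof -
  have sm: "submodule K W V" using W unfolding VectorSpace.subspace_def by simp
  have WV: "W \<subseteq> carrier V" using sm unfolding submodule_def by simp
  interpret W: vectorspace K "vs W" by (rule subspace_is_vs[OF W])
  have li: "LinearCombinations.module.lin_dep K (vs W) S = lin_dep S" if "S \<subseteq> W" for S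
    by (rule span_li_not_depend(2)[OF that sm])
  have "\<exists>A. finite A \<and> maximal A (\<lambda>S. S \<subseteq> carrier (vs W) \<and> W.lin_indpt S)"
  proof (rule maximal_exists[where N = dim and B = "{}"])
    fix A assume "A \<subseteq> carrier (vs W) \<and> W.lin_indpt A"
    then have "A \<subseteq> W" "lin_indpt A" using li by auto
    then show "finite A \<and> card A \<le> dim" using li_le_dim[OF fd, of A] WV by auto
  next
    show "{} \<subseteq> carrier (vs W) \<and> W.lin_indpt {}" by (auto simp: W.lin_dep_def)
  qed
  then obtain \<beta> where \<beta>: "finite \<beta>" "maximal \<beta> (\<lambda>S. S \<subseteq> carrier (vs W) \<and> W.lin_indpt S)" by blast
  have b: "W.basis \<beta>" by (rule W.max_li_is_basis[OF \<beta>(2)])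
  have sub: "\<beta> \<subseteq> W" using b unfolding W.basis_def by simp
  have "lin_indpt \<beta>" using b li[OF sub] unfolding W.basis_def by simp
  moreover have "span \<beta> = W" using b span_li_not_depend(1)[OF sub sm] unfolding W.basis_def by simp
  ultimately show ?thesis using \<beta>(1) sub W.dim_basis[OF \<beta>(1) b] by blast
qed

lemma mat_image_col_space:
  assumes "A \<in> carrier_mat n e"
  shows "mat_image A = LinearCombinations.module.span class_ring (module_vec TYPE('k::field) n) (set (cols (A :: 'k mat)))"
proof -
  interpret vec_space "TYPE('k)" n .
  show ?thesis using col_space_eq[OF assms] assms unfolding col_space_def by auto
qed

lemma mat_injective_iff_lin_indpt:
  assumes A: "(A :: 'k::field mat) \<in> carrier_mat n e"
  shows "mat_injective A \<longleftrightarrow> distinct (cols A) \<and> \<not> LinearCombinations.module.lin_dep class_ring (module_vec TYPE('k) n) (set (cols A))"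
proof -
  interpret vec_space "TYPE('k)" n .
  show ?thesis
  proof (intro iffI conjI)
    assume inj: "mat_injective A"
    show dist: "distinct (cols A)" unfolding distinct_conv_nth
    proof (intro allI impI)
      fix i j assume ij: "i < length (cols A)" "j < length (cols A)" "i \<noteq> j"
      then have ij': "i < e" "j < e" using A by auto
      show "cols A ! i \<noteq> cols A ! j"
      proof
        assume "cols A ! i = cols A ! j"
        then have "A *\<^sub>v unit_vec e i = A *\<^sub>v unit_vec e j" using A ij' by (simp add: mult_unit_vec)
        then have "unit_vec e i = (unit_vec e j :: 'k vec)" using inj_onD[OF inj] A by simp
        then have "unit_vec e i $ i = (unit_vec e j :: 'k vec) $ i" by simp
        then show False using ij' ij(3) by simp
      qed
    qed
    show "lin_indpt (set (cols A))"
      using lin_depE[OF A _ dist] inj[unfolded mat_injective_iff[OF A]] by blast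
  next
    assume "distinct (cols A) \<and> lin_indpt (set (cols A))"
    then show "mat_injective A" unfolding mat_injective_iff[OF A] using lin_depI[OF A] by blast
  qed
qed

text \<open>This replaces subspaces by matrices: all further arguments about Grassmannians are computations with matrices whose columns
  are a basis.\<close>

lemma grassmannian_eq_mat_image:
  "(grassmannian e n :: 'k::field vec set set) = mat_image ` {f \<in> carrier_mat n e. mat_injective f}"
proof -
  interpret V: vec_space "TYPE('k)" n .
  show ?thesis
  proof (intro equalityI subsetI)
    fix W :: "'k vec set" assume "W \<in> grassmannian e n"
    then have W: "VectorSpace.subspace class_ring W V.V" "vectorspace.dim class_ring (V.vs W) = e"
      unfolding grassmannian_def by auto
    obtain \<beta> where \<beta>: "finite \<beta>" "\<beta> \<subseteq> W" "V.lin_indpt \<beta>" "V.span \<beta> = W" "e = card \<beta>"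
      using V.subspace_basis[OF V.fin_dim W(1)] W(2) by auto
    have WV: "W \<subseteq> carrier_vec n" using W(1) unfolding VectorSpace.subspace_def submodule_def by (auto simp: module_vec_simps)
    obtain xs where xs: "set xs = \<beta>" "distinct xs" using finite_distinct_list[OF \<beta>(1)] by blast
    define f where "f = mat_of_cols n xs"
    have len: "length xs = e" using distinct_card[OF xs(2)] xs(1) \<beta>(5) by simp
    have f: "f \<in> carrier_mat n e" unfolding f_def using len mat_of_cols_carrier(1)[of n xs] by simp
    have cf: "cols f = xs" unfolding f_def using xs(1) \<beta>(2) WV by simp
    have "mat_injective f" unfolding mat_injective_iff_lin_indpt[OF f] cf xs(1) using xs(2) \<beta>(3) by simp
    moreover have "mat_image f = W" unfolding mat_image_col_space[OF f] cf xs(1) by (rule \<beta>(4))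
    ultimately show "W \<in> mat_image ` {f \<in> carrier_mat n e. mat_injective f}" using f by blast
  next
    fix W :: "'k vec set" assume "W \<in> mat_image ` {f \<in> carrier_mat n e. mat_injective f}"
    then obtain f where f: "f \<in> carrier_mat n e" "mat_injective f" "W = mat_image f" by blast
    have cf: "set (cols f) \<subseteq> carrier_vec n" using f(1) cols_dim by fastforce
    have W: "W = V.span (set (cols f))" using mat_image_col_space[OF f(1)] f(3) by simp
    have li: "distinct (cols f)" "V.lin_indpt (set (cols f))" using f(2) mat_injective_iff_lin_indpt[OF f(1)] by auto
    have "vectorspace.dim class_ring (V.vs W) = e"
      using V.lin_indpt_full_rank[OF f(1) li] unfolding V.rank_def W .
    moreover have "VectorSpace.subspace class_ring W V.V"
      unfolding W by (rule V.span_is_subspace) (use cf in simp)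
    ultimately show "W \<in> grassmannian e n" unfolding grassmannian_def by simp
  qed
qed

section \<open>Graph matrices\<close>

text \<open>Rows and columns of matrices are numbered from \<open>0\<close>, so sets of coordinates have to be enumerated.\<close>

definition nth_elem :: "nat set \<Rightarrow> nat \<Rightarrow> nat" where
  "nth_elem J k = sorted_list_of_set J ! k"

lemma nth_elem_bij: "finite J \<Longrightarrow> bij_betw (nth_elem J) {..<card J} J"
  unfolding nth_elem_def[abs_def] by (rule bij_betw_nth) auto

text \<open>For \<open>J \<subseteq> {..<n}\<close>, the projection of \<open>k\<^sup>n\<close> onto the coordinates in \<open>J\<close> and the inclusion of the coordinates outside
  \<open>J\<close>; the graph of the map \<open>a\<close> from the former to the latter is the image of \<open>graph_mat\<close> and the kernel of
  \<open>cograph_mat\<close>.\<close>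

definition sel_mat :: "nat \<Rightarrow> nat set \<Rightarrow> 'k::field mat" where
  "sel_mat n J = mat (card J) n (\<lambda>(k, r). if r = nth_elem J k then 1 else 0)"

definition cosel_mat :: "nat \<Rightarrow> nat set \<Rightarrow> 'k::field mat" where
  "cosel_mat n J = mat n (n - card J) (\<lambda>(r, l). if r = nth_elem ({..<n} - J) l then 1 else 0)"

definition graph_mat :: "nat \<Rightarrow> nat set \<Rightarrow> (nat \<Rightarrow> nat \<Rightarrow> 'k::field) \<Rightarrow> 'k mat" where
  "graph_mat n J a = mat n (card J) (\<lambda>(r, k). if r \<in> J then if r = nth_elem J k then 1 else 0 else a r (nth_elem J k))"

definition cograph_mat :: "nat \<Rightarrow> nat set \<Rightarrow> (nat \<Rightarrow> nat \<Rightarrow> 'k::field) \<Rightarrow> 'k mat" where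
  "cograph_mat n J a = mat (n - card J) n
     (\<lambda>(l, s). if s \<in> J then - a (nth_elem ({..<n} - J) l) s else if s = nth_elem ({..<n} - J) l then 1 else 0)"

context
  fixes n e d :: nat and J :: "nat set"
  assumes J: "J \<subseteq> {..<n}" "card J = e" and n: "n = e + d"
begin

lemma fin_J: "finite J" using J(1) finite_subset by blast

lemma card_co: "card ({..<n} - J) = d" using J n by (simp add: card_Diff_subset fin_J)

lemma nth_in_bij: "bij_betw (nth_elem J) {..<e} J" using nth_elem_bij[OF fin_J] J(2) by simp

lemma nth_out_bij: "bij_betw (nth_elem ({..<n} - J)) {..<d} ({..<n} - J)"
  using nth_elem_bij[of "{..<n} - J"] card_co by simp

lemma nth_in: "k < e \<Longrightarrow> nth_elem J k \<in> J" using nth_in_bij by (auto simp: bij_betw_def)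

lemma nth_less: "k < e \<Longrightarrow> nth_elem J k < n" using nth_in J(1) by blast

lemma nth_out: "l < d \<Longrightarrow> nth_elem ({..<n} - J) l \<in> {..<n} - J" using nth_out_bij by (auto simp: bij_betw_def)

lemma nth_in_inj: "k < e \<Longrightarrow> k' < e \<Longrightarrow> nth_elem J k = nth_elem J k' \<longleftrightarrow> k = k'"
  using nth_in_bij by (auto simp: bij_betw_def inj_on_def)

lemma nth_out_inj: "k < d \<Longrightarrow> k' < d \<Longrightarrow> nth_elem ({..<n} - J) k = nth_elem ({..<n} - J) k' \<longleftrightarrow> k = k'"
  using nth_out_bij by (auto simp: bij_betw_def inj_on_def)

lemma split_carrier:
  "sel_mat n J \<in> carrier_mat e n" "cosel_mat n J \<in> carrier_mat n d"
  "graph_mat n J a \<in> carrier_mat n e" "cograph_mat n J a \<in> carrier_mat d n"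
  using J(2) n by (simp_all add: sel_mat_def cosel_mat_def graph_mat_def cograph_mat_def)

lemma sel_mult_index:
  assumes f: "f \<in> carrier_mat n m" and k: "k < e" and s: "s < m"
  shows "(sel_mat n J * f) $$ (k, s) = f $$ (nth_elem J k, s)"
proof -
  have "(sel_mat n J * f) $$ (k, s) = (\<Sum>r<n. (if r = nth_elem J k then f $$ (r, s) else 0))"
    unfolding mult_index[OF split_carrier(1) f k s]
    using k J(2) by (intro sum.cong) (auto simp: sel_mat_def)
  then show ?thesis using nth_less[OF k] by simp
qed

lemma sel_graph: "sel_mat n J * graph_mat n J a = 1\<^sub>m e"
proof (rule eq_matI)
  fix k k' assume "k < dim_row (1\<^sub>m e :: 'a mat)" "k' < dim_col (1\<^sub>m e :: 'a mat)"
  then have k: "k < e" "k' < e" by simp_all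
  show "(sel_mat n J * graph_mat n J a) $$ (k, k') = 1\<^sub>m e $$ (k, k')"
    unfolding sel_mult_index[OF split_carrier(3) k]
    using k nth_in nth_less J(2) nth_in_inj by (simp add: graph_mat_def)
qed (use split_carrier in auto)

lemma cograph_cosel: "cograph_mat n J a * cosel_mat n J = 1\<^sub>m d"
proof (rule eq_matI)
  fix l l' assume "l < dim_row (1\<^sub>m d :: 'a mat)" "l' < dim_col (1\<^sub>m d :: 'a mat)"
  then have l: "l < d" "l' < d" by simp_all
  have "(cograph_mat n J a * cosel_mat n J) $$ (l, l') =
      (\<Sum>s<n. (if s = nth_elem ({..<n} - J) l' then cograph_mat n J a $$ (l, s) else 0))"
    unfolding mult_index[OF split_carrier(4,2) l]
    using l J(2) n by (intro sum.cong) (auto simp: cosel_mat_def)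
  then show "(cograph_mat n J a * cosel_mat n J) $$ (l, l') = 1\<^sub>m d $$ (l, l')"
    using nth_out[OF l(2)] l J(2) n nth_out_inj[OF l(2) l(1)] by (auto simp: cograph_mat_def)
qed (use split_carrier in auto)

lemma split_sum: "(\<Sum>s<n. h s) = (\<Sum>s\<in>J. h s) + (\<Sum>s\<in>{..<n} - J. h s)"
  for h :: "nat \<Rightarrow> 'a::comm_monoid_add"
  using J(1) by (metis add.commute finite_lessThan sum.subset_diff)

lemma cograph_graph: "cograph_mat n J a * graph_mat n J a = 0\<^sub>m d e"
proof (rule eq_matI)
  fix l k assume "l < dim_row (0\<^sub>m d e :: 'a mat)" "k < dim_col (0\<^sub>m d e :: 'a mat)"
  then have l: "l < d" and k: "k < e" by simp_all
  let ?q = "nth_elem ({..<n} - J) l" and ?p = "nth_elem J k"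
  have "(\<Sum>s\<in>J. cograph_mat n J a $$ (l, s) * graph_mat n J a $$ (s, k)) = (\<Sum>s\<in>J. if s = ?p then - a ?q s else 0)"
    using l k J n by (intro sum.cong) (auto simp: cograph_mat_def graph_mat_def)
  also have "\<dots> = - a ?q ?p" using nth_in[OF k] fin_J by simp
  finally have 1: "(\<Sum>s\<in>J. cograph_mat n J a $$ (l, s) * graph_mat n J a $$ (s, k)) = - a ?q ?p" .
  have "(\<Sum>s\<in>{..<n} - J. cograph_mat n J a $$ (l, s) * graph_mat n J a $$ (s, k)) =
      (\<Sum>s\<in>{..<n} - J. if s = ?q then a s ?p else 0)"
    using l k J n by (intro sum.cong) (auto simp: cograph_mat_def graph_mat_def)
  also have "\<dots> = a ?q ?p" using nth_out[OF l] by simp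
  finally have 2: "(\<Sum>s\<in>{..<n} - J. cograph_mat n J a $$ (l, s) * graph_mat n J a $$ (s, k)) = a ?q ?p" .
  show "(cograph_mat n J a * graph_mat n J a) $$ (l, k) = 0\<^sub>m d e $$ (l, k)"
    unfolding mult_index[OF split_carrier(4,3) l k] split_sum 1 2 using l k by simp
qed (use split_carrier in auto)

text \<open>Together with \<open>sel_graph\<close>, \<open>cograph_cosel\<close> and \<open>cograph_graph\<close> this says that \<open>k\<^sup>n\<close> is the direct sum of the graph and of
  the coordinate subspace complementary to \<open>J\<close>, with \<open>sel_mat\<close> and \<open>cosel_mat\<close> splitting the graph and cograph maps.\<close>

lemma graph_sel_cosel_cograph:
  "graph_mat n J a * sel_mat n J + cosel_mat n J * cograph_mat n J a = 1\<^sub>m n"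
proof (rule eq_matI)
  fix r s assume "r < dim_row (1\<^sub>m n :: 'a mat)" "s < dim_col (1\<^sub>m n :: 'a mat)"
  then have r: "r < n" and s: "s < n" by simp_all
  define f where "f t = (if r \<in> J then if r = t then 1 else 0 else a r t)" for t
  have "(graph_mat n J a * sel_mat n J) $$ (r, s) = (\<Sum>k<e. f (nth_elem J k) * (if s = nth_elem J k then 1 else 0))"
    unfolding mult_index[OF split_carrier(3,1) r s]
    using r s J(2) by (intro sum.cong) (auto simp: graph_mat_def sel_mat_def f_def)
  also have "\<dots> = (\<Sum>t\<in>J. f t * (if s = t then 1 else 0))"
    by (rule sum.reindex_bij_betw[OF nth_in_bij])
  also have "\<dots> = (\<Sum>t\<in>J. if s = t then f t else 0)" by (intro sum.cong) auto
  also have "\<dots> = (if s \<in> J then f s else 0)" using fin_J by simp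
  finally have 1: "(graph_mat n J a * sel_mat n J) $$ (r, s) = (if s \<in> J then f s else 0)" .
  define g where "g t = (if s \<in> J then - a t s else if s = t then 1 else 0)" for t
  have "(cosel_mat n J * cograph_mat n J a) $$ (r, s) =
      (\<Sum>l<d. (if r = nth_elem ({..<n} - J) l then 1 else 0) * g (nth_elem ({..<n} - J) l))"
    unfolding mult_index[OF split_carrier(2,4) r s]
    using r s J(2) n by (intro sum.cong) (auto simp: cograph_mat_def cosel_mat_def g_def)
  also have "\<dots> = (\<Sum>t\<in>{..<n} - J. (if r = t then 1 else 0) * g t)"
    by (rule sum.reindex_bij_betw[OF nth_out_bij])
  also have "\<dots> = (\<Sum>t\<in>{..<n} - J. if r = t then g t else 0)" by (intro sum.cong) auto
  also have "\<dots> = (if r \<in> J then 0 else g r)" using r by simp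
  finally have 2: "(cosel_mat n J * cograph_mat n J a) $$ (r, s) = (if r \<in> J then 0 else g r)" .
  have "(graph_mat n J a * sel_mat n J + cosel_mat n J * cograph_mat n J a) $$ (r, s) =
     (if s \<in> J then f s else 0) + (if r \<in> J then 0 else g r)"
    using 1 2 r s carrier_matD[OF mult_carrier_mat[OF split_carrier(2,4), of a]] by (subst index_add_mat(1)) simp_all
  then show "(graph_mat n J a * sel_mat n J + cosel_mat n J * cograph_mat n J a) $$ (r, s) = 1\<^sub>m n $$ (r, s)"
    using r s by (auto simp: f_def g_def)
qed (use split_carrier(1,2) split_carrier(3,4)[of a] in auto)

lemma graph_injective: "mat_injective (graph_mat n J a)"
  by (rule mat_injective_left_inverse[OF split_carrier(3) split_carrier(1) sel_graph])

lemma graph_image: "mat_image (graph_mat n J a) = {w \<in> carrier_vec n. cograph_mat n J a *\<^sub>v w = 0\<^sub>v d}"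
proof (intro equalityI subsetI)
  fix w assume "w \<in> mat_image (graph_mat n J a)"
  then obtain v where v: "v \<in> carrier_vec e" "w = graph_mat n J a *\<^sub>v v" using split_carrier(3)[of a] by auto
  have "cograph_mat n J a *\<^sub>v w = 0\<^sub>m d e *\<^sub>v v"
    unfolding v(2) cograph_graph[of a, symmetric] by (rule assoc_mult_mat_vec[OF split_carrier(4,3) v(1), symmetric])
  then show "w \<in> {w \<in> carrier_vec n. cograph_mat n J a *\<^sub>v w = 0\<^sub>v d}"
    using v mult_mat_vec_carrier[OF split_carrier(3) v(1), of a] by auto
next
  fix w assume "w \<in> {w \<in> carrier_vec n. cograph_mat n J a *\<^sub>v w = 0\<^sub>v d}"
  then have w: "w \<in> carrier_vec n" "cograph_mat n J a *\<^sub>v w = 0\<^sub>v d" by auto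
  have "w = 1\<^sub>m n *\<^sub>v w" using w by simp
  also have "\<dots> = graph_mat n J a * sel_mat n J *\<^sub>v w + cosel_mat n J * cograph_mat n J a *\<^sub>v w"
    unfolding graph_sel_cosel_cograph[of a, symmetric]
    by (rule add_mult_distrib_mat_vec[OF mult_carrier_mat[OF split_carrier(3,1)] mult_carrier_mat[OF split_carrier(2,4)] w(1)])
  also have "graph_mat n J a * sel_mat n J *\<^sub>v w = graph_mat n J a *\<^sub>v (sel_mat n J *\<^sub>v w)"
    by (rule assoc_mult_mat_vec[OF split_carrier(3,1) w(1)])
  also have "cosel_mat n J * cograph_mat n J a *\<^sub>v w = cosel_mat n J *\<^sub>v (cograph_mat n J a *\<^sub>v w)"
    by (rule assoc_mult_mat_vec[OF split_carrier(2,4) w(1)])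
  also have "cosel_mat n J *\<^sub>v (cograph_mat n J a *\<^sub>v w) = 0\<^sub>v n"
    unfolding w(2) using carrier_matD[OF split_carrier(2)]
    by (intro eq_vecI) (auto simp: scalar_prod_def)
  finally have "w = graph_mat n J a *\<^sub>v (sel_mat n J *\<^sub>v w)"
    using mult_mat_vec_carrier[OF split_carrier(3), of "sel_mat n J *\<^sub>v w" a] mult_mat_vec_carrier[OF split_carrier(1) w(1)] by simp
  moreover have "sel_mat n J *\<^sub>v w \<in> carrier_vec (dim_col (graph_mat n J a))"
    using mult_mat_vec_carrier[OF split_carrier(1) w(1)] split_carrier(3)[of a] by simp
  ultimately show "w \<in> mat_image (graph_mat n J a)" by blast
qed

lemma cograph_surjective: fixes a :: "nat \<Rightarrow> nat \<Rightarrow> 'k::field" shows "mat_surjective (cograph_mat n J a)"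
proof
  show "mat_image (cograph_mat n J a) \<subseteq> carrier_vec (dim_row (cograph_mat n J a))"
    by (auto intro!: mult_mat_vec_carrier[OF carrier_matI[OF refl refl]])
  show "carrier_vec (dim_row (cograph_mat n J a)) \<subseteq> mat_image (cograph_mat n J a)"
  proof
    fix v :: "'k vec" assume "v \<in> carrier_vec (dim_row (cograph_mat n J a))"
    then have v: "v \<in> carrier_vec d" using split_carrier(4)[of a] by simp
    have "cograph_mat n J a *\<^sub>v (cosel_mat n J *\<^sub>v v) = v"
      using assoc_mult_mat_vec[OF split_carrier(4,2) v, of a] cograph_cosel[of a] v by simp
    moreover have "cosel_mat n J *\<^sub>v v \<in> carrier_vec (dim_col (cograph_mat n J a))"
      using mult_mat_vec_carrier[OF split_carrier(2) v] split_carrier(4)[of a] by simp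
    ultimately show "v \<in> mat_image (cograph_mat n J a)" by (metis image_eqI)
  qed
qed

text \<open>The rows of the cograph matrix are the linear equations by which the standard charts are defined.\<close>

lemma cograph_kernel_condition:
  assumes w: "w \<in> carrier_vec n"
  shows "cograph_mat n J a *\<^sub>v w = 0\<^sub>v d \<longleftrightarrow> (\<forall>r\<in>{..<n} - J. w $ r = (\<Sum>s\<in>J. a r s * w $ s))"
proof -
  have ind: "(cograph_mat n J a *\<^sub>v w) $ l = w $ nth_elem ({..<n} - J) l - (\<Sum>s\<in>J. a (nth_elem ({..<n} - J) l) s * w $ s)"
    if l: "l < d" for l
  proof -
    let ?q = "nth_elem ({..<n} - J) l"
    have "(cograph_mat n J a *\<^sub>v w) $ l = (\<Sum>s<n. cograph_mat n J a $$ (l, s) * w $ s)"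
      using l w split_carrier(4)[of a] by (auto simp: scalar_prod_def lessThan_atLeast0 intro!: sum.cong)
    also have "\<dots> = (\<Sum>s\<in>J. - (a ?q s * w $ s)) + (\<Sum>s\<in>{..<n} - J. if s = ?q then w $ s else 0)"
      unfolding split_sum using l J n
      by (intro arg_cong2[where f = "(+)"] sum.cong) (auto simp: cograph_mat_def)
    also have "\<dots> = - (\<Sum>s\<in>J. a ?q s * w $ s) + w $ ?q" using nth_out[OF l] by (simp add: sum_negf)
    finally show ?thesis by simp
  qed
  have "cograph_mat n J a *\<^sub>v w = 0\<^sub>v d \<longleftrightarrow> (\<forall>l<d. (cograph_mat n J a *\<^sub>v w) $ l = 0)"
    using split_carrier(4)[of a] by (auto simp: vec_eq_iff)
  also have "\<dots> \<longleftrightarrow> (\<forall>l\<in>{..<d}. w $ nth_elem ({..<n} - J) l = (\<Sum>s\<in>J. a (nth_elem ({..<n} - J) l) s * w $ s))"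
    by (auto simp: ind)
  also have "\<dots> \<longleftrightarrow> (\<forall>r\<in>nth_elem ({..<n} - J) ` {..<d}. w $ r = (\<Sum>s\<in>J. a r s * w $ s))" by simp
  also have "nth_elem ({..<n} - J) ` {..<d} = {..<n} - J" using nth_out_bij by (simp add: bij_betw_def)
  finally show ?thesis .
qed

text \<open>Normalising the basis \<open>f\<close> so that its rows in \<open>J\<close> form an identity matrix leaves the entries of the linear map in
  the remaining rows.\<close>

definition graph_coords :: "'k::field mat \<Rightarrow> nat \<Rightarrow> nat \<Rightarrow> 'k" where
  "graph_coords f r s = (f * minv (sel_mat n J * f)) $$ (r, inv_into {..<e} (nth_elem J) s)"

lemma graph_mat_cong:
  "(\<And>r s. r \<in> {..<n} - J \<Longrightarrow> s \<in> J \<Longrightarrow> a r s = b r s) \<Longrightarrow> graph_mat n J a = graph_mat n J b"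
  unfolding graph_mat_def using J(2) nth_in by (intro cong_mat) auto

lemma graph_mat_entry: "r \<in> {..<n} - J \<Longrightarrow> s \<in> J \<Longrightarrow> graph_mat n J a $$ (r, inv_into {..<e} (nth_elem J) s) = a r s"
proof -
  assume r: "r \<in> {..<n} - J" and s: "s \<in> J"
  have "inv_into {..<e} (nth_elem J) s < e" "nth_elem J (inv_into {..<e} (nth_elem J) s) = s"
    using s nth_in_bij inv_into_into[of s "nth_elem J" "{..<e}"] by (auto simp: bij_betw_def f_inv_into_f)
  then show ?thesis using r J(2) by (simp add: graph_mat_def)
qed

lemma graph_mat_coords:
  assumes f: "f \<in> carrier_mat n e" and det: "det (sel_mat n J * f) \<noteq> 0"
  shows "graph_mat n J (graph_coords f) = f * minv (sel_mat n J * f)"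
    and "f = graph_mat n J (graph_coords f) * (sel_mat n J * f)"
proof -
  let ?B = "minv (sel_mat n J * f)"
  have Pf: "sel_mat n J * f \<in> carrier_mat e e" by (rule mult_carrier_mat[OF split_carrier(1) f])
  note B = minv[OF Pf det]
  have fB: "f * ?B \<in> carrier_mat n e" by (rule mult_carrier_mat[OF f B(1)])
  have sel: "sel_mat n J * (f * ?B) = 1\<^sub>m e" using B(2) assoc_mult_mat[OF split_carrier(1) f B(1)] by simp
  show 1: "graph_mat n J (graph_coords f) = f * ?B"
  proof (rule eq_matI)
    fix r k assume "r < dim_row (f * ?B)" "k < dim_col (f * ?B)"
    then have r: "r < n" and k: "k < e" using carrier_matD[OF fB] by (simp_all only:)
    show "graph_mat n J (graph_coords f) $$ (r, k) = (f * ?B) $$ (r, k)"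
    proof (cases "r \<in> J")
      case True
      then obtain k' where k': "k' < e" "r = nth_elem J k'" using nth_in_bij by (auto simp: bij_betw_def)
      have "(f * ?B) $$ (r, k) = 1\<^sub>m e $$ (k', k)"
        using sel_mult_index[OF fB k'(1) k] sel k'(2) by simp
      then show ?thesis using True r k k' J(2) nth_in_inj[OF k'(1) k] by (simp add: graph_mat_def)
    next
      case False
      have "inv_into {..<e} (nth_elem J) (nth_elem J k) = k"
        using nth_in_bij k by (simp add: bij_betw_def inv_into_f_f)
      then show ?thesis using False r k J(2) by (simp add: graph_mat_def graph_coords_def)
    qed
  qed (use fB J(2) in \<open>auto simp: graph_mat_def\<close>)
  have "f * ?B * (sel_mat n J * f) = f * (?B * (sel_mat n J * f))" by (rule assoc_mult_mat[OF f B(1) Pf])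
  then show "f = graph_mat n J (graph_coords f) * (sel_mat n J * f)" unfolding 1 B(3) using f by simp
qed

lemma det_sel_injective:
  assumes f: "f \<in> carrier_mat n e" and det: "det (sel_mat n J * f) \<noteq> 0"
  shows "mat_injective f"
proof -
  have Pf: "sel_mat n J * f \<in> carrier_mat e e" by (rule mult_carrier_mat[OF split_carrier(1) f])
  show ?thesis
    by (rule mat_injective_left_inverse[OF f mult_carrier_mat[OF minv(1)[OF Pf det] split_carrier(1)]])
       (use minv(3)[OF Pf det] assoc_mult_mat[OF minv(1)[OF Pf det] split_carrier(1) f] in simp)
qed

lemma graph_coords_image:
  assumes f: "f \<in> carrier_mat n e" and det: "det (sel_mat n J * f) \<noteq> 0"
  shows "mat_image (graph_mat n J (graph_coords f)) = mat_image f"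
proof -
  have Pf: "sel_mat n J * f \<in> carrier_mat e e" by (rule mult_carrier_mat[OF split_carrier(1) f])
  show ?thesis
    using mat_image_mult_invertible[OF split_carrier(3) Pf det, of "graph_coords f"]
      graph_mat_coords(2)[OF f det] by simp
qed

text \<open>The graph determines the map: an invertible change of basis between two graph matrices is trivial,
  as both have an identity matrix in the rows from \<open>J\<close>.\<close>

lemma graph_image_inj:
  assumes eq: "mat_image (graph_mat n J a) = mat_image (graph_mat n J b)" and r: "r \<in> {..<n} - J" and s: "s \<in> J"
  shows "a r s = b r s"
proof -
  obtain X where X: "X \<in> carrier_mat e e" "graph_mat n J b = graph_mat n J a * X"
    using mat_image_eq_factor[OF split_carrier(3) graph_injective split_carrier(3) graph_injective eq] by blast
  have "1\<^sub>m e = sel_mat n J * (graph_mat n J a * X)" using sel_graph[of b] X(2) by simp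
  also have "\<dots> = (sel_mat n J * graph_mat n J a) * X" by (rule assoc_mult_mat[OF split_carrier(1,3) X(1), symmetric])
  also have "\<dots> = X" unfolding sel_graph using X(1) by simp
  finally have "graph_mat n J b = graph_mat n J a" using X(2) right_mult_one_mat[OF split_carrier(3), of a] by simp
  then show ?thesis using graph_mat_entry[OF r s, of a] graph_mat_entry[OF r s, of b] by simp
qed

text \<open>The chart of \<open>J\<close> is the nonvanishing locus of a Pluecker coordinate.\<close>

lemma graph_image_det_iff:
  assumes f: "f \<in> carrier_mat n e" "mat_injective f"
  shows "det (sel_mat n J * f) \<noteq> 0 \<longleftrightarrow> (\<exists>a. mat_image f = mat_image (graph_mat n J a))"
proof
  assume "det (sel_mat n J * f) \<noteq> 0"
  from graph_coords_image[OF f(1) this] show "\<exists>a. mat_image f = mat_image (graph_mat n J a)" by metis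
next
  assume "\<exists>a. mat_image f = mat_image (graph_mat n J a)"
  then obtain a where a: "mat_image (graph_mat n J a) = mat_image f" by metis
  obtain X where X: "X \<in> carrier_mat e e" "det X \<noteq> 0" "f = graph_mat n J a * X"
    using mat_image_eq_factor[OF split_carrier(3) graph_injective f a] by blast
  have "sel_mat n J * f = (sel_mat n J * graph_mat n J a) * X"
    unfolding X(3) by (rule assoc_mult_mat[OF split_carrier(1,3) X(1), symmetric])
  then show "det (sel_mat n J * f) \<noteq> 0" unfolding sel_graph using X by simp
qed

end

text \<open>A minimal set \<open>J\<close> of rows on which \<open>f\<close> is still injective consists of independent rows: by minimality, for
  every row in \<open>J\<close> there is a vector that \<open>f\<close> sends to a unit vector on \<open>J\<close>. So the submatrix has
  a right inverse besides being injective, and both dimensions agree.\<close>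

lemma exists_minor:
  fixes f :: "'k::field mat"
  assumes f: "f \<in> carrier_mat n e" and inj: "mat_injective f"
  shows "\<exists>J\<subseteq>{..<n}. card J = e \<and> det (sel_mat n J * f) \<noteq> 0"
proof -
  \<comment> \<open>the sets of rows on which \<open>f\<close> is injective\<close>
  define \<J> where "\<J> = {J. J \<subseteq> {..<n} \<and> (\<forall>w\<in>carrier_vec e. (\<forall>r\<in>J. (f *\<^sub>v w) $ r = 0) \<longrightarrow> w = 0\<^sub>v e)}"
  have "{..<n} \<in> \<J>" unfolding \<J>_def
  proof (intro CollectI conjI ballI impI)
    fix w assume w: "w \<in> carrier_vec e" "\<forall>r\<in>{..<n}. (f *\<^sub>v w) $ r = 0"
    have "f *\<^sub>v w = 0\<^sub>v n" by (rule eq_vecI) (use w f in \<open>auto simp del: index_mult_mat_vec\<close>)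
    then show "w = 0\<^sub>v e" using inj w(1) unfolding mat_injective_iff[OF f] by blast
  qed simp
  then obtain J where J: "J \<in> \<J>" "\<forall>J'. J' \<in> \<J> \<longrightarrow> card J \<le> card J'"
    using ex_has_least_nat[of "\<lambda>J. J \<in> \<J>" "{..<n}" card] by blast
  have Jn: "J \<subseteq> {..<n}" and Jinj: "\<And>w. w \<in> carrier_vec e \<Longrightarrow> (\<forall>r\<in>J. (f *\<^sub>v w) $ r = 0) \<Longrightarrow> w = 0\<^sub>v e"
    using J(1) unfolding \<J>_def by auto
  have fin: "finite J" using Jn finite_subset by blast
  define m where "m = card J"
  have n: "n = m + (n - m)" using card_mono[OF _ Jn] unfolding m_def by simp
  let ?p = "nth_elem J"
  note ctx = Jn m_def[symmetric] n
  let ?A = "sel_mat n J * f"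
  have A: "?A \<in> carrier_mat m e" by (rule mult_carrier_mat[OF split_carrier(1)[OF ctx] f])
  have Aw: "(?A *\<^sub>v w) $ k = (f *\<^sub>v w) $ ?p k" if w: "w \<in> carrier_vec e" and k: "k < m" for w k
  proof -
    have "row ?A k = row f (?p k)"
    proof (rule eq_vecI)
      fix j assume "j < dim_vec (row f (?p k))"
      then have j: "j < e" using f by simp
      have "row ?A k $ j = ?A $$ (k, j)" using j k A by (simp only: index_row(1) carrier_matD)
      also have "\<dots> = f $$ (?p k, j)" by (rule sel_mult_index[OF ctx f k j])
      also have "\<dots> = row f (?p k) $ j" using j nth_less[OF ctx k] f by simp
      finally show "row ?A k $ j = row f (?p k) $ j" .
    qed (simp only: index_row(2) carrier_matD(2)[OF A] carrier_matD(2)[OF f])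
    moreover have "(?A *\<^sub>v w) $ k = row ?A k \<bullet> w" by (rule index_mult_mat_vec) (simp only: carrier_matD(1)[OF A] k)
    ultimately show ?thesis using nth_less[OF ctx k] f by simp
  qed
  \<comment> \<open>dropping row \<open>?p k\<close> destroys injectivity; rescale a vector that shows this\<close>
  have "\<exists>w\<in>carrier_vec e. (f *\<^sub>v w) $ ?p k = 1 \<and> (\<forall>r\<in>J - {?p k}. (f *\<^sub>v w) $ r = 0)" if k: "k < m" for k
  proof -
    have pk: "?p k \<in> J" by (rule nth_in[OF ctx k])
    then have "card (J - {?p k}) < card J" using fin by (intro card_Diff1_less)
    then have "J - {?p k} \<notin> \<J>" using J(2)[rule_format, of "J - {?p k}"] by auto
    then obtain w where w: "w \<in> carrier_vec e" "\<forall>r\<in>J - {?p k}. (f *\<^sub>v w) $ r = 0" "w \<noteq> 0\<^sub>v e"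
      using Jn unfolding \<J>_def by auto
    define c where "c = (f *\<^sub>v w) $ ?p k"
    have c: "c \<noteq> 0" unfolding c_def using Jinj[OF w(1)] w(2,3) by blast
    have sc: "(f *\<^sub>v (inverse c \<cdot>\<^sub>v w)) $ r = inverse c * (f *\<^sub>v w) $ r" if "r < n" for r
      using that w(1) f unfolding mult_mat_vec[OF f w(1)] by simp
    show ?thesis
    proof (intro bexI[of _ "inverse c \<cdot>\<^sub>v w"] conjI ballI)
      show "(f *\<^sub>v (inverse c \<cdot>\<^sub>v w)) $ ?p k = 1" using sc[OF nth_less[OF ctx k]] c unfolding c_def[symmetric] by simp
      show "(f *\<^sub>v (inverse c \<cdot>\<^sub>v w)) $ r = 0" if "r \<in> J - {?p k}" for r
        using sc[of r] w(2) that Jn by auto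
    qed (use w in simp)
  qed
  then obtain W where W: "\<forall>k<m. W k \<in> carrier_vec e \<and> (f *\<^sub>v W k) $ ?p k = 1 \<and> (\<forall>r\<in>J - {?p k}. (f *\<^sub>v W k) $ r = 0)"
    by metis
  \<comment> \<open>these vectors are the columns of a right inverse of the submatrix\<close>
  define B where "B = mat e m (\<lambda>(i, k). W k $ i)"
  have B: "B \<in> carrier_mat e m" unfolding B_def by simp
  have AB: "?A * B = 1\<^sub>m m"
  proof (rule eq_matI)
    fix k k' assume "k < dim_row (1\<^sub>m m :: 'k mat)" "k' < dim_col (1\<^sub>m m :: 'k mat)"
    then have k: "k < m" "k' < m" by simp_all
    have "col B k' = W k'" using W k(2) by (intro eq_vecI) (auto simp: B_def)
    moreover have "(?A * B) $$ (k, k') = row ?A k \<bullet> col B k'"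
      by (rule index_mult_mat(1)) (simp_all only: carrier_matD(1)[OF A] carrier_matD(2)[OF B] k)
    moreover have "(?A *\<^sub>v W k') $ k = row ?A k \<bullet> W k'"
      by (rule index_mult_mat_vec) (simp only: carrier_matD(1)[OF A] k)
    ultimately have "(?A * B) $$ (k, k') = (?A *\<^sub>v W k') $ k" by simp
    also have "\<dots> = (f *\<^sub>v W k') $ ?p k" by (rule Aw) (use W k in auto)
    also have "\<dots> = (if k = k' then 1 else 0)"
      using W[rule_format, OF k(2)] nth_in[OF ctx k(1)] nth_in_inj[OF ctx k] by auto
    finally show "(?A * B) $$ (k, k') = 1\<^sub>m m $$ (k, k')" using k by simp
  qed (use A B in auto)
  have "mat_injective ?A" unfolding mat_injective_iff[OF A]
  proof (intro ballI impI)
    fix w assume w: "w \<in> carrier_vec e" "?A *\<^sub>v w = 0\<^sub>v m"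
    show "w = 0\<^sub>v e"
    proof (rule Jinj[OF w(1)], rule ballI)
      fix r assume "r \<in> J"
      then obtain k where k: "k < m" "r = ?p k" using nth_in_bij[OF ctx] by (auto simp: bij_betw_def)
      show "(f *\<^sub>v w) $ r = 0" using Aw[OF w(1) k(1)] w(2) k by simp
    qed
  qed
  then have "e \<le> m" by (rule mat_injective_dim_le[OF A])
  moreover have "m \<le> e" by (rule mat_injective_dim_le[OF B mat_injective_left_inverse[OF B A AB]])
  ultimately have "m = e" by simp
  then have "det ?A \<noteq> 0" using inverse_mat_det[of ?A e B] A B AB by simp
  then show ?thesis using Jn \<open>m = e\<close> unfolding m_def by blast
qed

section \<open>Matrices of regular functions\<close>

text \<open>A matrix whose entries are regular functions on \<open>W\<close>.\<close>

definition reg_mat :: "('z, 'k::field) kspace \<Rightarrow> 'z set \<Rightarrow> nat \<Rightarrow> nat \<Rightarrow> ('z \<Rightarrow> 'k mat) \<Rightarrow> bool" where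
  "reg_mat Z W m n F \<longleftrightarrow> (\<forall>z\<in>W. F z \<in> carrier_mat m n) \<and> (\<forall>r<m. \<forall>s<n. (\<lambda>z. F z $$ (r, s)) \<in> reg Z W)"

lemma reg_matI:
  "(\<And>z. z \<in> W \<Longrightarrow> F z \<in> carrier_mat m n) \<Longrightarrow> (\<And>r s. r < m \<Longrightarrow> s < n \<Longrightarrow> (\<lambda>z. F z $$ (r, s)) \<in> reg Z W) \<Longrightarrow>
   reg_mat Z W m n F"
  unfolding reg_mat_def by simp

lemma reg_matD:
  assumes "reg_mat Z W m n F"
  shows "z \<in> W \<Longrightarrow> F z \<in> carrier_mat m n" "r < m \<Longrightarrow> s < n \<Longrightarrow> (\<lambda>z. F z $$ (r, s)) \<in> reg Z W"
  using assms unfolding reg_mat_def by simp_all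

lemma reg_mat_restrict:
  assumes Z: "space_with_functions Z" and W: "openin (zar Z) W" "openin (zar Z) V" "V \<subseteq> W" and F: "reg_mat Z W m n F"
  shows "reg_mat Z V m n F"
proof (rule reg_matI)
  show "F z \<in> carrier_mat m n" if "z \<in> V" for z using reg_matD(1)[OF F] that W(3) by blast
  show "(\<lambda>z. F z $$ (r, s)) \<in> reg Z V" if "r < m" "s < n" for r s
    by (rule swf_restrict[OF Z W(1) reg_matD(2)[OF F that] W(2,3)])
qed

lemma reg_mat_const:
  assumes Z: "space_with_functions Z" and W: "openin (zar Z) W" and A: "A \<in> carrier_mat m n"
  shows "reg_mat Z W m n (\<lambda>z. A)"
  by (rule reg_matI) (rule A, rule swf_const[OF Z W])

lemma reg_mat_mult:
  assumes Z: "space_with_functions Z" and W: "openin (zar Z) W"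
    and F: "reg_mat Z W m n F" and G: "reg_mat Z W n l G"
  shows "reg_mat Z W m l (\<lambda>z. F z * G z)"
proof (rule reg_matI)
  show "F z * G z \<in> carrier_mat m l" if "z \<in> W" for z
    by (rule mult_carrier_mat[OF reg_matD(1)[OF F that] reg_matD(1)[OF G that]])
  fix r s assume rs: "r < m" "s < l"
  have "(\<lambda>z. \<Sum>k<n. F z $$ (r, k) * G z $$ (k, s)) \<in> reg Z W"
    by (intro swf_sum[OF Z W] swf_mult[OF Z W] reg_matD(2)[OF F] reg_matD(2)[OF G] rs) simp_all
  then show "(\<lambda>z. (F z * G z) $$ (r, s)) \<in> reg Z W"
    by (rule swf_cong[OF Z W]) (use mult_index[OF reg_matD(1)[OF F] reg_matD(1)[OF G] rs] in simp)
qed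

lemma reg_det:
  assumes Z: "space_with_functions Z" and W: "openin (zar Z) W" and F: "reg_mat Z W n n F"
  shows "(\<lambda>z. det (F z)) \<in> reg Z W"
proof -
  have "(\<lambda>z. \<Sum>p\<in>{p. p permutes {0..<n}}. signof p * (\<Prod>i\<in>{0..<n}. F z $$ (i, p i))) \<in> reg Z W"
  proof (intro swf_sum[OF Z W] swf_mult[OF Z W] swf_prod[OF Z W] swf_const[OF Z W] reg_matD(2)[OF F])
    fix p i assume "p \<in> {p. p permutes {0..<n}}" "i \<in> {0..<n}"
    then show "i < n" "p i < n" using permutes_in_image[of p "{0..<n}" i] by auto
  qed
  then show ?thesis
    by (rule swf_cong[OF Z W]) (use det_def'[OF reg_matD(1)[OF F]] in simp)
qed

text \<open>Entries of the adjugate matrix are signed minors.\<close>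

lemma reg_minv:
  assumes Z: "space_with_functions Z" and W: "openin (zar Z) W" and F: "reg_mat Z W n n F"
    and d: "\<And>z. z \<in> W \<Longrightarrow> det (F z) \<noteq> 0"
  shows "reg_mat Z W n n (\<lambda>z. minv (F z))"
proof (rule reg_matI)
  show "minv (F z) \<in> carrier_mat n n" if "z \<in> W" for z by (rule minv(1)[OF reg_matD(1)[OF F that] d[OF that]])
  fix r s assume rs: "r < n" "s < n"
  \<comment> \<open>row \<open>s\<close> and column \<open>r\<close> are deleted for the entry at \<open>(r, s)\<close>, as the adjugate is transposed\<close>
  have del: "reg_mat Z W (n - 1) (n - 1) (\<lambda>z. mat_delete (F z) s r)"
  proof (rule reg_matI)
    show "mat_delete (F z) s r \<in> carrier_mat (n - 1) (n - 1)" if "z \<in> W" for z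
      using reg_matD(1)[OF F that] by (simp add: mat_delete_def)
    fix i j assume ij: "i < n - 1" "j < n - 1"
    have "(\<lambda>z. F z $$ (if i < s then i else Suc i, if j < r then j else Suc j)) \<in> reg Z W"
      by (rule reg_matD(2)[OF F]) (use ij in auto)
    then show "(\<lambda>z. mat_delete (F z) s r $$ (i, j)) \<in> reg Z W"
    proof (rule swf_cong[OF Z W])
      fix z assume "z \<in> W"
      from carrier_matD[OF reg_matD(1)[OF F this]] ij
      show "F z $$ (if i < s then i else Suc i, if j < r then j else Suc j) = mat_delete (F z) s r $$ (i, j)"
        by (simp add: mat_delete_def)
    qed
  qed
  have "(\<lambda>z. inverse (det (F z)) * ((- 1) ^ (s + r) * det (mat_delete (F z) s r))) \<in> reg Z W"
    by (intro swf_mult[OF Z W] swf_inverse[OF Z W] reg_det[OF Z W F] reg_det[OF Z W del] swf_const[OF Z W] d)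
  then show "(\<lambda>z. minv (F z) $$ (r, s)) \<in> reg Z W"
  proof (rule swf_cong[OF Z W])
    fix z assume "z \<in> W"
    from carrier_matD[OF reg_matD(1)[OF F this]] rs
    show "inverse (det (F z)) * ((- 1) ^ (s + r) * det (mat_delete (F z) s r)) = minv (F z) $$ (r, s)"
      by (simp add: minv_def adj_mat_def cofactor_def)
  qed
qed

lemma openin_mat_differ:
  assumes Z: "space_with_functions Z" and W: "openin (zar Z) W"
    and F: "reg_mat Z W m n F" and G: "reg_mat Z W m n G"
  shows "openin (zar Z) {z \<in> W. F z \<noteq> G z}"
proof -
  have "{z \<in> W. F z \<noteq> G z} = (\<Union>r\<in>{..<m}. \<Union>s\<in>{..<n}. {z \<in> W. F z $$ (r, s) + - (G z $$ (r, s)) \<noteq> 0})"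
  proof (intro equalityI subsetI)
    fix z assume z: "z \<in> {z \<in> W. F z \<noteq> G z}"
    then have "F z \<in> carrier_mat m n" "G z \<in> carrier_mat m n" using reg_matD(1)[OF F] reg_matD(1)[OF G] by auto
    then obtain r s where "r < m" "s < n" "F z $$ (r, s) \<noteq> G z $$ (r, s)"
      using z eq_matI[of "G z" "F z"] by auto
    then show "z \<in> (\<Union>r\<in>{..<m}. \<Union>s\<in>{..<n}. {z \<in> W. F z $$ (r, s) + - (G z $$ (r, s)) \<noteq> 0})" using z by auto
  qed auto
  moreover have "openin (zar Z) {z \<in> W. F z $$ (r, s) + - (G z $$ (r, s)) \<noteq> 0}" if "r < m" "s < n" for r s
    by (rule swf_nonzero[OF Z W swf_add[OF Z W reg_matD(2)[OF F that] swf_uminus[OF Z W reg_matD(2)[OF G that]]]])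
  ultimately show ?thesis by (auto intro!: openin_Union)
qed

lemma reg_mat_compose:
  assumes \<phi>: "is_morphism Z Y \<phi>" and W: "openin (zar Y) W" and F: "reg_mat Y W m n F"
  shows "reg_mat Z {z \<in> pts Z. \<phi> z \<in> W} m n (\<lambda>z. F (\<phi> z))"
  by (rule reg_matI) (use reg_matD(1)[OF F] is_morphismD_reg[OF \<phi> W reg_matD(2)[OF F]] in simp_all)

lemma reg_mat_into_induced:
  assumes "openin (zar Y) W" "reg_mat Y W m n F" "W' \<subseteq> W"
  shows "reg_mat (induced Y S) W' m n F"
proof (rule reg_matI)
  show "F z \<in> carrier_mat m n" if "z \<in> W'" for z using reg_matD(1)[OF assms(2)] that assms(3) by blast
  show "(\<lambda>z. F z $$ (r, s)) \<in> reg (induced Y S) W'" if "r < m" "s < n" for r s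
    by (rule reg_into_induced[OF assms(1) reg_matD(2)[OF assms(2) that] assms(3)])
qed

lemma is_morphism_cong:
  assumes X: "space_with_functions X" and \<phi>: "is_morphism X Y \<phi>" and eq: "\<And>x. x \<in> pts X \<Longrightarrow> \<phi> x = \<psi> x"
  shows "is_morphism X Y \<psi>"
proof (rule is_morphismI)
  have pre: "{x \<in> pts X. \<phi> x \<in> V} = {x \<in> pts X. \<psi> x \<in> V}" for V using eq by auto
  show "\<psi> x \<in> pts Y" if "x \<in> pts X" for x using is_morphismD_pts[OF \<phi> that] eq[OF that] by simp
  show o: "openin (zar X) {x \<in> pts X. \<psi> x \<in> V}" if "openin (zar Y) V" for V
    using is_morphismD_open[OF \<phi> that] unfolding pre .
  show "(\<lambda>x. h (\<psi> x)) \<in> reg X {x \<in> pts X. \<psi> x \<in> V}" if V: "openin (zar Y) V" "h \<in> reg Y V" for V h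
    using is_morphismD_reg[OF \<phi> V] unfolding pre by (rule swf_cong[OF X o[OF V(1)]]) (simp add: eq)
qed

section \<open>Products of Grassmannians\<close>

text \<open>The inverse of the chart map; it is meaningful on \<open>chart_domain V n J\<close> only.\<close>

definition chart_coords :: "'v set \<Rightarrow> ('v \<Rightarrow> nat) \<Rightarrow> ('v \<Rightarrow> nat set) \<Rightarrow> ('v \<Rightarrow> 'k::field vec set) \<Rightarrow> 'v \<times> nat \<times> nat \<Rightarrow> 'k" where
  "chart_coords V n J U = (SOME a. a \<in> chart_index V n J \<rightarrow>\<^sub>E UNIV \<and> chart V n J a = U)"

definition chart_domain :: "'v set \<Rightarrow> ('v \<Rightarrow> nat) \<Rightarrow> ('v \<Rightarrow> nat set) \<Rightarrow> ('v \<Rightarrow> 'k::field vec set) set" where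
  "chart_domain V n J = chart V n J ` (chart_index V n J \<rightarrow>\<^sub>E UNIV)"

definition chart_graph :: "('v \<Rightarrow> nat) \<Rightarrow> ('v \<Rightarrow> nat set) \<Rightarrow> ('v \<times> nat \<times> nat \<Rightarrow> 'k::field) \<Rightarrow> 'v \<Rightarrow> 'k mat" where
  "chart_graph n J a i = graph_mat (n i) (J i) (\<lambda>r s. a (i, r, s))"

definition chart_cograph :: "('v \<Rightarrow> nat) \<Rightarrow> ('v \<Rightarrow> nat set) \<Rightarrow> ('v \<times> nat \<times> nat \<Rightarrow> 'k::field) \<Rightarrow> 'v \<Rightarrow> 'k mat" where
  "chart_cograph n J a i = cograph_mat (n i) (J i) (\<lambda>r s. a (i, r, s))"

abbreviation mat_images :: "'v set \<Rightarrow> ('v \<Rightarrow> 'k::field mat) \<Rightarrow> 'v \<Rightarrow> 'k vec set" where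
  "mat_images V f \<equiv> (\<lambda>i\<in>V. mat_image (f i))"

lemma swf_affine_space: "space_with_functions (affine_space I)"
  unfolding affine_space_def by (rule swf_coord_space)

lemma pts_affine_space [simp]: "pts (affine_space I) = I \<rightarrow>\<^sub>E UNIV"
  unfolding affine_space_def by simp

lemma affine_space_coord: "k \<in> I \<Longrightarrow> openin (zar (affine_space I)) W \<Longrightarrow> (\<lambda>a. a k) \<in> reg (affine_space I) W"
  unfolding affine_space_def by (intro polynomial_reg polynomial_functions.coord) auto

lemma is_morphism_affine_space:
  assumes "space_with_functions Z" "\<And>z. z \<in> pts Z \<Longrightarrow> \<phi> z \<in> I \<rightarrow>\<^sub>E UNIV"
    and "\<And>k. k \<in> I \<Longrightarrow> (\<lambda>z. \<phi> z k) \<in> reg Z (pts Z)"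
  shows "is_morphism Z (affine_space I) \<phi>"
  unfolding affine_space_def by (rule is_morphism_coord_space[OF assms(1,2)]) (use assms(3) in auto)

lemma reg_mat_graph:
  assumes Z: "space_with_functions Z" and W: "openin (zar Z) W"
    and J: "J \<subseteq> {..<n}" "card J = e" "n = e + d"
    and a: "\<And>r s. r \<in> {..<n} - J \<Longrightarrow> s \<in> J \<Longrightarrow> (\<lambda>z. a z r s) \<in> reg Z W"
  shows "reg_mat Z W n e (\<lambda>z. graph_mat n J (a z))" "reg_mat Z W d n (\<lambda>z. cograph_mat n J (a z))"
proof -
  show "reg_mat Z W n e (\<lambda>z. graph_mat n J (a z))"
  proof (rule reg_matI)
    show "graph_mat n J (a z) \<in> carrier_mat n e" for z by (rule split_carrier(3)[OF J])
    fix r k assume rk: "r < n" "k < e"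
    show "(\<lambda>z. graph_mat n J (a z) $$ (r, k)) \<in> reg Z W"
    proof (cases "r \<in> J")
      case True
      then have "(\<lambda>z. graph_mat n J (a z) $$ (r, k)) = (\<lambda>z. if r = nth_elem J k then 1 else 0)"
        using rk J(2) by (simp add: graph_mat_def)
      then show ?thesis using swf_const[OF Z W] by simp
    next
      case False
      then have "(\<lambda>z. graph_mat n J (a z) $$ (r, k)) = (\<lambda>z. a z r (nth_elem J k))"
        using rk J(2) by (simp add: graph_mat_def)
      then show ?thesis using a[of r "nth_elem J k"] False rk nth_in[OF J] by simp
    qed
  qed
  show "reg_mat Z W d n (\<lambda>z. cograph_mat n J (a z))"
  proof (rule reg_matI)
    show "cograph_mat n J (a z) \<in> carrier_mat d n" for z by (rule split_carrier(4)[OF J])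
    fix l s assume ls: "l < d" "s < n"
    let ?q = "nth_elem ({..<n} - J) l"
    show "(\<lambda>z. cograph_mat n J (a z) $$ (l, s)) \<in> reg Z W"
    proof (cases "s \<in> J")
      case False
      then have "(\<lambda>z. cograph_mat n J (a z) $$ (l, s)) = (\<lambda>z. if s = ?q then 1 else 0)"
        using ls J(2,3) by (simp add: cograph_mat_def)
      then show ?thesis using swf_const[OF Z W] by simp
    next
      case True
      then have "(\<lambda>z. cograph_mat n J (a z) $$ (l, s)) = (\<lambda>z. - a z ?q s)"
        using ls J(2,3) by (simp add: cograph_mat_def)
      then show ?thesis using swf_uminus[OF Z W a[of ?q s]] True nth_out[OF J ls(1)] by simp
    qed
  qed
qed

locale grassmannian_charts =
  fixes V :: "'v set" and e d :: "'v \<Rightarrow> nat"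
  assumes finV: "finite V"
begin

abbreviation (input) "n \<equiv> \<lambda>i. e i + d i"
abbreviation (input) "valid J \<equiv> \<forall>i\<in>V. J i \<subseteq> {..<n i} \<and> card (J i) = e i"

lemma validD: "valid J \<Longrightarrow> i \<in> V \<Longrightarrow> J i \<subseteq> {..<n i}" "valid J \<Longrightarrow> i \<in> V \<Longrightarrow> card (J i) = e i"
  by simp_all

text \<open>The defining equations of the chart say that a vector lies in the kernel of the cograph matrix, which is the image of
  the graph matrix.\<close>

lemma chart_eq:
  assumes J: "valid J"
  shows "chart V n J a = mat_images V (chart_graph n J a)"
  unfolding chart_def
proof (rule restrict_ext)
  fix i assume i: "i \<in> V"
  note Ji = validD[OF J i] refl
  show "{w \<in> carrier_vec (n i). \<forall>r\<in>{..<n i} - J i. w $ r = (\<Sum>s\<in>J i. a (i, r, s) * w $ s)} =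
      mat_image (chart_graph n J a i)"
    unfolding chart_graph_def graph_image[OF Ji] using cograph_kernel_condition[OF Ji] by auto
qed

lemma chart_graph_carrier:
  assumes J: "valid J" and i: "i \<in> V"
  shows "chart_graph n J a i \<in> carrier_mat (n i) (e i)" "mat_injective (chart_graph n J a i)"
  unfolding chart_graph_def
  by (rule split_carrier(3)[OF validD[OF J i] refl], rule graph_injective[OF validD[OF J i] refl])

lemma mat_images_in:
  assumes "\<And>i. i \<in> V \<Longrightarrow> f i \<in> carrier_mat (n i) (e i)" "\<And>i. i \<in> V \<Longrightarrow> mat_injective (f i)"
  shows "mat_images V f \<in> grassmannian_prod V e n"
  unfolding grassmannian_prod_def grassmannian_eq_mat_image using assms by auto

lemma grassmannian_prodE:
  assumes "U \<in> grassmannian_prod V e n"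
  obtains f where "\<And>i. i \<in> V \<Longrightarrow> f i \<in> carrier_mat (n i) (e i)" "\<And>i. i \<in> V \<Longrightarrow> mat_injective (f i)" "U = mat_images V f"
proof -
  have "\<forall>i\<in>V. \<exists>f. f \<in> carrier_mat (n i) (e i) \<and> mat_injective f \<and> U i = mat_image f"
    using assms unfolding grassmannian_prod_def grassmannian_eq_mat_image by (auto simp: PiE_iff)
  then obtain f where f: "\<forall>i\<in>V. f i \<in> carrier_mat (n i) (e i) \<and> mat_injective (f i) \<and> U i = mat_image (f i)"
    by (rule bchoice[THEN exE])
  have "U = mat_images V f"
    using assms f unfolding grassmannian_prod_def by (intro extensionalityI[of _ V]) (auto simp: PiE_iff)
  then show ?thesis using f by (intro that[of f]) simp_all
qed

lemma chart_in: "valid J \<Longrightarrow> chart V n J a \<in> grassmannian_prod V e n"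
  unfolding chart_eq by (rule mat_images_in) (simp_all add: chart_graph_carrier)

abbreviation (input) "charts \<equiv> {(affine_space (chart_index V n J), chart V n J) | J. valid J}"

lemma swf_Gr: "space_with_functions (grassmannian_prod_variety V e n)"
  unfolding grassmannian_prod_variety_def by (rule swf_glued) (auto simp: swf_affine_space)

lemma pts_Gr: "pts (grassmannian_prod_variety V e n :: ('v \<Rightarrow> 'k vec set, 'k::field) kspace) = grassmannian_prod V e n"
  unfolding grassmannian_prod_variety_def by (rule pts_glued) (use chart_in in auto)

lemma is_morphism_Gr_chart:
  "valid J \<Longrightarrow> is_morphism (affine_space (chart_index V n J)) (grassmannian_prod_variety V e n) (chart V n J)"
  unfolding grassmannian_prod_variety_def by (rule is_morphism_chart) (use chart_in in auto)

lemma chart_inj: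
  assumes J: "valid J" and a: "a \<in> chart_index V n J \<rightarrow>\<^sub>E UNIV" and b: "b \<in> chart_index V n J \<rightarrow>\<^sub>E UNIV"
    and eq: "chart V n J a = chart V n J b"
  shows "a = b"
proof (rule PiE_ext[OF a b])
  fix k assume "k \<in> chart_index V n J"
  then obtain i r s where k: "k = (i, r, s)" "i \<in> V" "r \<in> {..<n i} - J i" "s \<in> J i" unfolding chart_index_def by auto
  have "mat_image (chart_graph n J a i) = mat_image (chart_graph n J b i)"
    using fun_cong[OF eq, of i] k(2) unfolding chart_eq[OF J] by simp
  from graph_image_inj[OF validD[OF J k(2)] refl this[unfolded chart_graph_def] k(3,4)]
  show "a k = b k" unfolding k(1) .
qed

lemma chart_coords_chart:
  assumes J: "valid J" and a: "a \<in> chart_index V n J \<rightarrow>\<^sub>E UNIV"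
  shows "chart_coords V n J (chart V n J a) = a"
  unfolding chart_coords_def
  by (rule some_equality) (use chart_inj[OF J _ a] a in auto)

lemma chart_chart_coords:
  assumes J: "valid J" and U: "U \<in> chart_domain V n J"
  shows "chart V n J (chart_coords V n J U) = U" "chart_coords V n J U \<in> chart_index V n J \<rightarrow>\<^sub>E UNIV"
proof -
  obtain a where a: "U = chart V n J a" "a \<in> chart_index V n J \<rightarrow>\<^sub>E UNIV"
    using U unfolding chart_domain_def by (rule imageE)
  from chart_coords_chart[OF J a(2)] show "chart V n J (chart_coords V n J U) = U" unfolding a(1) by simp
  from chart_coords_chart[OF J a(2)] a(2) show "chart_coords V n J U \<in> chart_index V n J \<rightarrow>\<^sub>E UNIV" unfolding a(1) by simp
qed

lemma mat_images_coords:
  assumes J: "valid J" and f: "\<And>i. i \<in> V \<Longrightarrow> f i \<in> carrier_mat (n i) (e i)"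
    and det: "\<And>i. i \<in> V \<Longrightarrow> det (sel_mat (n i) (J i) * f i) \<noteq> 0"
  shows "mat_images V f \<in> chart_domain V n J"
    and "chart_coords V n J (mat_images V f) = (\<lambda>(i, r, s)\<in>chart_index V n J. graph_coords (n i) (e i) (J i) (f i) r s)"
proof -
  let ?a = "\<lambda>(i, r, s)\<in>chart_index V n J. graph_coords (n i) (e i) (J i) (f i) r s"
  have a: "?a \<in> chart_index V n J \<rightarrow>\<^sub>E UNIV" by auto
  have c: "chart V n J ?a = mat_images V f"
    unfolding chart_eq[OF J]
  proof (rule restrict_ext)
    fix i assume i: "i \<in> V"
    note Ji = validD[OF J i] refl
    have "chart_graph n J ?a i = graph_mat (n i) (J i) (graph_coords (n i) (e i) (J i) (f i))"
      unfolding chart_graph_def by (rule graph_mat_cong[OF Ji]) (use i in \<open>simp add: chart_index_def\<close>)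
    then show "mat_image (chart_graph n J ?a i) = mat_image (f i)"
      using graph_coords_image[OF Ji f[OF i] det[OF i]] by simp
  qed
  show "mat_images V f \<in> chart_domain V n J" unfolding chart_domain_def c[symmetric] by (rule imageI[OF a])
  show "chart_coords V n J (mat_images V f) = ?a" using chart_coords_chart[OF J a] unfolding c .
qed

lemma chart_domain_det_iff:
  assumes J: "valid J" and f: "\<And>i. i \<in> V \<Longrightarrow> f i \<in> carrier_mat (n i) (e i)"
    and inj: "\<And>i. i \<in> V \<Longrightarrow> mat_injective (f i)"
  shows "mat_images V f \<in> chart_domain V n J \<longleftrightarrow> (\<Prod>i\<in>V. det (sel_mat (n i) (J i) * f i)) \<noteq> 0"
proof
  assume "mat_images V f \<in> chart_domain V n J"
  then obtain a where a: "mat_images V f = chart V n J a" unfolding chart_domain_def by blast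
  have "det (sel_mat (n i) (J i) * f i) \<noteq> 0" if i: "i \<in> V" for i
  proof -
    have "mat_image (f i) = mat_image (chart_graph n J a i)"
      using fun_cong[OF a, of i] i unfolding chart_eq[OF J] by simp
    then show ?thesis unfolding chart_graph_def
      by (intro iffD2[OF graph_image_det_iff[OF validD[OF J i] refl f[OF i] inj[OF i]]] exI)
  qed
  then show "(\<Prod>i\<in>V. det (sel_mat (n i) (J i) * f i)) \<noteq> 0" using finV by simp
next
  assume "(\<Prod>i\<in>V. det (sel_mat (n i) (J i) * f i)) \<noteq> 0"
  then show "mat_images V f \<in> chart_domain V n J" by (intro mat_images_coords[OF J f]) (use finV in simp_all)
qed

lemma exists_chart:
  assumes f: "\<And>i. i \<in> V \<Longrightarrow> f i \<in> carrier_mat (n i) (e i)" and inj: "\<And>i. i \<in> V \<Longrightarrow> mat_injective (f i)"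
  shows "\<exists>J. valid J \<and> mat_images V f \<in> chart_domain V n J"
proof -
  have "\<forall>i\<in>V. \<exists>J. J \<subseteq> {..<n i} \<and> card J = e i \<and> det (sel_mat (n i) J * f i) \<noteq> 0"
    using exists_minor[OF f inj] by blast
  then obtain J where J: "\<forall>i\<in>V. J i \<subseteq> {..<n i} \<and> card (J i) = e i \<and> det (sel_mat (n i) (J i) * f i) \<noteq> 0"
    by (rule bchoice[THEN exE])
  then have "valid J" by simp
  then show ?thesis using mat_images_coords(1)[OF _ f, of J] J by blast
qed

lemma grassmannian_prod_charts: "U \<in> grassmannian_prod V e n \<Longrightarrow> \<exists>J. valid J \<and> U \<in> chart_domain V n J"
  by (erule grassmannian_prodE) (simp add: exists_chart)

context
  fixes Z :: "('z, 'k::field) kspace" and F :: "'z \<Rightarrow> 'v \<Rightarrow> 'k mat"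
  assumes Z: "space_with_functions Z"
    and F: "\<And>i. i \<in> V \<Longrightarrow> reg_mat Z (pts Z) (n i) (e i) (\<lambda>z. F z i)"
    and inj: "\<And>z i. z \<in> pts Z \<Longrightarrow> i \<in> V \<Longrightarrow> mat_injective (F z i)"
begin

text \<open>The locus in the base of a family of subspaces where the family meets the chart of \<open>J\<close> is the
  nonvanishing locus of a product of minors.\<close>

lemma family_domain:
  assumes J: "valid J"
  shows "openin (zar Z) {z \<in> pts Z. mat_images V (F z) \<in> chart_domain V n J}"
    and "z \<in> pts Z \<Longrightarrow> mat_images V (F z) \<in> chart_domain V n J \<Longrightarrow> i \<in> V \<Longrightarrow> det (sel_mat (n i) (J i) * F z i) \<noteq> 0"
proof -
  have "reg_mat Z (pts Z) (e i) (e i) (\<lambda>z. sel_mat (n i) (J i) * F z i)" if i: "i \<in> V" for i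
    by (rule reg_mat_mult[OF Z openin_topspace reg_mat_const[OF Z openin_topspace split_carrier(1)[OF validD[OF J i] refl]] F[OF i]])
  then have "(\<lambda>z. \<Prod>i\<in>V. det (sel_mat (n i) (J i) * F z i)) \<in> reg Z (pts Z)"
    by (intro swf_prod[OF Z openin_topspace] reg_det[OF Z openin_topspace])
  from swf_nonzero[OF Z openin_topspace this]
  have o: "openin (zar Z) {z \<in> pts Z. (\<Prod>i\<in>V. det (sel_mat (n i) (J i) * F z i)) \<noteq> 0}" .
  have iff: "mat_images V (F z) \<in> chart_domain V n J \<longleftrightarrow> (\<Prod>i\<in>V. det (sel_mat (n i) (J i) * F z i)) \<noteq> 0"
    if "z \<in> pts Z" for z
    by (rule chart_domain_det_iff[OF J reg_matD(1)[OF F that] inj[OF that]])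
  then have "{z \<in> pts Z. mat_images V (F z) \<in> chart_domain V n J} =
      {z \<in> pts Z. (\<Prod>i\<in>V. det (sel_mat (n i) (J i) * F z i)) \<noteq> 0}" by auto
  then show "openin (zar Z) {z \<in> pts Z. mat_images V (F z) \<in> chart_domain V n J}" using o by simp
  show "z \<in> pts Z \<Longrightarrow> mat_images V (F z) \<in> chart_domain V n J \<Longrightarrow> i \<in> V \<Longrightarrow> det (sel_mat (n i) (J i) * F z i) \<noteq> 0"
    using iff[of z] finV by auto
qed

text \<open>The coordinates are the entries of \<open>F z * minv (sel_mat n J * F z)\<close>.\<close>

lemma family_coords:
  assumes J: "valid J" and k: "k \<in> chart_index V n J"
  shows "(\<lambda>z. chart_coords V n J (mat_images V (F z)) k) \<in> reg Z {z \<in> pts Z. mat_images V (F z) \<in> chart_domain V n J}"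
proof -
  obtain i r s where irs: "k = (i, r, s)" "i \<in> V" "r \<in> {..<n i} - J i" "s \<in> J i" using k unfolding chart_index_def by auto
  let ?W = "{z \<in> pts Z. mat_images V (F z) \<in> chart_domain V n J}"
  have W: "openin (zar Z) ?W" by (rule family_domain(1)[OF J])
  note Ji = validD[OF J irs(2)] refl
  have FW: "reg_mat Z ?W (n i) (e i) (\<lambda>z. F z i)"
    by (rule reg_mat_restrict[OF Z openin_topspace W _ F[OF irs(2)]]) blast
  have PF: "reg_mat Z ?W (e i) (e i) (\<lambda>z. sel_mat (n i) (J i) * F z i)"
    by (rule reg_mat_mult[OF Z W reg_mat_const[OF Z W split_carrier(1)[OF Ji]] FW])
  have inv: "reg_mat Z ?W (e i) (e i) (\<lambda>z. minv (sel_mat (n i) (J i) * F z i))"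
    by (rule reg_minv[OF Z W PF]) (use family_domain(2)[OF J _ _ irs(2)] in blast)
  have "inv_into {..<e i} (nth_elem (J i)) s < e i"
    using irs(4) nth_in_bij[OF Ji] inv_into_into[of s "nth_elem (J i)" "{..<e i}"] by (auto simp: bij_betw_def)
  then have "(\<lambda>z. (F z i * minv (sel_mat (n i) (J i) * F z i)) $$ (r, inv_into {..<e i} (nth_elem (J i)) s)) \<in> reg Z ?W"
    using irs(3) by (intro reg_matD(2)[OF reg_mat_mult[OF Z W FW inv]]) simp_all
  then show ?thesis
  proof (rule swf_cong[OF Z W])
    fix z assume "z \<in> ?W"
    then have z: "z \<in> pts Z" "mat_images V (F z) \<in> chart_domain V n J" by auto
    show "(F z i * minv (sel_mat (n i) (J i) * F z i)) $$ (r, inv_into {..<e i} (nth_elem (J i)) s) =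
        chart_coords V n J (mat_images V (F z)) k"
    proof -
      have "chart_coords V n J (mat_images V (F z)) =
          (\<lambda>(i, r, s)\<in>chart_index V n J. graph_coords (n i) (e i) (J i) (F z i) r s)"
        by (rule mat_images_coords(2)[OF J reg_matD(1)[OF F z(1)] family_domain(2)[OF J z]])
      then show ?thesis using k graph_coords_def[OF Ji, of "F z i" r s] unfolding irs(1) by simp
    qed
  qed
qed

text \<open>The universal property of the Grassmannian on points: a family of injective matrices with regular entries has
  column spaces that form a morphism. With \<open>F\<close> the second component of an inflation, this is the quotient map.\<close>

lemma family_morphism: "is_morphism Z (grassmannian_prod_variety V e n) (\<lambda>z. mat_images V (F z))"
proof (rule is_morphism_local[OF Z])
  fix z assume z: "z \<in> pts Z"
  obtain J where J: "valid J" "mat_images V (F z) \<in> chart_domain V n J"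
    using exists_chart[of "F z", OF reg_matD(1)[OF F z] inj[OF z]] by blast
  let ?W = "{z \<in> pts Z. mat_images V (F z) \<in> chart_domain V n J}"
  have W: "openin (zar Z) ?W" by (rule family_domain(1)[OF J(1)])
  have swf: "space_with_functions (induced Z ?W)" by (rule swf_induced[OF Z])
  have ptsW: "pts (induced Z ?W) = ?W" by auto
  have "is_morphism (induced Z ?W) (affine_space (chart_index V n J)) (\<lambda>z. chart_coords V n J (mat_images V (F z)))"
  proof (rule is_morphism_affine_space[OF swf])
    show "chart_coords V n J (mat_images V (F z)) \<in> chart_index V n J \<rightarrow>\<^sub>E UNIV" if "z \<in> pts (induced Z ?W)" for z
      by (rule chart_chart_coords(2)[OF J(1)]) (use that ptsW in blast)
    show "(\<lambda>z. chart_coords V n J (mat_images V (F z)) k) \<in> reg (induced Z ?W) (pts (induced Z ?W))"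
      if "k \<in> chart_index V n J" for k
      unfolding ptsW by (rule reg_into_induced[OF W family_coords[OF J(1) that] subset_refl])
  qed
  from is_morphism_comp[OF this is_morphism_Gr_chart[OF J(1)]]
  have "is_morphism (induced Z ?W) (grassmannian_prod_variety V e n) (\<lambda>z. mat_images V (F z))"
    by (rule is_morphism_cong[OF swf]) (use chart_chart_coords(1)[OF J(1)] ptsW in blast)
  then show "\<exists>W. openin (zar Z) W \<and> z \<in> W \<and> is_morphism (induced Z W) (grassmannian_prod_variety V e n) (\<lambda>z. mat_images V (F z))"
    using W z J(2) by blast
qed

end

lemma chart_graph_reg:
  assumes J: "valid J" and i: "i \<in> V"
  shows "reg_mat (affine_space (chart_index V n J)) (pts (affine_space (chart_index V n J))) (n i) (e i) (\<lambda>a. chart_graph n J a i)"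
  unfolding chart_graph_def
  by (rule reg_mat_graph(1)[OF swf_affine_space openin_topspace validD[OF J i] refl])
     (rule affine_space_coord[OF _ openin_topspace], use i in \<open>simp add: chart_index_def\<close>)

text \<open>By the construction of the glued space, this is to be checked in every other chart. There the point is a
  column space of a family of matrices, so that the results on families apply. The same reduction gives \<open>chart_coords_reg\<close>.\<close>

lemma openin_chart_domain:
  assumes J: "valid J"
  shows "openin (zar (grassmannian_prod_variety V e n)) (chart_domain V n J :: ('v \<Rightarrow> 'k::field vec set) set)"
  unfolding grassmannian_prod_variety_def
proof (rule openin_gluedI)
  show "chart_domain V n J \<subseteq> grassmannian_prod V e n" unfolding chart_domain_def using chart_in[OF J] by blast
  fix A :: "('v \<times> nat \<times> nat \<Rightarrow> 'k, 'k) kspace" and \<phi> :: "_ \<Rightarrow> 'v \<Rightarrow> 'k vec set" assume "(A, \<phi>) \<in> charts"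
  then obtain J' where J': "valid J'" "A = affine_space (chart_index V n J')" "\<phi> = chart V n J'" by blast
  show "openin (zar A) {a \<in> pts A. \<phi> a \<in> chart_domain V n J}"
    unfolding J'(2,3) chart_eq[OF J'(1)]
    by (rule family_domain(1)[OF swf_affine_space chart_graph_reg[OF J'(1)] chart_graph_carrier(2)[OF J'(1)] J])
qed

lemma chart_coords_reg:
  assumes J: "valid J" and k: "k \<in> chart_index V n J"
  shows "(\<lambda>U. chart_coords V n J U k) \<in> reg (grassmannian_prod_variety V e n) (chart_domain V n J :: ('v \<Rightarrow> 'k::field vec set) set)"
  unfolding grassmannian_prod_variety_def
proof (rule reg_gluedI)
  fix A :: "('v \<times> nat \<times> nat \<Rightarrow> 'k, 'k) kspace" and \<phi> :: "_ \<Rightarrow> 'v \<Rightarrow> 'k vec set" assume "(A, \<phi>) \<in> charts"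
  then obtain J' where J': "valid J'" "A = affine_space (chart_index V n J')" "\<phi> = chart V n J'" by blast
  show "(\<lambda>a. chart_coords V n J (\<phi> a) k) \<in> reg A {a \<in> pts A. \<phi> a \<in> chart_domain V n J}"
    unfolding J'(2,3) chart_eq[OF J'(1)]
    by (rule family_coords[OF swf_affine_space chart_graph_reg[OF J'(1)] chart_graph_carrier(2)[OF J'(1)] J k])
qed

lemma chart_matrices_reg:
  assumes J: "valid J" and i: "i \<in> V"
  shows "reg_mat (grassmannian_prod_variety V e n) (chart_domain V n J) (n i) (e i) (\<lambda>U. chart_graph n J (chart_coords V n J U) i)"
    and "reg_mat (grassmannian_prod_variety V e n) (chart_domain V n J) (d i) (n i) (\<lambda>U. chart_cograph n J (chart_coords V n J U) i)"
  unfolding chart_graph_def chart_cograph_def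
  by (rule reg_mat_graph[OF swf_Gr openin_chart_domain[OF J] validD[OF J i] refl],
      rule chart_coords_reg[OF J], use i in \<open>simp add: chart_index_def\<close>)+

lemma is_morphism_chart_coords:
  assumes J: "valid J"
  shows "is_morphism (induced (grassmannian_prod_variety V e n) (chart_domain V n J)) (affine_space (chart_index V n J)) (chart_coords V n J)"
proof (rule is_morphism_affine_space[OF swf_induced[OF swf_Gr]])
  fix U assume "U \<in> pts (induced (grassmannian_prod_variety V e n) (chart_domain V n J))"
  then show "chart_coords V n J U \<in> chart_index V n J \<rightarrow>\<^sub>E UNIV" by (intro chart_chart_coords(2)[OF J]) simp
next
  fix k assume "k \<in> chart_index V n J"
  from chart_coords_reg[OF J this]
  show "(\<lambda>U. chart_coords V n J U k) \<in> reg (induced (grassmannian_prod_variety V e n) (chart_domain V n J))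
          (pts (induced (grassmannian_prod_variety V e n) (chart_domain V n J)))"
    by (rule reg_into_induced[OF openin_chart_domain[OF J]]) simp
qed

lemma chart_domain_mat_images:
  assumes J: "valid J" and U: "U \<in> chart_domain V n J"
  shows "U = mat_images V (chart_graph n J (chart_coords V n J U))"
  using chart_chart_coords(1)[OF J U] unfolding chart_eq[OF J] by simp

text \<open>Values of \<open>J\<close> outside \<open>V\<close> do not affect the chart, so the charts are indexed by a finite set although there may be
  infinitely many functions \<open>J\<close>.\<close>

lemma finite_chart_domains: "finite {chart_domain V n J :: ('v \<Rightarrow> 'k::field vec set) set | J. valid J}"
proof -
  have "finite (\<Pi>\<^sub>E i\<in>V. Pow {..<n i})" using finV by (intro finite_PiE) auto
  moreover have "{chart_domain V n J :: ('v \<Rightarrow> 'k vec set) set | J. valid J} \<subseteq> chart_domain V n ` (\<Pi>\<^sub>E i\<in>V. Pow {..<n i})"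
  proof
    fix D :: "('v \<Rightarrow> 'k vec set) set" assume "D \<in> {chart_domain V n J | J. valid J}"
    then obtain J where J: "valid J" "D = chart_domain V n J" by blast
    \<comment> \<open>replace the irrelevant values of \<open>J\<close> outside \<open>V\<close> by a default\<close>
    let ?J = "restrict J V"
    have "chart_index V n J = chart_index V n ?J" unfolding chart_index_def by (intro Sigma_cong) auto
    moreover have "chart V n J a = chart V n ?J a" for a :: "'v \<times> nat \<times> nat \<Rightarrow> 'k"
      unfolding chart_def by (rule restrict_ext) simp
    ultimately have "D = chart_domain V n ?J" unfolding J(2) chart_domain_def by simp
    then show "D \<in> chart_domain V n ` (\<Pi>\<^sub>E i\<in>V. Pow {..<n i})" using J(1) by (intro image_eqI[of _ _ ?J]) auto
  qed
  ultimately show ?thesis by (rule finite_subset[OF _ finite_imageI, rotated])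
qed

end

section \<open>Submodules and quotient modules\<close>

lemma mat_surjective_cancel:
  fixes G :: "'k::field mat"
  assumes G: "G \<in> carrier_mat d n" "mat_surjective G" and XY: "X \<in> carrier_mat m d" "Y \<in> carrier_mat m d"
    and eq: "X * G = Y * G"
  shows "X = Y"
proof (rule mat_col_eqI)
  fix j assume "j < dim_col Y"
  then have j: "j < d" using XY by simp
  have "unit_vec d j \<in> mat_image G" using G by simp
  then obtain w where w: "w \<in> carrier_vec n" "unit_vec d j = G *\<^sub>v w" using G(1) by auto
  have "col X j = X * G *\<^sub>v w" using mult_unit_vec[OF XY(1) j] w(2) assoc_mult_mat_vec[OF XY(1) G(1) w(1)] by simp
  also have "\<dots> = col Y j" unfolding eq using mult_unit_vec[OF XY(2) j] w(2) assoc_mult_mat_vec[OF XY(2) G(1) w(1)] by simp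
  finally show "col X j = col Y j" .
qed (use XY in auto)

lemma mat_surjective_right_inverse:
  fixes G :: "'k::field mat"
  assumes G: "G \<in> carrier_mat d n" "mat_surjective G"
  shows "\<exists>R\<in>carrier_mat n d. G * R = 1\<^sub>m d"
proof -
  have "mat_image (1\<^sub>m d :: 'k mat) \<subseteq> mat_image G" using G by auto
  from mat_image_subset_factor[OF G(1) one_carrier_mat this] show ?thesis by metis
qed

text \<open>\<open>B\<close> vanishes on the differences \<open>v - R (G v)\<close>, for \<open>R\<close> a right inverse of \<open>G\<close>, because \<open>G\<close> does; so
  \<open>B = (B * R) * G\<close>.\<close>

lemma mat_kernel_subset_factor:
  fixes G :: "'k::field mat"
  assumes G: "G \<in> carrier_mat d n" "mat_surjective G" and B: "B \<in> carrier_mat m n"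
    and sub: "mat_kernel G \<subseteq> mat_kernel B"
  shows "\<exists>C\<in>carrier_mat m d. B = C * G"
proof -
  obtain R where R: "R \<in> carrier_mat n d" "G * R = 1\<^sub>m d" using mat_surjective_right_inverse[OF G] by blast
  have BR: "B * R \<in> carrier_mat m d" by (rule mult_carrier_mat[OF B R(1)])
  have RG: "R * G \<in> carrier_mat n n" by (rule mult_carrier_mat[OF R(1) G(1)])
  have "B = B * R * G"
  proof (rule mat_col_eqI)
    fix j assume "j < dim_col (B * R * G)"
    then have j: "j < n" using G by simp
    let ?v = "unit_vec n j - R * G *\<^sub>v unit_vec n j"
    have c: "unit_vec n j \<in> carrier_vec n" "R * G *\<^sub>v unit_vec n j \<in> carrier_vec n" using mult_mat_vec_carrier[OF RG] by simp_all
    have GRG: "G *\<^sub>v (R * G *\<^sub>v unit_vec n j) = G *\<^sub>v unit_vec n j"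
    proof -
      have "G *\<^sub>v (R * G *\<^sub>v unit_vec n j) = G * (R * G) *\<^sub>v unit_vec n j"
        by (rule assoc_mult_mat_vec[OF G(1) RG c(1), symmetric])
      also have "G * (R * G) = G * R * G" by (rule assoc_mult_mat[OF G(1) R(1) G(1), symmetric])
      also have "\<dots> = G" unfolding R(2) using G(1) by simp
      finally show ?thesis .
    qed
    have "G *\<^sub>v ?v = 0\<^sub>v d"
      unfolding mult_minus_distrib_mat_vec[OF G(1) c] GRG using mult_mat_vec_carrier[OF G(1) c(1)] by simp
    then have "?v \<in> mat_kernel G" using mat_kernelI[OF G(1)] c by simp
    then have "?v \<in> mat_kernel B" using sub by blast
    then have "B *\<^sub>v ?v = 0\<^sub>v m" by (rule mat_kernelD(2)[OF B])
    then have z: "B *\<^sub>v unit_vec n j - B *\<^sub>v (R * G *\<^sub>v unit_vec n j) = 0\<^sub>v m"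
      unfolding mult_minus_distrib_mat_vec[OF B c] .
    have "B *\<^sub>v unit_vec n j = B *\<^sub>v (R * G *\<^sub>v unit_vec n j)"
    proof (rule eq_vecI)
      fix i assume "i < dim_vec (B *\<^sub>v (R * G *\<^sub>v unit_vec n j))"
      then have i: "i < m" using B by simp
      have "(B *\<^sub>v unit_vec n j - B *\<^sub>v (R * G *\<^sub>v unit_vec n j)) $ i = 0" unfolding z using i by simp
      then show "(B *\<^sub>v unit_vec n j) $ i = (B *\<^sub>v (R * G *\<^sub>v unit_vec n j)) $ i"
        using i carrier_matD(1)[OF B] by (subst (asm) index_minus_vec(1)) (simp_all del: index_mult_mat_vec)
    qed (simp only: dim_mult_mat_vec)
    also have "\<dots> = B * (R * G) *\<^sub>v unit_vec n j" by (rule assoc_mult_mat_vec[OF B RG c(1), symmetric])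
    also have "B * (R * G) = B * R * G" by (rule assoc_mult_mat[OF B R(1) G(1), symmetric])
    finally show "col B j = col (B * R * G) j"
      unfolding mult_unit_vec[OF B j] mult_unit_vec[OF mult_carrier_mat[OF BR G(1)] j] .
  qed (use B G in auto)
  then show ?thesis using BR by blast
qed

lemma mat_kernel_eq_factor:
  fixes G :: "'k::field mat"
  assumes G: "G \<in> carrier_mat d n" "mat_surjective G" and B: "B \<in> carrier_mat d n" "mat_surjective B"
    and eq: "mat_kernel G = mat_kernel B"
  shows "\<exists>C\<in>carrier_mat d d. det C \<noteq> 0 \<and> B = C * G"
proof -
  obtain C where C: "C \<in> carrier_mat d d" "B = C * G"
    using mat_kernel_subset_factor[OF G B(1) equalityD1[OF eq]] by (rule bexE)
  obtain D where D: "D \<in> carrier_mat d d" "G = D * B"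
    using mat_kernel_subset_factor[OF B G(1) equalityD2[OF eq]] by (rule bexE)
  have "C * D * B = C * (D * B)" by (rule assoc_mult_mat[OF C(1) D(1) B(1)])
  also have "\<dots> = 1\<^sub>m d * B" using C(2) D(2) left_mult_one_mat[OF B(1)] by simp
  finally have "C * D = 1\<^sub>m d" by (rule mat_surjective_cancel[OF B mult_carrier_mat[OF C(1) D(1)] one_carrier_mat])
  then show ?thesis using inverse_mat_det[OF C(1) D(1)] C by blast
qed

text \<open>The block from \<open>i\<close> to \<open>j\<close> of the action of the path algebra element \<open>x\<close>.\<close>

definition relation_mat ::
  "('v, 'a) pre_digraph \<Rightarrow> ('v \<Rightarrow> nat) \<Rightarrow> ('a \<Rightarrow> 'k::field mat) \<Rightarrow> (('v, 'a) path \<Rightarrow>\<^sub>0 'k) \<Rightarrow> 'v \<Rightarrow> 'v \<Rightarrow> 'k mat" where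
  "relation_mat Q d M x i j = mat (d j) (d i) (\<lambda>(r, s).
     \<Sum>p | p \<in> Poly_Mapping.keys x \<and> fst p = i \<and> path_end Q p = j.
       Poly_Mapping.lookup x p * path_mat Q d M i (snd p) $$ (r, s))"

lemma relation_mat_carrier: "relation_mat Q d M x i j \<in> carrier_mat (d j) (d i)"
  unfolding relation_mat_def by simp

lemma satisfies_iff: "satisfies Q d M x \<longleftrightarrow> (\<forall>i\<in>verts Q. \<forall>j\<in>verts Q. relation_mat Q d M x i j = 0\<^sub>m (d j) (d i))"
  unfolding satisfies_def relation_mat_def by (auto simp: mat_eq_iff)

lemma rep_setD: "M \<in> rep_set Q d \<Longrightarrow> \<alpha> \<in> arcs Q \<Longrightarrow> M \<alpha> \<in> carrier_mat (d (head Q \<alpha>)) (d (tail Q \<alpha>))"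
  unfolding rep_set_def by auto

lemma is_homD:
  assumes "is_hom Q (d, X) (d', Y) f"
  shows "i \<in> verts Q \<Longrightarrow> f i \<in> carrier_mat (d' i) (d i)"
    and "\<alpha> \<in> arcs Q \<Longrightarrow> Y \<alpha> * f (tail Q \<alpha>) = f (head Q \<alpha>) * X \<alpha>"
  using assms unfolding is_hom_def by auto

context wf_digraph
begin

lemma path_mat_carrier:
  "M \<in> rep_set G d \<Longrightarrow> awalk i p j \<Longrightarrow> path_mat G d M i p \<in> carrier_mat (d j) (d i)"
proof (induction p arbitrary: i)
  case Nil
  then show ?case by (simp add: awalk_Nil_iff)
next
  case (Cons \<alpha> p)
  then have a: "\<alpha> \<in> arcs G" "i = tail G \<alpha>" "awalk (head G \<alpha>) p j" by (auto simp: awalk_Cons_iff)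
  show ?case using mult_carrier_mat[OF Cons.IH[OF Cons.prems(1) a(3)] rep_setD[OF Cons.prems(1) a(1)]] a(2) by simp
qed

lemma path_mat_hom:
  assumes X: "X \<in> rep_set G d" and Y: "Y \<in> rep_set G d'" and f: "is_hom G (d, X) (d', Y) f"
  shows "awalk i p j \<Longrightarrow> path_mat G d' Y i p * f i = f j * path_mat G d X i p"
proof (induction p arbitrary: i)
  case Nil
  then have "i \<in> verts G" "i = j" by (auto simp: awalk_Nil_iff)
  then show ?case using left_mult_one_mat[OF is_homD(1)[OF f], of j] right_mult_one_mat[OF is_homD(1)[OF f], of j] by simp
next
  case (Cons \<alpha> p)
  then have a: "\<alpha> \<in> arcs G" "i = tail G \<alpha>" "awalk (head G \<alpha>) p j" by (auto simp: awalk_Cons_iff)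
  then have v: "i \<in> verts G" "head G \<alpha> \<in> verts G" "j \<in> verts G" by auto
  note Yp = path_mat_carrier[OF Y a(3)] and Xp = path_mat_carrier[OF X a(3)]
  have Ya: "Y \<alpha> \<in> carrier_mat (d' (head G \<alpha>)) (d' i)" and Xa: "X \<alpha> \<in> carrier_mat (d (head G \<alpha>)) (d i)"
    using rep_setD[OF Y a(1)] rep_setD[OF X a(1)] a(2) by simp_all
  note fi = is_homD(1)[OF f v(1)] and fh = is_homD(1)[OF f v(2)] and fj = is_homD(1)[OF f v(3)]
  have "path_mat G d' Y (head G \<alpha>) p * Y \<alpha> * f i = path_mat G d' Y (head G \<alpha>) p * (Y \<alpha> * f i)"
    by (rule assoc_mult_mat[OF Yp Ya fi])
  also have "Y \<alpha> * f i = f (head G \<alpha>) * X \<alpha>" using is_homD(2)[OF f a(1)] a(2) by simp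
  also have "path_mat G d' Y (head G \<alpha>) p * (f (head G \<alpha>) * X \<alpha>) = path_mat G d' Y (head G \<alpha>) p * f (head G \<alpha>) * X \<alpha>"
    by (rule assoc_mult_mat[OF Yp fh Xa, symmetric])
  also have "\<dots> = f j * path_mat G d X (head G \<alpha>) p * X \<alpha>" unfolding Cons.IH[OF a(3)] ..
  also have "\<dots> = f j * (path_mat G d X (head G \<alpha>) p * X \<alpha>)" by (rule assoc_mult_mat[OF fj Xp Xa])
  finally show ?case by simp
qed

text \<open>A homomorphism commutes with the arrows, hence with paths and with their linear combinations. Only paths from \<open>i\<close> to \<open>j\<close>
  in the quiver contribute to the block, and elements of the path algebra are supported on such paths.\<close>

lemma relation_mat_hom:
  assumes X: "X \<in> rep_set G d" and Y: "Y \<in> rep_set G d'" and f: "is_hom G (d, X) (d', Y) f"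
    and x: "x \<in> carrier (path_algebra G)" and i: "i \<in> verts G" and j: "j \<in> verts G"
  shows "relation_mat G d' Y x i j * f i = f j * relation_mat G d X x i j"
proof (rule eq_matI)
  note fi = is_homD(1)[OF f i] and fj = is_homD(1)[OF f j]
  note RX = relation_mat_carrier[of G d X x i j] and RY = relation_mat_carrier[of G d' Y x i j]
  fix r s assume "r < dim_row (f j * relation_mat G d X x i j)" "s < dim_col (f j * relation_mat G d X x i j)"
  then have r: "r < d' j" and s: "s < d i" using fj RX by simp_all
  let ?P = "{p. p \<in> Poly_Mapping.keys x \<and> fst p = i \<and> path_end G p = j}"
  let ?c = "Poly_Mapping.lookup x"
  have walk: "awalk i (snd p) j" if "p \<in> ?P" for p
  proof -
    have "p \<in> path_set G" using x that by (auto simp: path_algebra_def)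
    moreover have "fst p = i" using that by simp
    ultimately obtain j' where w: "awalk i (snd p) j'" by (auto simp: path_set_def split_beta)
    have "path_end G p = j'" using awlast_if_cas[of i "snd p" j'] w that by (auto simp: path_end_def split_beta awalk_def)
    then show ?thesis using w that by simp
  qed
  have "(relation_mat G d' Y x i j * f i) $$ (r, s) = (\<Sum>k<d' i. (\<Sum>p\<in>?P. ?c p * path_mat G d' Y i (snd p) $$ (r, k)) * f i $$ (k, s))"
    unfolding mult_index[OF RY fi r s] using r by (intro sum.cong) (auto simp: relation_mat_def)
  also have "\<dots> = (\<Sum>p\<in>?P. ?c p * (\<Sum>k<d' i. path_mat G d' Y i (snd p) $$ (r, k) * f i $$ (k, s)))"
    unfolding sum_distrib_right by (subst sum.swap) (simp add: sum_distrib_left mult.assoc)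
  also have "\<dots> = (\<Sum>p\<in>?P. ?c p * (\<Sum>k<d j. f j $$ (r, k) * path_mat G d X i (snd p) $$ (k, s)))"
  proof (rule sum.cong[OF refl])
    fix p assume p: "p \<in> ?P"
    note w = walk[OF p]
    show "?c p * (\<Sum>k<d' i. path_mat G d' Y i (snd p) $$ (r, k) * f i $$ (k, s)) =
        ?c p * (\<Sum>k<d j. f j $$ (r, k) * path_mat G d X i (snd p) $$ (k, s))"
      using mult_index[OF path_mat_carrier[OF Y w] fi r s] mult_index[OF fj path_mat_carrier[OF X w] r s]
        path_mat_hom[OF X Y f w] by simp
  qed
  also have "\<dots> = (\<Sum>k<d j. f j $$ (r, k) * (\<Sum>p\<in>?P. ?c p * path_mat G d X i (snd p) $$ (k, s)))"
    unfolding sum_distrib_left by (subst sum.swap) (simp add: mult.left_commute)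
  also have "\<dots> = (f j * relation_mat G d X x i j) $$ (r, s)"
    unfolding mult_index[OF fj RX r s] using s by (intro sum.cong) (auto simp: relation_mat_def)
  finally show "(relation_mat G d' Y x i j * f i) $$ (r, s) = (f j * relation_mat G d X x i j) $$ (r, s)" .
qed (use is_homD(1)[OF f i] is_homD(1)[OF f j] in \<open>auto simp: relation_mat_def\<close>)

text \<open>The relation of the larger module, composed with the inclusion, is the inclusion after the relation of the
  submodule, and the inclusion can be cancelled.\<close>

lemma submodule_satisfies:
  assumes X: "X \<in> rep_set G d" and Y: "Y \<in> rep_set G d'" and f: "is_hom G (d, X) (d', Y) f"
    and x: "x \<in> carrier (path_algebra G)" and inj: "\<And>i. i \<in> verts G \<Longrightarrow> mat_injective (f i)"
    and sat: "satisfies G d' Y x"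
  shows "satisfies G d X x"
  unfolding satisfies_iff
proof (intro ballI)
  fix i j assume i: "i \<in> verts G" and j: "j \<in> verts G"
  note fi = is_homD(1)[OF f i] and fj = is_homD(1)[OF f j]
  have "f j * relation_mat G d X x i j = 0\<^sub>m (d' j) (d' i) * f i"
    using relation_mat_hom[OF X Y f x i j] sat i j unfolding satisfies_iff by simp
  also have "\<dots> = f j * 0\<^sub>m (d j) (d i)"
    unfolding left_mult_zero_mat[OF fi] right_mult_zero_mat[OF fj] ..
  finally show "relation_mat G d X x i j = 0\<^sub>m (d j) (d i)"
    by (rule mat_injective_cancel[OF fj inj[OF j] relation_mat_carrier[of G d X x i j] zero_carrier_mat[of "d j" "d i"]])
qed

lemma quotient_satisfies:
  assumes X: "X \<in> rep_set G d" and Y: "Y \<in> rep_set G d'" and f: "is_hom G (d, X) (d', Y) f"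
    and x: "x \<in> carrier (path_algebra G)" and surj: "\<And>i. i \<in> verts G \<Longrightarrow> mat_surjective (f i)"
    and sat: "satisfies G d X x"
  shows "satisfies G d' Y x"
  unfolding satisfies_iff
proof (intro ballI)
  fix i j assume i: "i \<in> verts G" and j: "j \<in> verts G"
  note fi = is_homD(1)[OF f i] and fj = is_homD(1)[OF f j]
  have "relation_mat G d' Y x i j * f i = f j * 0\<^sub>m (d j) (d i)"
    using relation_mat_hom[OF X Y f x i j] sat i j unfolding satisfies_iff by simp
  also have "\<dots> = 0\<^sub>m (d' j) (d' i) * f i"
    unfolding left_mult_zero_mat[OF fi] right_mult_zero_mat[OF fj] ..
  finally show "relation_mat G d' Y x i j = 0\<^sub>m (d' j) (d' i)"
    by (rule mat_surjective_cancel[OF fi surj[OF i] relation_mat_carrier[of G d' Y x i j] zero_carrier_mat[of "d' j" "d' i"]])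
qed

text \<open>The change of basis between the two inclusions commutes with the arrows because this holds after the injective map \<open>f\<close>.\<close>

lemma iso_submodules:
  assumes X: "X \<in> rep_set G e" and X': "X' \<in> rep_set G e" and M: "M \<in> rep_set G n"
    and f: "is_hom G (e, X) (n, M) f" and f': "is_hom G (e, X') (n, M) f'"
    and inj: "\<And>i. i \<in> verts G \<Longrightarrow> mat_injective (f i)" "\<And>i. i \<in> verts G \<Longrightarrow> mat_injective (f' i)"
    and im: "\<And>i. i \<in> verts G \<Longrightarrow> mat_image (f i) = mat_image (f' i)"
  shows "\<exists>c. is_hom G (e, X') (e, X) c \<and> (\<forall>i\<in>verts G. c i \<in> carrier_mat (e i) (e i) \<and> det (c i) \<noteq> 0 \<and> f' i = f i * c i)"
proof -
  have "\<forall>i\<in>verts G. \<exists>C. C \<in> carrier_mat (e i) (e i) \<and> det C \<noteq> 0 \<and> f' i = f i * C"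
    using mat_image_eq_factor[OF is_homD(1)[OF f] inj(1) is_homD(1)[OF f'] inj(2) im] by blast
  then obtain c where c: "\<forall>i\<in>verts G. c i \<in> carrier_mat (e i) (e i) \<and> det (c i) \<noteq> 0 \<and> f' i = f i * c i"
    by (rule bchoice[THEN exE])
  have "is_hom G (e, X') (e, X) c"
    unfolding is_hom_def fst_conv snd_conv
  proof (intro conjI ballI)
    show "c i \<in> carrier_mat (e i) (e i)" if "i \<in> verts G" for i using c that by blast
    fix \<alpha> assume \<alpha>: "\<alpha> \<in> arcs G"
    let ?t = "tail G \<alpha>" and ?h = "head G \<alpha>"
    have t: "?t \<in> verts G" and h: "?h \<in> verts G" using \<alpha> by auto
    have ct: "c ?t \<in> carrier_mat (e ?t) (e ?t)" "f' ?t = f ?t * c ?t"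
      and ch: "c ?h \<in> carrier_mat (e ?h) (e ?h)" "f' ?h = f ?h * c ?h" using c t h by blast+
    note ft = is_homD(1)[OF f t] and fh = is_homD(1)[OF f h]
    note Xa = rep_setD[OF X \<alpha>] and Xa' = rep_setD[OF X' \<alpha>] and Ma = rep_setD[OF M \<alpha>]
    have "f ?h * (X \<alpha> * c ?t) = f ?h * X \<alpha> * c ?t" by (rule assoc_mult_mat[OF fh Xa ct(1), symmetric])
    also have "\<dots> = M \<alpha> * f ?t * c ?t" using is_homD(2)[OF f \<alpha>] by simp
    also have "\<dots> = M \<alpha> * f' ?t" unfolding ct(2) by (rule assoc_mult_mat[OF Ma ft ct(1)])
    also have "\<dots> = f' ?h * X' \<alpha>" by (rule is_homD(2)[OF f' \<alpha>])
    also have "\<dots> = f ?h * (c ?h * X' \<alpha>)" unfolding ch(2) by (rule assoc_mult_mat[OF fh ch(1) Xa'])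
    finally show "X \<alpha> * c ?t = c ?h * X' \<alpha>"
      by (rule mat_injective_cancel[OF fh inj(1)[OF h] mult_carrier_mat[OF Xa ct(1)] mult_carrier_mat[OF ch(1) Xa']])
  qed
  then show ?thesis using c by blast
qed

text \<open>Dual to \<open>iso_submodules\<close>: here the surjective map \<open>g\<close> is cancelled on the right.\<close>

lemma iso_quotients:
  assumes N: "N \<in> rep_set G d" and N': "N' \<in> rep_set G d" and M: "M \<in> rep_set G n"
    and g: "is_hom G (n, M) (d, N) g" and g': "is_hom G (n, M) (d, N') g'"
    and surj: "\<And>i. i \<in> verts G \<Longrightarrow> mat_surjective (g i)" "\<And>i. i \<in> verts G \<Longrightarrow> mat_surjective (g' i)"
    and ker: "\<And>i. i \<in> verts G \<Longrightarrow> mat_kernel (g i) = mat_kernel (g' i)"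
  shows "\<exists>c. is_hom G (d, N) (d, N') c \<and> (\<forall>i\<in>verts G. c i \<in> carrier_mat (d i) (d i) \<and> det (c i) \<noteq> 0 \<and> g' i = c i * g i)"
proof -
  have "\<forall>i\<in>verts G. \<exists>C. C \<in> carrier_mat (d i) (d i) \<and> det C \<noteq> 0 \<and> g' i = C * g i"
    using mat_kernel_eq_factor[OF is_homD(1)[OF g] surj(1) is_homD(1)[OF g'] surj(2) ker] by blast
  then obtain c where c: "\<forall>i\<in>verts G. c i \<in> carrier_mat (d i) (d i) \<and> det (c i) \<noteq> 0 \<and> g' i = c i * g i"
    by (rule bchoice[THEN exE])
  have "is_hom G (d, N) (d, N') c"
    unfolding is_hom_def fst_conv snd_conv
  proof (intro conjI ballI)
    show "c i \<in> carrier_mat (d i) (d i)" if "i \<in> verts G" for i using c that by blast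
    fix \<alpha> assume \<alpha>: "\<alpha> \<in> arcs G"
    let ?t = "tail G \<alpha>" and ?h = "head G \<alpha>"
    have t: "?t \<in> verts G" and h: "?h \<in> verts G" using \<alpha> by auto
    have ct: "c ?t \<in> carrier_mat (d ?t) (d ?t)" "g' ?t = c ?t * g ?t"
      and ch: "c ?h \<in> carrier_mat (d ?h) (d ?h)" "g' ?h = c ?h * g ?h" using c t h by blast+
    note gt = is_homD(1)[OF g t] and gh = is_homD(1)[OF g h]
    note Na = rep_setD[OF N \<alpha>] and Na' = rep_setD[OF N' \<alpha>] and Ma = rep_setD[OF M \<alpha>]
    have "N' \<alpha> * c ?t * g ?t = N' \<alpha> * g' ?t" unfolding ct(2) by (rule assoc_mult_mat[OF Na' ct(1) gt])
    also have "\<dots> = g' ?h * M \<alpha>" by (rule is_homD(2)[OF g' \<alpha>])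
    also have "\<dots> = c ?h * (g ?h * M \<alpha>)" unfolding ch(2) by (rule assoc_mult_mat[OF ch(1) gh Ma])
    also have "\<dots> = c ?h * (N \<alpha> * g ?t)" using is_homD(2)[OF g \<alpha>] by simp
    also have "\<dots> = c ?h * N \<alpha> * g ?t" by (rule assoc_mult_mat[OF ch(1) Na gt, symmetric])
    finally show "N' \<alpha> * c ?t = c ?h * N \<alpha>"
      by (rule mat_surjective_cancel[OF gt surj(1)[OF t] mult_carrier_mat[OF Na' ct(1)] mult_carrier_mat[OF ch(1) Na]])
  qed
  then show ?thesis using c by blast
qed

end

lemma iso_modulesI:
  assumes "is_hom Q (d, X) (d, Y) c" "\<forall>i\<in>verts Q. c i \<in> carrier_mat (d i) (d i) \<and> det (c i) \<noteq> 0"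
  shows "iso_modules Q (d, X) (d, Y)"
  unfolding iso_modules_def using assms invertible_mat_iff_det by blast

section \<open>Grassmannians of submodules\<close>

locale grassmannian_setup = fin_digraph Q + grassmannian_charts "verts Q" e d
  for Q :: "('v, 'a) pre_digraph" and e d :: "'v \<Rightarrow> nat" +
  fixes I :: "(('v, 'a) path \<Rightarrow>\<^sub>0 'k::field) set" and M :: "'a \<Rightarrow> 'k mat"
  assumes I: "I \<subseteq> carrier (path_algebra Q)"
    and M: "M \<in> mod_set Q I (\<lambda>i. e i + d i)"
begin

definition iso_closed :: "('v, 'a, 'k) rep set \<Rightarrow> bool" where
  "iso_closed \<E> \<longleftrightarrow> \<E> \<subseteq> modules Q I \<and> (\<forall>X\<in>\<E>. \<forall>Y\<in>modules Q I. iso_modules Q X Y \<longrightarrow> Y \<in> \<E>)"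

lemma M_rep: "M \<in> rep_set Q n" using M unfolding mod_set_def by simp

lemma iso_closed_modules: "iso_closed (modules Q I)"
  unfolding iso_closed_def by blast

lemma iso_closedD: "iso_closed \<E> \<Longrightarrow> X \<in> cat_set \<E> c \<Longrightarrow> X \<in> mod_set Q I c"
  unfolding iso_closed_def cat_set_def modules_def by blast

lemma mod_setD: "X \<in> mod_set Q I c \<Longrightarrow> X \<in> rep_set Q c" unfolding mod_set_def by simp

lemma iso_closed_iso:
  assumes \<E>: "iso_closed \<E>" and X: "X \<in> cat_set \<E> c" and Y: "Y \<in> mod_set Q I c"
    and h: "is_hom Q (c, X) (c, Y) f" "\<forall>i\<in>verts Q. f i \<in> carrier_mat (c i) (c i) \<and> det (f i) \<noteq> 0"
  shows "Y \<in> cat_set \<E> c"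
  using iso_modulesI[OF h] \<E> X Y unfolding iso_closed_def cat_set_def modules_def by blast

lemma submodule_mod_set:
  assumes "X \<in> rep_set Q e" "is_hom Q (e, X) (n, M) f" "\<And>i. i \<in> verts Q \<Longrightarrow> mat_injective (f i)"
  shows "X \<in> mod_set Q I e"
  using submodule_satisfies[OF assms(1) M_rep assms(2) _ assms(3)] I M assms(1) unfolding mod_set_def by blast

lemma quotient_mod_set:
  assumes "N \<in> rep_set Q d" "is_hom Q (n, M) (d, N) g" "\<And>i. i \<in> verts Q \<Longrightarrow> mat_surjective (g i)"
  shows "N \<in> mod_set Q I d"
  using quotient_satisfies[OF M_rep assms(1,2) _ assms(3)] I M assms(1) unfolding mod_set_def by blast

lemma hom_image_stable:
  assumes X: "X \<in> rep_set Q e" and f: "is_hom Q (e, X) (n, M) f"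
  shows "\<forall>\<alpha>\<in>arcs Q. \<forall>w\<in>mat_images (verts Q) f (tail Q \<alpha>). M \<alpha> *\<^sub>v w \<in> mat_images (verts Q) f (head Q \<alpha>)"
proof (intro ballI)
  fix \<alpha> w assume \<alpha>: "\<alpha> \<in> arcs Q" and w: "w \<in> mat_images (verts Q) f (tail Q \<alpha>)"
  let ?t = "tail Q \<alpha>" and ?h = "head Q \<alpha>"
  have t: "?t \<in> verts Q" and h: "?h \<in> verts Q" using \<alpha> by auto
  note ft = is_homD(1)[OF f t] and fh = is_homD(1)[OF f h] and Ma = rep_setD[OF M_rep \<alpha>] and Xa = rep_setD[OF X \<alpha>]
  obtain v where v: "v \<in> carrier_vec (e ?t)" "w = f ?t *\<^sub>v v" using w t ft by auto
  have "M \<alpha> *\<^sub>v w = M \<alpha> * f ?t *\<^sub>v v" unfolding v(2) by (rule assoc_mult_mat_vec[OF Ma ft v(1), symmetric])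
  also have "\<dots> = f ?h *\<^sub>v (X \<alpha> *\<^sub>v v)"
    unfolding is_homD(2)[OF f \<alpha>] by (rule assoc_mult_mat_vec[OF fh Xa v(1)])
  finally have "M \<alpha> *\<^sub>v w = f ?h *\<^sub>v (X \<alpha> *\<^sub>v v)" .
  then have "M \<alpha> *\<^sub>v w \<in> mat_image (f ?h)"
    by (rule image_eqI) (use mult_mat_vec_carrier[OF Xa v(1)] fh in simp)
  then show "M \<alpha> *\<^sub>v w \<in> mat_images (verts Q) f ?h" using h by simp
qed

text \<open>The definition of the \<open>\<E>\<close>-Grassmannian asks for some bases of \<open>U\<close> and \<open>M/U\<close> in which the modules lie in
  \<open>\<E>\<close>. Any other bases give isomorphic modules, so the condition can be tested on any given pair of bases.\<close>

lemma gr_set_iff: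
  assumes \<E>: "iso_closed \<E>" and X: "X \<in> rep_set Q e" and N: "N \<in> rep_set Q d"
    and f: "is_hom Q (e, X) (n, M) f" and inj: "\<And>i. i \<in> verts Q \<Longrightarrow> mat_injective (f i)"
    and g: "is_hom Q (n, M) (d, N) g" and surj: "\<And>i. i \<in> verts Q \<Longrightarrow> mat_surjective (g i)"
    and ex: "\<And>i. i \<in> verts Q \<Longrightarrow> mat_kernel (g i) = mat_image (f i)"
  shows "mat_images (verts Q) f \<in> gr_set Q \<E> e d M \<longleftrightarrow> X \<in> cat_set \<E> e \<and> N \<in> cat_set \<E> d"
proof
  assume "mat_images (verts Q) f \<in> gr_set Q \<E> e d M"
  then obtain X' f' N' g' where X': "X' \<in> cat_set \<E> e" "is_hom Q (e, X') (n, M) f'"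
      "\<forall>i\<in>verts Q. mat_injective (f' i) \<and> mat_image (f' i) = mat_images (verts Q) f i"
    and N': "N' \<in> cat_set \<E> d" "is_hom Q (n, M) (d, N') g'"
      "\<forall>i\<in>verts Q. mat_surjective (g' i) \<and> mat_kernel (g' i) = mat_images (verts Q) f i"
    unfolding gr_set_def by (elim CollectE conjE bexE exE)
  note rX' = mod_setD[OF iso_closedD[OF \<E> X'(1)]] and rN' = mod_setD[OF iso_closedD[OF \<E> N'(1)]]
  have "\<exists>c. is_hom Q (e, X') (e, X) c \<and> (\<forall>i\<in>verts Q. c i \<in> carrier_mat (e i) (e i) \<and> det (c i) \<noteq> 0 \<and> f' i = f i * c i)"
    by (rule iso_submodules[OF X rX' M_rep f X'(2) inj]) (use X'(3) in simp_all)
  then obtain c where "is_hom Q (e, X') (e, X) c" "\<forall>i\<in>verts Q. c i \<in> carrier_mat (e i) (e i) \<and> det (c i) \<noteq> 0" by blast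
  then have 1: "X \<in> cat_set \<E> e"
    using iso_closed_iso[OF \<E> X'(1) submodule_mod_set[OF X f inj], of c] by simp
  have "\<exists>c. is_hom Q (d, N') (d, N) c \<and> (\<forall>i\<in>verts Q. c i \<in> carrier_mat (d i) (d i) \<and> det (c i) \<noteq> 0 \<and> g i = c i * g' i)"
    by (rule iso_quotients[OF rN' N M_rep N'(2) g]) (use N'(3) surj ex in simp_all)
  then obtain c where "is_hom Q (d, N') (d, N) c" "\<forall>i\<in>verts Q. c i \<in> carrier_mat (d i) (d i) \<and> det (c i) \<noteq> 0" by blast
  then have 2: "N \<in> cat_set \<E> d"
    using iso_closed_iso[OF \<E> N'(1) quotient_mod_set[OF N g surj], of c] by simp
  show "X \<in> cat_set \<E> e \<and> N \<in> cat_set \<E> d" using 1 2 by blast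
next
  assume XN: "X \<in> cat_set \<E> e \<and> N \<in> cat_set \<E> d"
  have gr: "mat_images (verts Q) f \<in> grassmannian_prod (verts Q) e n"
    by (rule mat_images_in[OF is_homD(1)[OF f] inj])
  note st = hom_image_stable[OF X f]
  have 1: "\<exists>X\<in>cat_set \<E> e. \<exists>f'. is_hom Q (e, X) (n, M) f' \<and>
      (\<forall>i\<in>verts Q. mat_injective (f' i) \<and> mat_image (f' i) = mat_images (verts Q) f i)"
    using XN f inj by (intro bexI[of _ X] exI[of _ f]) simp_all
  have 2: "\<exists>N\<in>cat_set \<E> d. \<exists>g. is_hom Q (n, M) (d, N) g \<and>
      (\<forall>i\<in>verts Q. mat_surjective (g i) \<and> mat_kernel (g i) = mat_images (verts Q) f i)"
    using XN g surj ex by (intro bexI[of _ N] exI[of _ g]) simp_all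
  show "mat_images (verts Q) f \<in> gr_set Q \<E> e d M"
    unfolding gr_set_def using gr st 1 2 by (intro CollectI conjI)
qed

lemma gr_set_subset:
  assumes "iso_closed \<E>" shows "gr_set Q \<E> e d M \<subseteq> gr_set Q (modules Q I) e d M"
proof -
  have c: "cat_set \<E> c \<subseteq> cat_set (modules Q I) c" for c
    using assms unfolding iso_closed_def cat_set_def by blast
  show ?thesis unfolding gr_set_def
    by (intro Collect_mono impI) (elim conjE, intro conjI, assumption, assumption, (erule bexE, rule bexI, assumption, erule subsetD[OF c])+)
qed

text \<open>An inflation is the same as an injective homomorphism whose image is a point of the \<open>\<E>\<close>-Grassmannian: the cokernel
  in \<open>\<E>\<close> that an inflation requires is the quotient that the Grassmannian requires.\<close>

lemma infl_set_iff:
  assumes \<E>: "iso_closed \<E>"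
  shows "(U, f) \<in> infl_set Q \<E> e d M \<longleftrightarrow>
     U \<in> rep_set Q e \<and> f \<in> (\<Pi>\<^sub>E i\<in>verts Q. carrier_mat (n i) (e i)) \<and> (\<forall>i\<in>verts Q. mat_injective (f i)) \<and>
     (\<forall>\<alpha>\<in>arcs Q. M \<alpha> * f (tail Q \<alpha>) = f (head Q \<alpha>) * U \<alpha>) \<and> mat_images (verts Q) f \<in> gr_set Q \<E> e d M"
  (is "?L \<longleftrightarrow> ?R")
proof
  assume ?L
  then obtain N g where U: "U \<in> cat_set \<E> e" and f: "f \<in> (\<Pi>\<^sub>E i\<in>verts Q. carrier_mat (n i) (e i))"
    and inj: "\<forall>i\<in>verts Q. mat_injective (f i)" and hom: "\<forall>\<alpha>\<in>arcs Q. M \<alpha> * f (tail Q \<alpha>) = f (head Q \<alpha>) * U \<alpha>"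
    and N: "N \<in> cat_set \<E> d" and se: "short_exact Q (e, U) f (n, M) g (d, N)"
    unfolding infl_set_def by (elim CollectE case_prodE) auto
  note rU = mod_setD[OF iso_closedD[OF \<E> U]] and rN = mod_setD[OF iso_closedD[OF \<E> N]]
  have "mat_images (verts Q) f \<in> gr_set Q \<E> e d M \<longleftrightarrow> U \<in> cat_set \<E> e \<and> N \<in> cat_set \<E> d"
    by (rule gr_set_iff[OF \<E> rU rN, of f g]) (use se in \<open>simp_all add: short_exact_def\<close>)
  then show ?R using U N rU f inj hom by blast
next
  assume R: ?R
  then have rU: "U \<in> rep_set Q e" and f: "f \<in> (\<Pi>\<^sub>E i\<in>verts Q. carrier_mat (n i) (e i))"
    and inj: "\<forall>i\<in>verts Q. mat_injective (f i)" and hom: "\<forall>\<alpha>\<in>arcs Q. M \<alpha> * f (tail Q \<alpha>) = f (head Q \<alpha>) * U \<alpha>"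
    and gr: "mat_images (verts Q) f \<in> gr_set Q \<E> e d M" by blast+
  have fh: "is_hom Q (e, U) (n, M) f" unfolding is_hom_def using f hom by auto
  obtain N g where N: "N \<in> cat_set \<E> d" "is_hom Q (n, M) (d, N) g"
      "\<forall>i\<in>verts Q. mat_surjective (g i) \<and> mat_kernel (g i) = mat_images (verts Q) f i"
    using gr unfolding gr_set_def by (elim CollectE conjE bexE exE)
  note rN = mod_setD[OF iso_closedD[OF \<E> N(1)]]
  have "mat_images (verts Q) f \<in> gr_set Q \<E> e d M \<longleftrightarrow> U \<in> cat_set \<E> e \<and> N \<in> cat_set \<E> d"
    by (rule gr_set_iff[OF \<E> rU rN fh _ N(2)]) (use inj N(3) in simp_all)
  then have U: "U \<in> cat_set \<E> e" using gr by blast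
  have "short_exact Q (e, U) f (n, M) g (d, N)" unfolding short_exact_def using fh N inj by simp
  then show ?L unfolding infl_set_def using U f inj hom N(1) by blast
qed

text \<open>The matrices of \<open>M|\<^sub>U\<close> and \<open>M/U\<close> for the point \<open>U\<close> with chart coordinates \<open>a\<close>, in the bases given by the columns of
  the graph matrix and by the coordinates outside \<open>J\<close>. They describe modules iff \<open>defect J a\<close>, the obstruction to \<open>U\<close> being a
  submodule, vanishes.\<close>

definition sub_rep :: "('v \<Rightarrow> nat set) \<Rightarrow> ('v \<times> nat \<times> nat \<Rightarrow> 'k) \<Rightarrow> 'a \<Rightarrow> 'k mat" where
  "sub_rep J a = (\<lambda>\<alpha>\<in>arcs Q. sel_mat (n (head Q \<alpha>)) (J (head Q \<alpha>)) * (M \<alpha> * chart_graph n J a (tail Q \<alpha>)))"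

definition quot_rep :: "('v \<Rightarrow> nat set) \<Rightarrow> ('v \<times> nat \<times> nat \<Rightarrow> 'k) \<Rightarrow> 'a \<Rightarrow> 'k mat" where
  "quot_rep J a = (\<lambda>\<alpha>\<in>arcs Q. chart_cograph n J a (head Q \<alpha>) * (M \<alpha> * cosel_mat (n (tail Q \<alpha>)) (J (tail Q \<alpha>))))"

definition defect :: "('v \<Rightarrow> nat set) \<Rightarrow> ('v \<times> nat \<times> nat \<Rightarrow> 'k) \<Rightarrow> 'a \<Rightarrow> 'k mat" where
  "defect J a \<alpha> = chart_cograph n J a (head Q \<alpha>) * (M \<alpha> * chart_graph n J a (tail Q \<alpha>))"

context
  fixes J assumes J: "valid J"
begin

lemma chart_carriers:
  assumes "i \<in> verts Q"
  shows "sel_mat (n i) (J i) \<in> carrier_mat (e i) (n i)" "cosel_mat (n i) (J i) \<in> carrier_mat (n i) (d i)"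
    "chart_graph n J a i \<in> carrier_mat (n i) (e i)" "chart_cograph n J a i \<in> carrier_mat (d i) (n i)"
  unfolding chart_graph_def chart_cograph_def
  by (rule split_carrier[OF validD[OF J assms] refl])+

lemma sub_rep_rep: "sub_rep J a \<in> rep_set Q e"
  unfolding rep_set_def sub_rep_def
  by (intro restrict_PiE_iff[THEN iffD2] ballI mult_carrier_mat[OF chart_carriers(1)] mult_carrier_mat[OF rep_setD[OF M_rep]] chart_carriers(3))
     auto

lemma quot_rep_rep: "quot_rep J a \<in> rep_set Q d"
  unfolding rep_set_def quot_rep_def
  by (intro restrict_PiE_iff[THEN iffD2] ballI mult_carrier_mat[OF chart_carriers(4)] mult_carrier_mat[OF rep_setD[OF M_rep]] chart_carriers(2))
     auto

lemma chart_kernel: "i \<in> verts Q \<Longrightarrow> mat_kernel (chart_cograph n J a i) = mat_image (chart_graph n J a i)"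
proof -
  assume i: "i \<in> verts Q"
  note Ji = validD[OF J i] refl
  show ?thesis unfolding chart_graph_def chart_cograph_def
    by (rule trans[OF mat_kernel[OF split_carrier(4)[OF Ji]] graph_image[OF Ji, symmetric]])
qed

lemma chart_cograph_surjective: "i \<in> verts Q \<Longrightarrow> mat_surjective (chart_cograph n J a i)"
  unfolding chart_cograph_def by (rule cograph_surjective[OF validD[OF J] refl])

lemma chart_graph_injective: "i \<in> verts Q \<Longrightarrow> mat_injective (chart_graph n J a i)"
  unfolding chart_graph_def by (rule graph_injective[OF validD[OF J] refl])

text \<open>Insert the decomposition of the identity from \<open>graph_sel_cosel_cograph\<close> to the left of \<open>M \<alpha> F\<close> and to the right of
  \<open>G M \<alpha>\<close>; one of the two summands contains the vanishing product \<open>G M \<alpha> F\<close> each time.\<close>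

lemma defect_homs:
  assumes def: "\<And>\<alpha>. \<alpha> \<in> arcs Q \<Longrightarrow> defect J a \<alpha> = 0\<^sub>m (d (head Q \<alpha>)) (e (tail Q \<alpha>))"
  shows "is_hom Q (e, sub_rep J a) (n, M) (chart_graph n J a)"
    and "is_hom Q (n, M) (d, quot_rep J a) (chart_cograph n J a)"
proof -
  have "M \<alpha> * chart_graph n J a (tail Q \<alpha>) = chart_graph n J a (head Q \<alpha>) * sub_rep J a \<alpha> \<and>
      quot_rep J a \<alpha> * chart_cograph n J a (tail Q \<alpha>) = chart_cograph n J a (head Q \<alpha>) * M \<alpha>" if \<alpha>: "\<alpha> \<in> arcs Q" for \<alpha>
  proof
    let ?t = "tail Q \<alpha>" and ?h = "head Q \<alpha>"
    have t: "?t \<in> verts Q" and h: "?h \<in> verts Q" using \<alpha> by auto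
    let ?Fh = "chart_graph n J a ?h" and ?Ft = "chart_graph n J a ?t" and ?Gh = "chart_cograph n J a ?h" and ?Gt = "chart_cograph n J a ?t"
    let ?Ph = "sel_mat (n ?h) (J ?h) :: 'k mat" and ?Rh = "cosel_mat (n ?h) (J ?h) :: 'k mat"
    let ?Pt = "sel_mat (n ?t) (J ?t) :: 'k mat" and ?Rt = "cosel_mat (n ?t) (J ?t) :: 'k mat"
    note Ma = rep_setD[OF M_rep \<alpha>]
    note ch = chart_carriers(1,2)[OF h] chart_carriers(3,4)[OF h, of a] and ct = chart_carriers(1,2)[OF t] chart_carriers(3,4)[OF t, of a]
    have one_h: "?Fh * ?Ph + ?Rh * ?Gh = 1\<^sub>m (n ?h)" and one_t: "?Ft * ?Pt + ?Rt * ?Gt = 1\<^sub>m (n ?t)"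
      unfolding chart_graph_def chart_cograph_def
      by (rule graph_sel_cosel_cograph[OF validD[OF J h] refl], rule graph_sel_cosel_cograph[OF validD[OF J t] refl])
    have zero: "?Gh * (M \<alpha> * ?Ft) = 0\<^sub>m (d ?h) (e ?t)" using def[OF \<alpha>] unfolding defect_def .
    let ?X = "M \<alpha> * ?Ft"
    have X: "?X \<in> carrier_mat (n ?h) (e ?t)" by (rule mult_carrier_mat[OF Ma ct(3)])
    have "?X = (?Fh * ?Ph + ?Rh * ?Gh) * ?X" unfolding one_h by (rule left_mult_one_mat[OF X, symmetric])
    also have "\<dots> = ?Fh * ?Ph * ?X + ?Rh * ?Gh * ?X"
      by (rule add_mult_distrib_mat[OF mult_carrier_mat[OF ch(3,1)] mult_carrier_mat[OF ch(2,4)] X])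
    also have "?Rh * ?Gh * ?X = ?Rh * (?Gh * ?X)" by (rule assoc_mult_mat[OF ch(2,4) X])
    also have "\<dots> = 0\<^sub>m (n ?h) (e ?t)" unfolding zero by (rule right_mult_zero_mat[OF ch(2)])
    also have "?Fh * ?Ph * ?X = ?Fh * (?Ph * ?X)" by (rule assoc_mult_mat[OF ch(3,1) X])
    also have "?Fh * (?Ph * ?X) + 0\<^sub>m (n ?h) (e ?t) = ?Fh * (?Ph * ?X)"
      by (rule right_add_zero_mat[OF mult_carrier_mat[OF ch(3) mult_carrier_mat[OF ch(1) X]]])
    finally have X_eq: "?X = ?Fh * (?Ph * ?X)" .
    have "sub_rep J a \<alpha> = ?Ph * ?X" unfolding sub_rep_def using \<alpha> by (rule restrict_apply')
    with X_eq show "?X = ?Fh * sub_rep J a \<alpha>" by metis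
    let ?Y = "?Gh * M \<alpha>"
    have Y: "?Y \<in> carrier_mat (d ?h) (n ?t)" by (rule mult_carrier_mat[OF ch(4) Ma])
    have "?Y = ?Y * (?Ft * ?Pt + ?Rt * ?Gt)" unfolding one_t by (rule right_mult_one_mat[OF Y, symmetric])
    also have "\<dots> = ?Y * (?Ft * ?Pt) + ?Y * (?Rt * ?Gt)"
      by (rule mult_add_distrib_mat[OF Y mult_carrier_mat[OF ct(3,1)] mult_carrier_mat[OF ct(2,4)]])
    also have "?Y * (?Ft * ?Pt) = ?Y * ?Ft * ?Pt" by (rule assoc_mult_mat[OF Y ct(3,1), symmetric])
    also have "?Y * ?Ft = 0\<^sub>m (d ?h) (e ?t)" using assoc_mult_mat[OF ch(4) Ma ct(3)] zero by simp
    also have "0\<^sub>m (d ?h) (e ?t) * ?Pt = 0\<^sub>m (d ?h) (n ?t)" by (rule left_mult_zero_mat[OF ct(1)])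
    also have "?Y * (?Rt * ?Gt) = ?Y * ?Rt * ?Gt" by (rule assoc_mult_mat[OF Y ct(2,4), symmetric])
    also have "?Y * ?Rt = ?Gh * (M \<alpha> * ?Rt)" by (rule assoc_mult_mat[OF ch(4) Ma ct(2)])
    also have "0\<^sub>m (d ?h) (n ?t) + ?Gh * (M \<alpha> * ?Rt) * ?Gt = ?Gh * (M \<alpha> * ?Rt) * ?Gt"
      by (rule left_add_zero_mat[OF mult_carrier_mat[OF mult_carrier_mat[OF ch(4) mult_carrier_mat[OF Ma ct(2)]] ct(4)]])
    finally have Y_eq: "?Y = ?Gh * (M \<alpha> * ?Rt) * ?Gt" .
    have "quot_rep J a \<alpha> = ?Gh * (M \<alpha> * ?Rt)" unfolding quot_rep_def using \<alpha> by (rule restrict_apply')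
    with Y_eq show "quot_rep J a \<alpha> * ?Gt = ?Y" by metis
  qed
  then show "is_hom Q (e, sub_rep J a) (n, M) (chart_graph n J a)" "is_hom Q (n, M) (d, quot_rep J a) (chart_cograph n J a)"
    unfolding is_hom_def fst_conv snd_conv by (intro conjI ballI chart_carriers, simp_all)+
qed

lemma stable_defect:
  assumes st: "\<forall>\<alpha>\<in>arcs Q. \<forall>w\<in>chart (verts Q) n J a (tail Q \<alpha>). M \<alpha> *\<^sub>v w \<in> chart (verts Q) n J a (head Q \<alpha>)"
    and \<alpha>: "\<alpha> \<in> arcs Q"
  shows "defect J a \<alpha> = 0\<^sub>m (d (head Q \<alpha>)) (e (tail Q \<alpha>))"
proof (rule mat_col_eqI)
  let ?t = "tail Q \<alpha>" and ?h = "head Q \<alpha>"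
  have t: "?t \<in> verts Q" and h: "?h \<in> verts Q" using \<alpha> by auto
  note Ma = rep_setD[OF M_rep \<alpha>]
  note ch = chart_carriers(1,2)[OF h] chart_carriers(3,4)[OF h, of a] and ct = chart_carriers(1,2)[OF t] chart_carriers(3,4)[OF t, of a]
  have MF: "M \<alpha> * chart_graph n J a ?t \<in> carrier_mat (n ?h) (e ?t)" by (rule mult_carrier_mat[OF Ma ct(3)])
  have D: "defect J a \<alpha> \<in> carrier_mat (d ?h) (e ?t)" unfolding defect_def by (rule mult_carrier_mat[OF ch(4) MF])
  show "dim_row (defect J a \<alpha>) = dim_row (0\<^sub>m (d ?h) (e ?t))" "dim_col (defect J a \<alpha>) = dim_col (0\<^sub>m (d ?h) (e ?t))"
    using D by auto
  fix j assume "j < dim_col (0\<^sub>m (d ?h) (e ?t) :: 'k mat)"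
  then have j: "j < e ?t" by simp
  let ?u = "unit_vec (e ?t) j"
  have u: "?u \<in> carrier_vec (e ?t)" by simp
  have "chart_graph n J a ?t *\<^sub>v ?u \<in> chart (verts Q) n J a ?t"
    unfolding chart_eq[OF J] using t ct(3) by auto
  then have "M \<alpha> *\<^sub>v (chart_graph n J a ?t *\<^sub>v ?u) \<in> mat_image (chart_graph n J a ?h)"
    using st \<alpha> h unfolding chart_eq[OF J] by fastforce
  then have "M \<alpha> *\<^sub>v (chart_graph n J a ?t *\<^sub>v ?u) \<in> mat_kernel (chart_cograph n J a ?h)"
    unfolding chart_kernel[OF h] .
  then have z: "chart_cograph n J a ?h *\<^sub>v (M \<alpha> *\<^sub>v (chart_graph n J a ?t *\<^sub>v ?u)) = 0\<^sub>v (d ?h)"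
    by (rule mat_kernelD(2)[OF ch(4)])
  have "col (defect J a \<alpha>) j = defect J a \<alpha> *\<^sub>v ?u" by (rule mult_unit_vec[OF D j, symmetric])
  also have "\<dots> = chart_cograph n J a ?h *\<^sub>v (M \<alpha> * chart_graph n J a ?t *\<^sub>v ?u)"
    unfolding defect_def by (rule assoc_mult_mat_vec[OF ch(4) MF u])
  also have "M \<alpha> * chart_graph n J a ?t *\<^sub>v ?u = M \<alpha> *\<^sub>v (chart_graph n J a ?t *\<^sub>v ?u)"
    by (rule assoc_mult_mat_vec[OF Ma ct(3) u])
  finally show "col (defect J a \<alpha>) j = col (0\<^sub>m (d ?h) (e ?t)) j" using z j by simp
qed

text \<open>Thus the quiver Grassmannian is closed in each chart. Submodules and quotients of \<open>M\<close>
  inherit the relations in \<open>I\<close>, so stability under the arrows is the only condition.\<close>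

lemma chart_gr_set_modules_iff:
  "chart (verts Q) n J a \<in> gr_set Q (modules Q I) e d M \<longleftrightarrow>
     (\<forall>\<alpha>\<in>arcs Q. defect J a \<alpha> = 0\<^sub>m (d (head Q \<alpha>)) (e (tail Q \<alpha>)))"
proof
  assume "chart (verts Q) n J a \<in> gr_set Q (modules Q I) e d M"
  then have "\<forall>\<alpha>\<in>arcs Q. \<forall>w\<in>chart (verts Q) n J a (tail Q \<alpha>). M \<alpha> *\<^sub>v w \<in> chart (verts Q) n J a (head Q \<alpha>)"
    unfolding gr_set_def by blast
  then show "\<forall>\<alpha>\<in>arcs Q. defect J a \<alpha> = 0\<^sub>m (d (head Q \<alpha>)) (e (tail Q \<alpha>))" using stable_defect by blast
next
  assume "\<forall>\<alpha>\<in>arcs Q. defect J a \<alpha> = 0\<^sub>m (d (head Q \<alpha>)) (e (tail Q \<alpha>))"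
  then have h: "is_hom Q (e, sub_rep J a) (n, M) (chart_graph n J a)" "is_hom Q (n, M) (d, quot_rep J a) (chart_cograph n J a)"
    using defect_homs by blast+
  have "sub_rep J a \<in> mod_set Q I e" by (rule submodule_mod_set[OF sub_rep_rep h(1) chart_graph_injective])
  moreover have "quot_rep J a \<in> mod_set Q I d" by (rule quotient_mod_set[OF quot_rep_rep h(2) chart_cograph_surjective])
  ultimately show "chart (verts Q) n J a \<in> gr_set Q (modules Q I) e d M"
    unfolding chart_eq[OF J]
    by (intro iffD2[OF gr_set_iff[OF iso_closed_modules sub_rep_rep quot_rep_rep h(1) chart_graph_injective h(2) chart_cograph_surjective chart_kernel]])
       (simp_all add: cat_set_def modules_def)
qed

lemma chart_gr_set:
  assumes U: "chart (verts Q) n J a \<in> gr_set Q (modules Q I) e d M"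
  shows "sub_rep J a \<in> mod_set Q I e" "quot_rep J a \<in> mod_set Q I d"
    and "is_hom Q (e, sub_rep J a) (n, M) (chart_graph n J a)"
    and "iso_closed \<E> \<Longrightarrow> chart (verts Q) n J a \<in> gr_set Q \<E> e d M \<longleftrightarrow> sub_rep J a \<in> cat_set \<E> e \<and> quot_rep J a \<in> cat_set \<E> d"
proof -
  have h: "is_hom Q (e, sub_rep J a) (n, M) (chart_graph n J a)" "is_hom Q (n, M) (d, quot_rep J a) (chart_cograph n J a)"
    using defect_homs U unfolding chart_gr_set_modules_iff by blast+
  show "is_hom Q (e, sub_rep J a) (n, M) (chart_graph n J a)" by (rule h(1))
  show "sub_rep J a \<in> mod_set Q I e" by (rule submodule_mod_set[OF sub_rep_rep h(1) chart_graph_injective])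
  show "quot_rep J a \<in> mod_set Q I d" by (rule quotient_mod_set[OF quot_rep_rep h(2) chart_cograph_surjective])
  show "chart (verts Q) n J a \<in> gr_set Q \<E> e d M \<longleftrightarrow> sub_rep J a \<in> cat_set \<E> e \<and> quot_rep J a \<in> cat_set \<E> d" if "iso_closed \<E>"
    unfolding chart_eq[OF J]
    by (rule gr_set_iff[OF that sub_rep_rep quot_rep_rep h(1) chart_graph_injective h(2) chart_cograph_surjective chart_kernel])
qed

end

end

section \<open>The action of the general linear groups\<close>

text \<open>Invertibility of the maps comes from the action of the inverse group elements.\<close>

lemma group_actionI:
  assumes G: "group G" and ext: "\<And>g. g \<in> carrier G \<Longrightarrow> act g \<in> extensional S"
    and cl: "\<And>g x. g \<in> carrier G \<Longrightarrow> x \<in> S \<Longrightarrow> act g x \<in> S"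
    and one: "\<And>x. x \<in> S \<Longrightarrow> act \<one>\<^bsub>G\<^esub> x = x"
    and mult: "\<And>g h x. g \<in> carrier G \<Longrightarrow> h \<in> carrier G \<Longrightarrow> x \<in> S \<Longrightarrow> act (g \<otimes>\<^bsub>G\<^esub> h) x = act g (act h x)"
  shows "group_action G S act"
proof -
  interpret G: group G by (rule G)
  have bij: "act g \<in> Bij S" if g: "g \<in> carrier G" for g
  proof -
    have ig: "inv\<^bsub>G\<^esub> g \<in> carrier G" using g by simp
    have "bij_betw (act g) S S"
    proof (rule bij_betw_byWitness[of S "act (inv\<^bsub>G\<^esub> g)"])
      show "\<forall>x\<in>S. act (inv\<^bsub>G\<^esub> g) (act g x) = x" using mult[OF ig g] one G.l_inv[OF g] by simp
      show "\<forall>x\<in>S. act g (act (inv\<^bsub>G\<^esub> g) x) = x" using mult[OF g ig] one G.r_inv[OF g] by simp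
    qed (use cl g ig in auto)
    then show ?thesis using ext[OF g] by (simp add: Bij_def)
  qed
  have "act \<in> hom G (BijGroup S)"
  proof (rule homI)
    show "act g \<in> carrier (BijGroup S)" if "g \<in> carrier G" for g using bij[OF that] by (simp add: BijGroup_def)
    fix g h assume g: "g \<in> carrier G" and h: "h \<in> carrier G"
    have "act (g \<otimes>\<^bsub>G\<^esub> h) = compose S (act g) (act h)"
    proof (rule extensionalityI[of _ S])
      show "act (g \<otimes>\<^bsub>G\<^esub> h) \<in> extensional S" by (rule ext) (use g h in simp)
      show "act (g \<otimes>\<^bsub>G\<^esub> h) x = compose S (act g) (act h) x" if "x \<in> S" for x
        using mult[OF g h that] that by (simp add: compose_def)
    qed (simp add: compose_def)
    then show "act (g \<otimes>\<^bsub>G\<^esub> h) = act g \<otimes>\<^bsub>BijGroup S\<^esub> act h"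
      using bij[OF g] bij[OF h] by (simp add: BijGroup_def)
  qed
  then show ?thesis
    unfolding group_action_def group_hom_def group_hom_axioms_def using G group_BijGroup by blast
qed

abbreviation ginv :: "('v \<Rightarrow> 'k::field mat) \<Rightarrow> 'v \<Rightarrow> 'k mat" where
  "ginv g i \<equiv> the (mat_inverse (g i))"

lemma the_mat_inverse_eq:
  fixes A :: "'k::field mat"
  assumes A: "A \<in> carrier_mat m m" and B: "B \<in> carrier_mat m m" and AB: "A * B = 1\<^sub>m m"
  shows "the (mat_inverse A) = B"
proof -
  have "invertible_mat A" using inverse_mat_det[OF A B AB] invertible_mat_iff_det[OF A] by simp
  note C = the_mat_inverse[OF A this]
  have "the (mat_inverse A) = the (mat_inverse A) * (A * B)" unfolding AB by (rule right_mult_one_mat[OF C(1), symmetric])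
  also have "\<dots> = the (mat_inverse A) * A * B" by (rule assoc_mult_mat[OF C(1) A B, symmetric])
  also have "\<dots> = B" unfolding C(3) by (rule left_mult_one_mat[OF B])
  finally show ?thesis .
qed

lemma GL_groupD:
  assumes "g \<in> carrier (GL_group Q e)" "i \<in> verts Q"
  shows "g i \<in> carrier_mat (e i) (e i)" "det (g i) \<noteq> 0" "ginv g i \<in> carrier_mat (e i) (e i)"
    "g i * ginv g i = 1\<^sub>m (e i)" "ginv g i * g i = 1\<^sub>m (e i)" "det (ginv g i) \<noteq> 0"
proof -
  have g: "g i \<in> carrier_mat (e i) (e i)" "invertible_mat (g i)" using assms by (auto simp: GL_group_def)
  show "g i \<in> carrier_mat (e i) (e i)" by (rule g(1))
  show "det (g i) \<noteq> 0" using g invertible_mat_iff_det by blast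
  note inv = the_mat_inverse[OF g]
  show "ginv g i \<in> carrier_mat (e i) (e i)" "g i * ginv g i = 1\<^sub>m (e i)" "ginv g i * g i = 1\<^sub>m (e i)" by (fact inv)+
  show "det (ginv g i) \<noteq> 0" by (rule inverse_mat_det[OF inv(1) g(1) inv(3)])
qed

lemma GL_groupI:
  assumes "\<And>i. i \<in> verts Q \<Longrightarrow> g i \<in> carrier_mat (e i) (e i)" "\<And>i. i \<in> verts Q \<Longrightarrow> det (g i) \<noteq> 0"
  shows "restrict g (verts Q) \<in> carrier (GL_group Q e)"
  using assms invertible_mat_iff_det[OF assms(1)] by (auto simp: GL_group_def)

lemma GL_mult: "g \<otimes>\<^bsub>GL_group Q e\<^esub> h = (\<lambda>i\<in>verts Q. g i * h i)"
  by (simp add: GL_group_def)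

lemma GL_one: "\<one>\<^bsub>GL_group Q e\<^esub> = (\<lambda>i\<in>verts Q. 1\<^sub>m (e i))"
  by (simp add: GL_group_def)

lemma GL_ext: "g \<in> carrier (GL_group Q e) \<Longrightarrow> g \<in> extensional (verts Q)"
  by (auto simp: GL_group_def PiE_iff)

lemma group_GL_group: "group (GL_group Q e :: ('v \<Rightarrow> 'k::field mat) monoid)"
proof (rule groupI)
  let ?G = "GL_group Q e :: ('v \<Rightarrow> 'k mat) monoid"
  show "\<one>\<^bsub>?G\<^esub> \<in> carrier ?G" unfolding GL_one by (rule GL_groupI) simp_all
  fix g :: "'v \<Rightarrow> 'k mat" assume g: "g \<in> carrier ?G"
  show "\<one>\<^bsub>?G\<^esub> \<otimes>\<^bsub>?G\<^esub> g = g"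
    unfolding GL_mult GL_one
    by (rule extensionalityI[of _ "verts Q"]) (use GL_ext[OF g] left_mult_one_mat[OF GL_groupD(1)[OF g]] in simp_all)
  have "restrict (ginv g) (verts Q) \<in> carrier ?G"
    by (rule GL_groupI) (use GL_groupD(3,6)[OF g] in simp_all)
  moreover have "restrict (ginv g) (verts Q) \<otimes>\<^bsub>?G\<^esub> g = \<one>\<^bsub>?G\<^esub>"
    unfolding GL_mult GL_one by (rule restrict_ext) (use GL_groupD(5)[OF g] in simp)
  ultimately show "\<exists>h\<in>carrier ?G. h \<otimes>\<^bsub>?G\<^esub> g = \<one>\<^bsub>?G\<^esub>" by (intro bexI)
  fix h :: "'v \<Rightarrow> 'k mat" assume h: "h \<in> carrier ?G"
  show "g \<otimes>\<^bsub>?G\<^esub> h \<in> carrier ?G" unfolding GL_mult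
  proof (rule GL_groupI)
    fix i assume i: "i \<in> verts Q"
    show "g i * h i \<in> carrier_mat (e i) (e i)" by (rule mult_carrier_mat[OF GL_groupD(1)[OF g i] GL_groupD(1)[OF h i]])
    show "det (g i * h i) \<noteq> 0"
      unfolding det_mult[OF GL_groupD(1)[OF g i] GL_groupD(1)[OF h i]] using GL_groupD(2)[OF g i] GL_groupD(2)[OF h i] by simp
  qed
  fix k :: "'v \<Rightarrow> 'k mat" assume k: "k \<in> carrier ?G"
  show "g \<otimes>\<^bsub>?G\<^esub> h \<otimes>\<^bsub>?G\<^esub> k = g \<otimes>\<^bsub>?G\<^esub> (h \<otimes>\<^bsub>?G\<^esub> k)"
    unfolding GL_mult
  proof (rule restrict_ext)
    fix i assume i: "i \<in> verts Q"
    show "(\<lambda>i\<in>verts Q. g i * h i) i * k i = g i * (\<lambda>i\<in>verts Q. h i * k i) i"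
      using assoc_mult_mat[OF GL_groupD(1)[OF g i] GL_groupD(1)[OF h i] GL_groupD(1)[OF k i]] i by simp
  qed
qed

lemma ginv_mult:
  assumes g: "g \<in> carrier (GL_group Q e)" and h: "h \<in> carrier (GL_group Q e)" and i: "i \<in> verts Q"
  shows "ginv (g \<otimes>\<^bsub>GL_group Q e\<^esub> h) i = ginv h i * ginv g i"
proof -
  note gi = GL_groupD[OF g i] and hi = GL_groupD[OF h i]
  have "g i * h i * (ginv h i * ginv g i) = g i * (h i * (ginv h i * ginv g i))"
    by (rule assoc_mult_mat[OF gi(1) hi(1) mult_carrier_mat[OF hi(3) gi(3)]])
  also have "h i * (ginv h i * ginv g i) = h i * ginv h i * ginv g i" by (rule assoc_mult_mat[OF hi(1,3) gi(3), symmetric])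
  also have "\<dots> = ginv g i" unfolding hi(4) by (rule left_mult_one_mat[OF gi(3)])
  also have "g i * ginv g i = 1\<^sub>m (e i)" by (rule gi(4))
  finally show ?thesis
    using the_mat_inverse_eq[OF mult_carrier_mat[OF gi(1) hi(1)] mult_carrier_mat[OF hi(3) gi(3)]] i by (simp add: GL_mult)
qed

section \<open>The quotient of the inflations\<close>

locale inflation_setup = grassmannian_setup Q e d I M
  for Q :: "('v, 'a) pre_digraph" and e d :: "'v \<Rightarrow> nat"
    and I :: "(('v, 'a) path \<Rightarrow>\<^sub>0 'k::field) set" and M :: "'a \<Rightarrow> 'k mat" +
  fixes \<E> :: "('v, 'a, 'k) rep set"
  assumes closed: "iso_closed \<E>" and open_cat: "open_subcategory Q I \<E>"
begin

abbreviation (input) "Gr \<equiv> grassmannian_prod_variety (verts Q) e n :: ('v \<Rightarrow> 'k vec set, 'k) kspace"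
abbreviation (input) "QGr \<equiv> quiver_grassmannian Q I e d M"
abbreviation (input) "CGr \<equiv> cat_grassmannian Q I \<E> e d M"
abbreviation (input) "Infl \<equiv> infl_variety Q \<E> e d M"
abbreviation (input) "Q_set \<equiv> gr_set Q (modules Q I) e d M"
abbreviation (input) "C_set \<equiv> gr_set Q \<E> e d M"
abbreviation (input) "W J \<equiv> chart_domain (verts Q) n J :: ('v \<Rightarrow> 'k vec set) set"
abbreviation (input) "co J \<equiv> chart_coords (verts Q) n J"
abbreviation (input) "Aff J \<equiv> affine_space (chart_index (verts Q) n J) :: ('v \<times> nat \<times> nat \<Rightarrow> 'k, 'k) kspace"

lemma Q_set_subset: "Q_set \<subseteq> grassmannian_prod (verts Q) e n" unfolding gr_set_def by blast

lemma C_set_subset: "C_set \<subseteq> Q_set" by (rule gr_set_subset[OF closed])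

lemma swf_QGr: "space_with_functions QGr" unfolding quiver_grassmannian_def by (rule swf_induced[OF swf_Gr])

lemma swf_CGr: "space_with_functions CGr" unfolding cat_grassmannian_def by (rule swf_induced[OF swf_QGr])

lemma pts_QGr: "pts QGr = Q_set" unfolding quiver_grassmannian_def using Q_set_subset by (simp add: pts_Gr Int_absorb1)

lemma pts_CGr: "pts CGr = C_set" unfolding cat_grassmannian_def using C_set_subset by (simp add: pts_QGr Int_absorb1)

lemma CGr_into_Gr: "is_morphism CGr Gr (\<lambda>U. U)"
  unfolding cat_grassmannian_def quiver_grassmannian_def
  using is_morphism_comp[OF is_morphism_inclusion is_morphism_inclusion] .

lemma openin_CGr_chart: "valid J \<Longrightarrow> openin (zar CGr) (C_set \<inter> W J)"
  using is_morphismD_open[OF CGr_into_Gr openin_chart_domain] unfolding pts_CGr Int_def by simp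

lemma into_CGr:
  assumes Z: "space_with_functions Z" and \<phi>: "is_morphism Z Gr \<phi>" and C: "\<And>z. z \<in> pts Z \<Longrightarrow> \<phi> z \<in> C_set"
  shows "is_morphism Z CGr \<phi>"
  unfolding cat_grassmannian_def quiver_grassmannian_def
  by (intro is_morphism_into_induced[OF Z] \<phi> C) (use C C_set_subset in blast)

lemma sub_quot_reg:
  assumes J: "valid J" and \<alpha>: "\<alpha> \<in> arcs Q"
  shows "reg_mat Gr (W J) (e (head Q \<alpha>)) (e (tail Q \<alpha>)) (\<lambda>U. sub_rep J (co J U) \<alpha>)"
    and "reg_mat Gr (W J) (d (head Q \<alpha>)) (d (tail Q \<alpha>)) (\<lambda>U. quot_rep J (co J U) \<alpha>)"
proof -
  have t: "tail Q \<alpha> \<in> verts Q" and h: "head Q \<alpha> \<in> verts Q" using \<alpha> by auto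
  note o = openin_chart_domain[OF J] and S = swf_Gr
  note c = reg_mat_const[OF S o]
  have eq: "sub_rep J a \<alpha> = sel_mat (n (head Q \<alpha>)) (J (head Q \<alpha>)) * (M \<alpha> * chart_graph n J a (tail Q \<alpha>))"
    "quot_rep J a \<alpha> = chart_cograph n J a (head Q \<alpha>) * (M \<alpha> * cosel_mat (n (tail Q \<alpha>)) (J (tail Q \<alpha>)))" for a
    using \<alpha> by (simp_all add: sub_rep_def quot_rep_def)
  show "reg_mat Gr (W J) (e (head Q \<alpha>)) (e (tail Q \<alpha>)) (\<lambda>U. sub_rep J (co J U) \<alpha>)"
    unfolding eq
    by (rule reg_mat_mult[OF S o c[OF chart_carriers(1)[OF J h]] reg_mat_mult[OF S o c[OF rep_setD[OF M_rep \<alpha>]] chart_matrices_reg(1)[OF J t]]])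
  show "reg_mat Gr (W J) (d (head Q \<alpha>)) (d (tail Q \<alpha>)) (\<lambda>U. quot_rep J (co J U) \<alpha>)"
    unfolding eq
    by (rule reg_mat_mult[OF S o chart_matrices_reg(2)[OF J h] reg_mat_mult[OF S o c[OF rep_setD[OF M_rep \<alpha>]] c[OF chart_carriers(2)[OF J t]]]])
qed

lemma chart_point:
  assumes J: "valid J" and U: "U \<in> Q_set" "U \<in> W J"
  shows "sub_rep J (co J U) \<in> mod_set Q I e" "quot_rep J (co J U) \<in> mod_set Q I d"
    "is_hom Q (e, sub_rep J (co J U)) (n, M) (chart_graph n J (co J U))"
    "U \<in> C_set \<longleftrightarrow> sub_rep J (co J U) \<in> cat_set \<E> e \<and> quot_rep J (co J U) \<in> cat_set \<E> d"
proof -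
  note ch = chart_chart_coords(1)[OF J U(2)]
  have "chart (verts Q) n J (co J U) \<in> Q_set" unfolding ch by (rule U(1))
  note * = chart_gr_set[OF J this]
  show "sub_rep J (co J U) \<in> mod_set Q I e" "quot_rep J (co J U) \<in> mod_set Q I d"
    "is_hom Q (e, sub_rep J (co J U)) (n, M) (chart_graph n J (co J U))" by (fact *)+
  show "U \<in> C_set \<longleftrightarrow> sub_rep J (co J U) \<in> cat_set \<E> e \<and> quot_rep J (co J U) \<in> cat_set \<E> d"
    using *(4)[OF closed] unfolding ch .
qed

text \<open>Matrix entries are the coordinates of the variety of modules.\<close>

lemma is_morphism_mod_variety:
  assumes Z: "space_with_functions Z" and X: "\<And>z. z \<in> pts Z \<Longrightarrow> X z \<in> mod_set Q I c"
    and reg: "\<And>\<alpha>. \<alpha> \<in> arcs Q \<Longrightarrow> reg_mat Z (pts Z) (c (head Q \<alpha>)) (c (tail Q \<alpha>)) (\<lambda>z. X z \<alpha>)"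
  shows "is_morphism Z (mod_variety Q I c) X"
  unfolding mod_variety_def
proof (rule is_morphism_into_induced[OF Z _ X])
  show "is_morphism Z (coord_space (rep_set Q c) (rep_coords Q c)) X"
  proof (rule is_morphism_coord_space[OF Z mod_setD[OF X]])
    fix f :: "('a \<Rightarrow> 'k mat) \<Rightarrow> 'k" assume "f \<in> rep_coords Q c"
    then obtain \<alpha> r s where f: "f = (\<lambda>M. M \<alpha> $$ (r, s))" "\<alpha> \<in> arcs Q" "r < c (head Q \<alpha>)" "s < c (tail Q \<alpha>)"
      unfolding rep_coords_def by (elim CollectE exE conjE)
    show "(\<lambda>z. f (X z)) \<in> reg Z (pts Z)" unfolding f(1) by (rule reg_matD(2)[OF reg[OF f(2)] f(3,4)])
  qed
qed

text \<open>In a chart, the matrices of \<open>M|\<^sub>U\<close> and \<open>M/U\<close> are morphisms to the varieties of modules, in which \<open>\<E>\<close> is open.\<close>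

lemma openin_C_set: "openin (zar QGr) C_set"
proof (subst openin_subopen, intro ballI)
  fix U assume U: "U \<in> C_set"
  then have UQ: "U \<in> Q_set" and UG: "U \<in> grassmannian_prod (verts Q) e n" using C_set_subset Q_set_subset by blast+
  from grassmannian_prod_charts[OF UG] obtain J where J: "valid J" "U \<in> W J" by (elim exE conjE)
  note oW = openin_chart_domain[OF J(1)]
  \<comment> \<open>\<open>sub_rep\<close> and \<open>quot_rep\<close> describe modules only over the submodules in the chart\<close>
  let ?Z = "induced Gr (W J \<inter> Q_set)"
  have Z: "space_with_functions ?Z" by (rule swf_induced[OF swf_Gr])
  have pZ: "pts ?Z = W J \<inter> Q_set" using Q_set_subset by (auto simp: pts_Gr)
  have ms: "is_morphism ?Z (mod_variety Q I e) (\<lambda>U. sub_rep J (co J U))"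
    by (rule is_morphism_mod_variety[OF Z]; unfold pZ)
       (use chart_point(1)[OF J(1)] in blast, rule reg_mat_into_induced[OF oW sub_quot_reg(1)[OF J(1)] Int_lower1])
  have mq: "is_morphism ?Z (mod_variety Q I d) (\<lambda>U. quot_rep J (co J U))"
    by (rule is_morphism_mod_variety[OF Z]; unfold pZ)
       (use chart_point(2)[OF J(1)] in blast, rule reg_mat_into_induced[OF oW sub_quot_reg(2)[OF J(1)] Int_lower1])
  have oE: "openin (zar (mod_variety Q I c)) (cat_set \<E> c)" for c using open_cat unfolding open_subcategory_def by blast
  have "openin (zar ?Z) ({U \<in> pts ?Z. sub_rep J (co J U) \<in> cat_set \<E> e} \<inter> {U \<in> pts ?Z. quot_rep J (co J U) \<in> cat_set \<E> d})"
    by (rule openin_Int[OF is_morphismD_open[OF ms oE] is_morphismD_open[OF mq oE]])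
  moreover have "{U \<in> pts ?Z. sub_rep J (co J U) \<in> cat_set \<E> e} \<inter> {U \<in> pts ?Z. quot_rep J (co J U) \<in> cat_set \<E> d} = W J \<inter> C_set"
    unfolding pZ using chart_point(4)[OF J(1)] C_set_subset by blast
  ultimately have "openin (zar ?Z) (W J \<inter> C_set)" by simp
  then obtain T where T: "openin (zar Gr) T" "W J \<inter> C_set = T \<inter> (W J \<inter> Q_set)"
    unfolding zar_induced openin_subtopology by blast
  have "openin (zar QGr) (T \<inter> W J \<inter> Q_set)"
    unfolding quiver_grassmannian_def zar_induced openin_subtopology using openin_Int[OF T(1) oW] by blast
  moreover have "U \<in> T \<inter> W J \<inter> Q_set" "T \<inter> W J \<inter> Q_set \<subseteq> C_set" using T(2) U UQ J(2) by blast+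
  ultimately show "\<exists>T. openin (zar QGr) T \<and> U \<in> T \<and> T \<subseteq> C_set" by blast
qed

lemma open_subvariety_CGr: "open_subvariety CGr QGr"
  unfolding open_subvariety_def pts_CGr using openin_C_set by (simp add: cat_grassmannian_def)

lemma C_set_trace: "\<exists>O'. openin (zar Gr) O' \<and> C_set = O' \<inter> Q_set"
  using openin_C_set unfolding quiver_grassmannian_def zar_induced openin_subtopology by blast

lemma affine_coords_affine_space:
  "finite K \<Longrightarrow> affine_coords (K \<rightarrow>\<^sub>E (UNIV :: 'k set)) ((\<lambda>j x. x j) ` K)"
proof (rule affine_coordsI[OF _ refl])
  show "\<exists>x\<in>K \<rightarrow>\<^sub>E UNIV. \<forall>k\<in>K. x k = y k" for y :: "_ \<Rightarrow> 'k" by (rule bexI[of _ "restrict y K"]) auto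
  show "x = x'" if "x \<in> K \<rightarrow>\<^sub>E UNIV" "x' \<in> K \<rightarrow>\<^sub>E UNIV" "\<And>k. k \<in> K \<Longrightarrow> x k = x' k" for x x' :: "_ \<Rightarrow> 'k"
    by (rule PiE_ext[OF that])
qed

lemma finite_chart_index: "valid J \<Longrightarrow> finite (chart_index (verts Q) n J)"
  unfolding chart_index_def using finite_subset[OF validD(1)] finV by (intro finite_SigmaI finite_cartesian_product) auto

lemma closedin_chart_Q_set:
  assumes J: "valid J"
  shows "closedin (zar (Aff J)) {a \<in> pts (Aff J). chart (verts Q) n J a \<in> Q_set}"
proof -
  have S: "space_with_functions (Aff J)" by (rule swf_affine_space)
  have def: "reg_mat (Aff J) (pts (Aff J)) (d (head Q \<alpha>)) (e (tail Q \<alpha>)) (\<lambda>a. defect J a \<alpha>)" if \<alpha>: "\<alpha> \<in> arcs Q" for \<alpha>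
  proof -
    have t: "tail Q \<alpha> \<in> verts Q" and h: "head Q \<alpha> \<in> verts Q" using \<alpha> by auto
    note c = reg_mat_const[OF S openin_topspace]
    have g: "reg_mat (Aff J) (pts (Aff J)) (d (head Q \<alpha>)) (n (head Q \<alpha>)) (\<lambda>a. chart_cograph n J a (head Q \<alpha>))"
      unfolding chart_cograph_def
      by (rule reg_mat_graph(2)[OF S openin_topspace validD[OF J h] refl])
         (rule affine_space_coord[OF _ openin_topspace], use h in \<open>simp add: chart_index_def\<close>)
    show ?thesis unfolding defect_def
      by (rule reg_mat_mult[OF S openin_topspace g reg_mat_mult[OF S openin_topspace c[OF rep_setD[OF M_rep \<alpha>]] chart_graph_reg[OF J t]]])
  qed
  have "openin (zar (Aff J)) (\<Union>\<alpha>\<in>arcs Q. {a \<in> pts (Aff J). defect J a \<alpha> \<noteq> 0\<^sub>m (d (head Q \<alpha>)) (e (tail Q \<alpha>))})"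
    by (rule openin_Union, clarify)
       (rule openin_mat_differ[OF S openin_topspace def reg_mat_const[OF S openin_topspace zero_carrier_mat]])
  moreover have "(\<Union>\<alpha>\<in>arcs Q. {a \<in> pts (Aff J). defect J a \<alpha> \<noteq> 0\<^sub>m (d (head Q \<alpha>)) (e (tail Q \<alpha>))}) =
      pts (Aff J) - {a \<in> pts (Aff J). chart (verts Q) n J a \<in> Q_set}"
    unfolding chart_gr_set_modules_iff[OF J] by blast
  ultimately show ?thesis unfolding closedin_def by simp
qed

text \<open>The chart identifies this piece of the Grassmannian with a subset of affine space that is open in a closed subset: open by
  \<open>openin_C_set\<close>, closed by the vanishing of the defects.\<close>

lemma affine_covered_chart:
  assumes J: "valid J"
  shows "affine_covered (induced CGr (C_set \<inter> W J))"
proof -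
  obtain O' where O': "openin (zar Gr) O'" "C_set = O' \<inter> Q_set" using C_set_trace by blast
  let ?O = "{a \<in> pts (Aff J). chart (verts Q) n J a \<in> O'}" and ?C = "{a \<in> pts (Aff J). chart (verts Q) n J a \<in> Q_set}"
  have "openin (zar (Aff J)) ?O" by (rule is_morphismD_open[OF is_morphism_Gr_chart[OF J] O'(1)])
  then have cov: "affine_covered (induced (Aff J) (?O \<inter> ?C))"
    using closedin_chart_Q_set[OF J] unfolding affine_space_def
    by (intro affine_covered_locally_closed affine_coords_affine_space finite_chart_index[OF J])
  have OC: "?O \<inter> ?C = {a \<in> pts (Aff J). chart (verts Q) n J a \<in> C_set}" using O'(2) by blast
  let ?Y = "induced CGr (C_set \<inter> W J)" and ?A = "induced (Aff J) (?O \<inter> ?C)"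
  have Y: "space_with_functions ?Y" by (rule swf_induced[OF swf_CGr])
  have A: "space_with_functions ?A" by (rule swf_induced[OF swf_affine_space])
  have pY: "pts ?Y = C_set \<inter> W J" using pts_CGr by auto
  have pA: "pts ?A = {a \<in> pts (Aff J). chart (verts Q) n J a \<in> C_set}" unfolding OC by auto
  have "isomorphic ?Y ?A"
  proof (rule isomorphicI[of _ _ "co J" "chart (verts Q) n J"])
    have "is_morphism ?Y (induced Gr (W J)) (\<lambda>U. U)"
      by (rule is_morphism_into_induced[OF Y is_morphism_restrict[OF CGr_into_Gr]]) (use pY in blast)
    from is_morphism_comp[OF this is_morphism_chart_coords[OF J]]
    show "is_morphism ?Y ?A (co J)"
    proof (rule is_morphism_into_induced[OF Y])
      fix U assume "U \<in> pts ?Y"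
      then have "U \<in> C_set" "U \<in> W J" using pY by auto
      then show "co J U \<in> ?O \<inter> ?C" unfolding OC using chart_chart_coords[OF J \<open>U \<in> W J\<close>] by simp
    qed
    have chW: "chart (verts Q) n J a \<in> W J" if "a \<in> pts (Aff J)" for a unfolding chart_domain_def using that by simp
    show "is_morphism ?A ?Y (chart (verts Q) n J)"
    proof (rule is_morphism_into_induced[OF A into_CGr[OF A is_morphism_restrict[OF is_morphism_Gr_chart[OF J]]]])
      fix a assume "a \<in> pts ?A"
      then have "a \<in> pts (Aff J)" "chart (verts Q) n J a \<in> C_set" unfolding pA by simp_all
      then show "chart (verts Q) n J a \<in> C_set" "chart (verts Q) n J a \<in> C_set \<inter> W J" using chW by simp_all
    qed
    show "chart (verts Q) n J (co J U) = U" if "U \<in> pts ?Y" for U using chart_chart_coords(1)[OF J] that pY by blast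
    show "co J (chart (verts Q) n J a) = a" if "a \<in> pts ?A" for a
      by (rule chart_coords_chart[OF J]) (use that in simp)
  qed
  then show ?thesis by (rule affine_covered_isomorphic[OF Y A _ cov])
qed

lemma affine_covered_CGr: "affine_covered CGr"
proof (rule affine_covered_union[OF swf_CGr])
  let ?W = "(\<lambda>D. C_set \<inter> D) ` {W J | J. valid J}"
  show "finite ?W" using finite_chart_domains by (rule finite_imageI)
  show "\<Union>?W = pts CGr"
    unfolding pts_CGr
  proof (intro equalityI subsetI)
    fix U assume U: "U \<in> C_set"
    then have "U \<in> grassmannian_prod (verts Q) e n" using C_set_subset Q_set_subset by blast
    from grassmannian_prod_charts[OF this] obtain J where "valid J" "U \<in> W J" by (elim exE conjE)
    then have "C_set \<inter> W J \<in> ?W" "U \<in> C_set \<inter> W J" using U by simp_all blast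
    then show "U \<in> \<Union>?W" by (rule UnionI)
  qed blast
  fix D assume "D \<in> ?W"
  then obtain J where "valid J" "D = C_set \<inter> W J" by blast
  then show "openin (zar CGr) D \<and> affine_covered (induced CGr D)"
    using openin_CGr_chart affine_covered_chart by simp
qed

text \<open>With \<open>F\<close> taken in a chart around \<open>U'\<close> and \<open>G\<close> in a chart around \<open>U\<close>, the product of \<open>G\<close> at \<open>Z\<close> and \<open>F\<close> at \<open>Z'\<close> vanishes
  iff \<open>Z'\<close> is contained in \<open>Z\<close>, and then both are equal, having the same dimension. The entries of the product are sums of
  products of regular functions of \<open>Z\<close> and of \<open>Z'\<close>, as \<open>separatedI\<close> requires.\<close>

lemma separated_CGr: "separated CGr"
proof (rule separatedI[OF swf_CGr])
  fix U U' assume UU': "U \<in> pts CGr" "U' \<in> pts CGr" "U \<noteq> U'"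
  then have U: "U \<in> C_set" "U \<in> grassmannian_prod (verts Q) e n" and U': "U' \<in> C_set" "U' \<in> grassmannian_prod (verts Q) e n"
    using pts_CGr C_set_subset Q_set_subset by blast+
  from grassmannian_prod_charts[OF U(2)] obtain J where J: "valid J" "U \<in> W J" by (elim exE conjE)
  from grassmannian_prod_charts[OF U'(2)] obtain J' where J': "valid J'" "U' \<in> W J'" by (elim exE conjE)
  let ?G = "\<lambda>i U. chart_cograph n J (co J U) i" and ?F = "\<lambda>i U. chart_graph n J' (co J' U) i"
  have im: "mat_image (?F i Z) = Z i" if "i \<in> verts Q" "Z \<in> W J'" for i Z
    using fun_cong[OF chart_domain_mat_images[OF J'(1) that(2)], of i] that(1) by simp
  have ker: "mat_kernel (?G i Z) = Z i" if "i \<in> verts Q" "Z \<in> W J" for i Z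
    using fun_cong[OF chart_domain_mat_images[OF J(1) that(2)], of i] chart_kernel[OF J(1) that(1)] that(1) by simp
  \<comment> \<open>if all products vanish, then \<open>U' i\<close> is contained in \<open>U i\<close>, and the dimensions agree\<close>
  have "\<exists>i\<in>verts Q. ?G i U * ?F i U' \<noteq> 0\<^sub>m (d i) (e i)"
  proof (rule ccontr)
    assume "\<not> ?thesis"
    then have z: "\<And>i. i \<in> verts Q \<Longrightarrow> ?G i U * ?F i U' = 0\<^sub>m (d i) (e i)" by blast
    have "U i = U' i" if i: "i \<in> verts Q" for i
    proof -
      note G = chart_carriers(4)[OF J(1) i, of "co J U"] and F = chart_carriers(3)[OF J'(1) i, of "co J' U'"]
        and K = chart_carriers(3)[OF J(1) i, of "co J U"]
      have "mat_image (?F i U') \<subseteq> mat_kernel (?G i U)"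
      proof
        fix w assume "w \<in> mat_image (?F i U')"
        then obtain v where v: "v \<in> carrier_vec (e i)" "w = ?F i U' *\<^sub>v v" using F by auto
        have "?G i U *\<^sub>v w = ?G i U * ?F i U' *\<^sub>v v" unfolding v(2) by (rule assoc_mult_mat_vec[OF G F v(1), symmetric])
        also have "\<dots> = 0\<^sub>v (d i)" unfolding z[OF i] using v(1) by (intro eq_vecI) (auto simp: scalar_prod_def)
        finally show "w \<in> mat_kernel (?G i U)"
          using mult_mat_vec_carrier[OF F v(1)] v(2) by (intro mat_kernelI[OF G]) simp_all
      qed
      then have "mat_image (?F i U') \<subseteq> mat_image (chart_graph n J (co J U) i)" unfolding chart_kernel[OF J(1) i] .
      from mat_image_subset_factor[OF K F this]
      obtain X where X: "X \<in> carrier_mat (e i) (e i)" "?F i U' = chart_graph n J (co J U) i * X" by (rule bexE)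
      have "mat_injective X" unfolding mat_injective_iff[OF X(1)]
      proof (intro ballI impI)
        fix v assume v: "v \<in> carrier_vec (e i)" "X *\<^sub>v v = 0\<^sub>v (e i)"
        have "?F i U' *\<^sub>v v = chart_graph n J (co J U) i *\<^sub>v (X *\<^sub>v v)" unfolding X(2) by (rule assoc_mult_mat_vec[OF K X(1) v(1)])
        also have "\<dots> = 0\<^sub>v (n i)" unfolding v(2) using K by (intro eq_vecI) (auto simp: scalar_prod_def)
        finally show "v = 0\<^sub>v (e i)"
          using chart_graph_injective[OF J'(1) i, of "co J' U'"] v(1) unfolding mat_injective_iff[OF F] by blast
      qed
      then have "det X \<noteq> 0" unfolding mat_injective_iff[OF X(1)] det_0_iff_vec_prod_zero_field[OF X(1)] by blast
      from mat_image_mult_invertible[OF K X(1) this]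
      have "mat_image (?F i U') = mat_image (chart_graph n J (co J U) i)" unfolding X(2) .
      from trans[OF trans[OF im[OF i J'(2), symmetric] this] trans[OF chart_kernel[OF J(1) i, symmetric] ker[OF i J(2)]]]
      show "U i = U' i" by (rule sym)
    qed
    then have "U = U'" using U(2) U'(2) unfolding grassmannian_prod_def by (intro PiE_ext[of U _ _ U']) auto
    then show False using UU'(3) by blast
  qed
  then obtain i where i: "i \<in> verts Q" "?G i U * ?F i U' \<noteq> 0\<^sub>m (d i) (e i)" by blast
  have G: "?G i Z \<in> carrier_mat (d i) (n i)" and F: "?F i Z \<in> carrier_mat (n i) (e i)" for Z
    using chart_carriers(4)[OF J(1) i(1)] chart_carriers(3)[OF J'(1) i(1)] by blast+
  have "\<exists>r s. r < d i \<and> s < e i \<and> (?G i U * ?F i U') $$ (r, s) \<noteq> 0"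
  proof (rule ccontr)
    assume "\<not> ?thesis"
    then have z: "(?G i U * ?F i U') $$ (r, s) = 0" if "r < d i" "s < e i" for r s using that by blast
    have "?G i U * ?F i U' = 0\<^sub>m (d i) (e i)"
    proof (rule eq_matI)
      fix r s assume "r < dim_row (0\<^sub>m (d i) (e i) :: 'k mat)" "s < dim_col (0\<^sub>m (d i) (e i) :: 'k mat)"
      then have rs: "r < d i" "s < e i" by simp_all
      show "(?G i U * ?F i U') $$ (r, s) = 0\<^sub>m (d i) (e i) $$ (r, s)" unfolding index_zero_mat(1)[OF rs] by (rule z[OF rs])
    qed (simp_all only: index_zero_mat index_mult_mat carrier_matD[OF G] carrier_matD[OF F])
    then show False using i(2) by contradiction
  qed
  then obtain r s where rs: "r < d i" "s < e i" "(?G i U * ?F i U') $$ (r, s) \<noteq> 0" by (elim exE conjE)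
  let ?f = "\<lambda>k Z. ?G i Z $$ (r, k)" and ?g = "\<lambda>k Z. ?F i Z $$ (k, s)"
  have prod: "(\<Sum>k<n i. ?f k Z * ?g k Z') = (?G i Z * ?F i Z') $$ (r, s)" for Z Z'
    by (rule mult_index[OF G F rs(1,2), symmetric])
  have regf: "?f k \<in> reg CGr (C_set \<inter> W J)" if "k < n i" for k
    using is_morphismD_reg[OF CGr_into_Gr openin_chart_domain[OF J(1)] reg_matD(2)[OF chart_matrices_reg(2)[OF J(1) i(1)] rs(1) that]]
    unfolding pts_CGr Int_def by simp
  have regg: "?g k \<in> reg CGr (C_set \<inter> W J')" if "k < n i" for k
    using is_morphismD_reg[OF CGr_into_Gr openin_chart_domain[OF J'(1)] reg_matD(2)[OF chart_matrices_reg(1)[OF J'(1) i(1)] that rs(2)]]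
    unfolding pts_CGr Int_def by simp
  \<comment> \<open>on the diagonal, the columns of \<open>F\<close> lie in \<open>Z i\<close>, which is the kernel of \<open>G\<close>\<close>
  have vanish: "(\<Sum>k<n i. ?f k Z * ?g k Z) = 0" if Z: "Z \<in> (C_set \<inter> W J) \<inter> (C_set \<inter> W J')" for Z
  proof -
    have "col (?F i Z) s = ?F i Z *\<^sub>v unit_vec (e i) s" by (rule mult_unit_vec[OF F rs(2), symmetric])
    moreover have "\<dots> \<in> mat_image (?F i Z)" by (rule imageI) (unfold carrier_matD(2)[OF F], rule unit_vec_carrier)
    ultimately have "col (?F i Z) s \<in> mat_kernel (?G i Z)" using im[OF i(1), of Z] ker[OF i(1), of Z] Z by simp
    then have "?G i Z *\<^sub>v col (?F i Z) s = 0\<^sub>v (d i)" by (rule mat_kernelD(2)[OF G])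
    then have "(?G i Z *\<^sub>v col (?F i Z) s) $ r = 0" using rs(1) by simp
    moreover have "(?G i Z *\<^sub>v col (?F i Z) s) $ r = (?G i Z * ?F i Z) $$ (r, s)"
      by (rule trans[OF index_mult_mat_vec index_mult_mat(1)[symmetric]])
        (simp_all only: carrier_matD[OF G] carrier_matD[OF F] rs)
    ultimately show ?thesis unfolding prod by simp
  qed
  show "\<exists>D D' f g (m::nat). openin (zar CGr) D \<and> openin (zar CGr) D' \<and> U \<in> D \<and> U' \<in> D' \<and>
        (\<forall>k<m. f k \<in> reg CGr D \<and> g k \<in> reg CGr D') \<and> (\<Sum>k<m. f k U * g k U') \<noteq> 0 \<and>
        (\<forall>z\<in>D \<inter> D'. (\<Sum>k<m. f k z * g k z) = 0)"
  proof (rule exI[of _ "C_set \<inter> W J"], rule exI[of _ "C_set \<inter> W J'"], rule exI[of _ ?f], rule exI[of _ ?g], rule exI[of _ "n i"],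
      intro conjI)
    show "openin (zar CGr) (C_set \<inter> W J)" "openin (zar CGr) (C_set \<inter> W J')" by (rule openin_CGr_chart[OF J(1)], rule openin_CGr_chart[OF J'(1)])
    show "U \<in> C_set \<inter> W J" "U' \<in> C_set \<inter> W J'" using U J U' J' by blast+
    show "\<forall>k<n i. ?f k \<in> reg CGr (C_set \<inter> W J) \<and> ?g k \<in> reg CGr (C_set \<inter> W J')" using regf regg by simp
    show "(\<Sum>k<n i. ?f k U * ?g k U') \<noteq> 0" unfolding prod by (rule rs(3))
    show "\<forall>z\<in>(C_set \<inter> W J) \<inter> (C_set \<inter> W J'). (\<Sum>k<n i. ?f k z * ?g k z) = 0" using vanish by (rule ballI)
  qed
qed

lemma variety_CGr: "variety CGr"
  using swf_CGr affine_covered_CGr separated_CGr unfolding variety_def affine_covered_def by simp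

text \<open>The affine space of all pairs of matrix families in which the variety of inflations is defined.\<close>

definition infl_ambient :: "(('v, 'a, 'k) infl, 'k) kspace" where
  "infl_ambient = coord_space
     (rep_set Q e \<times> (\<Pi>\<^sub>E i\<in>verts Q. carrier_mat (n i) (e i)))
     ({\<lambda>(U, f). c U | c. c \<in> rep_coords Q e} \<union>
      {\<lambda>(U, f). f i $$ (r, s) | i r s. i \<in> verts Q \<and> r < n i \<and> s < e i})"

lemma infl_variety_eq: "Infl = induced infl_ambient (infl_set Q \<E> e d M)"
  unfolding infl_variety_def infl_ambient_def ..

lemma swf_ambient: "space_with_functions infl_ambient" unfolding infl_ambient_def by (rule swf_coord_space)

lemma pts_ambient: "pts infl_ambient = rep_set Q e \<times> (\<Pi>\<^sub>E i\<in>verts Q. carrier_mat (n i) (e i))"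
  unfolding infl_ambient_def by simp

lemma ambient_coords:
  "affine_coords (rep_set Q e \<times> (\<Pi>\<^sub>E i\<in>verts Q. carrier_mat (n i) (e i)))
     ({\<lambda>(U, f). c U | c. c \<in> rep_coords Q e} \<union>
      {\<lambda>(U, f). f i $$ (r, s) | i r s. i \<in> verts Q \<and> r < n i \<and> s < e i} :: (('v, 'a, 'k) infl \<Rightarrow> 'k) set)"
proof (rule affine_coordsI)
  let ?KA = "SIGMA \<alpha>:arcs Q. {..<e (head Q \<alpha>)} \<times> {..<e (tail Q \<alpha>)}"
  let ?KV = "SIGMA i:verts Q. {..<n i} \<times> {..<e i}"
  let ?c = "\<lambda>k (z :: ('v, 'a, 'k) infl). case k of Inl (\<alpha>, r, s) \<Rightarrow> fst z \<alpha> $$ (r, s) | Inr (i, r, s) \<Rightarrow> snd z i $$ (r, s)"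
  show "finite (?KA <+> ?KV)" by (intro finite_Plus finite_SigmaI finite_cartesian_product) auto
  have 1: "{\<lambda>(U, f). c U | c. c \<in> rep_coords Q e} = (\<lambda>k. ?c (Inl k)) ` ?KA"
    unfolding rep_coords_def by (force simp: split_beta' image_iff)
  have 2: "{\<lambda>(U, f). f i $$ (r, s) | i r s. i \<in> verts Q \<and> r < n i \<and> s < e i} = (\<lambda>k. ?c (Inr k)) ` ?KV"
    by (force simp: split_beta' image_iff)
  show "{\<lambda>(U, f). c U | c. c \<in> rep_coords Q e} \<union>
      {\<lambda>(U, f). f i $$ (r, s) | i r s. i \<in> verts Q \<and> r < n i \<and> s < e i} = ?c ` (?KA <+> ?KV)"
    unfolding 1 2 Plus_def image_Un image_image ..
  show "\<exists>z\<in>rep_set Q e \<times> (\<Pi>\<^sub>E i\<in>verts Q. carrier_mat (n i) (e i)). \<forall>k\<in>?KA <+> ?KV. ?c k z = y k" for y :: "_ \<Rightarrow> 'k"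
  proof (rule bexI[of _ "(\<lambda>\<alpha>\<in>arcs Q. mat (e (head Q \<alpha>)) (e (tail Q \<alpha>)) (\<lambda>(r, s). y (Inl (\<alpha>, r, s))),
        \<lambda>i\<in>verts Q. mat (n i) (e i) (\<lambda>(r, s). y (Inr (i, r, s))))"])
  qed (auto simp: rep_set_def)
  fix z z' :: "('v, 'a, 'k) infl"
  assume z: "z \<in> rep_set Q e \<times> (\<Pi>\<^sub>E i\<in>verts Q. carrier_mat (n i) (e i))"
    and z': "z' \<in> rep_set Q e \<times> (\<Pi>\<^sub>E i\<in>verts Q. carrier_mat (n i) (e i))"
    and eq: "\<And>k. k \<in> ?KA <+> ?KV \<Longrightarrow> ?c k z = ?c k z'"
  show "z = z'"
  proof (rule prod_eqI)
    show "fst z = fst z'"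
    proof (rule PiE_ext)
      show "fst z \<in> (\<Pi>\<^sub>E \<alpha>\<in>arcs Q. carrier_mat (e (head Q \<alpha>)) (e (tail Q \<alpha>)))"
        "fst z' \<in> (\<Pi>\<^sub>E \<alpha>\<in>arcs Q. carrier_mat (e (head Q \<alpha>)) (e (tail Q \<alpha>)))"
        using z z' unfolding rep_set_def by auto
      fix \<alpha> assume \<alpha>: "\<alpha> \<in> arcs Q"
      have c: "fst z \<alpha> \<in> carrier_mat (e (head Q \<alpha>)) (e (tail Q \<alpha>))" "fst z' \<alpha> \<in> carrier_mat (e (head Q \<alpha>)) (e (tail Q \<alpha>))"
        using z z' \<alpha> by (auto intro: rep_setD)
      show "fst z \<alpha> = fst z' \<alpha>"
      proof (rule eq_matI)
        fix r s assume "r < dim_row (fst z' \<alpha>)" "s < dim_col (fst z' \<alpha>)"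
        then show "fst z \<alpha> $$ (r, s) = fst z' \<alpha> $$ (r, s)" using eq[of "Inl (\<alpha>, r, s)"] c \<alpha> by auto
      qed (use c in auto)
    qed
    show "snd z = snd z'"
    proof (rule PiE_ext)
      show "snd z \<in> (\<Pi>\<^sub>E i\<in>verts Q. carrier_mat (n i) (e i))" "snd z' \<in> (\<Pi>\<^sub>E i\<in>verts Q. carrier_mat (n i) (e i))"
        using z z' by auto
      fix i assume i: "i \<in> verts Q"
      have c: "snd z i \<in> carrier_mat (n i) (e i)" "snd z' i \<in> carrier_mat (n i) (e i)" using z z' i by auto
      show "snd z i = snd z' i"
      proof (rule eq_matI)
        fix r s assume "r < dim_row (snd z' i)" "s < dim_col (snd z' i)"
        then show "snd z i $$ (r, s) = snd z' i $$ (r, s)" using eq[of "Inr (i, r, s)"] c i by auto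
      qed (use c in auto)
    qed
  qed
qed

lemma ambient_reg:
  "\<alpha> \<in> arcs Q \<Longrightarrow> reg_mat infl_ambient (pts infl_ambient) (e (head Q \<alpha>)) (e (tail Q \<alpha>)) (\<lambda>z. fst z \<alpha>)"
  "i \<in> verts Q \<Longrightarrow> reg_mat infl_ambient (pts infl_ambient) (n i) (e i) (\<lambda>z. snd z i)"
proof -
  assume \<alpha>: "\<alpha> \<in> arcs Q"
  show "reg_mat infl_ambient (pts infl_ambient) (e (head Q \<alpha>)) (e (tail Q \<alpha>)) (\<lambda>z. fst z \<alpha>)"
  proof (rule reg_matI)
    show "fst z \<alpha> \<in> carrier_mat (e (head Q \<alpha>)) (e (tail Q \<alpha>))" if "z \<in> pts infl_ambient" for z
      using that \<alpha> unfolding pts_ambient by (auto intro: rep_setD)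
    fix r s assume rs: "r < e (head Q \<alpha>)" "s < e (tail Q \<alpha>)"
    have "(\<lambda>M. M \<alpha> $$ (r, s)) \<in> rep_coords Q e" unfolding rep_coords_def using \<alpha> rs by blast
    then have "(\<lambda>(U, f). U \<alpha> $$ (r, s)) \<in> {\<lambda>(U, f). c U | c. c \<in> rep_coords Q e}"
      by (intro CollectI exI[of _ "\<lambda>M. M \<alpha> $$ (r, s)"] conjI refl)
    then show "(\<lambda>z. fst z \<alpha> $$ (r, s)) \<in> reg infl_ambient (pts infl_ambient)"
      unfolding infl_ambient_def
      by (intro polynomial_reg[OF polynomial_functions.coord openin_topspace] UnI1) (simp add: split_beta')
  qed
next
  assume i: "i \<in> verts Q"
  show "reg_mat infl_ambient (pts infl_ambient) (n i) (e i) (\<lambda>z. snd z i)"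
  proof (rule reg_matI)
    show "snd z i \<in> carrier_mat (n i) (e i)" if "z \<in> pts infl_ambient" for z
      using that i unfolding pts_ambient by auto
    fix r s assume rs: "r < n i" "s < e i"
    then have "(\<lambda>(U, f). f i $$ (r, s)) \<in>
        ({\<lambda>(U, f). f i $$ (r, s) | i r s. i \<in> verts Q \<and> r < n i \<and> s < e i} :: (('v, 'a, 'k) infl \<Rightarrow> 'k) set)"
      using i by blast
    then show "(\<lambda>z. snd z i $$ (r, s)) \<in> reg infl_ambient (pts infl_ambient)"
      unfolding infl_ambient_def
      by (intro polynomial_reg[OF polynomial_functions.coord openin_topspace] UnI2) (simp add: split_beta')
  qed
qed

abbreviation (input) "Inj \<equiv> {z \<in> pts infl_ambient. \<forall>i\<in>verts Q. mat_injective (snd z i)}"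
abbreviation (input) "Hom \<equiv> {z \<in> pts infl_ambient. \<forall>\<alpha>\<in>arcs Q. M \<alpha> * snd z (tail Q \<alpha>) = snd z (head Q \<alpha>) * fst z \<alpha>}"

lemma openin_Inj: "openin (zar infl_ambient) Inj"
proof (subst openin_subopen, intro ballI)
  fix z assume z: "z \<in> Inj"
  then have zp: "z \<in> pts infl_ambient" and inj: "\<And>i. i \<in> verts Q \<Longrightarrow> mat_injective (snd z i)" by auto
  note o = openin_topspace[of "zar infl_ambient"]
  have snd: "snd x i \<in> carrier_mat (n i) (e i)" if "x \<in> pts infl_ambient" "i \<in> verts Q" for x i
    by (rule reg_matD(1)[OF ambient_reg(2)[OF that(2)] that(1)])
  have "\<exists>J. valid J \<and> mat_images (verts Q) (snd z) \<in> W J" by (rule exists_chart[OF snd[OF zp] inj])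
  then obtain J where J: "valid J" "mat_images (verts Q) (snd z) \<in> W J" by (elim exE conjE)
  let ?p = "\<lambda>x. \<Prod>i\<in>verts Q. det (sel_mat (n i) (J i) * snd x i)"
  have "?p \<in> reg infl_ambient (pts infl_ambient)"
  proof (rule swf_prod[OF swf_ambient o])
    fix i assume i: "i \<in> verts Q"
    show "(\<lambda>x. det (sel_mat (n i) (J i) * snd x i)) \<in> reg infl_ambient (pts infl_ambient)"
      by (rule reg_det[OF swf_ambient o reg_mat_mult[OF swf_ambient o
            reg_mat_const[OF swf_ambient o chart_carriers(1)[OF J(1) i]] ambient_reg(2)[OF i]]])
  qed
  from swf_nonzero[OF swf_ambient o this] have "openin (zar infl_ambient) {x \<in> pts infl_ambient. ?p x \<noteq> 0}" .
  moreover have "z \<in> {x \<in> pts infl_ambient. ?p x \<noteq> 0}"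
    using zp J(2) chart_domain_det_iff[OF J(1) snd[OF zp] inj] by simp
  moreover have "{x \<in> pts infl_ambient. ?p x \<noteq> 0} \<subseteq> Inj"
  proof
    fix x assume x: "x \<in> {x \<in> pts infl_ambient. ?p x \<noteq> 0}"
    then have xp: "x \<in> pts infl_ambient" by simp
    have "mat_injective (snd x i)" if i: "i \<in> verts Q" for i
      by (rule det_sel_injective[OF validD[OF J(1) i] refl snd[OF xp i]]) (use x i finV in simp)
    then show "x \<in> Inj" using xp by simp
  qed
  ultimately show "\<exists>T. openin (zar infl_ambient) T \<and> z \<in> T \<and> T \<subseteq> Inj" by blast
qed

lemma closedin_Hom: "closedin (zar infl_ambient) Hom"
proof -
  note o = openin_topspace[of "zar infl_ambient"]
  have "openin (zar infl_ambient) (\<Union>\<alpha>\<in>arcs Q. {z \<in> pts infl_ambient. M \<alpha> * snd z (tail Q \<alpha>) \<noteq> snd z (head Q \<alpha>) * fst z \<alpha>})"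
  proof (rule openin_Union, clarify)
    fix \<alpha> assume \<alpha>: "\<alpha> \<in> arcs Q"
    have t: "tail Q \<alpha> \<in> verts Q" and h: "head Q \<alpha> \<in> verts Q" using \<alpha> by auto
    show "openin (zar infl_ambient) {z \<in> pts infl_ambient. M \<alpha> * snd z (tail Q \<alpha>) \<noteq> snd z (head Q \<alpha>) * fst z \<alpha>}"
      by (rule openin_mat_differ[OF swf_ambient o
            reg_mat_mult[OF swf_ambient o reg_mat_const[OF swf_ambient o rep_setD[OF M_rep \<alpha>]] ambient_reg(2)[OF t]]
            reg_mat_mult[OF swf_ambient o ambient_reg(2)[OF h] ambient_reg(1)[OF \<alpha>]]])
  qed
  moreover have "(\<Union>\<alpha>\<in>arcs Q. {z \<in> pts infl_ambient. M \<alpha> * snd z (tail Q \<alpha>) \<noteq> snd z (head Q \<alpha>) * fst z \<alpha>}) = pts infl_ambient - Hom"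
    by blast
  ultimately show ?thesis unfolding closedin_def by simp
qed

text \<open>Inflations are singled out by an open condition, a closed condition and the condition that the image lies in the
  \<open>\<E>\<close>-Grassmannian, which is open once the others hold.\<close>

lemma infl_set_eq: "infl_set Q \<E> e d M = {z \<in> Inj \<inter> Hom. mat_images (verts Q) (snd z) \<in> C_set}"
proof (intro equalityI subsetI)
  fix z assume "z \<in> infl_set Q \<E> e d M"
  then have "(fst z, snd z) \<in> infl_set Q \<E> e d M" by simp
  then show "z \<in> {z \<in> Inj \<inter> Hom. mat_images (verts Q) (snd z) \<in> C_set}"
    unfolding infl_set_iff[OF closed] by (simp add: pts_ambient mem_Times_iff)
next
  fix z assume "z \<in> {z \<in> Inj \<inter> Hom. mat_images (verts Q) (snd z) \<in> C_set}"
  then have "(fst z, snd z) \<in> infl_set Q \<E> e d M"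
    unfolding infl_set_iff[OF closed] by (simp add: pts_ambient mem_Times_iff)
  then show "z \<in> infl_set Q \<E> e d M" by simp
qed

lemma Inj_Hom_Q_set:
  assumes z: "z \<in> Inj \<inter> Hom"
  shows "mat_images (verts Q) (snd z) \<in> Q_set"
proof -
  have zp: "z \<in> pts infl_ambient" and inj: "\<And>i. i \<in> verts Q \<Longrightarrow> mat_injective (snd z i)"
    and hom: "\<And>\<alpha>. \<alpha> \<in> arcs Q \<Longrightarrow> M \<alpha> * snd z (tail Q \<alpha>) = snd z (head Q \<alpha>) * fst z \<alpha>" using z by auto
  have snd: "snd z i \<in> carrier_mat (n i) (e i)" if "i \<in> verts Q" for i
    by (rule reg_matD(1)[OF ambient_reg(2)[OF that] zp])
  have rep: "fst z \<in> rep_set Q e" using zp unfolding pts_ambient by auto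
  have h: "is_hom Q (e, fst z) (n, M) (snd z)" unfolding is_hom_def using snd hom by simp
  have "\<exists>J. valid J \<and> mat_images (verts Q) (snd z) \<in> W J" by (rule exists_chart[OF snd inj])
  then obtain J where J: "valid J" "mat_images (verts Q) (snd z) \<in> W J" by (elim exE conjE)
  have ch: "chart (verts Q) n J (co J (mat_images (verts Q) (snd z))) = mat_images (verts Q) (snd z)"
    by (rule chart_chart_coords(1)[OF J])
  have "\<forall>\<alpha>\<in>arcs Q. defect J (co J (mat_images (verts Q) (snd z))) \<alpha> = 0\<^sub>m (d (head Q \<alpha>)) (e (tail Q \<alpha>))"
  proof
    fix \<alpha> assume \<alpha>: "\<alpha> \<in> arcs Q"
    show "defect J (co J (mat_images (verts Q) (snd z))) \<alpha> = 0\<^sub>m (d (head Q \<alpha>)) (e (tail Q \<alpha>))"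
      by (rule stable_defect[OF J(1) _ \<alpha>], unfold ch) (rule hom_image_stable[OF rep h])
  qed
  then have "chart (verts Q) n J (co J (mat_images (verts Q) (snd z))) \<in> Q_set"
    unfolding chart_gr_set_modules_iff[OF J(1)] .
  then show ?thesis unfolding ch .
qed

lemma image_morphism:
  assumes T: "T \<subseteq> Inj"
  shows "is_morphism (induced infl_ambient T) Gr (\<lambda>z. mat_images (verts Q) (snd z))"
proof (rule family_morphism[OF swf_induced[OF swf_ambient]])
  fix i assume i: "i \<in> verts Q"
  show "reg_mat (induced infl_ambient T) (pts (induced infl_ambient T)) (n i) (e i) (\<lambda>z. snd z i)"
    by (rule reg_mat_into_induced[OF openin_topspace ambient_reg(2)[OF i]]) auto
next
  fix z i assume "z \<in> pts (induced infl_ambient T)" "i \<in> verts Q"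
  then show "mat_injective (snd z i)" using T by auto
qed

text \<open>The last condition of \<open>infl_set_eq\<close> is pulled back along the morphism that takes images; for this the map has to be
  defined on all injective \<open>f\<close> and not only on inflations.\<close>

lemma infl_set_locally_closed: "\<exists>O'. openin (zar infl_ambient) O' \<and> infl_set Q \<E> e d M = O' \<inter> Hom"
proof -
  obtain G where G: "openin (zar Gr) G" "C_set = G \<inter> Q_set" using C_set_trace by (elim exE conjE)
  let ?Z = "induced infl_ambient Inj"
  have pZ: "pts ?Z = Inj" by auto
  have "openin (zar ?Z) {z \<in> pts ?Z. mat_images (verts Q) (snd z) \<in> G}"
    by (rule is_morphismD_open[OF image_morphism[OF subset_refl] G(1)])
  then have "openin (subtopology (zar infl_ambient) Inj) {z \<in> Inj. mat_images (verts Q) (snd z) \<in> G}"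
    unfolding pZ unfolding zar_induced .
  then have o: "openin (zar infl_ambient) {z \<in> Inj. mat_images (verts Q) (snd z) \<in> G}"
    by (rule openin_trans_full[OF _ openin_Inj])
  have "infl_set Q \<E> e d M = {z \<in> Inj. mat_images (verts Q) (snd z) \<in> G} \<inter> Hom"
    unfolding infl_set_eq G(2) using Inj_Hom_Q_set by blast
  then show ?thesis using o by blast
qed

lemma pts_Infl: "pts Infl = infl_set Q \<E> e d M"
  unfolding infl_variety_eq using infl_set_eq by auto

lemma swf_Infl: "space_with_functions Infl" unfolding infl_variety_eq by (rule swf_induced[OF swf_ambient])

lemma variety_Infl: "variety Infl"
proof -
  obtain G where G: "openin (zar infl_ambient) G" "infl_set Q \<E> e d M = G \<inter> Hom" using infl_set_locally_closed by (elim exE conjE)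
  have "affine_covered Infl"
    unfolding infl_variety_eq G(2) using G(1) closedin_Hom unfolding infl_ambient_def
    by (rule affine_covered_locally_closed[OF ambient_coords])
  moreover have "separated Infl"
    unfolding infl_variety_eq infl_ambient_def by (rule separated_induced_coord_space[OF ambient_coords])
  ultimately show ?thesis using swf_Infl unfolding variety_def affine_covered_def by simp
qed

lemma infl_image_eq: "infl_image Q = (\<lambda>z. mat_images (verts Q) (snd z))"
  unfolding infl_image_def by (simp add: split_beta')

lemma infl_image_morphism: "is_morphism Infl CGr (infl_image Q)"
proof (rule into_CGr[OF swf_Infl])
  show "is_morphism Infl Gr (infl_image Q)"
    unfolding infl_variety_eq infl_image_eq by (rule image_morphism) (use infl_set_eq in blast)
  show "infl_image Q z \<in> C_set" if "z \<in> pts Infl" for z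
    using that unfolding pts_Infl infl_set_eq infl_image_eq by simp
qed

text \<open>The tautological inflation over a chart: the restriction of \<open>M\<close> to \<open>U\<close>, written in the basis of \<open>U\<close> given by the columns of
  its graph matrix.\<close>

lemma local_section:
  assumes J: "valid J"
  defines "s \<equiv> \<lambda>U. (sub_rep J (co J U), \<lambda>i\<in>verts Q. chart_graph n J (co J U) i)"
  shows "is_morphism (induced CGr (C_set \<inter> W J)) Infl s" "U \<in> C_set \<inter> W J \<Longrightarrow> infl_image Q (s U) = U"
proof -
  have img: "mat_images (verts Q) (snd (s U)) = U" if "U \<in> W J" for U
  proof -
    have "mat_images (verts Q) (snd (s U)) = mat_images (verts Q) (chart_graph n J (co J U))"
      unfolding s_def by (rule restrict_ext) simp
    also have "\<dots> = U" by (rule chart_domain_mat_images[OF J that, symmetric])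
    finally show ?thesis .
  qed
  then show "U \<in> C_set \<inter> W J \<Longrightarrow> infl_image Q (s U) = U" unfolding infl_image_eq by simp
  let ?Y = "induced CGr (C_set \<inter> W J)"
  have Y: "space_with_functions ?Y" by (rule swf_induced[OF swf_CGr])
  have pY: "pts ?Y = C_set \<inter> W J" using pts_CGr by auto
  have inT: "s U \<in> infl_set Q \<E> e d M" if U: "U \<in> pts ?Y" for U
  proof -
    have UC: "U \<in> C_set" and UW: "U \<in> W J" using U pY by auto
    then have UQ: "U \<in> Q_set" using C_set_subset by blast
    note h = chart_point(3)[OF J UQ UW]
    have "snd (s U) \<in> (\<Pi>\<^sub>E i\<in>verts Q. carrier_mat (n i) (e i))"
      unfolding s_def snd_conv by (rule restrict_PiE_iff[THEN iffD2]) (rule ballI, rule chart_carriers(3)[OF J])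
    moreover have "\<forall>i\<in>verts Q. mat_injective (snd (s U) i)"
    proof
      fix i assume i: "i \<in> verts Q"
      show "mat_injective (snd (s U) i)"
        unfolding s_def snd_conv restrict_apply'[OF i] by (rule chart_graph_injective[OF J i])
    qed
    moreover have "\<forall>\<alpha>\<in>arcs Q. M \<alpha> * snd (s U) (tail Q \<alpha>) = snd (s U) (head Q \<alpha>) * fst (s U) \<alpha>"
      unfolding s_def using is_homD(2)[OF h] by simp
    moreover have "fst (s U) \<in> rep_set Q e" unfolding s_def using sub_rep_rep[OF J] by simp
    ultimately have "(fst (s U), snd (s U)) \<in> infl_set Q \<E> e d M"
      unfolding infl_set_iff[OF closed] img[OF UW] using UC by blast
    then show ?thesis by simp
  qed
  have reg: "reg_mat ?Y (pts ?Y) m m' F" if "reg_mat Gr (W J) m m' F" for m m' F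
  proof (rule reg_mat_into_induced[OF openin_CGr_chart[OF J]])
    show "reg_mat CGr (C_set \<inter> W J) m m' F"
      using reg_mat_compose[OF CGr_into_Gr openin_chart_domain[OF J] that] unfolding pts_CGr Int_def by simp
  qed (use pY in simp)
  have "is_morphism ?Y infl_ambient s"
    unfolding infl_ambient_def
  proof (rule is_morphism_coord_space[OF Y])
    show "s U \<in> rep_set Q e \<times> (\<Pi>\<^sub>E i\<in>verts Q. carrier_mat (n i) (e i))" if "U \<in> pts ?Y" for U
      using inT[OF that] infl_set_eq pts_ambient by blast
    fix c :: "('v, 'a, 'k) infl \<Rightarrow> 'k"
    assume "c \<in> {\<lambda>(U, f). c U | c. c \<in> rep_coords Q e} \<union>
      {\<lambda>(U, f). f i $$ (r, s) | i r s. i \<in> verts Q \<and> r < n i \<and> s < e i}"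
    then show "(\<lambda>U. c (s U)) \<in> reg ?Y (pts ?Y)"
    proof
      assume "c \<in> {\<lambda>(U, f). c U | c. c \<in> rep_coords Q e}"
      then obtain \<alpha> r t where c: "c = (\<lambda>(U, f). U \<alpha> $$ (r, t))" "\<alpha> \<in> arcs Q" "r < e (head Q \<alpha>)" "t < e (tail Q \<alpha>)"
        unfolding rep_coords_def by auto
      have "(\<lambda>U. c (s U)) = (\<lambda>U. sub_rep J (co J U) \<alpha> $$ (r, t))" unfolding c(1) s_def by simp
      then show ?thesis using reg_matD(2)[OF reg[OF sub_quot_reg(1)[OF J c(2)]] c(3,4)] by simp
    next
      assume "c \<in> {\<lambda>(U, f). f i $$ (r, s) | i r s. i \<in> verts Q \<and> r < n i \<and> s < e i}"
      then obtain i r t where c: "c = (\<lambda>(U, f). f i $$ (r, t))" "i \<in> verts Q" "r < n i" "t < e i" by auto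
      have "(\<lambda>U. c (s U)) = (\<lambda>U. chart_graph n J (co J U) i $$ (r, t))" unfolding c(1) s_def using c(2) by simp
      then show ?thesis using reg_matD(2)[OF reg[OF chart_matrices_reg(1)[OF J c(2)]] c(3,4)] by simp
    qed
  qed
  then show "is_morphism ?Y Infl s"
    unfolding infl_variety_eq by (rule is_morphism_into_induced[OF Y]) (rule inT)
qed

lemma local_sections:
  assumes "U \<in> pts CGr"
  shows "\<exists>D s. openin (zar CGr) D \<and> U \<in> D \<and> is_morphism (induced CGr D) Infl s \<and> (\<forall>w\<in>D. infl_image Q (s w) = w)"
proof -
  have U: "U \<in> C_set" "U \<in> grassmannian_prod (verts Q) e n" using assms pts_CGr C_set_subset Q_set_subset by blast+
  from grassmannian_prod_charts[OF U(2)] obtain J where J: "valid J" "U \<in> W J" by (elim exE conjE)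
  show ?thesis
  proof (rule exI[of _ "C_set \<inter> W J"],
      rule exI[of _ "\<lambda>U. (sub_rep J (co J U), \<lambda>i\<in>verts Q. chart_graph n J (co J U) i)"], intro conjI)
    show "openin (zar CGr) (C_set \<inter> W J)" by (rule openin_CGr_chart[OF J(1)])
    show "U \<in> C_set \<inter> W J" by (rule IntI[OF U(1) J(2)])
    show "is_morphism (induced CGr (C_set \<inter> W J)) Infl (\<lambda>U. (sub_rep J (co J U), \<lambda>i\<in>verts Q. chart_graph n J (co J U) i))"
      by (rule local_section(1)[OF J(1)])
    show "\<forall>w\<in>C_set \<inter> W J. infl_image Q (sub_rep J (co J w), \<lambda>i\<in>verts Q. chart_graph n J (co J w) i) = w"
      by (rule ballI) (rule local_section(2)[OF J(1)])
  qed
qed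

lemma infl_action_eq:
  "(U, f) \<in> infl_set Q \<E> e d M \<Longrightarrow> infl_action Q \<E> e d M g (U, f) =
     (\<lambda>\<alpha>\<in>arcs Q. g (head Q \<alpha>) * U \<alpha> * ginv g (tail Q \<alpha>), \<lambda>i\<in>verts Q. f i * ginv g i)"
  unfolding infl_action_def by simp

lemma infl_setD:
  assumes "(U, f) \<in> infl_set Q \<E> e d M"
  shows "U \<in> rep_set Q e" "f \<in> (\<Pi>\<^sub>E i\<in>verts Q. carrier_mat (n i) (e i))"
    "i \<in> verts Q \<Longrightarrow> f i \<in> carrier_mat (n i) (e i)" "i \<in> verts Q \<Longrightarrow> mat_injective (f i)"
    "\<alpha> \<in> arcs Q \<Longrightarrow> M \<alpha> * f (tail Q \<alpha>) = f (head Q \<alpha>) * U \<alpha>" "mat_images (verts Q) f \<in> C_set"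
  using assms unfolding infl_set_iff[OF closed] by auto

lemma infl_action_image:
  assumes x: "(U, f) \<in> infl_set Q \<E> e d M" and g: "g \<in> carrier (GL_group Q e)"
  shows "mat_images (verts Q) (\<lambda>i\<in>verts Q. f i * ginv g i) = mat_images (verts Q) f"
proof (rule restrict_ext)
  fix i assume i: "i \<in> verts Q"
  from mat_image_mult_invertible[OF infl_setD(3)[OF x i] GL_groupD(3,6)[OF g i]] i
  show "mat_image ((\<lambda>i\<in>verts Q. f i * ginv g i) i) = mat_image (f i)" by simp
qed

lemma infl_action_closed:
  assumes g: "g \<in> carrier (GL_group Q e)" and x: "x \<in> infl_set Q \<E> e d M"
  shows "infl_action Q \<E> e d M g x \<in> infl_set Q \<E> e d M"
proof -
  obtain U f where x_eq: "x = (U, f)" by (cases x)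
  note x = x[unfolded x_eq]
  let ?U = "\<lambda>\<alpha>\<in>arcs Q. g (head Q \<alpha>) * U \<alpha> * ginv g (tail Q \<alpha>)" and ?f = "\<lambda>i\<in>verts Q. f i * ginv g i"
  have 1: "?U \<in> rep_set Q e" unfolding rep_set_def
  proof (rule restrict_PiE_iff[THEN iffD2], rule ballI)
    fix \<alpha> assume \<alpha>: "\<alpha> \<in> arcs Q"
    then have t: "tail Q \<alpha> \<in> verts Q" and h: "head Q \<alpha> \<in> verts Q" by auto
    show "g (head Q \<alpha>) * U \<alpha> * ginv g (tail Q \<alpha>) \<in> carrier_mat (e (head Q \<alpha>)) (e (tail Q \<alpha>))"
      by (rule mult_carrier_mat[OF mult_carrier_mat[OF GL_groupD(1)[OF g h] rep_setD[OF infl_setD(1)[OF x] \<alpha>]] GL_groupD(3)[OF g t]])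
  qed
  have 2: "?f \<in> (\<Pi>\<^sub>E i\<in>verts Q. carrier_mat (n i) (e i))"
    by (rule restrict_PiE_iff[THEN iffD2], rule ballI) (rule mult_carrier_mat[OF infl_setD(3)[OF x] GL_groupD(3)[OF g]])
  have 3: "\<forall>i\<in>verts Q. mat_injective (?f i)"
  proof
    fix i assume i: "i \<in> verts Q"
    have "mat_injective (f i * ginv g i)"
      by (rule mat_injective_mult[OF infl_setD(3,4)[OF x i] GL_groupD(3)[OF g i]
            mat_injective_left_inverse[OF GL_groupD(3)[OF g i] GL_groupD(1)[OF g i] GL_groupD(4)[OF g i]]])
    then show "mat_injective (?f i)" using i by simp
  qed
  have 4: "\<forall>\<alpha>\<in>arcs Q. M \<alpha> * ?f (tail Q \<alpha>) = ?f (head Q \<alpha>) * ?U \<alpha>"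
  proof
    fix \<alpha> assume \<alpha>: "\<alpha> \<in> arcs Q"
    let ?t = "tail Q \<alpha>" and ?h = "head Q \<alpha>"
    have t: "?t \<in> verts Q" and h: "?h \<in> verts Q" using \<alpha> by auto
    note gt = GL_groupD[OF g t] and gh = GL_groupD[OF g h]
    note ft = infl_setD(3)[OF x t] and fh = infl_setD(3)[OF x h] and Ua = rep_setD[OF infl_setD(1)[OF x] \<alpha>] and Ma = rep_setD[OF M_rep \<alpha>]
    note Ug = mult_carrier_mat[OF Ua gt(3)]
    have "M \<alpha> * (f ?t * ginv g ?t) = M \<alpha> * f ?t * ginv g ?t" by (rule assoc_mult_mat[OF Ma ft gt(3), symmetric])
    also have "\<dots> = f ?h * U \<alpha> * ginv g ?t" using infl_setD(5)[OF x \<alpha>] by simp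
    also have "\<dots> = f ?h * (U \<alpha> * ginv g ?t)" by (rule assoc_mult_mat[OF fh Ua gt(3)])
    also have "U \<alpha> * ginv g ?t = ginv g ?h * g ?h * (U \<alpha> * ginv g ?t)"
      unfolding gh(5) by (rule left_mult_one_mat[OF Ug, symmetric])
    also have "\<dots> = ginv g ?h * (g ?h * (U \<alpha> * ginv g ?t))" by (rule assoc_mult_mat[OF gh(3,1) Ug])
    also have "g ?h * (U \<alpha> * ginv g ?t) = g ?h * U \<alpha> * ginv g ?t" by (rule assoc_mult_mat[OF gh(1) Ua gt(3), symmetric])
    also have "f ?h * (ginv g ?h * (g ?h * U \<alpha> * ginv g ?t)) = f ?h * ginv g ?h * (g ?h * U \<alpha> * ginv g ?t)"
      by (rule assoc_mult_mat[OF fh gh(3) mult_carrier_mat[OF mult_carrier_mat[OF gh(1) Ua] gt(3)], symmetric])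
    finally have "M \<alpha> * (f ?t * ginv g ?t) = f ?h * ginv g ?h * (g ?h * U \<alpha> * ginv g ?t)" .
    then show "M \<alpha> * ?f ?t = ?f ?h * ?U \<alpha>" unfolding restrict_apply'[OF t] restrict_apply'[OF h] restrict_apply'[OF \<alpha>] .
  qed
  have "(?U, ?f) \<in> infl_set Q \<E> e d M"
    unfolding infl_set_iff[OF closed] infl_action_image[OF x g] using 1 2 3 4 infl_setD(6)[OF x] by blast
  then show ?thesis unfolding x_eq infl_action_eq[OF x] .
qed

lemma infl_group_action: "group_action (GL_group Q e) (pts Infl) (infl_action Q \<E> e d M)"
  unfolding pts_Infl
proof (rule group_actionI[OF group_GL_group _ infl_action_closed])
  show "infl_action Q \<E> e d M g \<in> extensional (infl_set Q \<E> e d M)" for g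
    unfolding infl_action_def by simp
  fix x assume "x \<in> infl_set Q \<E> e d M"
  moreover obtain U f where x_eq: "x = (U, f)" by (cases x)
  ultimately have x: "(U, f) \<in> infl_set Q \<E> e d M" by simp
  note U = infl_setD(1)[OF x] and f = infl_setD(2)[OF x]
  have inv1: "ginv (\<one>\<^bsub>GL_group Q e\<^esub> :: 'v \<Rightarrow> 'k mat) i = 1\<^sub>m (e i)" if "i \<in> verts Q" for i
    using the_mat_inverse_eq[of "1\<^sub>m (e i)" "e i" "1\<^sub>m (e i) :: 'k mat"] that by (simp add: GL_one)
  have "(\<lambda>\<alpha>\<in>arcs Q. \<one>\<^bsub>GL_group Q e\<^esub> (head Q \<alpha>) * U \<alpha> * ginv \<one>\<^bsub>GL_group Q e\<^esub> (tail Q \<alpha>)) = U"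
  proof (rule extensionalityI[of _ "arcs Q"])
    fix \<alpha> assume \<alpha>: "\<alpha> \<in> arcs Q"
    then have t: "tail Q \<alpha> \<in> verts Q" and h: "head Q \<alpha> \<in> verts Q" by auto
    show "(\<lambda>\<alpha>\<in>arcs Q. \<one>\<^bsub>GL_group Q e\<^esub> (head Q \<alpha>) * U \<alpha> * ginv \<one>\<^bsub>GL_group Q e\<^esub> (tail Q \<alpha>)) \<alpha> = U \<alpha>"
      using \<alpha> h inv1[OF t] left_mult_one_mat[OF rep_setD[OF U \<alpha>]] right_mult_one_mat[OF rep_setD[OF U \<alpha>]] by (simp add: GL_one)
  qed (use U in \<open>simp_all add: rep_set_def PiE_iff\<close>)
  moreover have "(\<lambda>i\<in>verts Q. f i * ginv \<one>\<^bsub>GL_group Q e\<^esub> i) = f"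
  proof (rule extensionalityI[of _ "verts Q"])
    fix i assume i: "i \<in> verts Q"
    show "(\<lambda>i\<in>verts Q. f i * ginv \<one>\<^bsub>GL_group Q e\<^esub> i) i = f i"
      using i inv1[OF i] right_mult_one_mat[OF infl_setD(3)[OF x i]] by simp
  qed (use f in \<open>simp_all add: PiE_iff\<close>)
  ultimately show "infl_action Q \<E> e d M \<one>\<^bsub>GL_group Q e\<^esub> x = x" unfolding x_eq infl_action_eq[OF x] by simp
  fix g h :: "'v \<Rightarrow> 'k mat" assume g: "g \<in> carrier (GL_group Q e)" and h: "h \<in> carrier (GL_group Q e)"
  let ?U = "\<lambda>\<alpha>\<in>arcs Q. h (head Q \<alpha>) * U \<alpha> * ginv h (tail Q \<alpha>)" and ?f = "\<lambda>i\<in>verts Q. f i * ginv h i"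
  have hx: "(?U, ?f) \<in> infl_set Q \<E> e d M" using infl_action_closed[OF h x] unfolding infl_action_eq[OF x] .
  let ?gh = "g \<otimes>\<^bsub>GL_group Q e\<^esub> h"
  have "(\<lambda>\<alpha>\<in>arcs Q. ?gh (head Q \<alpha>) * U \<alpha> * ginv ?gh (tail Q \<alpha>)) = (\<lambda>\<alpha>\<in>arcs Q. g (head Q \<alpha>) * ?U \<alpha> * ginv g (tail Q \<alpha>))"
  proof (rule restrict_ext)
    fix \<alpha> assume \<alpha>: "\<alpha> \<in> arcs Q"
    let ?t = "tail Q \<alpha>" and ?h = "head Q \<alpha>"
    have tv: "?t \<in> verts Q" and hv: "?h \<in> verts Q" using \<alpha> by auto
    note Ua = rep_setD[OF U \<alpha>]
    note gt = GL_groupD[OF g tv] and gv = GL_groupD[OF g hv] and ht = GL_groupD[OF h tv] and hh = GL_groupD[OF h hv]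
    note hU = mult_carrier_mat[OF hh(1) Ua]
    have "g ?h * h ?h * U \<alpha> * (ginv h ?t * ginv g ?t) = g ?h * (h ?h * U \<alpha>) * (ginv h ?t * ginv g ?t)"
      unfolding assoc_mult_mat[OF gv(1) hh(1) Ua] ..
    also have "\<dots> = g ?h * (h ?h * U \<alpha>) * ginv h ?t * ginv g ?t"
      by (rule assoc_mult_mat[OF mult_carrier_mat[OF gv(1) hU] ht(3) gt(3), symmetric])
    also have "g ?h * (h ?h * U \<alpha>) * ginv h ?t = g ?h * (h ?h * U \<alpha> * ginv h ?t)" by (rule assoc_mult_mat[OF gv(1) hU ht(3)])
    finally show "?gh ?h * U \<alpha> * ginv ?gh ?t = g ?h * ?U \<alpha> * ginv g ?t"
      unfolding ginv_mult[OF g h tv] restrict_apply'[OF \<alpha>] unfolding GL_mult restrict_apply'[OF hv] .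
  qed
  moreover have "(\<lambda>i\<in>verts Q. f i * ginv ?gh i) = (\<lambda>i\<in>verts Q. ?f i * ginv g i)"
  proof (rule restrict_ext)
    fix i assume i: "i \<in> verts Q"
    show "f i * ginv ?gh i = ?f i * ginv g i"
      unfolding ginv_mult[OF g h i] restrict_apply'[OF i]
      by (rule assoc_mult_mat[OF infl_setD(3)[OF x i] GL_groupD(3)[OF h i] GL_groupD(3)[OF g i], symmetric])
  qed
  ultimately show "infl_action Q \<E> e d M ?gh x = infl_action Q \<E> e d M g (infl_action Q \<E> e d M h x)"
    unfolding x_eq infl_action_eq[OF x] infl_action_eq[OF hx] by simp
qed

text \<open>Inflations with the same image \<open>U\<close> are two bases of \<open>U\<close> together with the matrices of \<open>M|\<^sub>U\<close> in them; the inverse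
  of the change of basis acts by taking one to the other.\<close>

lemma infl_image_orbit:
  assumes x: "x \<in> pts Infl" and y: "y \<in> pts Infl"
  shows "infl_image Q x = infl_image Q y \<longleftrightarrow> y \<in> orbit (GL_group Q e) (infl_action Q \<E> e d M) x"
proof -
  obtain U f where x_eq: "x = (U, f)" by (cases x)
  obtain U' f' where y_eq: "y = (U', f')" by (cases y)
  have x: "(U, f) \<in> infl_set Q \<E> e d M" and y: "(U', f') \<in> infl_set Q \<E> e d M" using assms unfolding pts_Infl x_eq y_eq by auto
  show ?thesis
  proof
    assume eq: "infl_image Q x = infl_image Q y"
    have hom: "is_hom Q (e, U) (n, M) f" "is_hom Q (e, U') (n, M) f'"
      unfolding is_hom_def using infl_setD(3,5)[OF x] infl_setD(3,5)[OF y] by simp_all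
    have im: "mat_image (f i) = mat_image (f' i)" if "i \<in> verts Q" for i
      using fun_cong[OF eq, of i] that unfolding x_eq y_eq infl_image_eq by simp
    have "\<exists>c. is_hom Q (e, U') (e, U) c \<and>
        (\<forall>i\<in>verts Q. c i \<in> carrier_mat (e i) (e i) \<and> det (c i) \<noteq> 0 \<and> f' i = f i * c i)"
      by (rule iso_submodules[OF infl_setD(1)[OF x] infl_setD(1)[OF y] M_rep hom infl_setD(4)[OF x] infl_setD(4)[OF y] im])
    then obtain c where c: "is_hom Q (e, U') (e, U) c"
        "\<forall>i\<in>verts Q. c i \<in> carrier_mat (e i) (e i) \<and> det (c i) \<noteq> 0 \<and> f' i = f i * c i"
      by (elim exE conjE)
    \<comment> \<open>\<open>g\<close> acts on \<open>f\<close> by its inverse, and \<open>f'\<close> is \<open>f\<close> times \<open>c\<close>\<close>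
    let ?g = "\<lambda>i\<in>verts Q. minv (c i)"
    have ci: "c i \<in> carrier_mat (e i) (e i)" "det (c i) \<noteq> 0" "f' i = f i * c i" if "i \<in> verts Q" for i using c(2) that by auto
    note mc = minv[OF ci(1,2)]
    have g: "?g \<in> carrier (GL_group Q e)"
      by (rule GL_groupI) (use mc inverse_mat_det[OF mc(1) ci(1) mc(3)] in auto)
    have inv: "ginv ?g i = c i" if i: "i \<in> verts Q" for i
      using the_mat_inverse_eq[OF mc(1)[OF i i] ci(1)[OF i] mc(3)[OF i i]] i by simp
    have "(\<lambda>\<alpha>\<in>arcs Q. ?g (head Q \<alpha>) * U \<alpha> * ginv ?g (tail Q \<alpha>)) = U'"
    proof (rule extensionalityI[of _ "arcs Q"])
      fix \<alpha> assume \<alpha>: "\<alpha> \<in> arcs Q"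
      let ?t = "tail Q \<alpha>" and ?h = "head Q \<alpha>"
      have t: "?t \<in> verts Q" and h: "?h \<in> verts Q" using \<alpha> by auto
      note Ua = rep_setD[OF infl_setD(1)[OF x] \<alpha>] and Ua' = rep_setD[OF infl_setD(1)[OF y] \<alpha>]
      have "minv (c ?h) * U \<alpha> * c ?t = minv (c ?h) * (U \<alpha> * c ?t)" by (rule assoc_mult_mat[OF mc(1)[OF h h] Ua ci(1)[OF t]])
      also have "U \<alpha> * c ?t = c ?h * U' \<alpha>" by (rule is_homD(2)[OF c(1) \<alpha>])
      also have "minv (c ?h) * (c ?h * U' \<alpha>) = minv (c ?h) * c ?h * U' \<alpha>"
        by (rule assoc_mult_mat[OF mc(1)[OF h h] ci(1)[OF h] Ua', symmetric])
      also have "\<dots> = U' \<alpha>" unfolding mc(3)[OF h h] by (rule left_mult_one_mat[OF Ua'])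
      finally show "(\<lambda>\<alpha>\<in>arcs Q. ?g (head Q \<alpha>) * U \<alpha> * ginv ?g (tail Q \<alpha>)) \<alpha> = U' \<alpha>"
        unfolding restrict_apply'[OF \<alpha>] inv[OF t] unfolding restrict_apply'[OF h] .
    qed (use infl_setD(1)[OF y] in \<open>simp_all add: rep_set_def PiE_iff\<close>)
    moreover have "(\<lambda>i\<in>verts Q. f i * ginv ?g i) = f'"
      by (rule extensionalityI[of _ "verts Q"]) (use infl_setD(2)[OF y] inv ci(3) in \<open>simp_all add: PiE_iff\<close>)
    ultimately have "y = infl_action Q \<E> e d M ?g x" unfolding x_eq y_eq infl_action_eq[OF x] by simp
    then show "y \<in> orbit (GL_group Q e) (infl_action Q \<E> e d M) x" unfolding orbit_def using g by blast
  next
    assume "y \<in> orbit (GL_group Q e) (infl_action Q \<E> e d M) x"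
    then obtain g where g: "g \<in> carrier (GL_group Q e)" "y = infl_action Q \<E> e d M g x" unfolding orbit_def by blast
    show "infl_image Q x = infl_image Q y"
      using infl_action_image[OF x g(1)] unfolding g(2) x_eq infl_action_eq[OF x] infl_image_eq by simp
  qed
qed

lemma geometric_quotient_Infl:
  "geometric_quotient (GL_group Q e) (infl_action Q \<E> e d M) Infl CGr (infl_image Q)"
  unfolding geometric_quotient_def
proof (intro conjI)
  show "variety Infl" "variety CGr" by (rule variety_Infl, rule variety_CGr)
  show "group_action (GL_group Q e) (pts Infl) (infl_action Q \<E> e d M)" by (rule infl_group_action)
  show m: "is_morphism Infl CGr (infl_image Q)" by (rule infl_image_morphism)
  show "infl_image Q ` pts Infl = pts CGr"
  proof (intro equalityI subsetI)
    fix U assume "U \<in> infl_image Q ` pts Infl"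
    then show "U \<in> pts CGr" using is_morphismD_pts[OF m] by blast
  next
    fix U assume U: "U \<in> pts CGr"
    from local_sections[OF this] obtain D s where s: "openin (zar CGr) D" "U \<in> D" "is_morphism (induced CGr D) Infl s"
      "\<forall>w\<in>D. infl_image Q (s w) = w" by (elim exE conjE)
    have "s U \<in> pts Infl" by (rule is_morphismD_pts[OF s(3)]) (use U s(2) in simp)
    then show "U \<in> infl_image Q ` pts Infl" by (rule rev_image_eqI) (use s(2,4) in simp)
  qed
  show "\<forall>x\<in>pts Infl. \<forall>y\<in>pts Infl. infl_image Q x = infl_image Q y \<longleftrightarrow>
      y \<in> orbit (GL_group Q e) (infl_action Q \<E> e d M) x"
    by (intro ballI infl_image_orbit)
  show "\<forall>V. V \<subseteq> pts CGr \<longrightarrow> openin (zar Infl) {x \<in> pts Infl. infl_image Q x \<in> V} \<longrightarrow> openin (zar CGr) V"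
    by (intro allI impI) (rule local_sections_quotient_topology[OF swf_Infl m local_sections])
  show "\<forall>V f. openin (zar CGr) V \<and> f \<in> reg Infl {x \<in> pts Infl. infl_image Q x \<in> V} \<and>
        (\<forall>g\<in>carrier (GL_group Q e). \<forall>x\<in>pts Infl. infl_image Q x \<in> V \<longrightarrow> f (infl_action Q \<E> e d M g x) = f x) \<longrightarrow>
        (\<exists>h\<in>reg CGr V. \<forall>x\<in>pts Infl. infl_image Q x \<in> V \<longrightarrow> f x = h (infl_image Q x))"
  proof (intro allI impI, elim conjE)
    fix V f assume V: "openin (zar CGr) V" and f: "f \<in> reg Infl {x \<in> pts Infl. infl_image Q x \<in> V}"
      and inv: "\<forall>g\<in>carrier (GL_group Q e). \<forall>x\<in>pts Infl. infl_image Q x \<in> V \<longrightarrow> f (infl_action Q \<E> e d M g x) = f x"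
    show "\<exists>h\<in>reg CGr V. \<forall>x\<in>pts Infl. infl_image Q x \<in> V \<longrightarrow> f x = h (infl_image Q x)"
    proof (rule local_sections_descent[OF swf_Infl swf_CGr m local_sections V f])
      fix x y assume x: "x \<in> pts Infl" and y: "y \<in> pts Infl" and xV: "infl_image Q x \<in> V" and eq: "infl_image Q x = infl_image Q y"
      have "y \<in> orbit (GL_group Q e) (infl_action Q \<E> e d M) x" using eq unfolding infl_image_orbit[OF x y] .
      then obtain g where "g \<in> carrier (GL_group Q e)" "y = infl_action Q \<E> e d M g x" unfolding orbit_def by blast
      then show "f x = f y" using inv x xV by simp
    qed
  qed
qed

end

theorem lemma3p3:
  fixes Q :: "('v, 'a) pre_digraph"
    and I :: "(('v, 'a) path \<Rightarrow>\<^sub>0 'k::alg_closed_field) set"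
    and \<Lambda> :: "('k, 'l) module"
    and \<E> :: "('v, 'a, 'k) rep set"
    and e d :: "'v \<Rightarrow> nat"
    and M :: "'a \<Rightarrow> 'k mat"
  assumes "basic_algebra Q I \<Lambda>"
    and "open_fully_exact Q I \<E>"
    and "M \<in> cat_set \<E> (\<lambda>i. e i + d i)"
  shows "geometric_quotient (GL_group Q e) (infl_action Q \<E> e d M) (infl_variety Q \<E> e d M)
           (cat_grassmannian Q I \<E> e d M) (infl_image Q) \<and>
         (\<forall>(Y :: ('y, 'k) kspace) \<pi>.
           geometric_quotient (GL_group Q e) (infl_action Q \<E> e d M) (infl_variety Q \<E> e d M) Y \<pi> \<longrightarrow>
           isomorphic (cat_grassmannian Q I \<E> e d M) Y) \<and>
         open_subvariety (cat_grassmannian Q I \<E> e d M) (quiver_grassmannian Q I e d M)"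
proof -
  have fin: "fin_digraph Q" and I: "I \<subseteq> carrier (path_algebra Q)"
    using assms(1) unfolding basic_algebra_def admissible_def arrow_ideal_power_def by auto
  have sub: "\<E> \<subseteq> modules Q I" and iso: "\<forall>X\<in>\<E>. \<forall>Y\<in>modules Q I. iso_modules Q X Y \<longrightarrow> Y \<in> \<E>"
    and op: "open_subcategory Q I \<E>"
    using assms(2) unfolding open_fully_exact_def additively_closed_def by - (elim conjE, assumption)+
  have M: "M \<in> mod_set Q I (\<lambda>i. e i + d i)" using assms(3) sub unfolding cat_set_def modules_def by blast
  interpret fin_digraph Q by (rule fin)
  interpret grassmannian_setup Q e d I M by unfold_locales (rule finite_verts, rule I, rule M)
  interpret inflation_setup Q e d I M \<E>
    by unfold_locales (unfold iso_closed_def, intro conjI sub iso, rule op)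
  show ?thesis
    using geometric_quotient_Infl geometric_quotient_unique[OF geometric_quotient_Infl] open_subvariety_CGr by blast
qed

end
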